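(* Let $(Q,W)$ be a quiver with finite potential whose cyclic derivatives generate an admissible ideal of $kQ$, with an action of a finite cyclic group $G=\langle g\rangle$ of order $n$ satisfying assumptions (A1)–(A7) of the context. Let $(Q_G,W_G)$ be the associated quiver with potential, with the action of the dual group $\hat G$, and let $((Q_G)_{\hat G},(W_G)_{\hat G})$ be the quiver with potential obtained by applying the same construction to $(Q_G,W_G)$ and $\hat G$, as described in the context. Let $\phi:(Q_G)_{\hat G}\to Q$ be the morphism of quivers defined by: - $\phi(\eta^\varepsilon_0\otimes1)=\varepsilon$ for $\varepsilon\in\mathcal E''$; - $\phi(\eta^\varepsilon\otimes e_\mu)=g^\mu(\varepsilon)$ for $\varepsilon\in\mathcal E'$, $0\le\mu\le n-1$; - $\phi(\tilde\beta)=\alpha$, where $\beta=\tilde\alpha^{b(\alpha)}$ and $\alpha$ is an arrow of type (4) in $Q$; - $\phi(\tilde\beta^\nu)=g^\nu(\alpha)$, where $\beta=\tilde\alpha^0$, $0\le\nu\le n-1$ and $\alpha$ is an arrow of type (3) in $Q$; - $\phi(\tilde\beta^\nu)=g^\nu(\alpha)$, where $\beta=\tilde\alpha^0$, $0\le\nu\le n-1$ and $\alpha$ is an arrow of type (2) in $Q$; - $\phi(\tilde\beta^\nu)=g^{\nu-t(\alpha)}(\alpha)$, where $\beta=\tilde\alpha$, $0\le\nu\le n-1$ and $\alpha$ is an arrow of type (1) in $Q$. Then $\phi$ is an isomorphism of quivers and, if it is extended to an isomorphism between the corresponding path algebras, $\phi((W_G)_{\hat G})=W$ (as potentials, i.e.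 with cycles up to cyclic permutation).
   Context: **Conventions.** $k$ is a field. Quivers are finite and connected; $Q_0,Q_1$ are the vertices and arrows, $\mathfrak s(\alpha),\mathfrak t(\alpha)$ the start and target of an arrow. Arrows are composed right to left (as functions). A vertex is identified with its idempotent (trivial path). If a finite group $G$ acts on an algebra $A$ by automorphisms, the skew group algebra $AG$ is $A\otimes_k kG$ with $(\lambda\otimes g)(\mu\otimes h)=\lambda g(\mu)\otimes gh$. **Quivers with potential.** $\widehat{kQ}$ is the completion of $kQ$ in the $\langle Q_1\rangle$-adic topology, $\mathrm{com}_Q=\overline{[\widehat{kQ},\widehat{kQ}]}$. A potential is an element $W\in\langle Q_1\rangle^3/(\langle Q_1\rangle^3\cap\mathrm{com}_Q)$, i.e. a (possibly infinite) linear combination of cycles of length at least 3, taken up to cyclic permutation; it is finite if it can be written as a finite linear combination. The cyclic derivative $\partial_\alpha$ ($\alpha\in Q_1$) is the continuous linear map with $\partial_\alpha(\alpha_1\cdots\alpha_l)=\sum_{m:\alpha_m=\alpha}\alpha_{m+1}\cdots\alpha_l\alpha_1\cdots\alpha_{m-1}$. Write $W=\sum_c a(c)c$; the cycles appearing in $W$ are those with $a(c)\ne0$. **Assumptions.** $G$ is cyclic of order $n$ with generator $g$, acting on $kQ$ by automorphisms. A vertex is "fixed" if it is fixed by $G$. (A1) $k$ contains a primitive $n$-th root of unity $\zeta$ (in particular $n\ne0$ in $k$). (A2) $G$ permutes the vertices of $Q$ and maps every arrow to a scalar multiple of an arrow. (A3) Every vertex which is not fixed has an orbit of cardinality $n$.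 (A4) $GW=W$ in $\widehat{kQ}/\mathrm{com}_Q$. (A5) If $\alpha$ is an arrow between two fixed vertices, then $g(\alpha)=\zeta^{b(\alpha)}\alpha$ for an integer $b(\alpha)$. (A6) Arrows with at least one non-fixed end are sent to arrows by $G$. (A7) Every cycle $c$ appearing in $W$ is of one of the types: (i) $c$ goes through no fixed vertex; (ii) $c$ goes through exactly one (counted with multiplicity) fixed vertex; (iii) $c$ goes through exactly one (counted with multiplicity) non-fixed vertex; (iv) $c$ goes only through fixed vertices. Integers used as indices or exponents of $g,\zeta$ are read modulo $n$. The action $*$ of $G$ on $Q$ is $g*v=g(v)$ on vertices, and $g*\alpha=\beta$ if $\beta$ is the arrow of which $g(\alpha)$ is a scalar multiple; it extends to cycles arrow by arrow. **Idempotents.** $e_\mu=\frac1n\sum_{i=0}^{n-1}\zeta^{i\mu}g^i\in kG$, $\mu=0,\dots,n-1$. Fix a set $\mathcal E\subseteq Q_0$ of representatives of the $G$-orbits of vertices, $\mathcal E=\mathcal E'\sqcup\mathcal E''$, with $\mathcal E'$ the non-fixed ones (orbits of size $n$) and $\mathcal E''$ the fixed ones. Put $\eta^\varepsilon=\varepsilon\otimes1$ for $\varepsilon\in\mathcal E'$, $\eta^\varepsilon_\mu=\varepsilon\otimes e_\mu$ for $\varepsilon\in\mathcal E''$. **The quiver $Q_G$.** Its vertices are the $\eta^\varepsilon$ ($\varepsilon\in\mathcal E'$) and $\eta^\varepsilon_\mu$ ($\varepsilon\in\mathcal E''$, $0\le\mu\le n-1$). Its arrows are the following elements of $(kQ)G$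 (with $0\le\mu\le n-1$): - type (1): for each arrow $\alpha:g^t(\varepsilon)\to\varepsilon'$ of $Q$ with $\varepsilon,\varepsilon'\in\mathcal E'$, $\tilde\alpha=\alpha\otimes g^t:\eta^\varepsilon\to\eta^{\varepsilon'}$; put $t(\alpha)=t$; - type (2): for each $\alpha:\varepsilon\to\varepsilon'$ with $\varepsilon\in\mathcal E',\varepsilon'\in\mathcal E''$, $\tilde\alpha^\mu=(1\otimes e_\mu)(\alpha\otimes1):\eta^\varepsilon\to\eta^{\varepsilon'}_\mu$; - type (3): for each $\alpha:\varepsilon\to\varepsilon'$ with $\varepsilon\in\mathcal E'',\varepsilon'\in\mathcal E'$, $\tilde\alpha^\mu=\alpha\otimes e_\mu:\eta^\varepsilon_\mu\to\eta^{\varepsilon'}$; - type (4): for each $\alpha:\varepsilon\to\varepsilon'$ with $\varepsilon,\varepsilon'\in\mathcal E''$, $\tilde\alpha^\mu=\alpha\otimes e_\mu:\eta^\varepsilon_\mu\to\eta^{\varepsilon'}_{\mu-b(\alpha)}$. For types (2),(3),(4) put $t(\alpha)=0$. **The potential $W_G$.** For each cycle $c$ of $W$ one picks $\hat c$ in the orbit $G*c$ (the same for all cycles in the orbit), written up to cyclic permutation as $\hat c=\alpha_1\,g^{t_1}(\alpha_2)\,g^{t_1+t_2}(\alpha_3)\cdots g^{t_1+\dots+t_{l-1}}(\alpha_l)$ with $\alpha_i:g^{t_i}(\varepsilon_i)\to\varepsilon_{i-1}$, $\varepsilon_i\in\mathcal E$, $\varepsilon_0=\varepsilon_l$, as follows.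 (i) $c$ of type (i): any $\hat c\in G*c$ through a vertex of $\mathcal E'$, all $\varepsilon_i\in\mathcal E'$; each $\alpha_i$ has type (1), $t_i=t(\alpha_i)$. Put $\tilde c=\tilde\alpha_1\cdots\tilde\alpha_l$. (ii) $c$ of type (ii): the unique $\hat c$ with $\varepsilon_1\in\mathcal E''$, $\varepsilon_i\in\mathcal E'$ for $i\ne1$, $t_1=0$. Then $\alpha_1$ has type (3), $g^{-t_2}(\alpha_2)$ has type (2), and $\alpha_i$ has type (1) with $t_i=t(\alpha_i)$ for $i\ge3$. Put $p(c)=t_2$ and $\tilde c^\mu=\tilde\alpha_1^\mu\,\widetilde{g^{-t_2}(\alpha_2)}^\mu\,\tilde\alpha_3\cdots\tilde\alpha_l$. (iii) $c$ of type (iii): the unique $\hat c$ with $\varepsilon_1\in\mathcal E'$, $\varepsilon_i\in\mathcal E''$ for $i\neq1$, all $t_i=0$. Then $\alpha_1,\alpha_2$ have types (2),(3) and $\alpha_i$ has type (4) for $i\ge3$. With $b_i=b(\alpha_i)+\dots+b(\alpha_l)$ for $i\ge3$, put $q(c)=b_3$ and $\tilde c^\mu=\tilde\alpha_1^\mu\tilde\alpha_2^{\mu-b_3}\tilde\alpha_3^{\mu-b_4}\cdots\tilde\alpha_{l-1}^{\mu-b_l}\tilde\alpha_l^\mu$. (iv) $c$ of type (iv): $\hat c=c=\alpha_1\cdots\alpha_l$, all $\varepsilon_i\in\mathcal E''$, all $t_i=0$, all $\alpha_i$ of type (4). With $b_i=b(\alpha_i)+\dots+b(\alpha_l)$, put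 $\tilde c^\mu=\tilde\alpha_1^{\mu-b_2}\tilde\alpha_2^{\mu-b_3}\cdots\tilde\alpha_{l-1}^{\mu-b_l}\tilde\alpha_l^\mu$. Let $\mathcal C(x)=\{\hat c\mid c\text{ a cycle of }W\text{ of type }x\}$ for $x=$ (i),…,(iv), and $$W_G=\sum_{c\in\mathcal C(\mathrm i)}a(c)\frac{|Gc|}{n}\tilde c+\sum_{c\in\mathcal C(\mathrm{ii})}a(c)\sum_{\mu=0}^{n-1}\zeta^{-p(c)\mu}\tilde c^\mu+\sum_{c\in\mathcal C(\mathrm{iii})\cup\mathcal C(\mathrm{iv})}a(c)\sum_{\mu=0}^{n-1}\tilde c^\mu .$$ **Dual group action and second construction.** $\hat G=\mathrm{Hom}(G,k^* )$ is cyclic of order $n$ with generator $\chi$, $\chi(g)=\zeta$. It acts on $(kQ)G$ by $\chi(\lambda\otimes h)=\chi(h)\lambda\otimes h$, and hence on $kQ_G$ by $\chi(\eta^\varepsilon)=\eta^\varepsilon$, $\chi(\eta^\varepsilon_\mu)=\eta^\varepsilon_{\mu+1}$, $\chi(\tilde\alpha)=\zeta^{t(\alpha)}\tilde\alpha$ for $\alpha$ of type (1), and $\chi(\tilde\alpha^\mu)=\tilde\alpha^{\mu+1}$ for $\alpha$ of type (2),(3),(4). This action on $(Q_G,W_G)$ again satisfies (A1)–(A7) (with generator $\chi$ and the same $\zeta$). Apply to it the construction which produces the quiver with potential $(Q_G,W_G)$ from $(Q,W)$, $G=\langle g\rangle$ and $\mathcal E=\mathcal E'\sqcup\mathcal E''$,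 with $(Q,W)$, $G$, $g$ replaced by $(Q_G,W_G)$, $\hat G$, $\chi$, using the orbit representatives $\mathcal E_G=\mathcal E'_G\sqcup\mathcal E''_G$, $\mathcal E'_G=\{\eta^\varepsilon_0\mid\varepsilon\in\mathcal E''\}$ (non-fixed), $\mathcal E''_G=\{\eta^\varepsilon\mid\varepsilon\in\mathcal E'\}$ (fixed) in place of $\mathcal E,\mathcal E',\mathcal E''$; the result is $((Q_G)_{\hat G},(W_G)_{\hat G})$. With respect to $\hat G$ and $\mathcal E_G$, the arrow $\tilde\alpha^{b(\alpha)}$ of $Q_G$ has type (1) with $t(\tilde\alpha^{b(\alpha)})=b(\alpha)$ if $\alpha$ has type (4) in $Q$; $\tilde\alpha^0$ has type (2), resp. (3), if $\alpha$ has type (3), resp. (2), in $Q$; and $\tilde\alpha$ has type (4) with $b(\tilde\alpha)=t(\alpha)$ if $\alpha$ has type (1) in $Q$. Writing $W_G=\sum_d a(d)d$, and defining $\hat d$, $\tilde d$, $\tilde d^\nu$, $p(d)$ and the sets $\mathcal C_G(x)=\{\hat d\mid d\text{ a cycle of }W_G\text{ of type }x\}$ for the cycles $d$ of $W_G$ in the same way as $\hat c$, $\tilde c$, $\tilde c^\mu$, $p(c)$ and $\mathcal C(x)$ are defined for the cycles $c$ of $W$ (with these replacements), the potential is $$(W_G)_{\hat G}=\sum_{d\in\mathcal C_G(\mathrm i)}a(d)\frac{|\hat Gd|}{n}\tilde d+\sum_{d\in\mathcal C_G(\mathrm{ii})}a(d)\sum_{\nu=0}^{n-1}\zeta^{-p(d)\nu}\tilde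 d^\nu+\sum_{d\in\mathcal C_G(\mathrm{iii})\cup\mathcal C_G(\mathrm{iv})}a(d)\sum_{\nu=0}^{n-1}\tilde d^\nu .$$ Explicitly, the vertices of $(Q_G)_{\hat G}$ are $\eta^\varepsilon_0\otimes1$ ($\varepsilon\in\mathcal E''$) and $\eta^\varepsilon\otimes e_\nu$ ($\varepsilon\in\mathcal E'$, $0\le\nu\le n-1$), where here $e_\nu=\frac1n\sum_i\zeta^{i\nu}\chi^i\in k\hat G$. Its arrows are (for $\alpha:\varepsilon\to\varepsilon'$ of type (4),(3),(2), resp. $\alpha:g^{t(\alpha)}(\varepsilon)\to\varepsilon'$ of type (1), in $Q$): - $\tilde\beta:\eta^\varepsilon_0\otimes1\to\eta^{\varepsilon'}_0\otimes1$, $\beta=\tilde\alpha^{b(\alpha)}$, $\alpha$ of type (4); - $\tilde\beta^\nu:\eta^\varepsilon_0\otimes1\to\eta^{\varepsilon'}\otimes e_\nu$, $\beta=\tilde\alpha^0$, $\alpha$ of type (3); - $\tilde\beta^\nu:\eta^\varepsilon\otimes e_\nu\to\eta^{\varepsilon'}_0\otimes1$, $\beta=\tilde\alpha^0$, $\alpha$ of type (2); - $\tilde\beta^\nu:\eta^\varepsilon\otimes e_\nu\to\eta^{\varepsilon'}\otimes e_{\nu-t(\alpha)}$, $\beta=\tilde\alpha$, $\alpha$ of type (1). *)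

theory Defs
  imports
    "Graph_Theory.Digraph_Component"
    "HOL-Algebra.QuotRing"
    "HOL-Algebra.Ideal_Product"
begin

section \<open>Path algebras\<close>

text \<open>
  A quiver is a \<open>pre_digraph\<close>; the start and the target of an arrow are its \<open>tail\<close> and its \<open>head\<close>.
  A path \<open>\<alpha>\<^sub>1 \<dots> \<alpha>\<^sub>l\<close> is composed from right to left and is represented by the triple
  \<open>(target, [\<alpha>\<^sub>1, \<dots>, \<alpha>\<^sub>l], start)\<close>, so that \<open>(v, [], v)\<close> is the trivial path at \<open>v\<close>; read as a
  walk of the digraph it is the reversed list. An element of the path algebra is its coefficient function.
\<close>

type_synonym ('v, 'a) path = "'v \<times> 'a list \<times> 'v"
type_synonym ('v, 'a, 'k) palg = "('v, 'a) path \<Rightarrow> 'k"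

definition paths :: "('v, 'a) pre_digraph \<Rightarrow> ('v, 'a) path set" where
  "paths Q = {(w, l, u). pre_digraph.awalk Q u (rev l) w}"

definition path_algebra :: "('v, 'a) pre_digraph \<Rightarrow> ('v, 'a, 'k::field) palg set" where
  "path_algebra Q = {x. finite {p. x p \<noteq> 0} \<and> {p. x p \<noteq> 0} \<subseteq> paths Q}"

definition single :: "('v, 'a) path \<Rightarrow> ('v, 'a, 'k::field) palg" where
  "single p = (\<lambda>q. if q = p then 1 else 0)"

definition vertex :: "'v \<Rightarrow> ('v, 'a, 'k::field) palg" where
  "vertex v = single (v, [], v)"

definition arrow :: "('v, 'a) pre_digraph \<Rightarrow> 'a \<Rightarrow> ('v, 'a, 'k::field) palg" where
  "arrow Q \<alpha> = single (head Q \<alpha>, [\<alpha>], tail Q \<alpha>)"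

definition scal :: "'k::field \<Rightarrow> ('v, 'a, 'k) palg \<Rightarrow> ('v, 'a, 'k) palg" where
  "scal c x = (\<lambda>p. c * x p)"

definition pmult ::
  "('v, 'a) pre_digraph \<Rightarrow> ('v, 'a, 'k::field) palg \<Rightarrow> ('v, 'a, 'k) palg \<Rightarrow> ('v, 'a, 'k) palg" where
  "pmult Q x y = (\<lambda>(w, l, u).
     \<Sum>(q, r) \<in> {((w, l1, v), (v, l2, u)) | l1 l2 v.
         l = l1 @ l2 \<and> (w, l1, v) \<in> paths Q \<and> (v, l2, u) \<in> paths Q}. x q * y r)"

definition pone :: "('v, 'a) pre_digraph \<Rightarrow> ('v, 'a, 'k::field) palg" where
  "pone Q = (\<lambda>p. if \<exists>v \<in> verts Q. p = (v, [], v) then 1 else 0)"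

definition path_ring :: "('v, 'a) pre_digraph \<Rightarrow> ('v, 'a, 'k::field) palg ring" where
  "path_ring Q = \<lparr>carrier = path_algebra Q, monoid.mult = pmult Q, one = pone Q,
     zero = (\<lambda>p. 0), add = (\<lambda>x y p. x p + y p)\<rparr>"

definition path_alg_iso ::
  "('v, 'a) pre_digraph \<Rightarrow> ('w, 'b) pre_digraph \<Rightarrow>
   (('v, 'a, 'k::field) palg \<Rightarrow> ('w, 'b, 'k) palg) \<Rightarrow> bool" where
  "path_alg_iso Q Q' F \<longleftrightarrow> F \<in> ring_iso (path_ring Q) (path_ring Q') \<and>
     (\<forall>c. \<forall>x \<in> path_algebra Q. F (scal c x) = scal c (F x))"

text \<open>
  \<open>alg_ext Q' f0 f1\<close> is the linear and multiplicative extension to paths of the assignment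
  \<open>v \<mapsto> f0 v\<close>, \<open>\<alpha> \<mapsto> f1 \<alpha>\<close> of elements of the path algebra of \<open>Q'\<close> to vertices and arrows.
\<close>

definition path_image ::
  "('w, 'b) pre_digraph \<Rightarrow> ('v \<Rightarrow> ('w, 'b, 'k::field) palg) \<Rightarrow> ('a \<Rightarrow> ('w, 'b, 'k) palg) \<Rightarrow>
   ('v, 'a) path \<Rightarrow> ('w, 'b, 'k) palg" where
  "path_image Q' f0 f1 = (\<lambda>(w, l, u). foldr (\<lambda>\<alpha> y. pmult Q' (f1 \<alpha>) y) l (f0 u))"

definition alg_ext ::
  "('w, 'b) pre_digraph \<Rightarrow> ('v \<Rightarrow> ('w, 'b, 'k::field) palg) \<Rightarrow> ('a \<Rightarrow> ('w, 'b, 'k) palg) \<Rightarrow>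
   ('v, 'a, 'k) palg \<Rightarrow> ('w, 'b, 'k) palg" where
  "alg_ext Q' f0 f1 x = (\<lambda>p. \<Sum>q \<in> {q. x q \<noteq> 0}. x q * path_image Q' f0 f1 q p)"

definition quiver_iso ::
  "('v, 'a) pre_digraph \<Rightarrow> ('w, 'b) pre_digraph \<Rightarrow> ('v \<Rightarrow> 'w) \<Rightarrow> ('a \<Rightarrow> 'b) \<Rightarrow> bool" where
  "quiver_iso Q Q' f0 f1 \<longleftrightarrow>
     bij_betw f0 (verts Q) (verts Q') \<and> bij_betw f1 (arcs Q) (arcs Q') \<and>
     (\<forall>\<alpha> \<in> arcs Q. tail Q' (f1 \<alpha>) = f0 (tail Q \<alpha>) \<and> head Q' (f1 \<alpha>) = f0 (head Q \<alpha>))"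


section \<open>Finite potentials\<close>

text \<open>
  A finite potential is represented by an element of the path algebra which is a linear combination of
  cycles of length at least 3. Two such elements are the same potential if they agree up to cyclic
  permutation, i.e. have the same total coefficient on each class of cycles under rotation;
  \<open>cyc_coeff W c\<close> is the coefficient \<open>a(c)\<close> when equal cycles have been collected. The word of a
  nontrivial cycle determines the cycle.
\<close>

definition finite_potential :: "('v, 'a) pre_digraph \<Rightarrow> ('v, 'a, 'k::field) palg \<Rightarrow> bool" where
  "finite_potential Q W \<longleftrightarrow> W \<in> path_algebra Q \<and>
     (\<forall>w l u. W (w, l, u) \<noteq> 0 \<longrightarrow> w = u \<and> 3 \<le> length l)"

definition cyc_class :: "'a list \<Rightarrow> 'a list set" where
  "cyc_class c = range (\<lambda>m. rotate m c)"

definition cyc_coeff :: "('v, 'a, 'k::field) palg \<Rightarrow> 'a list \<Rightarrow> 'k" where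
  "cyc_coeff W c = (\<Sum>p \<in> {(v, l, v) | v l. W (v, l, v) \<noteq> 0 \<and> l \<in> cyc_class c}. W p)"

definition same_potential :: "('v, 'a, 'k::field) palg \<Rightarrow> ('v, 'a, 'k) palg \<Rightarrow> bool" where
  "same_potential W W' \<longleftrightarrow> (\<forall>c. cyc_coeff W c = cyc_coeff W' c)"

definition cycles_of :: "('v, 'a, 'k::field) palg \<Rightarrow> 'a list set" where
  "cycles_of W = {c. cyc_coeff W c \<noteq> 0}"

definition cyclic_deriv ::
  "('v, 'a) pre_digraph \<Rightarrow> 'a \<Rightarrow> ('v, 'a, 'k::field) palg \<Rightarrow> ('v, 'a, 'k) palg" where
  "cyclic_deriv Q \<alpha> W = (\<lambda>p. \<Sum>(v, l, u) \<in> {q. W q \<noteq> 0}. W (v, l, u) *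
     of_nat (card {m. m < length l \<and> l ! m = \<alpha> \<and>
       p = (tail Q \<alpha>, drop (Suc m) l @ take m l, head Q \<alpha>)}))"

definition arrow_ideal :: "('v, 'a) pre_digraph \<Rightarrow> ('v, 'a, 'k::field) palg set" where
  "arrow_ideal Q = genideal (path_ring Q) (arrow Q ` arcs Q)"

primrec arrow_ideal_pow :: "('v, 'a) pre_digraph \<Rightarrow> nat \<Rightarrow> ('v, 'a, 'k::field) palg set" where
  "arrow_ideal_pow Q 0 = path_algebra Q"
| "arrow_ideal_pow Q (Suc m) = ideal_prod (path_ring Q) (arrow_ideal Q) (arrow_ideal_pow Q m)"

definition admissible :: "('v, 'a) pre_digraph \<Rightarrow> ('v, 'a, 'k::field) palg set \<Rightarrow> bool" where
  "admissible Q I \<longleftrightarrow> ideal I (path_ring Q) \<and>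
     (\<exists>m\<ge>2. arrow_ideal_pow Q m \<subseteq> I \<and> I \<subseteq> arrow_ideal_pow Q 2)"

definition jacobian_ideal ::
  "('v, 'a) pre_digraph \<Rightarrow> ('v, 'a, 'k::field) palg \<Rightarrow> ('v, 'a, 'k) palg set" where
  "jacobian_ideal Q W = genideal (path_ring Q) ((\<lambda>\<alpha>. cyclic_deriv Q \<alpha> W) ` arcs Q)"


section \<open>Cyclic group actions\<close>

text \<open>
  The data entering the construction of \<open>(Q\<^sub>G, W\<^sub>G)\<close>: a quiver with potential, the automorphism \<open>act\<close> of
  the path algebra by which the generator \<open>g\<close> of the cyclic group of order \<open>gord\<close> acts, the root of
  unity \<open>\<zeta>\<close>, and the orbit representatives \<open>\<E>'\<close> (\<open>free_reps\<close>) and \<open>\<E>''\<close> (\<open>fix_reps\<close>). The element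
  \<open>g\<^sup>t\<close> of the group is represented by the exponent \<open>t\<close> modulo \<open>gord\<close>.
\<close>

record ('v, 'a, 'k) qp_datum =
  quiv :: "('v, 'a) pre_digraph"
  pot :: "('v, 'a, 'k) palg"
  act :: "('v, 'a, 'k) palg \<Rightarrow> ('v, 'a, 'k) palg"
  gord :: nat
  zeta :: 'k
  free_reps :: "'v set"
  fix_reps :: "'v set"

definition star_v :: "('v, 'a, 'k::field) qp_datum \<Rightarrow> 'v \<Rightarrow> 'v" where
  "star_v D v = (THE w. w \<in> verts (quiv D) \<and> act D (vertex v) = vertex w)"

definition star_a :: "('v, 'a, 'k::field) qp_datum \<Rightarrow> 'a \<Rightarrow> 'a" where
  "star_a D \<alpha> = (THE \<beta>. \<beta> \<in> arcs (quiv D) \<and>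
     (\<exists>s. act D (arrow (quiv D) \<alpha>) = scal s (arrow (quiv D) \<beta>)))"

text \<open>\<open>g\<^sup>t\<close> acting on vertices, resp. on arrows, of \<open>Q\<close>; the integer \<open>t\<close> is read modulo the group order.\<close>

definition gv :: "('v, 'a, 'k::field) qp_datum \<Rightarrow> int \<Rightarrow> 'v \<Rightarrow> 'v" where
  "gv D t = star_v D ^^ nat (t mod int (gord D))"

definition ga :: "('v, 'a, 'k::field) qp_datum \<Rightarrow> int \<Rightarrow> 'a \<Rightarrow> 'a" where
  "ga D t = star_a D ^^ nat (t mod int (gord D))"

definition fixed_verts :: "('v, 'a, 'k::field) qp_datum \<Rightarrow> 'v set" where
  "fixed_verts D = {v \<in> verts (quiv D). star_v D v = v}"

definition b_exp :: "('v, 'a, 'k::field) qp_datum \<Rightarrow> 'a \<Rightarrow> int" where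
  "b_exp D \<alpha> = (THE b. 0 \<le> b \<and> b < int (gord D) \<and>
     act D (arrow (quiv D) \<alpha>) = scal (zeta D powi b) (arrow (quiv D) \<alpha>))"

definition t_exp :: "('v, 'a, 'k::field) qp_datum \<Rightarrow> 'a \<Rightarrow> int" where
  "t_exp D \<alpha> = (THE t. 0 \<le> t \<and> t < int (gord D) \<and>
     (\<exists>\<epsilon> \<in> free_reps D. tail (quiv D) \<alpha> = gv D t \<epsilon>))"

definition group_action :: "('v, 'a, 'k::field) qp_datum \<Rightarrow> bool" where
  "group_action D \<longleftrightarrow> 0 < gord D \<and> path_alg_iso (quiv D) (quiv D) (act D) \<and>
     (\<forall>x \<in> path_algebra (quiv D). (act D ^^ gord D) x = x)"

definition orbit_reps :: "('v, 'a, 'k::field) qp_datum \<Rightarrow> bool" where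
  "orbit_reps D \<longleftrightarrow> free_reps D \<subseteq> verts (quiv D) - fixed_verts D \<and> fix_reps D \<subseteq> fixed_verts D \<and>
     (\<forall>v \<in> verts (quiv D). \<exists>!\<epsilon>. \<epsilon> \<in> free_reps D \<union> fix_reps D \<and> (\<exists>i. (star_v D ^^ i) \<epsilon> = v))"

text \<open>
  The four types of cycles with respect to a set \<open>F\<close> of fixed vertices. The vertices through which the
  cycle \<open>\<alpha>\<^sub>1 \<dots> \<alpha>\<^sub>l\<close> goes are counted with multiplicity as the targets of its arrows.
\<close>

definition fix_count :: "('v, 'a) pre_digraph \<Rightarrow> 'v set \<Rightarrow> 'a list \<Rightarrow> nat" where
  "fix_count Q F c = card {i. i < length c \<and> head Q (c ! i) \<in> F}"

definition cyc_i :: "('v, 'a) pre_digraph \<Rightarrow> 'v set \<Rightarrow> 'a list \<Rightarrow> bool" where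
  "cyc_i Q F c \<longleftrightarrow> fix_count Q F c = 0"

definition cyc_ii :: "('v, 'a) pre_digraph \<Rightarrow> 'v set \<Rightarrow> 'a list \<Rightarrow> bool" where
  "cyc_ii Q F c \<longleftrightarrow> fix_count Q F c = 1"

definition cyc_iii :: "('v, 'a) pre_digraph \<Rightarrow> 'v set \<Rightarrow> 'a list \<Rightarrow> bool" where
  "cyc_iii Q F c \<longleftrightarrow> fix_count Q F c + 1 = length c"

definition cyc_iv :: "('v, 'a) pre_digraph \<Rightarrow> 'v set \<Rightarrow> 'a list \<Rightarrow> bool" where
  "cyc_iv Q F c \<longleftrightarrow> fix_count Q F c = length c"

definition A1 :: "('v, 'a, 'k::field) qp_datum \<Rightarrow> bool" where
  "A1 D \<longleftrightarrow> zeta D ^ gord D = 1 \<and> (\<forall>m. 0 < m \<and> m < gord D \<longrightarrow> zeta D ^ m \<noteq> 1)"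

definition A2 :: "('v, 'a, 'k::field) qp_datum \<Rightarrow> bool" where
  "A2 D \<longleftrightarrow>
     (\<forall>v \<in> verts (quiv D). \<exists>w \<in> verts (quiv D). act D (vertex v) = vertex w) \<and>
     (\<forall>\<alpha> \<in> arcs (quiv D). \<exists>\<beta> \<in> arcs (quiv D). \<exists>s.
        act D (arrow (quiv D) \<alpha>) = scal s (arrow (quiv D) \<beta>))"

definition A3 :: "('v, 'a, 'k::field) qp_datum \<Rightarrow> bool" where
  "A3 D \<longleftrightarrow> (\<forall>v \<in> verts (quiv D) - fixed_verts D. card (range (\<lambda>i. (star_v D ^^ i) v)) = gord D)"

definition A4 :: "('v, 'a, 'k::field) qp_datum \<Rightarrow> bool" where
  "A4 D \<longleftrightarrow> (\<forall>i. same_potential ((act D ^^ i) (pot D)) (pot D))"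

definition A5 :: "('v, 'a, 'k::field) qp_datum \<Rightarrow> bool" where
  "A5 D \<longleftrightarrow> (\<forall>\<alpha> \<in> arcs (quiv D).
     tail (quiv D) \<alpha> \<in> fixed_verts D \<and> head (quiv D) \<alpha> \<in> fixed_verts D \<longrightarrow>
     (\<exists>b::int. act D (arrow (quiv D) \<alpha>) = scal (zeta D powi b) (arrow (quiv D) \<alpha>)))"

definition A6 :: "('v, 'a, 'k::field) qp_datum \<Rightarrow> bool" where
  "A6 D \<longleftrightarrow> (\<forall>\<alpha> \<in> arcs (quiv D).
     tail (quiv D) \<alpha> \<notin> fixed_verts D \<or> head (quiv D) \<alpha> \<notin> fixed_verts D \<longrightarrow>
     (\<forall>i. (act D ^^ i) (arrow (quiv D) \<alpha>) \<in> arrow (quiv D) ` arcs (quiv D)))"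

definition A7 :: "('v, 'a, 'k::field) qp_datum \<Rightarrow> bool" where
  "A7 D \<longleftrightarrow> (\<forall>c \<in> cycles_of (pot D).
     cyc_i (quiv D) (fixed_verts D) c \<or> cyc_ii (quiv D) (fixed_verts D) c \<or>
     cyc_iii (quiv D) (fixed_verts D) c \<or> cyc_iv (quiv D) (fixed_verts D) c)"


section \<open>The skew group algebra\<close>

text \<open>The element \<open>\<Sum>\<^sub>i x i \<otimes> g\<^sup>i\<close> (\<open>0 \<le> i < n\<close>) of \<open>(kQ)G\<close> is represented by \<open>x\<close>, with value 0 for \<open>i \<ge> n\<close>.\<close>

type_synonym ('v, 'a, 'k) skew = "nat \<Rightarrow> ('v, 'a, 'k) palg"

definition tensor :: "('v, 'a, 'k::field) palg \<Rightarrow> (nat \<Rightarrow> 'k) \<Rightarrow> ('v, 'a, 'k) skew" where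
  "tensor x a = (\<lambda>i. scal (a i) x)"

definition smult ::
  "('v, 'a, 'k::field) qp_datum \<Rightarrow> ('v, 'a, 'k) skew \<Rightarrow> ('v, 'a, 'k) skew \<Rightarrow> ('v, 'a, 'k) skew" where
  "smult D x y = (\<lambda>m p.
     \<Sum>(i, j) \<in> {(i, j). i < gord D \<and> j < gord D \<and> (i + j) mod gord D = m}.
       pmult (quiv D) (x i) ((act D ^^ i) (y j)) p)"

definition gpow :: "('v, 'a, 'k::field) qp_datum \<Rightarrow> int \<Rightarrow> nat \<Rightarrow> 'k" where
  "gpow D t = (\<lambda>i. if i = nat (t mod int (gord D)) then 1 else 0)"

definition idem :: "('v, 'a, 'k::field) qp_datum \<Rightarrow> int \<Rightarrow> nat \<Rightarrow> 'k" where
  "idem D \<mu> = (\<lambda>i. if i < gord D then zeta D powi (int i * \<mu>) / of_nat (gord D) else 0)"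

definition eta :: "('v, 'a, 'k::field) qp_datum \<Rightarrow> 'v \<Rightarrow> ('v, 'a, 'k) skew" where
  "eta D \<epsilon> = tensor (vertex \<epsilon>) (gpow D 0)"

definition eta_mu :: "('v, 'a, 'k::field) qp_datum \<Rightarrow> 'v \<Rightarrow> int \<Rightarrow> ('v, 'a, 'k) skew" where
  "eta_mu D \<epsilon> \<mu> = tensor (vertex \<epsilon>) (idem D \<mu>)"


section \<open>The quiver \<open>Q\<^sub>G\<close>\<close>

definition arrows1 :: "('v, 'a, 'k::field) qp_datum \<Rightarrow> 'a set" where
  "arrows1 D = {\<alpha> \<in> arcs (quiv D). head (quiv D) \<alpha> \<in> free_reps D \<and>
     (\<exists>t. \<exists>\<epsilon> \<in> free_reps D. tail (quiv D) \<alpha> = gv D t \<epsilon>)}"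

definition arrows2 :: "('v, 'a, 'k::field) qp_datum \<Rightarrow> 'a set" where
  "arrows2 D = {\<alpha> \<in> arcs (quiv D). tail (quiv D) \<alpha> \<in> free_reps D \<and> head (quiv D) \<alpha> \<in> fix_reps D}"

definition arrows3 :: "('v, 'a, 'k::field) qp_datum \<Rightarrow> 'a set" where
  "arrows3 D = {\<alpha> \<in> arcs (quiv D). tail (quiv D) \<alpha> \<in> fix_reps D \<and> head (quiv D) \<alpha> \<in> free_reps D}"

definition arrows4 :: "('v, 'a, 'k::field) qp_datum \<Rightarrow> 'a set" where
  "arrows4 D = {\<alpha> \<in> arcs (quiv D). tail (quiv D) \<alpha> \<in> fix_reps D \<and> head (quiv D) \<alpha> \<in> fix_reps D}"

definition tilde1 :: "('v, 'a, 'k::field) qp_datum \<Rightarrow> 'a \<Rightarrow> ('v, 'a, 'k) skew" where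
  "tilde1 D \<alpha> = tensor (arrow (quiv D) \<alpha>) (gpow D (t_exp D \<alpha>))"

definition tilde2 :: "('v, 'a, 'k::field) qp_datum \<Rightarrow> 'a \<Rightarrow> int \<Rightarrow> ('v, 'a, 'k) skew" where
  "tilde2 D \<alpha> \<mu> =
     smult D (tensor (pone (quiv D)) (idem D \<mu>)) (tensor (arrow (quiv D) \<alpha>) (gpow D 0))"

definition tilde3 :: "('v, 'a, 'k::field) qp_datum \<Rightarrow> 'a \<Rightarrow> int \<Rightarrow> ('v, 'a, 'k) skew" where
  "tilde3 D \<alpha> \<mu> = tensor (arrow (quiv D) \<alpha>) (idem D \<mu>)"

definition tilde4 :: "('v, 'a, 'k::field) qp_datum \<Rightarrow> 'a \<Rightarrow> int \<Rightarrow> ('v, 'a, 'k) skew" where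
  "tilde4 D \<alpha> \<mu> = tensor (arrow (quiv D) \<alpha>) (idem D \<mu>)"

text \<open>\<open>QG_arrow D x \<eta> \<eta>'\<close>: the element \<open>x\<close> of \<open>(kQ)G\<close> is an arrow \<open>\<eta> \<rightarrow> \<eta>'\<close> of \<open>Q\<^sub>G\<close>.\<close>

inductive QG_arrow ::
  "('v, 'a, 'k::field) qp_datum \<Rightarrow> ('v, 'a, 'k) skew \<Rightarrow> ('v, 'a, 'k) skew \<Rightarrow> ('v, 'a, 'k) skew \<Rightarrow> bool"
  for D where
  type1: "\<lbrakk>\<alpha> \<in> arrows1 D; \<epsilon> \<in> free_reps D; tail (quiv D) \<alpha> = gv D (t_exp D \<alpha>) \<epsilon>\<rbrakk> \<Longrightarrow>
    QG_arrow D (tilde1 D \<alpha>) (eta D \<epsilon>) (eta D (head (quiv D) \<alpha>))"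
| type2: "\<lbrakk>\<alpha> \<in> arrows2 D; 0 \<le> \<mu>; \<mu> < int (gord D)\<rbrakk> \<Longrightarrow>
    QG_arrow D (tilde2 D \<alpha> \<mu>) (eta D (tail (quiv D) \<alpha>)) (eta_mu D (head (quiv D) \<alpha>) \<mu>)"
| type3: "\<lbrakk>\<alpha> \<in> arrows3 D; 0 \<le> \<mu>; \<mu> < int (gord D)\<rbrakk> \<Longrightarrow>
    QG_arrow D (tilde3 D \<alpha> \<mu>) (eta_mu D (tail (quiv D) \<alpha>) \<mu>) (eta D (head (quiv D) \<alpha>))"
| type4: "\<lbrakk>\<alpha> \<in> arrows4 D; 0 \<le> \<mu>; \<mu> < int (gord D)\<rbrakk> \<Longrightarrow>
    QG_arrow D (tilde4 D \<alpha> \<mu>) (eta_mu D (tail (quiv D) \<alpha>) \<mu>)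
      (eta_mu D (head (quiv D) \<alpha>) (\<mu> - b_exp D \<alpha>))"

definition QG ::
  "('v, 'a, 'k::field) qp_datum \<Rightarrow> (('v, 'a, 'k) skew, ('v, 'a, 'k) skew) pre_digraph" where
  "QG D = \<lparr>
     verts = eta D ` free_reps D \<union>
       {eta_mu D \<epsilon> \<mu> | \<epsilon> \<mu>. \<epsilon> \<in> fix_reps D \<and> 0 \<le> \<mu> \<and> \<mu> < int (gord D)},
     arcs = {x. \<exists>s t. QG_arrow D x s t},
     tail = (\<lambda>x. THE s. \<exists>t. QG_arrow D x s t),
     head = (\<lambda>x. THE t. \<exists>s. QG_arrow D x s t)\<rparr>"


section \<open>The potential \<open>W\<^sub>G\<close>\<close>

text \<open>
  The orbit \<open>G*c\<close> as the set of all words of its cycles (closed under rotation), and its cardinality,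
  where cycles are counted up to rotation.
\<close>

definition cyc_orbit :: "('v, 'a, 'k::field) qp_datum \<Rightarrow> 'a list \<Rightarrow> 'a list set" where
  "cyc_orbit D c = (\<Union>i. cyc_class (map (star_a D ^^ i) c))"

definition orbit_card :: "('v, 'a, 'k::field) qp_datum \<Rightarrow> 'a list \<Rightarrow> nat" where
  "orbit_card D c = card (range (\<lambda>i. cyc_class (map (star_a D ^^ i) c)))"

text \<open>
  A chosen cycle \<open>\<alpha>\<^sub>1 g\<^bsup>t\<^sub>1\<^esup>(\<alpha>\<^sub>2) g\<^bsup>t\<^sub>1+t\<^sub>2\<^esup>(\<alpha>\<^sub>3) \<dots>\<close> is stored as the pair of the lists
  \<open>[\<alpha>\<^sub>1, \<dots>, \<alpha>\<^sub>l]\<close> and \<open>[t\<^sub>1, \<dots>, t\<^sub>l]\<close>. List positions start at 0: \<open>\<alpha>\<^sub>i\<close> is \<open>as ! (i - 1)\<close>, and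
  \<open>\<epsilon>\<^bsub>i-1\<^esub>\<close> is the target of \<open>\<alpha>\<^sub>i\<close>.
\<close>

definition hword :: "('v, 'a, 'k::field) qp_datum \<Rightarrow> 'a list \<times> int list \<Rightarrow> 'a list" where
  "hword D = (\<lambda>(as, ts). map (\<lambda>i. ga D (\<Sum>j<i. ts ! j) (as ! i)) [0..<length as])"

definition hshape :: "('v, 'a, 'k::field) qp_datum \<Rightarrow> 'a list \<times> int list \<Rightarrow> bool" where
  "hshape D = (\<lambda>(as, ts). as \<noteq> [] \<and> length ts = length as \<and> set as \<subseteq> arcs (quiv D) \<and>
     (\<forall>i < length as.
        tail (quiv D) (as ! i) = gv D (ts ! i) (head (quiv D) (as ! (Suc i mod length as)))))"

definition hshape_i :: "('v, 'a, 'k::field) qp_datum \<Rightarrow> 'a list \<times> int list \<Rightarrow> bool" where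
  "hshape_i D = (\<lambda>(as, ts). hshape D (as, ts) \<and>
     (\<forall>i < length as. head (quiv D) (as ! i) \<in> free_reps D))"

definition hshape_ii :: "('v, 'a, 'k::field) qp_datum \<Rightarrow> 'a list \<times> int list \<Rightarrow> bool" where
  "hshape_ii D = (\<lambda>(as, ts). hshape D (as, ts) \<and> 1 < length as \<and> ts ! 0 = 0 \<and>
     (\<forall>i < length as. head (quiv D) (as ! i) \<in> (if i = 1 then fix_reps D else free_reps D)))"

definition hshape_iii :: "('v, 'a, 'k::field) qp_datum \<Rightarrow> 'a list \<times> int list \<Rightarrow> bool" where
  "hshape_iii D = (\<lambda>(as, ts). hshape D (as, ts) \<and> 1 < length as \<and> (\<forall>i < length as. ts ! i = 0) \<and>
     (\<forall>i < length as. head (quiv D) (as ! i) \<in> (if i = 1 then free_reps D else fix_reps D)))"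

definition hshape_iv :: "('v, 'a, 'k::field) qp_datum \<Rightarrow> 'a list \<times> int list \<Rightarrow> bool" where
  "hshape_iv D = (\<lambda>(as, ts). hshape D (as, ts) \<and> (\<forall>i < length as. ts ! i = 0) \<and>
     (\<forall>i < length as. head (quiv D) (as ! i) \<in> fix_reps D))"

text \<open>
  In the construction \<open>fix_reps\<close> plays the role of the set of fixed vertices (every fixed vertex is the
  representative of its orbit). This makes the dual action meaningful also for a group of order 1, where
  the vertices \<open>\<eta>\<^sup>\<epsilon>\<^sub>0\<close> are treated as non-fixed.
\<close>

definition cycles_i :: "('v, 'a, 'k::field) qp_datum \<Rightarrow> 'a list set" where
  "cycles_i D = {c \<in> cycles_of (pot D). cyc_i (quiv D) (fix_reps D) c}"

definition cycles_ii :: "('v, 'a, 'k::field) qp_datum \<Rightarrow> 'a list set" where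
  "cycles_ii D = {c \<in> cycles_of (pot D). cyc_ii (quiv D) (fix_reps D) c}"

definition cycles_iii :: "('v, 'a, 'k::field) qp_datum \<Rightarrow> 'a list set" where
  "cycles_iii D = {c \<in> cycles_of (pot D). cyc_iii (quiv D) (fix_reps D) c}"

definition cycles_iv :: "('v, 'a, 'k::field) qp_datum \<Rightarrow> 'a list set" where
  "cycles_iv D = {c \<in> cycles_of (pot D). cyc_iv (quiv D) (fix_reps D) c}"

text \<open>\<open>hat\<close> is a valid choice of the distinguished representatives, constant on orbits and under rotation.\<close>

definition hat_choice ::
  "('v, 'a, 'k::field) qp_datum \<Rightarrow> ('a list \<Rightarrow> 'a list \<times> int list) \<Rightarrow> bool" where
  "hat_choice D hat \<longleftrightarrow> (\<forall>c \<in> cycles_of (pot D).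
     hword D (hat c) \<in> cyc_orbit D c \<and>
     (\<forall>c' \<in> cycles_of (pot D). c' \<in> cyc_orbit D c \<longrightarrow> hat c' = hat c) \<and>
     (c \<in> cycles_i D \<longrightarrow> hshape_i D (hat c)) \<and>
     (c \<in> cycles_ii D \<longrightarrow> hshape_ii D (hat c)) \<and>
     (c \<in> cycles_iii D \<longrightarrow> hshape_iii D (hat c)) \<and>
     (c \<in> cycles_iv D \<longrightarrow> hshape_iv D (hat c)))"

definition tilde_i ::
  "('v, 'a, 'k::field) qp_datum \<Rightarrow> 'a list \<times> int list \<Rightarrow> ('v, 'a, 'k) skew list" where
  "tilde_i D = (\<lambda>(as, ts). map (tilde1 D) as)"

definition tilde_ii ::
  "('v, 'a, 'k::field) qp_datum \<Rightarrow> 'a list \<times> int list \<Rightarrow> int \<Rightarrow> ('v, 'a, 'k) skew list" where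
  "tilde_ii D = (\<lambda>(as, ts) \<mu>.
     tilde3 D (as ! 0) \<mu> # tilde2 D (ga D (- (ts ! 1)) (as ! 1)) \<mu> # map (tilde1 D) (drop 2 as))"

text \<open>\<open>b_sum D as i\<close> is \<open>b\<^sub>i = b(\<alpha>\<^sub>i) + \<dots> + b(\<alpha>\<^sub>l)\<close>, which is 0 for \<open>i = l + 1\<close>.\<close>

definition b_sum :: "('v, 'a, 'k::field) qp_datum \<Rightarrow> 'a list \<Rightarrow> nat \<Rightarrow> int" where
  "b_sum D as i = (\<Sum>j = i..length as. b_exp D (as ! (j - 1)))"

definition tilde_iii ::
  "('v, 'a, 'k::field) qp_datum \<Rightarrow> 'a list \<times> int list \<Rightarrow> int \<Rightarrow> ('v, 'a, 'k) skew list" where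
  "tilde_iii D = (\<lambda>(as, ts) \<mu>.
     tilde2 D (as ! 0) \<mu> # tilde3 D (as ! 1) (\<mu> - b_sum D as 3) #
     map (\<lambda>i. tilde4 D (as ! (i - 1)) (\<mu> - b_sum D as (i + 1))) [3..<length as + 1])"

definition tilde_iv ::
  "('v, 'a, 'k::field) qp_datum \<Rightarrow> 'a list \<times> int list \<Rightarrow> int \<Rightarrow> ('v, 'a, 'k) skew list" where
  "tilde_iv D = (\<lambda>(as, ts) \<mu>.
     map (\<lambda>i. tilde4 D (as ! (i - 1)) (\<mu> - b_sum D as (i + 1))) [1..<length as + 1])"

definition cyc_path :: "('v, 'a) pre_digraph \<Rightarrow> 'a list \<Rightarrow> ('v, 'a, 'k::field) palg" where
  "cyc_path Q c = single (head Q (hd c), c, tail Q (last c))"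

definition WG ::
  "('v, 'a, 'k::field) qp_datum \<Rightarrow> ('a list \<Rightarrow> 'a list \<times> int list) \<Rightarrow>
   (('v, 'a, 'k) skew, ('v, 'a, 'k) skew, 'k) palg" where
  "WG D hat = (\<lambda>p.
     (\<Sum>h \<in> hat ` cycles_i D. cyc_coeff (pot D) (hword D h) *
        (of_nat (orbit_card D (hword D h)) / of_nat (gord D)) * cyc_path (QG D) (tilde_i D h) p)
   + (\<Sum>h \<in> hat ` cycles_ii D. cyc_coeff (pot D) (hword D h) *
        (\<Sum>\<mu> = 0..<int (gord D). zeta D powi (- (snd h ! 1) * \<mu>) * cyc_path (QG D) (tilde_ii D h \<mu>) p))
   + (\<Sum>h \<in> hat ` cycles_iii D. cyc_coeff (pot D) (hword D h) *
        (\<Sum>\<mu> = 0..<int (gord D). cyc_path (QG D) (tilde_iii D h \<mu>) p))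
   + (\<Sum>h \<in> hat ` cycles_iv D. cyc_coeff (pot D) (hword D h) *
        (\<Sum>\<mu> = 0..<int (gord D). cyc_path (QG D) (tilde_iv D h \<mu>) p)))"


section \<open>The dual action\<close>

text \<open>
  \<open>\<chi>\<close> acts on \<open>(kQ)G\<close> by \<open>chi_skew\<close>; it permutes the vertices of \<open>Q\<^sub>G\<close> and maps each arrow to a scalar
  multiple of an arrow, and this assignment is extended to the path algebra of \<open>Q\<^sub>G\<close>.
\<close>

definition chi_skew :: "('v, 'a, 'k::field) qp_datum \<Rightarrow> ('v, 'a, 'k) skew \<Rightarrow> ('v, 'a, 'k) skew" where
  "chi_skew D x = (\<lambda>i. scal (zeta D ^ i) (x i))"

definition chi_arrow ::
  "('v, 'a, 'k::field) qp_datum \<Rightarrow> ('v, 'a, 'k) skew \<Rightarrow>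
   (('v, 'a, 'k) skew, ('v, 'a, 'k) skew, 'k) palg" where
  "chi_arrow D x = (THE z. \<exists>y \<in> arcs (QG D). \<exists>s.
     chi_skew D x = (\<lambda>i. scal s (y i)) \<and> z = scal s (arrow (QG D) y))"

definition chi ::
  "('v, 'a, 'k::field) qp_datum \<Rightarrow>
   (('v, 'a, 'k) skew, ('v, 'a, 'k) skew, 'k) palg \<Rightarrow> (('v, 'a, 'k) skew, ('v, 'a, 'k) skew, 'k) palg" where
  "chi D = alg_ext (QG D) (\<lambda>\<eta>. vertex (chi_skew D \<eta>)) (chi_arrow D)"

definition dual ::
  "('v, 'a, 'k::field) qp_datum \<Rightarrow> ('a list \<Rightarrow> 'a list \<times> int list) \<Rightarrow>
   (('v, 'a, 'k) skew, ('v, 'a, 'k) skew, 'k) qp_datum" where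
  "dual D hat = \<lparr>quiv = QG D, pot = WG D hat, act = chi D, gord = gord D, zeta = zeta D,
     free_reps = (\<lambda>\<epsilon>. eta_mu D \<epsilon> 0) ` fix_reps D, fix_reps = eta D ` free_reps D\<rparr>"


section \<open>The morphism \<open>\<phi>\<close>\<close>

text \<open>
  The graphs of \<open>\<phi>\<close> on vertices and on arrows. Here \<open>E\<close> stands for \<open>dual D hat\<close>, so that
  \<open>QG E\<close> is the quiver obtained from \<open>Q\<^sub>G\<close> and the dual group.
\<close>

inductive phi_v_graph ::
  "('v, 'a, 'k::field) qp_datum \<Rightarrow> (('v, 'a, 'k) skew, ('v, 'a, 'k) skew, 'k) qp_datum \<Rightarrow>
   (('v, 'a, 'k) skew, ('v, 'a, 'k) skew, 'k) skew \<Rightarrow> 'v \<Rightarrow> bool"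
  for D E where
  "\<epsilon> \<in> fix_reps D \<Longrightarrow> phi_v_graph D E (eta E (eta_mu D \<epsilon> 0)) \<epsilon>"
| "\<lbrakk>\<epsilon> \<in> free_reps D; 0 \<le> \<mu>; \<mu> < int (gord D)\<rbrakk> \<Longrightarrow>
     phi_v_graph D E (eta_mu E (eta D \<epsilon>) \<mu>) (gv D \<mu> \<epsilon>)"

inductive phi_a_graph ::
  "('v, 'a, 'k::field) qp_datum \<Rightarrow> (('v, 'a, 'k) skew, ('v, 'a, 'k) skew, 'k) qp_datum \<Rightarrow>
   (('v, 'a, 'k) skew, ('v, 'a, 'k) skew, 'k) skew \<Rightarrow> 'a \<Rightarrow> bool"
  for D E where
  "\<alpha> \<in> arrows4 D \<Longrightarrow> phi_a_graph D E (tilde1 E (tilde4 D \<alpha> (b_exp D \<alpha>))) \<alpha>"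
| "\<lbrakk>\<alpha> \<in> arrows3 D; 0 \<le> \<nu>; \<nu> < int (gord D)\<rbrakk> \<Longrightarrow>
     phi_a_graph D E (tilde2 E (tilde3 D \<alpha> 0) \<nu>) (ga D \<nu> \<alpha>)"
| "\<lbrakk>\<alpha> \<in> arrows2 D; 0 \<le> \<nu>; \<nu> < int (gord D)\<rbrakk> \<Longrightarrow>
     phi_a_graph D E (tilde3 E (tilde2 D \<alpha> 0) \<nu>) (ga D \<nu> \<alpha>)"
| "\<lbrakk>\<alpha> \<in> arrows1 D; 0 \<le> \<nu>; \<nu> < int (gord D)\<rbrakk> \<Longrightarrow>
     phi_a_graph D E (tilde4 E (tilde1 D \<alpha>) \<nu>) (ga D (\<nu> - t_exp D \<alpha>) \<alpha>)"

definition phi_v ::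
  "('v, 'a, 'k::field) qp_datum \<Rightarrow> (('v, 'a, 'k) skew, ('v, 'a, 'k) skew, 'k) qp_datum \<Rightarrow>
   (('v, 'a, 'k) skew, ('v, 'a, 'k) skew, 'k) skew \<Rightarrow> 'v" where
  "phi_v D E x = (THE v. phi_v_graph D E x v)"

definition phi_a ::
  "('v, 'a, 'k::field) qp_datum \<Rightarrow> (('v, 'a, 'k) skew, ('v, 'a, 'k) skew, 'k) qp_datum \<Rightarrow>
   (('v, 'a, 'k) skew, ('v, 'a, 'k) skew, 'k) skew \<Rightarrow> 'a" where
  "phi_a D E x = (THE \<alpha>. phi_a_graph D E x \<alpha>)"

definition phi ::
  "('v, 'a, 'k::field) qp_datum \<Rightarrow> (('v, 'a, 'k) skew, ('v, 'a, 'k) skew, 'k) qp_datum \<Rightarrow>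
   ((('v, 'a, 'k) skew, ('v, 'a, 'k) skew, 'k) skew, (('v, 'a, 'k) skew, ('v, 'a, 'k) skew, 'k) skew, 'k) palg \<Rightarrow>
   ('v, 'a, 'k) palg" where
  "phi D E = alg_ext (quiv D) (\<lambda>x. vertex (phi_v D E x)) (\<lambda>x. arrow (quiv D) (phi_a D E x))"

end

theory Submission
  imports Defs "HOL-Computational_Algebra.Polynomial"
begin

text \<open>
  The second construction undoes the first one cycle by cycle. Let \<open>c\<close> be a chosen cycle of \<open>W\<close> of type
  (i), (ii), (iii) or (iv). The cycles of \<open>W\<^sub>G\<close> obtained from it form one orbit of the dual group, which has
  type (iv), (iii), (ii) or (i) respectively, and the cycles \<open>d\<^sub>\<nu>\<close> which the dual construction produces from
  that orbit satisfy \<open>\<phi>(d\<^sub>\<nu>) = g\<^sup>\<nu>(c)\<close>. It remains to compare coefficients, a cycle being taken up to rotation.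
  For types (ii) and (iii) a cycle of \<open>W\<^sub>G\<close> determines \<open>c\<close> and its index \<open>\<mu>\<close>, and the powers of \<open>\<zeta>\<close> match
  because \<open>W\<close> is invariant: \<open>a(g\<^sup>\<nu>(c)) = \<zeta>\<^sup>\<nu>\<^sup>q a(c)\<close>, with \<open>q = q(c)\<close> for type (iii) and \<open>q = 0\<close> for type (ii).
  For types (i) and (iv) several indices give the same cycle up to rotation; their number times the length
  of the orbit is \<open>n\<close>, and the factor \<open>|Gc| / n\<close> compensates for it. The same argument shows that neither
  potential has further cycles.
\<close>


text \<open>Both \<open>hat\<close> and \<open>hat'\<close> are arbitrary admissible choices, so it
  is not known which cycle the second one picks in an orbit. The coefficients of \<open>W_G\<close>
  are therefore computed on rotation classes, for an arbitrary shape instead of a chosen one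
  (\<open>coeff_tilde_i\<close> to \<open>coeff_tilde_iv\<close>), and every shape of
  \<open>D\<close> gets an explicit shape of the dual lying over it (\<open>enc_i\<close> to
  \<open>enc_iv\<close>), to which these formulas apply. To serve both constructions, the formulas
  rest on abstract properties which pass to the dual. The invariance (A4) enters as a scaling law:
  \<open>g\<close> multiplies the class coefficient of a cycle by a product of powers of zeta. Two
  consequences have to survive dualisation: coefficients are constant along orbits avoiding the
  fixed vertices, and \<open>n\<close> divides the sum of the exponents \<open>b\<close> on cycles
  inside the fixed vertices. The second one makes the words \<open>tilde_iv\<close> close up; the
  analogous divisibility for the exponents \<open>t\<close> follows from the freeness of the
  non-fixed orbits. Duality exchanges the two, since \<open>b\<close> of the dual is
  \<open>t\<close> of the original.\<close>

text \<open>If \<open>n = 0\<close> in the field, then the \<open>n\<close> distinct powers of \<open>z\<close> are roots of \<open>1 + X + \<dots> + X\<^sup>n\<^sup>-\<^sup>1\<close>.\<close>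

lemma of_nat_order_root_of_unity:
  fixes z :: "'k::field"
  assumes "0 < n" and "z ^ n = 1" and "\<And>m. 0 < m \<Longrightarrow> m < n \<Longrightarrow> z ^ m \<noteq> 1"
  shows "of_nat n \<noteq> (0::'k)"
proof
  assume 0: "of_nat n = (0::'k)"
  define p :: "'k poly" where "p = (\<Sum>i<n. monom 1 i)"
  have c: "coeff p i = (if i < n then 1 else 0)" for i
    unfolding p_def by (simp add: coeff_sum coeff_monom)
  have "p \<noteq> 0"
    using c[of 0] \<open>0 < n\<close> by (cases "p = 0") simp_all
  have "degree p < n"
    using \<open>0 < n\<close> by (intro degree_lessI) (simp_all add: c)
  have inj: "inj_on (\<lambda>j. z ^ j) {..<n}"
  proof (rule linorder_inj_onI)
    fix i j assume ij: "i < j" "i \<in> {..<n}" "j \<in> {..<n}"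
    have "z \<noteq> 0"
      using assms(1,2) by (cases "z = 0") (simp_all add: power_0_left)
    have "z ^ j = z ^ i * z ^ (j - i)"
      using ij by (metis le_add_diff_inverse less_imp_le power_add)
    moreover have "z ^ (j - i) \<noteq> 1"
      by (rule assms(3)) (use ij in simp_all)
    ultimately show "z ^ i \<noteq> z ^ j"
      using \<open>z \<noteq> 0\<close> by simp
  qed auto
  have "(\<lambda>j. z ^ j) ` {..<n} \<subseteq> {x. poly p x = 0}"
  proof safe
    fix j assume "j < n"
    have e: "poly p (z ^ j) = (\<Sum>i<n. (z ^ j) ^ i)"
      unfolding p_def by (simp add: poly_sum poly_monom)
    show "poly p (z ^ j) = 0"
    proof (cases "j = 0")
      case True
      then show ?thesis using e 0 by simp
    next
      case False
      then have "z ^ j \<noteq> 1"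
        by (intro assms(3) \<open>j < n\<close>) simp
      moreover have "(z ^ j) ^ n = 1"
      proof -
        have "(z ^ j) ^ n = (z ^ n) ^ j" by (metis power_mult mult.commute)
        then show ?thesis using assms(2) by simp
      qed
      ultimately show ?thesis
        unfolding e by (simp add: geometric_sum)
    qed
  qed
  from card_mono[OF poly_roots_finite[OF \<open>p \<noteq> 0\<close>] this]
  have "card {..<n} \<le> card {x. poly p x = 0}"
    by (simp add: card_image[OF inj])
  also have "\<dots> \<le> degree p"
    using card_poly_roots_bound[OF \<open>p \<noteq> 0\<close>] .
  finally show False
    using \<open>degree p < n\<close> by simp
qed

section \<open>Path algebras\<close>

lemma paths_Nil: "(w, [], u) \<in> paths Q \<longleftrightarrow> w = u \<and> u \<in> verts Q"
  by (auto simp: paths_def pre_digraph.awalk_def pre_digraph.cas.simps)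

text \<open>A path word is a reversed walk, so prepending an arrow to the word means appending it to
  the walk.\<close>

lemma cas_snoc:
  "pre_digraph.cas Q u (p @ [a]) w \<longleftrightarrow> pre_digraph.cas Q u p (tail Q a) \<and> head Q a = w"
  by (induction p arbitrary: u) (auto simp: pre_digraph.cas.simps)

lemma paths_Cons:
  "(w, a # l, u) \<in> paths Q \<longleftrightarrow> a \<in> arcs Q \<and> head Q a = w \<and> (tail Q a, l, u) \<in> paths Q"
  by (auto simp: paths_def pre_digraph.awalk_def cas_snoc)

lemma paths_append:
  assumes "wf_digraph Q"
  shows "(w, l1 @ l2, u) \<in> paths Q \<longleftrightarrow> (\<exists>v. (w, l1, v) \<in> paths Q \<and> (v, l2, u) \<in> paths Q)"
proof (induction l1 arbitrary: w)
  case Nil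
  have "w \<in> verts Q" if "(w, l2, u) \<in> paths Q"
    using that wf_digraph.head_in_verts[OF assms] by (cases l2) (auto simp: paths_Nil paths_Cons)
  then show ?case by (auto simp: paths_Nil)
next
  case (Cons a l1)
  then show ?case by (simp add: paths_Cons)
qed

lemma paths_ends_in_verts:
  assumes "wf_digraph Q" and "(w, l, u) \<in> paths Q"
  shows "w \<in> verts Q" "u \<in> verts Q"
  using assms(2)
  by (induction l arbitrary: w)
     (use assms(1) in \<open>auto simp: paths_Nil paths_Cons wf_digraph.head_in_verts\<close>)

text \<open>For a nonempty word the two stored end vertices are redundant; this is what allows
  potentials to be handled through words alone.\<close>

lemma paths_conv:
  assumes "wf_digraph Q" and "l \<noteq> []"
  shows "(w, l, u) \<in> paths Q \<longleftrightarrow> w = head Q (hd l) \<and> u = tail Q (last l) \<and> set l \<subseteq> arcs Q \<and>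
    (\<forall>i. Suc i < length l \<longrightarrow> tail Q (l ! i) = head Q (l ! Suc i))"
  using assms(2)
proof (induction l arbitrary: w)
  case (Cons a l)
  show ?case
  proof (cases l)
    case Nil
    then show ?thesis
      using assms(1) by (auto simp: paths_Cons paths_Nil wf_digraph.tail_in_verts)
  next
    case (Cons b l')
    have "(\<forall>i. Suc i < length (a # l) \<longrightarrow> tail Q ((a # l) ! i) = head Q ((a # l) ! Suc i)) \<longleftrightarrow>
        tail Q a = head Q (hd l) \<and> (\<forall>i. Suc i < length l \<longrightarrow> tail Q (l ! i) = head Q (l ! Suc i))"
      (is "?A \<longleftrightarrow> ?B")
    proof
      assume A: ?A
      show ?B
        using A[rule_format, of 0] A[rule_format, of "Suc _"] Cons by auto
    next
      assume B: ?B
      show ?A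
      proof (intro allI impI)
        fix i assume "Suc i < length (a # l)"
        then show "tail Q ((a # l) ! i) = head Q ((a # l) ! Suc i)"
          using B Cons by (cases i) auto
      qed
    qed
    then show ?thesis
      using assms(1) Cons.IH[of "tail Q a"] Cons by (auto simp: paths_Cons)
  qed
qed simp

text \<open>Factorisations of a path are indexed by the cut position \<open>k\<close>. The middle
  vertex is forced: it is the tail of the last arrow of the left factor, or the target
  \<open>w\<close> if that factor is trivial. From here on this sum replaces the one over pairs of
  paths in the definition.\<close>

lemma pmult_eq:
  assumes wf: "wf_digraph Q"
  shows "pmult Q x y (w, l, u) = (if (w, l, u) \<in> paths Q then
     \<Sum>k\<le>length l. x (w, take k l, if k = 0 then w else tail Q (l ! (k - 1))) *
       y (if k = 0 then w else tail Q (l ! (k - 1)), drop k l, u) else 0)"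
proof -
  define S where "S = {((w, l1, v), (v, l2, u)) | l1 l2 v.
         l = l1 @ l2 \<and> (w, l1, v) \<in> paths Q \<and> (v, l2, u) \<in> paths Q}"
  define m where "m k = (if k = 0 then w else tail Q (l ! (k - 1)))" for k
  have e: "pmult Q x y (w, l, u) = (\<Sum>(q, r) \<in> S. x q * y r)"
    unfolding pmult_def S_def by simp
  show ?thesis
  proof (cases "(w, l, u) \<in> paths Q")
    case False
    then have "S = {}"
      unfolding S_def using paths_append[OF wf] by blast
    then show ?thesis using e False by simp
  next
    case True
    define f where "f k = ((w, take k l, m k), (m k, drop k l, u))" for k
    have mid: "v = m (length l1)" if "l = l1 @ l2" "(w, l1, v) \<in> paths Q" for l1 l2 v
      using that by (cases l1 rule: rev_cases)
         (auto simp: paths_Nil m_def paths_conv[OF wf])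
    have "bij_betw f {..length l} S"
    proof (rule bij_betwI')
      fix i j assume "i \<in> {..length l}" "j \<in> {..length l}"
      then have "length (take i l) = i" "length (take j l) = j" by auto
      then show "f i = f j \<longleftrightarrow> i = j"
        unfolding f_def by (metis prod.inject)
    next
      fix k assume "k \<in> {..length l}"
      moreover obtain v where v: "(w, take k l, v) \<in> paths Q" "(v, drop k l, u) \<in> paths Q"
        using True paths_append[OF wf, of w "take k l" "drop k l" u] by auto
      ultimately have "v = m k"
        using mid[of "take k l" "drop k l" v] by simp
      then show "f k \<in> S"
        unfolding S_def f_def using v by auto
    next
      fix s assume "s \<in> S"
      then obtain l1 l2 v where s: "s = ((w, l1, v), (v, l2, u))" "l = l1 @ l2" "(w, l1, v) \<in> paths Q"
        unfolding S_def by auto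
      then have "s = f (length l1)"
        using mid unfolding f_def by auto
      then show "\<exists>k\<in>{..length l}. s = f k"
        using s by auto
    qed
    from sum.reindex_bij_betw[OF this, of "\<lambda>(q, r). x q * y r"]
    show ?thesis
      using True unfolding e by (simp add: f_def m_def)
  qed
qed

lemma path_algebra_fin: "x \<in> path_algebra Q \<Longrightarrow> finite {p. x p \<noteq> 0}"
  by (simp add: path_algebra_def)

lemma path_algebra_supp: "x \<in> path_algebra Q \<Longrightarrow> x p \<noteq> 0 \<Longrightarrow> p \<in> paths Q"
  unfolding path_algebra_def by (simp only: mem_Collect_eq) (blast dest: subsetD)

lemma path_algebraI: "finite {p. x p \<noteq> 0} \<Longrightarrow> (\<And>p. x p \<noteq> 0 \<Longrightarrow> p \<in> paths Q) \<Longrightarrow> x \<in> path_algebra Q"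
  unfolding path_algebra_def by (simp add: subset_eq)

lemma scal_apply: "scal c x p = c * x p"
  by (simp add: scal_def)

lemma scal_single_apply: "scal c (single p) q = (if q = p then c else 0)"
  by (simp add: scal_def single_def)

lemma scal_scal: "scal c (scal d x) = scal (c * d) x"
  by (auto simp: scal_def mult.assoc)

lemma scal_1 [simp]: "scal 1 x = x"
  by (simp add: scal_def)

lemma scal_0 [simp]: "scal 0 x = (\<lambda>p. 0)"
  by (simp add: scal_def)

lemma scal_zero [simp]: "scal c (\<lambda>p. 0) = (\<lambda>p. 0)"
  by (simp add: scal_def)

text \<open>Two zero scalars have to be kept apart, since the zero element forgets the path. With
  nonzero scalars, an arrow and its scalar can be read off from the value of an action.\<close>

lemma scal_single_eq_iff:
  "scal c (single p) = scal d (single q) \<longleftrightarrow> (c = 0 \<and> d = 0) \<or> (c = d \<and> p = q)"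
proof
  assume e: "scal c (single p) = scal d (single q)"
  have "scal c (single p) p = scal d (single q) p" "scal c (single p) q = scal d (single q) q"
    using e by simp_all
  then show "(c = 0 \<and> d = 0) \<or> (c = d \<and> p = q)"
    by (auto simp: scal_def single_def split: if_splits)
qed auto

lemma arrow_eq_iff: "scal c (arrow Q a) = scal d (arrow Q b) \<longleftrightarrow> (c = 0 \<and> d = 0) \<or> (c = d \<and> a = b)"
  unfolding arrow_def scal_single_eq_iff by auto

lemma vertex_eq_iff: "scal c (vertex a) = scal d (vertex b) \<longleftrightarrow> (c = 0 \<and> d = 0) \<or> (c = d \<and> a = b)"
  unfolding vertex_def scal_single_eq_iff by auto

lemma vertex_inj: "(vertex a :: ('v, 'a, 'k::field) palg) = vertex b \<longleftrightarrow> a = b"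
  using vertex_eq_iff[of "1::'k" a 1 b] by simp

text \<open>Only the cut at \<open>length l1\<close> can contribute, and there the middle vertex has
  to be both \<open>v\<close> and \<open>v'\<close>.\<close>

lemma pmult_single:
  fixes Q :: "('v, 'a) pre_digraph"
  assumes wf: "wf_digraph Q" and p: "(w, l1, v) \<in> paths Q" and q: "(v', l2, u) \<in> paths Q"
  shows "pmult Q (scal c (single (w, l1, v))) (scal d (single (v', l2, u))) =
    (if v = v' then scal (c * d) (single (w, l1 @ l2, u)) else (\<lambda>p. 0))"
proof (rule ext)
  fix p :: "('v, 'a) path"
  obtain w0 l u0 where p0: "p = (w0, l, u0)" by (cases p)
  define m where "m k = (if k = 0 then w0 else tail Q (l ! (k - 1)))" for k
  have val: "pmult Q (scal c (single (w, l1, v))) (scal d (single (v', l2, u))) p =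
     (if (w0, l, u0) \<in> paths Q then
       \<Sum>k\<le>length l. (if (w0, take k l, m k) = (w, l1, v) then c else 0) *
         (if (m k, drop k l, u0) = (v', l2, u) then d else 0) else 0)"
    unfolding p0 pmult_eq[OF wf] by (simp only: scal_single_apply m_def)
  show "pmult Q (scal c (single (w, l1, v))) (scal d (single (v', l2, u))) p =
     (if v = v' then scal (c * d) (single (w, l1 @ l2, u)) else (\<lambda>p. 0)) p"
  proof (cases "v = v' \<and> p = (w, l1 @ l2, u)")
    case True
    then have l: "l = l1 @ l2" "w0 = w" "u0 = u" using p0 by auto
    have path: "(w0, l, u0) \<in> paths Q"
      using True p q l paths_append[OF wf] by blast
    have m: "m (length l1) = v"
      using p l by (cases l1 rule: rev_cases) (auto simp: paths_Nil m_def paths_conv[OF wf] nth_append)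
    have "(\<Sum>k\<le>length l. (if (w0, take k l, m k) = (w, l1, v) then c else 0) *
         (if (m k, drop k l, u0) = (v', l2, u) then d else 0)) =
       (\<Sum>k\<le>length l. if k = length l1 then c * d else 0)"
    proof (rule sum.cong[OF refl])
      fix k assume k: "k \<in> {..length l}"
      have "k = length l1" if "take k l = l1"
        using that k by auto
      then show "(if (w0, take k l, m k) = (w, l1, v) then c else 0) *
         (if (m k, drop k l, u0) = (v', l2, u) then d else 0) = (if k = length l1 then c * d else 0)"
        using m l True by auto
    qed
    then show ?thesis
      using val path True l by (simp add: scal_def single_def)
  next
    case False
    have "(\<Sum>k\<le>length l. (if (w0, take k l, m k) = (w, l1, v) then c else 0) *
         (if (m k, drop k l, u0) = (v', l2, u) then d else 0)) = 0"
    proof (rule sum.neutral, safe)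
      fix k
      have "l = take k l @ drop k l" by simp
      then show "(if (w0, take k l, m k) = (w, l1, v) then c else 0) *
         (if (m k, drop k l, u0) = (v', l2, u) then d else 0) = 0"
        using False p0 by (auto split: if_splits)
    qed
    then show ?thesis
      using val False by (auto simp: scal_def single_def)
  qed
qed

lemma arrow_path: "wf_digraph Q \<Longrightarrow> a \<in> arcs Q \<Longrightarrow> (head Q a, [a], tail Q a) \<in> paths Q"
  by (simp add: paths_Cons paths_Nil wf_digraph.tail_in_verts)

lemma pmult_arrow_vertex:
  assumes "wf_digraph Q" and "a \<in> arcs Q" and "v \<in> verts Q"
  shows "pmult Q (scal c (arrow Q a)) (vertex v) = (if tail Q a = v then scal c (arrow Q a) else (\<lambda>p. 0))"
    and "pmult Q (vertex v) (scal c (arrow Q a)) = (if v = head Q a then scal c (arrow Q a) else (\<lambda>p. 0))"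
  using pmult_single[OF assms(1) arrow_path[OF assms(1,2)], of v "[]" v c 1]
    pmult_single[OF assms(1) _ arrow_path[OF assms(1,2)], of v "[]" v 1 c] assms(3)
  by (auto simp: paths_Nil arrow_def vertex_def)

text \<open>\<open>pone\<close> is supported on trivial paths, so only the cut \<open>k = 0\<close>
  survives. This serves the left factor \<open>1 \<otimes> e_\<mu>\<close> in
  \<open>tilde2\<close>.\<close>

lemma pmult_pone_arrow:
  fixes Q :: "('v, 'a) pre_digraph"
  assumes wf: "wf_digraph Q" and "a \<in> arcs Q"
  shows "pmult Q (scal c (pone Q)) (scal d (arrow Q a)) = scal (c * d) (arrow Q a)"
proof (rule ext)
  fix p :: "('v, 'a) path"
  obtain w l u where p: "p = (w, l, u)" by (cases p)
  define m where "m k = (if k = 0 then w else tail Q (l ! (k - 1)))" for k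
  have "pmult Q (scal c (pone Q)) (scal d (arrow Q a)) p = (if (w, l, u) \<in> paths Q then
     \<Sum>k\<le>length l. if k = 0 then c * d * arrow Q a (w, l, u) else 0 else 0)"
  proof (cases "(w, l, u) \<in> paths Q")
    case True
    then have "w \<in> verts Q" using paths_ends_in_verts[OF wf] by blast
    then have "scal c (pone Q) (w, take k l, m k) * scal d (arrow Q a) (m k, drop k l, u) =
        (if k = 0 then c * d * arrow Q a (w, l, u) else 0)" if "k \<le> length l" for k
      using that by (cases l) (auto simp: scal_def pone_def m_def)
    then show ?thesis
      using True unfolding p pmult_eq[OF wf] m_def[symmetric] by simp
  qed (simp add: p pmult_eq[OF wf])
  also have "\<dots> = scal (c * d) (arrow Q a) p"
    using arrow_path[OF assms] unfolding p by (auto simp: scal_def arrow_def single_def)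
  finally show "pmult Q (scal c (pone Q)) (scal d (arrow Q a)) p = scal (c * d) (arrow Q a) p" .
qed

section \<open>From a quiver isomorphism to an isomorphism of path algebras\<close>

definition path_map :: "('v \<Rightarrow> 'w) \<Rightarrow> ('a \<Rightarrow> 'b) \<Rightarrow> ('v, 'a) path \<Rightarrow> ('w, 'b) path" where
  "path_map f0 f1 = (\<lambda>(w, l, u). (f0 w, map f1 l, f0 u))"

lemma path_map_simp [simp]: "path_map f0 f1 (w, l, u) = (f0 w, map f1 l, f0 u)"
  by (simp add: path_map_def)

text \<open>Arbitrary quivers are treated because nothing here depends on the construction; the
  iterated quiver is substituted only at the end, to obtain the properties of
  \<open>phi\<close>.\<close>

locale quiver_isomorphism =
  fixes Q :: "('v, 'a) pre_digraph" and Q' :: "('w, 'b) pre_digraph"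
    and f0 :: "'v \<Rightarrow> 'w" and f1 :: "'a \<Rightarrow> 'b"
  assumes wf: "wf_digraph Q" and wf': "wf_digraph Q'" and iso: "quiver_iso Q Q' f0 f1"
begin

abbreviation "P \<equiv> path_map f0 f1"

lemma bij0: "bij_betw f0 (verts Q) (verts Q')"
  and bij1: "bij_betw f1 (arcs Q) (arcs Q')"
  and tail_f1: "a \<in> arcs Q \<Longrightarrow> tail Q' (f1 a) = f0 (tail Q a)"
  and head_f1: "a \<in> arcs Q \<Longrightarrow> head Q' (f1 a) = f0 (head Q a)"
  using iso unfolding quiver_iso_def by simp_all

lemma P_in_paths: "p \<in> paths Q \<Longrightarrow> P p \<in> paths Q'"
proof -
  have "P (w, l, u) \<in> paths Q'" if "(w, l, u) \<in> paths Q" for w l u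
    using that
  proof (induction l arbitrary: w)
    case Nil
    then show ?case using bij_betwE[OF bij0] by (simp add: paths_Nil)
  next
    case (Cons a l)
    then show ?case
      using bij_betwE[OF bij1] by (simp add: paths_Cons tail_f1 head_f1)
  qed
  then show "p \<in> paths Q \<Longrightarrow> P p \<in> paths Q'" by (cases p) auto
qed

lemma paths_subset_arcs: "(w, l, u) \<in> paths Q \<Longrightarrow> set l \<subseteq> arcs Q"
  by (simp add: paths_def pre_digraph.awalk_def)

lemma P_bij: "bij_betw P (paths Q) (paths Q')"
proof (rule bij_betw_imageI)
  show "inj_on P (paths Q)"
  proof (rule inj_onI)
    fix p q assume *: "p \<in> paths Q" "q \<in> paths Q" "P p = P q"
    obtain w l u where p: "p = (w, l, u)" by (cases p)
    obtain w' l' u' where q: "q = (w', l', u')" by (cases q)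
    have "l = l'"
    proof (rule map_inj_on)
      show "map f1 l = map f1 l'" using *(3) p q by simp
      have "set l \<union> set l' \<subseteq> arcs Q" using *(1,2) p q paths_subset_arcs by blast
      then show "inj_on f1 (set l \<union> set l')"
        using bij_betw_imp_inj_on[OF bij1] by (rule inj_on_subset[rotated])
    qed
    moreover have "w = w'" "u = u'"
      using * p q paths_ends_in_verts[OF wf] bij_betw_imp_inj_on[OF bij0]
      by (simp_all, (meson inj_onD)+)
    ultimately show "p = q" using p q by simp
  qed
  show "P ` paths Q = paths Q'"
  proof (intro equalityI subsetI)
    fix p assume "p \<in> P ` paths Q" then show "p \<in> paths Q'" using P_in_paths by auto
  next
    have "\<exists>w l u. (w, l, u) \<in> paths Q \<and> P (w, l, u) = (w', l', u')" if "(w', l', u') \<in> paths Q'" for w' l' u'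
      using that
    proof (induction l' arbitrary: w')
      case Nil
      then have "w' \<in> f0 ` verts Q"
        by (simp add: paths_Nil bij_betw_imp_surj_on[OF bij0])
      then obtain v where "v \<in> verts Q" "f0 v = w'" by blast
      then show ?case using Nil by (intro exI[of _ v] exI[of _ "[]"]) (auto simp: paths_Nil)
    next
      case (Cons b l')
      then obtain w l u where 1: "(w, l, u) \<in> paths Q" "P (w, l, u) = (tail Q' b, l', u')"
        using Cons.IH[of "tail Q' b"] unfolding paths_Cons by blast
      have "b \<in> f1 ` arcs Q"
        using Cons.prems by (simp add: paths_Cons bij_betw_imp_surj_on[OF bij1])
      then obtain a where 2: "a \<in> arcs Q" "f1 a = b" by blast
      \<comment> \<open>The preimages of the letters compose because \<open>f0\<close> is injective
        on vertices.\<close>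
      have "w \<in> verts Q" "tail Q a \<in> verts Q" "f0 w = f0 (tail Q a)"
        using 1 2 paths_ends_in_verts[OF wf] tail_f1[of a] by (auto simp: wf_digraph.tail_in_verts[OF wf])
      then have "w = tail Q a"
        using bij0 unfolding bij_betw_def by (meson inj_onD)
      then have "(head Q a, a # l, u) \<in> paths Q" "P (head Q a, a # l, u) = (w', b # l', u')"
        using 1 2 Cons.prems head_f1[of a] by (auto simp: paths_Cons)
      then show ?case by blast
    qed
    then show "p \<in> P ` paths Q" if "p \<in> paths Q'" for p
      using that by (cases p) (metis image_eqI)
  qed
qed

definition F :: "('v, 'a, 'k::field) palg \<Rightarrow> ('w, 'b, 'k) palg" where
  "F = alg_ext Q' (\<lambda>v. vertex (f0 v)) (\<lambda>a. arrow Q' (f1 a))"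

lemma path_image_eq:
  "p \<in> paths Q \<Longrightarrow> path_image Q' (\<lambda>v. vertex (f0 v)) (\<lambda>a. arrow Q' (f1 a)) p = single (P p)"
proof -
  have "path_image Q' (\<lambda>v. vertex (f0 v)) (\<lambda>a. arrow Q' (f1 a)) (w, l, u) = single (P (w, l, u))"
    if "(w, l, u) \<in> paths Q" for w l u
    using that
  proof (induction l arbitrary: w)
    case Nil
    then show ?case by (simp add: path_image_def vertex_def paths_Nil)
  next
    case (Cons a l)
    then have a: "a \<in> arcs Q" "head Q a = w" and l: "(tail Q a, l, u) \<in> paths Q"
      by (auto simp: paths_Cons)
    have "f1 a \<in> arcs Q'" using a bij1 by (auto simp: bij_betw_def)
    moreover have "(f0 (tail Q a), map f1 l, f0 u) \<in> paths Q'"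
      using P_in_paths[OF l] by simp
    ultimately have "pmult Q' (scal 1 (arrow Q' (f1 a))) (scal 1 (single (f0 (tail Q a), map f1 l, f0 u))) =
        scal (1 * 1) (single (head Q' (f1 a), [f1 a] @ map f1 l, f0 u))"
      unfolding arrow_def
      using arrow_path[OF wf', of "f1 a"] by (subst pmult_single) (auto simp: wf' tail_f1 a)
    then show ?case
      using Cons.IH[OF l] a by (simp add: path_image_def head_f1)
  qed
  then show "p \<in> paths Q \<Longrightarrow> ?thesis" by (cases p) auto
qed

text \<open>By \<open>path_image_eq\<close> the value is a sum over the preimages of
  \<open>P p\<close>, and injectivity of \<open>P\<close> on paths leaves one summand.\<close>

lemma F_P:
  assumes "x \<in> path_algebra Q" and p: "p \<in> paths Q"
  shows "F x (P p) = x p"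
proof -
  note fin = path_algebra_fin[OF assms(1)]
  have "F x (P p) = (\<Sum>q \<in> {q. x q \<noteq> 0}. if q = p then x p else 0)"
    unfolding F_def alg_ext_def
  proof (rule sum.cong[OF refl])
    fix q assume "q \<in> {q. x q \<noteq> 0}"
    then have "q \<in> paths Q" using path_algebra_supp[OF assms(1)] by simp
    then have "P p = P q \<longleftrightarrow> p = q"
      using p P_bij unfolding bij_betw_def by (meson inj_on_eq_iff)
    then show "x q * path_image Q' (\<lambda>v. vertex (f0 v)) (\<lambda>a. arrow Q' (f1 a)) q (P p) =
        (if q = p then x p else 0)"
      by (subst path_image_eq[OF \<open>q \<in> paths Q\<close>]) (auto simp: single_def)
  qed
  then show ?thesis using fin by auto
qed

lemma F_outside:
  assumes "x \<in> path_algebra Q" and "p \<notin> paths Q'"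
  shows "F x p = 0"
  unfolding F_def alg_ext_def
proof (rule sum.neutral, rule ballI)
  fix q assume "q \<in> {q. x q \<noteq> 0}"
  then have "q \<in> paths Q" using path_algebra_supp[OF assms(1)] by simp
  then show "x q * path_image Q' (\<lambda>v. vertex (f0 v)) (\<lambda>a. arrow Q' (f1 a)) q p = 0"
    using P_in_paths[of q] assms(2) by (subst path_image_eq) (auto simp: single_def)
qed

text \<open>Since \<open>P\<close> is a bijection on paths, a candidate for \<open>F x\<close> is
  tested along \<open>P\<close> and outside the paths of \<open>Q'\<close>. This reduces each
  algebra law for \<open>F\<close> to a pointwise identity.\<close>

lemma F_eqI:
  assumes "x \<in> path_algebra Q" and "\<And>p. p \<in> paths Q \<Longrightarrow> y (P p) = x p" and "\<And>p. p \<notin> paths Q' \<Longrightarrow> y p = 0"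
  shows "F x = y"
proof (rule ext)
  fix p show "F x p = y p"
  proof (cases "p \<in> paths Q'")
    case True
    then obtain q where "q \<in> paths Q" "p = P q" using P_bij unfolding bij_betw_def by blast
    then show ?thesis using F_P[OF assms(1)] assms(2) by simp
  next
    case False
    then show ?thesis using F_outside[OF assms(1)] assms(3) by simp
  qed
qed

lemma F_in: assumes "x \<in> path_algebra Q" shows "F x \<in> path_algebra Q'"
proof -
  have "{p. F x p \<noteq> 0} \<subseteq> P ` {p. x p \<noteq> 0}"
  proof
    fix p assume p: "p \<in> {p. F x p \<noteq> 0}"
    then have "p \<in> paths Q'" using F_outside[OF assms] by blast
    then obtain q where "q \<in> paths Q" "p = P q" using P_bij unfolding bij_betw_def by blast
    then show "p \<in> P ` {p. x p \<noteq> 0}" using p F_P[OF assms] by auto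
  qed
  then have "finite {p. F x p \<noteq> 0}"
    by (rule finite_subset) (use assms in \<open>intro finite_imageI path_algebra_fin, simp\<close>)
  then show ?thesis
  proof (rule path_algebraI)
    show "p \<in> paths Q'" if "F x p \<noteq> 0" for p
      using that F_outside[OF assms, of p] by (cases "p \<in> paths Q'") simp_all
  qed
qed

lemma F_bij: "bij_betw F (path_algebra Q :: ('v, 'a, 'k::field) palg set) (path_algebra Q')"
proof (rule bij_betw_imageI)
  show "inj_on F (path_algebra Q :: ('v, 'a, 'k) palg set)"
  proof (rule inj_onI, rule ext)
    fix x y :: "('v, 'a, 'k) palg" and p
    assume xy: "x \<in> path_algebra Q" "y \<in> path_algebra Q" "F x = F y"
    show "x p = y p"
    proof (cases "p \<in> paths Q")
      case True
      then show ?thesis using F_P[OF xy(1) True] F_P[OF xy(2) True] xy(3) by simp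
    next
      case False
      then have "x p = 0" "y p = 0" using xy(1,2)[THEN path_algebra_supp, of p] by metis+
      then show ?thesis by simp
    qed
  qed
  show "F ` path_algebra Q = (path_algebra Q' :: ('w, 'b, 'k) palg set)"
  proof (intro equalityI subsetI)
    fix y :: "('w, 'b, 'k) palg" assume "y \<in> F ` path_algebra Q"
    then show "y \<in> path_algebra Q'" using F_in by auto
  next
    fix y :: "('w, 'b, 'k) palg" assume y: "y \<in> path_algebra Q'"
    define x where "x p = (if p \<in> paths Q then y (P p) else 0)" for p
    have "inj_on P {p. x p \<noteq> 0}"
      using P_bij by (auto simp: bij_betw_def x_def intro: inj_on_subset)
    moreover have "P ` {p. x p \<noteq> 0} \<subseteq> {p. y p \<noteq> 0}" by (auto simp: x_def)
    ultimately have "finite {p. x p \<noteq> 0}"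
      using path_algebra_fin[OF y] by (rule inj_on_finite)
    then have x: "x \<in> path_algebra Q"
      by (rule path_algebraI) (simp add: x_def split: if_splits)
    have "F x = y"
    proof (rule F_eqI[OF x])
      show "y (P p) = x p" if "p \<in> paths Q" for p using that by (simp add: x_def)
      show "y p = 0" if "p \<notin> paths Q'" for p
        using path_algebra_supp[OF y, of p] that by metis
    qed
    then show "y \<in> F ` path_algebra Q" using x by auto
  qed
qed

text \<open>The support of a product lies in the set of concatenations from the two supports, which
  is finite.\<close>

lemma pmult_in_path_algebra:
  assumes "x \<in> path_algebra Q" and "y \<in> path_algebra Q"
  shows "pmult Q x y \<in> path_algebra Q"
proof -
  let ?f = "\<lambda>(p, q). (fst p, fst (snd p) @ fst (snd q), snd (snd q))"
  have "{p. pmult Q x y p \<noteq> 0} \<subseteq> ?f ` ({p. x p \<noteq> 0} \<times> {p. y p \<noteq> 0})"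
  proof
    fix p assume "p \<in> {p. pmult Q x y p \<noteq> 0}"
    moreover obtain w l u where p: "p = (w, l, u)" by (cases p)
    ultimately have "(\<Sum>k\<le>length l. x (w, take k l, if k = 0 then w else tail Q (l ! (k - 1))) *
       y (if k = 0 then w else tail Q (l ! (k - 1)), drop k l, u)) \<noteq> 0"
      using pmult_eq[OF wf, of x y w l u] by (auto split: if_splits)
    then obtain k where "x (w, take k l, if k = 0 then w else tail Q (l ! (k - 1))) *
       y (if k = 0 then w else tail Q (l ! (k - 1)), drop k l, u) \<noteq> 0"
      by (meson sum.not_neutral_contains_not_neutral)
    then show "p \<in> ?f ` ({p. x p \<noteq> 0} \<times> {p. y p \<noteq> 0})"
      unfolding p
      by (intro image_eqI[of _ _ "((w, take k l, if k = 0 then w else tail Q (l ! (k - 1))),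
         (if k = 0 then w else tail Q (l ! (k - 1)), drop k l, u))"]) auto
  qed
  then have "finite {p. pmult Q x y p \<noteq> 0}"
    by (rule finite_subset) (intro finite_imageI finite_cartesian_product path_algebra_fin[OF assms(1)] path_algebra_fin[OF assms(2)])
  then show ?thesis
  proof (rule path_algebraI)
    show "p \<in> paths Q" if "pmult Q x y p \<noteq> 0" for p
      using that by (cases p) (simp add: pmult_eq[OF wf] split: if_splits)
  qed
qed

text \<open>Cut positions of a path and of its image agree, and so do the middle vertices up to
  \<open>f0\<close>; the two convolution sums are equal term by term.\<close>

lemma F_pmult:
  assumes x: "x \<in> path_algebra Q" and y: "y \<in> path_algebra Q"
  shows "F (pmult Q x y) = pmult Q' (F x) (F y)"
proof (rule F_eqI[OF pmult_in_path_algebra[OF x y]])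
  fix p assume p: "p \<in> paths Q"
  obtain w l u where pe: "p = (w, l, u)" by (cases p)
  have path: "(w, l, u) \<in> paths Q" using p pe by simp
  let ?m = "\<lambda>k. if k = 0 then w else tail Q (l ! (k - 1))"
  let ?m' = "\<lambda>k. if k = 0 then f0 w else tail Q' (map f1 l ! (k - 1))"
  have "F x (f0 w, take k (map f1 l), ?m' k) * F y (?m' k, drop k (map f1 l), f0 u) =
      x (w, take k l, ?m k) * y (?m k, drop k l, u)" if k: "k \<le> length l" for k
  proof -
    obtain v where v: "(w, take k l, v) \<in> paths Q" "(v, drop k l, u) \<in> paths Q"
      using path paths_append[OF wf, of w "take k l" "drop k l" u] by auto
    have vm: "v = ?m k"
    proof (cases "k = 0")
      case True
      then show ?thesis using v by (simp add: paths_Nil)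
    next
      case False
      then have ne: "take k l \<noteq> []" using k by auto
      then have "last (take k l) = l ! (k - 1)"
        using k False by (simp add: last_conv_nth min_def)
      then show ?thesis using v(1) False paths_conv[OF wf ne, of w v] by simp
    qed
    have "l ! (k - 1) \<in> arcs Q" if "k \<noteq> 0"
      using paths_subset_arcs[OF path] k that by (simp add: subset_eq)
    then have m': "?m' k = f0 (?m k)"
      using k by (simp add: tail_f1)
    have "F x (f0 w, take k (map f1 l), f0 v) = x (w, take k l, v)"
      using F_P[OF x v(1)] by (simp add: take_map)
    moreover have "F y (f0 v, drop k (map f1 l), f0 u) = y (v, drop k l, u)"
      using F_P[OF y v(2)] by (simp add: drop_map)
    ultimately show ?thesis
      unfolding m' vm[symmetric] by simp
  qed
  then show "pmult Q' (F x) (F y) (P p) = pmult Q x y p"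
    using path P_in_paths[OF path] unfolding pe path_map_simp pmult_eq[OF wf] pmult_eq[OF wf'] by simp
next
  fix p assume "p \<notin> paths Q'"
  then show "pmult Q' (F x) (F y) p = 0" by (cases p) (simp add: pmult_eq[OF wf'])
qed

text \<open>Finiteness of the vertex set is what puts the unit \<open>pone Q\<close> into the path
  algebra, whose elements have finite support.\<close>

lemma path_alg_iso_F:
  assumes "finite (verts Q)"
  shows "path_alg_iso Q Q' (F :: ('v, 'a, 'k::field) palg \<Rightarrow> ('w, 'b, 'k) palg)"
proof -
  have one: "(pone Q :: ('v, 'a, 'k) palg) \<in> path_algebra Q"
  proof -
    have "{p. (pone Q :: ('v, 'a, 'k) palg) p \<noteq> 0} = (\<lambda>v. (v, [], v)) ` verts Q"
      by (auto simp: pone_def)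
    then show ?thesis using assms by (auto simp: path_algebra_def paths_Nil)
  qed
  have P_Nil: "(\<exists>v \<in> verts Q'. P p = (v, [], v)) \<longleftrightarrow> (\<exists>v \<in> verts Q. p = (v, [], v))" if "p \<in> paths Q" for p
  proof -
    obtain w l u where p: "p = (w, l, u)" by (cases p)
    have "w \<in> verts Q" "f0 w \<in> verts Q'"
      using paths_ends_in_verts[OF wf, of w l u] that p bij_betwE[OF bij0] by auto
    then show ?thesis using that p by (cases l) (auto simp: paths_Nil)
  qed
  have "F (pone Q :: ('v, 'a, 'k) palg) = pone Q'"
  proof (rule F_eqI[OF one])
    show "pone Q' (P p) = (pone Q p :: 'k)" if "p \<in> paths Q" for p
      using P_Nil[OF that] by (simp only: pone_def)
    show "pone Q' p = (0::'k)" if "p \<notin> paths Q'" for p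
      using that by (auto simp: pone_def paths_Nil)
  qed
  moreover have add: "(\<lambda>p. x p + y p) \<in> path_algebra Q"
    if "x \<in> path_algebra Q" "y \<in> path_algebra Q" for x y :: "('v, 'a, 'k) palg"
  proof -
    have "{p. x p + y p \<noteq> 0} \<subseteq> {p. x p \<noteq> 0} \<union> {p. y p \<noteq> 0}" by auto
    then have "finite {p. x p + y p \<noteq> 0}"
      by (rule finite_subset) (intro finite_UnI path_algebra_fin[OF that(1)] path_algebra_fin[OF that(2)])
    then show ?thesis
    proof (rule path_algebraI)
      show "p \<in> paths Q" if "x p + y p \<noteq> 0" for p
        using that path_algebra_supp[OF \<open>x \<in> path_algebra Q\<close>, of p]
          path_algebra_supp[OF \<open>y \<in> path_algebra Q\<close>, of p] by (cases "x p = 0") simp_all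
    qed
  qed
  moreover have "F (\<lambda>p. x p + y p) = (\<lambda>p. F x p + F y p)"
    if "x \<in> path_algebra Q" "y \<in> path_algebra Q" for x y :: "('v, 'a, 'k) palg"
    by (rule F_eqI[OF add[OF that]]) (simp_all add: F_P F_outside that)
  moreover have sc: "scal c x \<in> path_algebra Q" if "x \<in> path_algebra Q" for c and x :: "('v, 'a, 'k) palg"
  proof -
    have "{p. scal c x p \<noteq> 0} \<subseteq> {p. x p \<noteq> 0}" by (auto simp: scal_def)
    then have "finite {p. scal c x p \<noteq> 0}"
      by (rule finite_subset) (rule path_algebra_fin[OF that])
    then show ?thesis
      using path_algebra_supp[OF that] by (rule path_algebraI) (simp add: scal_def)
  qed
  moreover have "F (scal c x) = scal c (F x)" if "x \<in> path_algebra Q" for c and x :: "('v, 'a, 'k) palg"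
    by (rule F_eqI[OF sc[OF that]]) (simp_all add: F_P F_outside scal_def that)
  ultimately have hom: "F \<in> ring_hom (path_ring Q) (path_ring Q' :: ('w, 'b, 'k) palg ring)"
    and F_scal: "\<And>c (x :: ('v, 'a, 'k) palg). x \<in> path_algebra Q \<Longrightarrow> F (scal c x) = scal c (F x)"
    by (simp_all add: ring_hom_def path_ring_def F_in F_pmult)
  have "bij_betw F (carrier (path_ring Q)) (carrier (path_ring Q' :: ('w, 'b, 'k) palg ring))"
    using F_bij by (simp add: path_ring_def)
  then show ?thesis
    unfolding path_alg_iso_def ring_iso_def using hom F_scal by simp
qed

end

section \<open>Cyclic words\<close>

lemma cyc_class_refl [simp]: "c \<in> cyc_class c"
  unfolding cyc_class_def by (metis rangeI rotate0 id_apply)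

lemma cyc_class_rotate: "rotate m c \<in> cyc_class c"
  unfolding cyc_class_def by simp

lemma rotate1_in_cyc_class: "rotate1 c \<in> cyc_class c"
  using cyc_class_rotate[of 1 c] by simp

lemma cyc_class_trans: "d \<in> cyc_class c \<Longrightarrow> e \<in> cyc_class d \<Longrightarrow> e \<in> cyc_class c"
  unfolding cyc_class_def by (auto simp: rotate_rotate)

lemma cyc_class_sym: "d \<in> cyc_class c \<Longrightarrow> c \<in> cyc_class d"
proof -
  assume "d \<in> cyc_class c"
  then obtain m where d: "d = rotate m c" unfolding cyc_class_def by auto
  \<comment> \<open>A rotation by \<open>m\<close> is undone by \<open>length c - 1\<close> further
    rotations by \<open>m\<close>, since the total \<open>length c * m\<close> is a multiple of the
    length.\<close>
  have "rotate ((length c - 1) * m) d = rotate (length c * m) c"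
  proof (cases "c = []")
    case False
    then have "(length c - 1) * m + m = length c * m"
      by (cases c) auto
    then show ?thesis unfolding d rotate_rotate by simp
  qed (simp add: d)
  also have "\<dots> = c" by (simp add: rotate_id)
  finally show ?thesis using cyc_class_rotate[of "(length c - 1) * m" d] by simp
qed

lemma cyc_class_eq_iff: "cyc_class d = cyc_class c \<longleftrightarrow> d \<in> cyc_class c"
  using cyc_class_trans cyc_class_sym cyc_class_refl by blast

lemma cyc_class_eq: "d \<in> cyc_class c \<Longrightarrow> cyc_class d = cyc_class c"
  by (simp add: cyc_class_eq_iff)

lemma cyc_class_length: "d \<in> cyc_class c \<Longrightarrow> length d = length c"
  unfolding cyc_class_def by auto

lemma cyc_class_set: "d \<in> cyc_class c \<Longrightarrow> set d = set c"
  unfolding cyc_class_def by auto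

lemma finite_cyc_class [simp]: "finite (cyc_class c)"
proof (rule finite_subset)
  show "cyc_class c \<subseteq> {l. set l \<subseteq> set c \<and> length l = length c}"
    unfolding cyc_class_def by auto
qed (simp add: finite_lists_length_eq)

lemma cyc_class_map: "cyc_class (map f c) = map f ` cyc_class c"
  unfolding cyc_class_def by (auto simp: rotate_map image_image)

lemma map_in_cyc_class: "d \<in> cyc_class c \<Longrightarrow> map f d \<in> cyc_class (map f c)"
  by (simp add: cyc_class_map)

text \<open>Injectivity is asked only on an alphabet \<open>A\<close> containing both words: the
  letter maps used later (\<open>tilde1\<close>, \<open>star_a\<close>, \<open>phi_a\<close>) are
  controlled on arrows only.\<close>

lemma map_in_cyc_class_iff:
  assumes "inj_on f A" and "set c \<subseteq> A" and "set d \<subseteq> A"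
  shows "map f d \<in> cyc_class (map f c) \<longleftrightarrow> d \<in> cyc_class c"
proof
  assume "map f d \<in> cyc_class (map f c)"
  then obtain e where e: "e \<in> cyc_class c" "map f d = map f e"
    unfolding cyc_class_map by auto
  have "d = e"
    using e(2) by (rule map_inj_on)
      (use assms cyc_class_set[OF e(1)] in \<open>auto intro: inj_on_subset\<close>)
  then show "d \<in> cyc_class c" using e by simp
qed (rule map_in_cyc_class)

lemma prod_list_cyc_class:
  fixes s :: "'a \<Rightarrow> 'k::comm_monoid_mult"
  shows "d \<in> cyc_class c \<Longrightarrow> prod_list (map s d) = prod_list (map s c)"
proof -
  assume "d \<in> cyc_class c"
  then obtain m where "d = rotate m c" unfolding cyc_class_def by auto
  then obtain k where d: "d = drop k c @ take k c" using rotate_drop_take by blast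
  have "prod_list (map s c) = prod_list (map s (take k c @ drop k c))" by simp
  also have "\<dots> = prod_list (map s d)" unfolding d map_append by (simp only: prod_list.append mult.commute)
  finally show ?thesis by simp
qed

lemma sum_list_cyc_class:
  fixes s :: "'a \<Rightarrow> 'k::comm_monoid_add"
  shows "d \<in> cyc_class c \<Longrightarrow> sum_list (map s d) = sum_list (map s c)"
proof -
  assume "d \<in> cyc_class c"
  then obtain m where "d = rotate m c" unfolding cyc_class_def by auto
  then obtain k where d: "d = drop k c @ take k c" using rotate_drop_take by blast
  have "sum_list (map s c) = sum_list (map s (take k c @ drop k c))" by simp
  also have "\<dots> = sum_list (map s d)" unfolding d map_append by (simp only: sum_list.append add.commute)
  finally show ?thesis by simp
qed

text \<open>The format of paths stores a base vertex next to the word. This condition makes it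
  redundant on cycles, so that \<open>cyc_coeff\<close> becomes a sum over a rotation class of
  words.\<close>

definition canonical :: "('v, 'a) pre_digraph \<Rightarrow> ('v, 'a, 'k::field) palg \<Rightarrow> bool" where
  "canonical Q W \<longleftrightarrow> (\<forall>v l. W (v, l, v) \<noteq> 0 \<longrightarrow> l \<noteq> [] \<and> v = head Q (hd l))"

lemma cyc_coeff_canonical:
  assumes "canonical Q W"
  shows "cyc_coeff W c = (\<Sum>l\<in>cyc_class c. W (head Q (hd l), l, head Q (hd l)))"
proof -
  let ?f = "\<lambda>l. (head Q (hd l), l, head Q (hd l))"
  have "{(v, l, v) | v l. W (v, l, v) \<noteq> 0 \<and> l \<in> cyc_class c} = ?f ` {l \<in> cyc_class c. W (?f l) \<noteq> 0}"
    using assms unfolding canonical_def by (auto simp: image_iff)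
  then have "cyc_coeff W c = (\<Sum>l\<in>{l \<in> cyc_class c. W (?f l) \<noteq> 0}. W (?f l))"
    unfolding cyc_coeff_def by (simp add: sum.reindex inj_on_def)
  also have "\<dots> = (\<Sum>l\<in>cyc_class c. W (?f l))"
    by (rule sum.mono_neutral_left) auto
  finally show ?thesis .
qed

lemma cyc_coeff_cyc_class: "d \<in> cyc_class c \<Longrightarrow> cyc_coeff W d = cyc_coeff W c"
  unfolding cyc_coeff_def by (simp add: cyc_class_eq)

text \<open>Used twice: with \<open>f\<close> the action on arrows and \<open>s\<close> the product
  of its scalars, and with \<open>f\<close> the arrow map of \<open>phi\<close> and
  \<open>s = 1\<close>.\<close>

lemma cyc_coeff_map:
  assumes "canonical Q W" and "canonical Q' W'" and inj: "inj_on f (set c)"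
    and eq: "\<And>l. l \<in> cyc_class c \<Longrightarrow>
      W' (head Q' (hd (map f l)), map f l, head Q' (hd (map f l))) = s * W (head Q (hd l), l, head Q (hd l))"
  shows "cyc_coeff W' (map f c) = s * cyc_coeff W c"
proof -
  have "inj_on (map f) (cyc_class c)"
  proof (rule inj_onI)
    fix d e assume de: "d \<in> cyc_class c" "e \<in> cyc_class c" "map f d = map f e"
    from de(3) show "d = e"
      by (rule map_inj_on) (simp add: cyc_class_set[OF de(1)] cyc_class_set[OF de(2)] inj)
  qed
  then show ?thesis
    unfolding cyc_coeff_canonical[OF assms(1)] cyc_coeff_canonical[OF assms(2)] cyc_class_map
    by (simp add: sum.reindex eq sum_distrib_left)
qed

lemma finite_cycles_of:
  assumes "finite {p. W p \<noteq> 0}"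
  shows "finite (cycles_of W)"
proof (rule finite_subset)
  show "cycles_of W \<subseteq> (\<Union>p\<in>{p. W p \<noteq> 0}. cyc_class (fst (snd p)))"
  proof
    fix c assume "c \<in> cycles_of W"
    then have "cyc_coeff W c \<noteq> 0" by (simp add: cycles_of_def)
    then obtain p where "p \<in> {(v, l, v) | v l. W (v, l, v) \<noteq> 0 \<and> l \<in> cyc_class c}" "W p \<noteq> 0"
      unfolding cyc_coeff_def by (meson sum.not_neutral_contains_not_neutral)
    then show "c \<in> (\<Union>p\<in>{p. W p \<noteq> 0}. cyc_class (fst (snd p)))"
      by (intro UN_I[of p]) (auto simp: cyc_class_sym)
  qed
qed (use assms in auto)

text \<open>The orbit-stabiliser theorem: \<open>f i\<close> is the image of a point under the \<open>i\<close>-th power of a generator.\<close>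

lemma cyclic_orbit_count:
  fixes f :: "int \<Rightarrow> 'b"
  assumes n: "0 < n" and step: "\<And>i j k. f i = f j \<Longrightarrow> f (i + k) = f (j + k)"
    and per: "\<And>i. f (i mod int n) = f i"
  shows "card (range f) * card {i \<in> {0..<int n}. f i = f j} = n"
proof -
  let ?I = "{0..<int n}"
  have per': "f i = f i'" if "i mod int n = i' mod int n" for i i'
    using per that by metis
  \<comment> \<open>Translating the exponent by \<open>j - k\<close> modulo the order matches the
    fibre over \<open>f k\<close> with the one over \<open>f j\<close>, so all fibres have equal
    size.\<close>
  have fib: "card {i \<in> ?I. f i = f k} = card {i \<in> ?I. f i = f j}" for k
  proof (rule bij_betw_same_card)
    show "bij_betw (\<lambda>i. (i + (j - k)) mod int n) {i \<in> ?I. f i = f k} {i \<in> ?I. f i = f j}"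
    proof (rule bij_betw_byWitness[where f' = "\<lambda>i. (i + (k - j)) mod int n"])
      show "\<forall>a\<in>{i \<in> ?I. f i = f k}. ((a + (j - k)) mod int n + (k - j)) mod int n = a"
        using n by (auto simp: mod_simps)
      show "\<forall>a\<in>{i \<in> ?I. f i = f j}. ((a + (k - j)) mod int n + (j - k)) mod int n = a"
        using n by (auto simp: mod_simps)
      show "(\<lambda>i. (i + (j - k)) mod int n) ` {i \<in> ?I. f i = f k} \<subseteq> {i \<in> ?I. f i = f j}"
        using n step[of _ k "j - k"] by (auto simp: per)
      show "(\<lambda>i. (i + (k - j)) mod int n) ` {i \<in> ?I. f i = f j} \<subseteq> {i \<in> ?I. f i = f k}"
        using n step[of _ j "k - j"] by (auto simp: per)
    qed
  qed
  have im: "f ` ?I = range f"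
  proof (intro equalityI subsetI)
    fix y assume "y \<in> range f"
    then obtain i where "y = f (i mod int n)" by (auto simp: per)
    then show "y \<in> f ` ?I" using n by auto
  qed auto
  have "n = card ?I" by simp
  also have "\<dots> = (\<Sum>y\<in>f ` ?I. card {i \<in> ?I. f i = y})"
    unfolding card_eq_sum by (rule sum.image_gen) simp
  also have "\<dots> = (\<Sum>y\<in>f ` ?I. card {i \<in> ?I. f i = f j})"
  proof (rule sum.cong[OF refl])
    fix y assume "y \<in> f ` ?I"
    then obtain k where "y = f k" by blast
    then show "card {i \<in> ?I. f i = y} = card {i \<in> ?I. f i = f j}" using fib[of k] by simp
  qed
  finally show ?thesis using im by simp
qed


section \<open>The combinatorics of the construction\<close>

text \<open>
  The properties of \<open>(Q, W)\<close> which the construction uses. They hold for the given datum and are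
  inherited by \<open>(Q\<^sub>G, W\<^sub>G)\<close> with the dual action, also when the group is trivial: then every vertex of
  \<open>Q\<^sub>G\<close> is fixed but treated as non-fixed, so the notion of a fixed vertex is replaced by \<open>fix_reps\<close>.
\<close>

locale cyclic_action =
  fixes D :: "('v, 'a, 'k::field) qp_datum"
  assumes gord_pos: "0 < gord D"
    and zeta_pow_gord: "zeta D ^ gord D = 1"
    and zeta_primitive: "\<And>m. 0 < m \<Longrightarrow> m < gord D \<Longrightarrow> zeta D ^ m \<noteq> 1"
    and wf_quiv: "wf_digraph (quiv D)"
    and star_v_in: "\<And>v. v \<in> verts (quiv D) \<Longrightarrow> star_v D v \<in> verts (quiv D)"
    and star_a_in: "\<And>\<alpha>. \<alpha> \<in> arcs (quiv D) \<Longrightarrow> star_a D \<alpha> \<in> arcs (quiv D)"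
    and tail_star: "\<And>\<alpha>. \<alpha> \<in> arcs (quiv D) \<Longrightarrow> tail (quiv D) (star_a D \<alpha>) = star_v D (tail (quiv D) \<alpha>)"
    and head_star: "\<And>\<alpha>. \<alpha> \<in> arcs (quiv D) \<Longrightarrow> head (quiv D) (star_a D \<alpha>) = star_v D (head (quiv D) \<alpha>)"
    and star_v_order: "\<And>v. v \<in> verts (quiv D) \<Longrightarrow> (star_v D ^^ gord D) v = v"
    and star_a_order: "\<And>\<alpha>. \<alpha> \<in> arcs (quiv D) \<Longrightarrow> (star_a D ^^ gord D) \<alpha> = \<alpha>"
    and free_verts: "free_reps D \<subseteq> verts (quiv D)"
    and fix_verts: "fix_reps D \<subseteq> verts (quiv D)"
    and star_v_fix: "\<And>v. v \<in> fix_reps D \<Longrightarrow> star_v D v = v"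
    and act_arrow_free: "\<And>\<alpha> c. \<alpha> \<in> arcs (quiv D) \<Longrightarrow>
      tail (quiv D) \<alpha> \<notin> fix_reps D \<or> head (quiv D) \<alpha> \<notin> fix_reps D \<Longrightarrow>
      act D (scal c (arrow (quiv D) \<alpha>)) = scal c (arrow (quiv D) (star_a D \<alpha>))"
    and act_arrow_fix: "\<And>\<alpha>. \<alpha> \<in> arcs (quiv D) \<Longrightarrow> tail (quiv D) \<alpha> \<in> fix_reps D \<Longrightarrow>
      head (quiv D) \<alpha> \<in> fix_reps D \<Longrightarrow> star_a D \<alpha> = \<alpha> \<and>
      (\<exists>b::int. act D (arrow (quiv D) \<alpha>) = scal (zeta D powi b) (arrow (quiv D) \<alpha>))"
    and free_cover: "\<And>v. v \<in> verts (quiv D) \<Longrightarrow> v \<notin> fix_reps D \<Longrightarrow> \<exists>t. \<exists>\<epsilon> \<in> free_reps D. v = gv D t \<epsilon>"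
    and free_unique: "\<And>\<epsilon> \<epsilon>' s t. \<epsilon> \<in> free_reps D \<Longrightarrow> \<epsilon>' \<in> free_reps D \<Longrightarrow> gv D s \<epsilon> = gv D t \<epsilon>' \<Longrightarrow>
      \<epsilon> = \<epsilon>' \<and> s mod int (gord D) = t mod int (gord D)"
    and free_not_fix: "\<And>\<epsilon> t. \<epsilon> \<in> free_reps D \<Longrightarrow> gv D t \<epsilon> \<notin> fix_reps D"
begin

abbreviation "Q \<equiv> quiv D"
abbreviation "n \<equiv> int (gord D)"
abbreviation "Fr \<equiv> free_reps D"
abbreviation "Fx \<equiv> fix_reps D"

lemma n_pos: "0 < n"
  using gord_pos by simp

lemma tail_in: "\<alpha> \<in> arcs Q \<Longrightarrow> tail Q \<alpha> \<in> verts Q"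
  and head_in: "\<alpha> \<in> arcs Q \<Longrightarrow> head Q \<alpha> \<in> verts Q"
  using wf_quiv by (auto simp: wf_digraph_def)

lemma gv_mod [simp]: "gv D (t mod n) = gv D t"
  by (simp add: gv_def)

lemma ga_mod [simp]: "ga D (t mod n) = ga D t"
  by (simp add: ga_def)

lemma gv_0 [simp]: "gv D 0 v = v"
  by (simp add: gv_def)

lemma ga_0 [simp]: "ga D 0 \<alpha> = \<alpha>"
  by (simp add: ga_def)

lemma gv_cong: "s mod n = t mod n \<Longrightarrow> gv D s = gv D t"
  using gv_mod[of s] gv_mod[of t] by simp

lemma ga_cong: "s mod n = t mod n \<Longrightarrow> ga D s = ga D t"
  using ga_mod[of s] ga_mod[of t] by simp

lemma star_v_pow_in: "v \<in> verts Q \<Longrightarrow> (star_v D ^^ i) v \<in> verts Q"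
  by (induction i) (auto intro: star_v_in)

lemma star_a_pow_in: "\<alpha> \<in> arcs Q \<Longrightarrow> (star_a D ^^ i) \<alpha> \<in> arcs Q"
  by (induction i) (auto intro: star_a_in)

lemma gv_in: "v \<in> verts Q \<Longrightarrow> gv D t v \<in> verts Q"
  by (simp add: gv_def star_v_pow_in)

lemma ga_in: "\<alpha> \<in> arcs Q \<Longrightarrow> ga D t \<alpha> \<in> arcs Q"
  by (simp add: ga_def star_a_pow_in)

text \<open>The exponents in \<open>gv\<close> and \<open>ga\<close> are naturals below the group
  order; this identity turns their composition into addition of integer exponents.\<close>

lemma nat_mod_add: "(nat (s mod n) + nat (t mod n)) mod gord D = nat ((s + t) mod n)"
proof -
  have "int ((nat (s mod n) + nat (t mod n)) mod gord D) = (s mod n + t mod n) mod n"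
    using n_pos by (simp add: zmod_int)
  also have "\<dots> = int (nat ((s + t) mod n))"
    using n_pos by (simp add: mod_add_eq)
  finally show ?thesis by (simp only: of_nat_eq_iff)
qed

lemma gv_add: "v \<in> verts Q \<Longrightarrow> gv D s (gv D t v) = gv D (s + t) v"
  unfolding gv_def nat_mod_add[symmetric]
  by (simp add: funpow_mod_eq[OF star_v_order] funpow_add)

lemma ga_add: "\<alpha> \<in> arcs Q \<Longrightarrow> ga D s (ga D t \<alpha>) = ga D (s + t) \<alpha>"
  unfolding ga_def nat_mod_add[symmetric]
  by (simp add: funpow_mod_eq[OF star_a_order] funpow_add)

lemma ga_star_a: "\<alpha> \<in> arcs Q \<Longrightarrow> (star_a D ^^ i) \<alpha> = ga D (int i) \<alpha>"
  unfolding ga_def by (simp add: funpow_mod_eq[OF star_a_order] flip: zmod_int)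

lemma star_a_eq: "\<alpha> \<in> arcs Q \<Longrightarrow> star_a D \<alpha> = ga D 1 \<alpha>"
  using ga_star_a[of \<alpha> 1] by simp

lemma tail_star_pow: "\<alpha> \<in> arcs Q \<Longrightarrow> tail Q ((star_a D ^^ i) \<alpha>) = (star_v D ^^ i) (tail Q \<alpha>)"
  by (induction i) (simp_all add: tail_star star_a_pow_in)

lemma head_star_pow: "\<alpha> \<in> arcs Q \<Longrightarrow> head Q ((star_a D ^^ i) \<alpha>) = (star_v D ^^ i) (head Q \<alpha>)"
  by (induction i) (simp_all add: head_star star_a_pow_in)

lemma tail_ga: "\<alpha> \<in> arcs Q \<Longrightarrow> tail Q (ga D t \<alpha>) = gv D t (tail Q \<alpha>)"
  by (simp add: ga_def gv_def tail_star_pow)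

lemma head_ga: "\<alpha> \<in> arcs Q \<Longrightarrow> head Q (ga D t \<alpha>) = gv D t (head Q \<alpha>)"
  by (simp add: ga_def gv_def head_star_pow)

lemma ga_inj: "\<alpha> \<in> arcs Q \<Longrightarrow> \<beta> \<in> arcs Q \<Longrightarrow> ga D t \<alpha> = ga D t \<beta> \<longleftrightarrow> \<alpha> = \<beta>"
proof
  assume xy: "\<alpha> \<in> arcs Q" "\<beta> \<in> arcs Q" "ga D t \<alpha> = ga D t \<beta>"
  then have "ga D (- t) (ga D t \<alpha>) = ga D (- t) (ga D t \<beta>)" by simp
  then show "\<alpha> = \<beta>" using xy(1,2) by (simp add: ga_add)
qed simp

lemma gv_fix [simp]: "v \<in> Fx \<Longrightarrow> gv D t v = v"
proof -
  assume "v \<in> Fx"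
  then have "(star_v D ^^ i) v = v" for i
    by (induction i) (simp_all add: star_v_fix)
  then show ?thesis by (simp add: gv_def)
qed

text \<open>A vertex outside \<open>Fx\<close> is a translate of a free representative, and no
  translate of a free representative lies in \<open>Fx\<close>.\<close>

lemma gv_in_fix_iff: "v \<in> verts Q \<Longrightarrow> gv D t v \<in> Fx \<longleftrightarrow> v \<in> Fx"
proof
  assume v: "v \<in> verts Q" and f: "gv D t v \<in> Fx"
  show "v \<in> Fx"
  proof (rule ccontr)
    assume "v \<notin> Fx"
    then obtain s \<epsilon> where "\<epsilon> \<in> Fr" "v = gv D s \<epsilon>" using free_cover v by blast
    then show False
      using f free_not_fix[of \<epsilon> "t + s"] gv_add[of \<epsilon> t s] free_verts by auto
  qed
qed simp

lemma free_fix_disjoint: "\<epsilon> \<in> Fr \<Longrightarrow> \<epsilon> \<notin> Fx"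
  using free_not_fix[of \<epsilon> 0] by simp

lemma ga_fix: "\<alpha> \<in> arrows4 D \<Longrightarrow> ga D t \<alpha> = \<alpha>"
proof -
  assume "\<alpha> \<in> arrows4 D"
  then have "star_a D \<alpha> = \<alpha>"
    using act_arrow_fix unfolding arrows4_def by blast
  then have "(star_a D ^^ i) \<alpha> = \<alpha>" for i
    by (induction i) simp_all
  then show ?thesis by (simp add: ga_def)
qed

subsection \<open>Roots of unity\<close>

lemma zeta_nz: "zeta D \<noteq> 0"
  using zeta_pow_gord gord_pos by (cases "zeta D = 0") (simp_all add: power_0_left)

lemma n_nz: "of_nat (gord D) \<noteq> (0 :: 'k)"
  using of_nat_order_root_of_unity[OF gord_pos zeta_pow_gord zeta_primitive] .

lemma zeta_powi_mod: "zeta D powi (t mod n) = zeta D powi t"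
proof -
  have "zeta D powi t = zeta D powi (n * (t div n) + t mod n)" by simp
  also have "\<dots> = (zeta D powi n) powi (t div n) * zeta D powi (t mod n)"
    by (subst power_int_add) (simp_all add: zeta_nz power_int_mult)
  also have "zeta D powi n = 1"
    using zeta_pow_gord by simp
  finally show ?thesis by simp
qed

lemma zeta_powi_eq_iff: "zeta D powi s = zeta D powi t \<longleftrightarrow> s mod n = t mod n"
proof
  assume e: "zeta D powi s = zeta D powi t"
  define r where "r = nat ((s - t) mod n)"
  have "zeta D ^ r = zeta D powi ((s - t) mod n)"
    using n_pos by (simp add: r_def power_int_nonneg_exp)
  also have "\<dots> = 1"
    unfolding zeta_powi_mod using e zeta_nz by (simp add: power_int_diff)
  finally have "r = 0"
    using zeta_primitive[of r] n_pos by (cases "r = 0") (simp_all add: r_def nat_less_iff)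
  then have "(s - t) mod n = 0"
    using pos_mod_sign[OF n_pos, of "s - t"] by (simp add: r_def)
  then show "s mod n = t mod n"
    by (simp add: mod_eq_dvd_iff dvd_eq_mod_eq_0)
qed (metis zeta_powi_mod)

lemma idem_cong: "s mod n = t mod n \<Longrightarrow> idem D s = idem D t"
proof
  fix i assume "s mod n = t mod n"
  then have "(int i * s) mod n = (int i * t) mod n"
    by (rule mod_mult_cong[OF refl])
  then show "idem D s i = idem D t i"
    by (simp add: idem_def zeta_powi_eq_iff)
qed

lemma idem_0: "idem D \<mu> 0 = 1 / of_nat (gord D)"
  using gord_pos by (simp add: idem_def)

lemma idem_nz: "i < gord D \<Longrightarrow> idem D \<mu> i \<noteq> 0"
  using n_nz zeta_nz by (simp add: idem_def)

text \<open>The coefficient of \<open>e_\<mu>\<close> at \<open>g\<close> is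
  \<open>\<zeta>^\<mu> / n\<close> and thus determines the index modulo \<open>n\<close>. Position 1
  exists only in a nontrivial group, hence the case split on \<open>gord D = 1\<close> in the
  uses.\<close>

lemma idem_eq_mod: "1 < gord D \<Longrightarrow> idem D \<mu> 1 = idem D \<nu> 1 \<Longrightarrow> \<mu> mod n = \<nu> mod n"
  using n_nz by (simp add: idem_def zeta_powi_eq_iff)

subsection \<open>The exponents of arrows\<close>

lemma b_exp:
  assumes "\<alpha> \<in> arrows4 D"
  shows "0 \<le> b_exp D \<alpha>" "b_exp D \<alpha> < n" "act D (arrow Q \<alpha>) = scal (zeta D powi b_exp D \<alpha>) (arrow Q \<alpha>)"
proof -
  let ?P = "\<lambda>b. 0 \<le> b \<and> b < n \<and> act D (arrow Q \<alpha>) = scal (zeta D powi b) (arrow Q \<alpha>)"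
  obtain b where b: "act D (arrow Q \<alpha>) = scal (zeta D powi b) (arrow Q \<alpha>)"
    using act_arrow_fix assms unfolding arrows4_def by blast
  have "\<exists>!b. ?P b"
  proof (rule ex1I[of _ "b mod n"])
    show "?P (b mod n)" using b n_pos by (simp add: zeta_powi_mod)
    show "c = b mod n" if "?P c" for c
    proof -
      have "zeta D powi c = zeta D powi b"
        using that b zeta_nz by (simp add: arrow_eq_iff)
      then show ?thesis using that by (simp add: zeta_powi_eq_iff)
    qed
  qed
  from theI'[OF this] have "?P (b_exp D \<alpha>)" unfolding b_exp_def .
  then show "0 \<le> b_exp D \<alpha>" "b_exp D \<alpha> < n"
    "act D (arrow Q \<alpha>) = scal (zeta D powi b_exp D \<alpha>) (arrow Q \<alpha>)" by simp_all
qed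

text \<open>The description of \<open>t_exp\<close> leaves the representative open; the exponent is
  unique nevertheless, because \<open>free_unique\<close> identifies the representatives along with
  the exponents.\<close>

lemma t_exp:
  assumes "\<alpha> \<in> arrows1 D"
  obtains \<epsilon> where "\<epsilon> \<in> Fr" "tail Q \<alpha> = gv D (t_exp D \<alpha>) \<epsilon>" "0 \<le> t_exp D \<alpha>" "t_exp D \<alpha> < n"
proof -
  let ?P = "\<lambda>t. 0 \<le> t \<and> t < n \<and> (\<exists>\<epsilon> \<in> Fr. tail Q \<alpha> = gv D t \<epsilon>)"
  obtain t \<epsilon> where t: "\<epsilon> \<in> Fr" "tail Q \<alpha> = gv D t \<epsilon>"
    using assms unfolding arrows1_def by blast
  have "\<exists>!t. ?P t"
  proof (rule ex1I[of _ "t mod n"])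
    show "?P (t mod n)" using t n_pos unfolding gv_mod by (intro conjI bexI[of _ \<epsilon>]) simp_all
    show "s = t mod n" if s: "?P s" for s
    proof -
      obtain \<epsilon>' where "\<epsilon>' \<in> Fr" "tail Q \<alpha> = gv D s \<epsilon>'" using s by blast
      then have "s mod n = t mod n" using free_unique[of \<epsilon>' \<epsilon> s t] t by simp
      then show ?thesis using s by simp
    qed
  qed
  from theI'[OF this] have "?P (t_exp D \<alpha>)" unfolding t_exp_def .
  then show thesis using that by blast
qed

lemma t_exp_eqI:
  assumes "\<alpha> \<in> arrows1 D" and "\<epsilon> \<in> Fr" and "tail Q \<alpha> = gv D s \<epsilon>"
  shows "t_exp D \<alpha> = s mod n"
proof -
  obtain \<epsilon>' where e: "\<epsilon>' \<in> Fr" "tail Q \<alpha> = gv D (t_exp D \<alpha>) \<epsilon>'" and t: "0 \<le> t_exp D \<alpha>" "t_exp D \<alpha> < n"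
    using t_exp[OF assms(1)] by blast
  have "t_exp D \<alpha> mod n = s mod n"
    using free_unique[OF e(1) assms(2) trans[OF e(2)[symmetric] assms(3)]] by (rule conjunct2)
  then show ?thesis unfolding mod_pos_pos_trivial[OF t] .
qed

lemma arrows_in_arcs: "\<alpha> \<in> arrows1 D \<Longrightarrow> \<alpha> \<in> arcs Q" "\<alpha> \<in> arrows2 D \<Longrightarrow> \<alpha> \<in> arcs Q"
  "\<alpha> \<in> arrows3 D \<Longrightarrow> \<alpha> \<in> arcs Q" "\<alpha> \<in> arrows4 D \<Longrightarrow> \<alpha> \<in> arcs Q"
  by (simp_all add: arrows1_def arrows2_def arrows3_def arrows4_def)

lemma arrows_ends:
  "\<alpha> \<in> arrows1 D \<Longrightarrow> tail Q \<alpha> \<notin> Fx \<and> head Q \<alpha> \<notin> Fx"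
  "\<alpha> \<in> arrows2 D \<Longrightarrow> tail Q \<alpha> \<notin> Fx \<and> head Q \<alpha> \<in> Fx"
  "\<alpha> \<in> arrows3 D \<Longrightarrow> tail Q \<alpha> \<in> Fx \<and> head Q \<alpha> \<notin> Fx"
  "\<alpha> \<in> arrows4 D \<Longrightarrow> tail Q \<alpha> \<in> Fx \<and> head Q \<alpha> \<in> Fx"
  subgoal by (auto simp: arrows1_def free_not_fix free_fix_disjoint)
  subgoal by (simp add: arrows2_def free_fix_disjoint)
  subgoal by (simp add: arrows3_def free_fix_disjoint)
  subgoal by (simp add: arrows4_def)
  done

lemma ga_ends_fix: "\<alpha> \<in> arcs Q \<Longrightarrow> tail Q (ga D t \<alpha>) \<in> Fx \<longleftrightarrow> tail Q \<alpha> \<in> Fx"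
  "\<alpha> \<in> arcs Q \<Longrightarrow> head Q (ga D t \<alpha>) \<in> Fx \<longleftrightarrow> head Q \<alpha> \<in> Fx"
  by (simp_all add: tail_ga head_ga gv_in_fix_iff tail_in head_in)

subsection \<open>The arrows of \<open>Q\<^sub>G\<close>\<close>

text \<open>The scalar is carried along because the locale assumes no linearity of
  \<open>act\<close>, while \<open>smult\<close> applies powers of \<open>act\<close> to scalar
  multiples of arrows.\<close>

lemma act_pow_arrow:
  assumes "\<alpha> \<in> arcs Q" and "tail Q \<alpha> \<notin> Fx \<or> head Q \<alpha> \<notin> Fx"
  shows "(act D ^^ i) (scal c (arrow Q \<alpha>)) = scal c (arrow Q (ga D (int i) \<alpha>))"
proof (induction i)
  case (Suc i)
  have "star_a D (ga D (int i) \<alpha>) = ga D (int (Suc i)) \<alpha>"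
    using assms(1) by (simp add: star_a_eq ga_in ga_add)
  then show ?case
    using Suc assms by (simp add: act_arrow_free ga_in ga_ends_fix)
qed simp

lemma tilde1_apply: "tilde1 D \<alpha> i = scal (gpow D (t_exp D \<alpha>) i) (arrow Q \<alpha>)"
  by (simp add: tilde1_def tensor_def)

lemma tilde3_apply: "tilde3 D \<alpha> \<mu> i = scal (idem D \<mu> i) (arrow Q \<alpha>)"
  by (simp add: tilde3_def tensor_def)

lemma tilde4_eq: "tilde4 D \<alpha> \<mu> = tilde3 D \<alpha> \<mu>"
  by (simp add: tilde3_def tilde4_def)

text \<open>In the product of \<open>1 \<otimes> e_\<mu>\<close> and
  \<open>\<alpha> \<otimes> 1\<close> only \<open>j = 0\<close> occurs in the right factor, so the
  component at \<open>g^m\<close> comes from \<open>i = m\<close> and carries the translate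
  \<open>g^m(\<alpha>)\<close>.\<close>

lemma tilde2_apply:
  assumes "\<alpha> \<in> arrows2 D"
  shows "tilde2 D \<alpha> \<mu> m = scal (idem D \<mu> m) (arrow Q (ga D (int m) \<alpha>))"
proof
  fix p
  have \<alpha>: "\<alpha> \<in> arcs Q" "tail Q \<alpha> \<notin> Fx \<or> head Q \<alpha> \<notin> Fx"
    using assms arrows_in_arcs arrows_ends by blast+
  let ?S = "{(i, j). i < gord D \<and> j < gord D \<and> (i + j) mod gord D = m}"
  have fin: "finite ?S"
    by (rule finite_subset[of _ "{..<gord D} \<times> {..<gord D}"]) auto
  have "tilde2 D \<alpha> \<mu> m p = (\<Sum>(i, j) \<in> ?S. (idem D \<mu> i * gpow D 0 j) * arrow Q (ga D (int i) \<alpha>) p)"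
    unfolding tilde2_def Defs.smult_def tensor_def
    by (simp only: act_pow_arrow[OF \<alpha>] pmult_pone_arrow[OF wf_quiv ga_in[OF \<alpha>(1)]] scal_apply)
  also have "\<dots> = (\<Sum>s \<in> ?S. if s = (m, 0) then idem D \<mu> m * arrow Q (ga D (int m) \<alpha>) p else 0)"
  proof (rule sum.cong[OF refl])
    fix s assume "s \<in> ?S"
    then obtain i j where s: "s = (i, j)" "i < gord D" "(i + j) mod gord D = m" by auto
    then show "(case s of (i, j) \<Rightarrow> (idem D \<mu> i * gpow D 0 j) * arrow Q (ga D (int i) \<alpha>) p) =
        (if s = (m, 0) then idem D \<mu> m * arrow Q (ga D (int m) \<alpha>) p else 0)"
      by (cases "j = 0") (simp_all add: gpow_def)
  qed
  \<comment> \<open>For \<open>m\<close> beyond the group order the pair \<open>(m, 0)\<close> is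
    absent from the sum, but then \<open>idem D \<mu> m\<close> is 0 as well.\<close>
  also have "\<dots> = scal (idem D \<mu> m) (arrow Q (ga D (int m) \<alpha>)) p"
    using fin gord_pos by (auto simp: scal_def idem_def)
  finally show "tilde2 D \<alpha> \<mu> m p = scal (idem D \<mu> m) (arrow Q (ga D (int m) \<alpha>)) p" .
qed

lemma tilde_cong:
  assumes "\<mu> mod n = \<nu> mod n"
  shows "tilde2 D \<alpha> \<mu> = tilde2 D \<alpha> \<nu>" "tilde3 D \<alpha> \<mu> = tilde3 D \<alpha> \<nu>" "tilde4 D \<alpha> \<mu> = tilde4 D \<alpha> \<nu>"
    "eta_mu D \<epsilon> \<mu> = eta_mu D \<epsilon> \<nu>"
  by (simp_all add: tilde2_def tilde3_def tilde4_def eta_mu_def idem_cong[OF assms])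

lemma gpow_at: "0 \<le> t \<Longrightarrow> t < n \<Longrightarrow> gpow D t i = (if i = nat t then 1 else 0)"
  by (simp add: gpow_def)

text \<open>
  A common notation for the four kinds of arrows (\<open>tilde3\<close> and \<open>tilde4\<close> are given by the same formula),
  which turns their distinctness into a single injectivity statement.
\<close>

definition tilde_any :: "'a \<Rightarrow> int \<Rightarrow> ('v, 'a, 'k) skew" where
  "tilde_any \<alpha> \<mu> = (if \<alpha> \<in> arrows1 D then tilde1 D \<alpha> else if \<alpha> \<in> arrows2 D then tilde2 D \<alpha> \<mu> else tilde3 D \<alpha> \<mu>)"

definition "arrows = arrows1 D \<union> arrows2 D \<union> arrows3 D \<union> arrows4 D"

lemma arrows_disjoint:
  "\<alpha> \<in> arrows1 D \<Longrightarrow> \<alpha> \<notin> arrows2 D \<and> \<alpha> \<notin> arrows3 D \<and> \<alpha> \<notin> arrows4 D"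
  "\<alpha> \<in> arrows2 D \<Longrightarrow> \<alpha> \<notin> arrows1 D \<and> \<alpha> \<notin> arrows3 D \<and> \<alpha> \<notin> arrows4 D"
  "\<alpha> \<in> arrows3 D \<Longrightarrow> \<alpha> \<notin> arrows1 D \<and> \<alpha> \<notin> arrows2 D \<and> \<alpha> \<notin> arrows4 D"
  "\<alpha> \<in> arrows4 D \<Longrightarrow> \<alpha> \<notin> arrows1 D \<and> \<alpha> \<notin> arrows2 D \<and> \<alpha> \<notin> arrows3 D"
  using arrows_ends by blast+

lemma tilde_any_simps:
  "\<alpha> \<in> arrows1 D \<Longrightarrow> tilde_any \<alpha> \<mu> = tilde1 D \<alpha>"
  "\<alpha> \<in> arrows2 D \<Longrightarrow> tilde_any \<alpha> \<mu> = tilde2 D \<alpha> \<mu>"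
  "\<alpha> \<in> arrows3 D \<Longrightarrow> tilde_any \<alpha> \<mu> = tilde3 D \<alpha> \<mu>"
  "\<alpha> \<in> arrows4 D \<Longrightarrow> tilde_any \<alpha> \<mu> = tilde4 D \<alpha> \<mu>"
  subgoal by (simp add: tilde_any_def)
  subgoal by (simp add: tilde_any_def arrows_disjoint(2))
  subgoal by (simp add: tilde_any_def arrows_disjoint(3))
  subgoal by (simp add: tilde_any_def arrows_disjoint(4) tilde4_eq)
  done

text \<open>The arrow found at group position \<open>i\<close> does not depend on the index:
  position 0 shows the arrow itself, and the scalar at position 1 shows the index. That it touches
  \<open>Fx\<close> separates these elements from those of type (1).\<close>

lemma tilde_any_apply_other:
  assumes "\<alpha> \<in> arrows" and "\<alpha> \<notin> arrows1 D"
  shows "\<exists>\<beta>. \<beta> \<in> arcs Q \<and> (tail Q \<beta> \<in> Fx \<or> head Q \<beta> \<in> Fx) \<and> (i = 0 \<longrightarrow> \<beta> = \<alpha>) \<and>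
    (\<forall>\<mu>. tilde_any \<alpha> \<mu> i = scal (idem D \<mu> i) (arrow Q \<beta>))"
proof (cases "\<alpha> \<in> arrows2 D")
  case True
  then show ?thesis
    using arrows_in_arcs(2)[OF True] arrows_ends(2)[OF True]
    by (intro exI[of _ "ga D (int i) \<alpha>"]) (simp add: tilde_any_simps tilde2_apply ga_in ga_ends_fix)
next
  case False
  then have "\<alpha> \<in> arcs Q" "tail Q \<alpha> \<in> Fx \<or> head Q \<alpha> \<in> Fx"
    using assms arrows_in_arcs arrows_ends unfolding arrows_def by blast+
  then show ?thesis
    using False assms(2) by (intro exI[of _ \<alpha>]) (simp add: tilde_any_def tilde3_apply)
qed

lemma tilde_any_scal_inj:
  assumes \<alpha>: "\<alpha> \<in> arrows" and \<beta>: "\<beta> \<in> arrows" and s: "s \<noteq> 0"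
    and eq: "(\<lambda>i. scal s (tilde_any \<alpha> \<mu> i)) = (\<lambda>i. scal r (tilde_any \<beta> \<nu> i))"
  shows "s = r \<and> \<alpha> = \<beta> \<and> (\<alpha> \<notin> arrows1 D \<longrightarrow> \<mu> mod n = \<nu> mod n)"
proof -
  have e: "scal s (tilde_any \<alpha> \<mu> i) = scal r (tilde_any \<beta> \<nu> i)" for i
    using fun_cong[OF eq] .
  consider "\<alpha> \<in> arrows1 D" "\<beta> \<in> arrows1 D" | "\<alpha> \<in> arrows1 D" "\<beta> \<notin> arrows1 D"
    | "\<alpha> \<notin> arrows1 D" "\<beta> \<in> arrows1 D" | "\<alpha> \<notin> arrows1 D" "\<beta> \<notin> arrows1 D" by blast
  then show ?thesis
  proof cases
    case 1
    obtain t where "0 \<le> t_exp D \<alpha>" "t_exp D \<alpha> < n" using t_exp[OF 1(1)] by blast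
    then have "scal s (arrow Q \<alpha>) = scal (r * gpow D (t_exp D \<beta>) (nat (t_exp D \<alpha>))) (arrow Q \<beta>)"
      using e[of "nat (t_exp D \<alpha>)"] 1 by (simp add: tilde_any_simps tilde1_apply scal_scal gpow_at)
    then show ?thesis using s 1 by (auto simp: arrow_eq_iff gpow_def split: if_splits)
  next
    case 2
    obtain t where t: "0 \<le> t_exp D \<alpha>" "t_exp D \<alpha> < n" using t_exp[OF 2(1)] by blast
    let ?i = "nat (t_exp D \<alpha>)"
    obtain \<gamma> where \<gamma>: "tail Q \<gamma> \<in> Fx \<or> head Q \<gamma> \<in> Fx" "tilde_any \<beta> \<nu> ?i = scal (idem D \<nu> ?i) (arrow Q \<gamma>)"
      using tilde_any_apply_other[OF \<beta> 2(2), of ?i] by blast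
    then have "scal s (arrow Q \<alpha>) = scal (r * idem D \<nu> ?i) (arrow Q \<gamma>)"
      using e[of ?i] t 2 by (simp add: tilde_any_simps tilde1_apply scal_scal gpow_at)
    then have "\<alpha> = \<gamma>" using s by (simp add: arrow_eq_iff)
    then show ?thesis using \<gamma>(1) arrows_ends(1)[OF 2(1)] by blast
  next
    case 3
    have "tilde_any \<alpha> \<mu> 0 = scal (idem D \<mu> 0) (arrow Q \<alpha>)"
      using tilde_any_apply_other[OF \<alpha> 3(1), of 0] by blast
    then have "scal (s * idem D \<mu> 0) (arrow Q \<alpha>) = scal (r * gpow D (t_exp D \<beta>) 0) (arrow Q \<beta>)"
      using e[of 0] 3 by (simp add: tilde_any_simps tilde1_apply scal_scal)
    then have "\<alpha> = \<beta>" using s idem_nz[of 0] gord_pos by (auto simp: arrow_eq_iff)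
    then show ?thesis using 3 by blast
  next
    case 4
    have "tilde_any \<alpha> \<mu> 0 = scal (idem D \<mu> 0) (arrow Q \<alpha>)" "tilde_any \<beta> \<nu> 0 = scal (idem D \<nu> 0) (arrow Q \<beta>)"
      using tilde_any_apply_other[OF \<alpha> 4(1), of 0] tilde_any_apply_other[OF \<beta> 4(2), of 0] by blast+
    then have "scal (s * idem D \<mu> 0) (arrow Q \<alpha>) = scal (r * idem D \<nu> 0) (arrow Q \<beta>)"
      using e[of 0] by (simp add: scal_scal)
    then have sr: "s = r" "\<alpha> = \<beta>"
      using s n_nz by (auto simp: arrow_eq_iff idem_0)
    moreover have "\<mu> mod n = \<nu> mod n"
    proof (cases "gord D = 1")
      case False
      then have n1: "1 < gord D" using gord_pos by simp
      obtain \<gamma> where "tilde_any \<alpha> \<mu> 1 = scal (idem D \<mu> 1) (arrow Q \<gamma>)" "tilde_any \<alpha> \<nu> 1 = scal (idem D \<nu> 1) (arrow Q \<gamma>)"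
        using tilde_any_apply_other[OF \<alpha> 4(1), of 1] by blast
      then have "scal (s * idem D \<mu> 1) (arrow Q \<gamma>) = scal (s * idem D \<nu> 1) (arrow Q \<gamma>)"
        using e[of 1] sr by (simp add: scal_scal)
      then have "idem D \<mu> 1 = idem D \<nu> 1"
        using s idem_nz[OF n1] by (auto simp: arrow_eq_iff)
      then show ?thesis using idem_eq_mod[OF n1] by blast
    qed simp
    ultimately show ?thesis by simp
  qed
qed

lemma tilde_any_inj:
  assumes "\<alpha> \<in> arrows" and "\<beta> \<in> arrows" and "tilde_any \<alpha> \<mu> = tilde_any \<beta> \<nu>"
  shows "\<alpha> = \<beta>" "\<alpha> \<notin> arrows1 D \<Longrightarrow> \<mu> mod n = \<nu> mod n"
  using tilde_any_scal_inj[OF assms(1,2), of 1 \<mu> 1 \<nu>] assms(3) by simp_all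

lemma eta_mu_inj:
  assumes "eta_mu D \<epsilon> \<mu> = eta_mu D \<epsilon>' \<nu>" shows "\<epsilon> = \<epsilon>'" "\<mu> mod n = \<nu> mod n"
proof -
  have e: "scal (idem D \<mu> i) (vertex \<epsilon> :: ('v, 'a, 'k) palg) = scal (idem D \<nu> i) (vertex \<epsilon>')" for i
    using fun_cong[OF assms, of i] by (simp add: eta_mu_def tensor_def)
  show "\<epsilon> = \<epsilon>'" using e[of 0] idem_nz[OF gord_pos] by (simp add: vertex_eq_iff)
  show "\<mu> mod n = \<nu> mod n"
  proof (cases "gord D = 1")
    case False
    then have n1: "1 < gord D" using gord_pos by simp
    then have "idem D \<mu> 1 = idem D \<nu> 1"
      using e[of 1] idem_nz[OF n1] by (auto simp: vertex_eq_iff)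
    then show ?thesis using idem_eq_mod[OF n1] by blast
  qed simp
qed

lemma eta_mu_eq_iff: "eta_mu D \<epsilon> \<mu> = eta_mu D \<epsilon>' \<nu> \<longleftrightarrow> \<epsilon> = \<epsilon>' \<and> \<mu> mod n = \<nu> mod n"
  using eta_mu_inj tilde_cong(4) by blast

lemma eta_inj: "eta D \<epsilon> = eta D \<epsilon>' \<longleftrightarrow> \<epsilon> = \<epsilon>'"
proof
  assume "eta D \<epsilon> = eta D \<epsilon>'"
  from fun_cong[OF this, of 0] show "\<epsilon> = \<epsilon>'"
    by (simp add: eta_def tensor_def gpow_def vertex_eq_iff[of 1 _ 1, simplified])
qed simp

lemma eta_neq_eta_mu: "\<epsilon> \<in> Fr \<Longrightarrow> \<epsilon>' \<in> Fx \<Longrightarrow> eta D \<epsilon> \<noteq> eta_mu D \<epsilon>' \<mu>"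
proof
  assume "\<epsilon> \<in> Fr" "\<epsilon>' \<in> Fx" "eta D \<epsilon> = eta_mu D \<epsilon>' \<mu>"
  from fun_cong[OF this(3), of 0] have "scal 1 (vertex \<epsilon> :: ('v, 'a, 'k) palg) = scal (idem D \<mu> 0) (vertex \<epsilon>')"
    by (simp add: eta_def eta_mu_def tensor_def gpow_def)
  then have "\<epsilon> = \<epsilon>'" by (simp only: vertex_eq_iff) auto
  then show False using free_fix_disjoint \<open>\<epsilon> \<in> Fr\<close> \<open>\<epsilon>' \<in> Fx\<close> by blast
qed

lemma QG_arrow_tilde_any:
  "QG_arrow D x s t \<Longrightarrow> \<exists>\<alpha> \<mu>. \<alpha> \<in> arrows \<and> x = tilde_any \<alpha> \<mu> \<and>
    (\<alpha> \<in> arrows1 D \<longrightarrow> (\<exists>\<epsilon> \<in> Fr. tail Q \<alpha> = gv D (t_exp D \<alpha>) \<epsilon> \<and> s = eta D \<epsilon> \<and> t = eta D (head Q \<alpha>))) \<and>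
    (\<alpha> \<in> arrows2 D \<longrightarrow> s = eta D (tail Q \<alpha>) \<and> t = eta_mu D (head Q \<alpha>) \<mu>) \<and>
    (\<alpha> \<in> arrows3 D \<longrightarrow> s = eta_mu D (tail Q \<alpha>) \<mu> \<and> t = eta D (head Q \<alpha>)) \<and>
    (\<alpha> \<in> arrows4 D \<longrightarrow> s = eta_mu D (tail Q \<alpha>) \<mu> \<and> t = eta_mu D (head Q \<alpha>) (\<mu> - b_exp D \<alpha>))"
proof (induction rule: QG_arrow.induct)
  case (type1 \<alpha> \<epsilon>)
  then show ?case using arrows_disjoint(1)[OF type1(1)]
    by (intro exI[of _ \<alpha>] exI[of _ 0]) (auto simp: arrows_def tilde_any_simps)
next
  case (type2 \<alpha> \<mu>)
  then show ?case using arrows_disjoint(2)[OF type2(1)]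
    by (intro exI[of _ \<alpha>] exI[of _ \<mu>]) (auto simp: arrows_def tilde_any_simps)
next
  case (type3 \<alpha> \<mu>)
  then show ?case using arrows_disjoint(3)[OF type3(1)]
    by (intro exI[of _ \<alpha>] exI[of _ \<mu>]) (auto simp: arrows_def tilde_any_simps)
next
  case (type4 \<alpha> \<mu>)
  then show ?case using arrows_disjoint(4)[OF type4(1)]
    by (intro exI[of _ \<alpha>] exI[of _ \<mu>]) (auto simp: arrows_def tilde_any_simps)
qed

text \<open>This makes the descriptions of \<open>tail\<close> and \<open>head\<close> in
  \<open>QG\<close> meaningful: an element determines its arrow and its index modulo
  \<open>n\<close>, and the ends depend on nothing else.\<close>

lemma QG_arrow_unique:
  assumes "QG_arrow D x s t" and "QG_arrow D x s' t'"
  shows "s = s' \<and> t = t'"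
proof -
  obtain \<alpha> \<mu> where 1: "\<alpha> \<in> arrows" "x = tilde_any \<alpha> \<mu>"
    "\<alpha> \<in> arrows1 D \<Longrightarrow> \<exists>\<epsilon> \<in> Fr. tail Q \<alpha> = gv D (t_exp D \<alpha>) \<epsilon> \<and> s = eta D \<epsilon> \<and> t = eta D (head Q \<alpha>)"
    "\<alpha> \<in> arrows2 D \<Longrightarrow> s = eta D (tail Q \<alpha>) \<and> t = eta_mu D (head Q \<alpha>) \<mu>"
    "\<alpha> \<in> arrows3 D \<Longrightarrow> s = eta_mu D (tail Q \<alpha>) \<mu> \<and> t = eta D (head Q \<alpha>)"
    "\<alpha> \<in> arrows4 D \<Longrightarrow> s = eta_mu D (tail Q \<alpha>) \<mu> \<and> t = eta_mu D (head Q \<alpha>) (\<mu> - b_exp D \<alpha>)"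
    using QG_arrow_tilde_any[OF assms(1)] by metis
  obtain \<beta> \<nu> where 2: "\<beta> \<in> arrows" "x = tilde_any \<beta> \<nu>"
    "\<beta> \<in> arrows1 D \<Longrightarrow> \<exists>\<epsilon> \<in> Fr. tail Q \<beta> = gv D (t_exp D \<beta>) \<epsilon> \<and> s' = eta D \<epsilon> \<and> t' = eta D (head Q \<beta>)"
    "\<beta> \<in> arrows2 D \<Longrightarrow> s' = eta D (tail Q \<beta>) \<and> t' = eta_mu D (head Q \<beta>) \<nu>"
    "\<beta> \<in> arrows3 D \<Longrightarrow> s' = eta_mu D (tail Q \<beta>) \<nu> \<and> t' = eta D (head Q \<beta>)"
    "\<beta> \<in> arrows4 D \<Longrightarrow> s' = eta_mu D (tail Q \<beta>) \<nu> \<and> t' = eta_mu D (head Q \<beta>) (\<nu> - b_exp D \<beta>)"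
    using QG_arrow_tilde_any[OF assms(2)] by metis
  have eq: "\<beta> = \<alpha>" and m: "\<alpha> \<notin> arrows1 D \<Longrightarrow> \<mu> mod n = \<nu> mod n"
    using tilde_any_inj[OF 1(1) 2(1), of \<mu> \<nu>] 1(2) 2(2) by simp_all
  consider "\<alpha> \<in> arrows1 D" | "\<alpha> \<in> arrows2 D" | "\<alpha> \<in> arrows3 D" | "\<alpha> \<in> arrows4 D"
    using 1(1) unfolding arrows_def by blast
  then show ?thesis
  proof cases
    case 1
    then show ?thesis using \<open>\<alpha> \<in> arrows1 D \<Longrightarrow> \<exists>\<epsilon> \<in> Fr. _\<close> 2(3) free_unique unfolding eq by metis
  next
    case 2
    then have "\<mu> mod n = \<nu> mod n" using m arrows_disjoint by blast
    then show ?thesis using 2 \<open>\<beta> \<in> arrows2 D \<Longrightarrow> _\<close> 1(4) unfolding eq by (simp add: eta_mu_eq_iff)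
  next
    case 3
    then have "\<mu> mod n = \<nu> mod n" using m arrows_disjoint by blast
    then show ?thesis using 3 2(5) 1(5) unfolding eq by (simp add: eta_mu_eq_iff)
  next
    case 4
    then have "\<mu> mod n = \<nu> mod n" using m arrows_disjoint by blast
    moreover from this have "(\<mu> - b_exp D \<alpha>) mod n = (\<nu> - b_exp D \<alpha>) mod n"
      by (rule mod_diff_cong[OF _ refl])
    ultimately show ?thesis using 4 2(6) 1(6) unfolding eq by (simp add: eta_mu_eq_iff)
  qed
qed

lemma QG_arrowD:
  assumes "QG_arrow D x s t"
  shows "x \<in> arcs (QG D)" "tail (QG D) x = s" "head (QG D) x = t"
proof -
  show "x \<in> arcs (QG D)" using assms by (auto simp: QG_def)
  have "(THE s. \<exists>t. QG_arrow D x s t) = s" "(THE t. \<exists>s. QG_arrow D x s t) = t"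
    using assms QG_arrow_unique[OF assms] by (blast intro!: the_equality)+
  then show "tail (QG D) x = s" "head (QG D) x = t" by (simp_all add: QG_def)
qed

lemma QG_tilde1:
  assumes "\<alpha> \<in> arrows1 D"
  shows "tilde1 D \<alpha> \<in> arcs (QG D)" "head (QG D) (tilde1 D \<alpha>) = eta D (head Q \<alpha>)"
    "\<epsilon> \<in> Fr \<Longrightarrow> tail Q \<alpha> = gv D s \<epsilon> \<Longrightarrow> tail (QG D) (tilde1 D \<alpha>) = eta D \<epsilon>"
proof -
  obtain \<epsilon>' where e: "\<epsilon>' \<in> Fr" "tail Q \<alpha> = gv D (t_exp D \<alpha>) \<epsilon>'" using t_exp[OF assms] by blast
  note q = QG_arrowD[OF QG_arrow.type1[OF assms e]]
  show "tilde1 D \<alpha> \<in> arcs (QG D)" "head (QG D) (tilde1 D \<alpha>) = eta D (head Q \<alpha>)"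
    using q by simp_all
  show "tail (QG D) (tilde1 D \<alpha>) = eta D \<epsilon>" if "\<epsilon> \<in> Fr" "tail Q \<alpha> = gv D s \<epsilon>"
    using q(2) free_unique[of \<epsilon>' \<epsilon> "t_exp D \<alpha>" s] e that by simp
qed

text \<open>The inductive rule admits only indices in range. Allowing every integer here, by
  reduction modulo \<open>n\<close>, lets the words of cycles shift indices freely; the same is done
  for the types (3) and (4).\<close>

lemma QG_tilde2:
  assumes "\<alpha> \<in> arrows2 D"
  shows "tilde2 D \<alpha> \<mu> \<in> arcs (QG D)" "tail (QG D) (tilde2 D \<alpha> \<mu>) = eta D (tail Q \<alpha>)"
    "head (QG D) (tilde2 D \<alpha> \<mu>) = eta_mu D (head Q \<alpha>) \<mu>"
  using QG_arrowD[OF QG_arrow.type2[OF assms, of "\<mu> mod n"]] n_pos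
    tilde_cong[of "\<mu> mod n" \<mu>] by simp_all

lemma QG_tilde3:
  assumes "\<alpha> \<in> arrows3 D"
  shows "tilde3 D \<alpha> \<mu> \<in> arcs (QG D)" "tail (QG D) (tilde3 D \<alpha> \<mu>) = eta_mu D (tail Q \<alpha>) \<mu>"
    "head (QG D) (tilde3 D \<alpha> \<mu>) = eta D (head Q \<alpha>)"
  using QG_arrowD[OF QG_arrow.type3[OF assms, of "\<mu> mod n"]] n_pos
    tilde_cong[of "\<mu> mod n" \<mu>] by simp_all

lemma QG_tilde4:
  assumes "\<alpha> \<in> arrows4 D"
  shows "tilde4 D \<alpha> \<mu> \<in> arcs (QG D)" "tail (QG D) (tilde4 D \<alpha> \<mu>) = eta_mu D (tail Q \<alpha>) \<mu>"
    "head (QG D) (tilde4 D \<alpha> \<mu>) = eta_mu D (head Q \<alpha>) (\<mu> - b_exp D \<alpha>)"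
  using QG_arrowD[OF QG_arrow.type4[OF assms, of "\<mu> mod n"]] n_pos
    tilde_cong[of "\<mu> mod n" \<mu>] tilde_cong(4)[of "\<mu> mod n - b_exp D \<alpha>" "\<mu> - b_exp D \<alpha>"]
  by (simp_all add: mod_simps)

lemma QG_arcs_cases:
  assumes "x \<in> arcs (QG D)"
  obtains (1) \<alpha> where "\<alpha> \<in> arrows1 D" "x = tilde1 D \<alpha>"
    | (2) \<alpha> \<mu> where "\<alpha> \<in> arrows2 D" "x = tilde2 D \<alpha> \<mu>" "0 \<le> \<mu>" "\<mu> < n"
    | (3) \<alpha> \<mu> where "\<alpha> \<in> arrows3 D" "x = tilde3 D \<alpha> \<mu>" "0 \<le> \<mu>" "\<mu> < n"
    | (4) \<alpha> \<mu> where "\<alpha> \<in> arrows4 D" "x = tilde4 D \<alpha> \<mu>" "0 \<le> \<mu>" "\<mu> < n"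
proof -
  obtain s t where "QG_arrow D x s t" using assms by (auto simp: QG_def)
  then show thesis by (cases rule: QG_arrow.cases) (use that in blast)+
qed

lemma eta_in_QG: "\<epsilon> \<in> Fr \<Longrightarrow> eta D \<epsilon> \<in> verts (QG D)"
  by (simp add: QG_def)

lemma eta_mu_in_QG: "\<epsilon> \<in> Fx \<Longrightarrow> eta_mu D \<epsilon> \<mu> \<in> verts (QG D)"
proof -
  assume "\<epsilon> \<in> Fx"
  moreover have "eta_mu D \<epsilon> \<mu> = eta_mu D \<epsilon> (\<mu> mod n)" by (simp add: eta_mu_eq_iff)
  moreover have "0 \<le> \<mu> mod n" "\<mu> mod n < n" using n_pos by simp_all
  ultimately show ?thesis unfolding QG_def by auto
qed

lemma QG_verts_cases:
  assumes "x \<in> verts (QG D)"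
  obtains (eta) \<epsilon> where "\<epsilon> \<in> Fr" "x = eta D \<epsilon>"
    | (eta_mu) \<epsilon> \<mu> where "\<epsilon> \<in> Fx" "x = eta_mu D \<epsilon> \<mu>" "0 \<le> \<mu>" "\<mu> < n"
  using assms that unfolding QG_def by auto

lemma arrows_reps:
  "\<alpha> \<in> arrows1 D \<Longrightarrow> head Q \<alpha> \<in> Fr"
  "\<alpha> \<in> arrows2 D \<Longrightarrow> tail Q \<alpha> \<in> Fr \<and> head Q \<alpha> \<in> Fx"
  "\<alpha> \<in> arrows3 D \<Longrightarrow> tail Q \<alpha> \<in> Fx \<and> head Q \<alpha> \<in> Fr"
  "\<alpha> \<in> arrows4 D \<Longrightarrow> tail Q \<alpha> \<in> Fx \<and> head Q \<alpha> \<in> Fx"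
  by (simp_all add: arrows1_def arrows2_def arrows3_def arrows4_def)

lemma wf_QG: "wf_digraph (QG D)"
proof
  fix x assume "x \<in> arcs (QG D)"
  then show "tail (QG D) x \<in> verts (QG D)"
  proof (cases rule: QG_arcs_cases)
    case (1 \<alpha>)
    obtain \<epsilon> where "\<epsilon> \<in> Fr" "tail Q \<alpha> = gv D (t_exp D \<alpha>) \<epsilon>" using t_exp[OF 1(1)] by blast
    then show ?thesis using 1 by (simp add: QG_tilde1 eta_in_QG)
  qed (simp_all add: QG_tilde2 QG_tilde3 QG_tilde4 eta_in_QG eta_mu_in_QG arrows_reps)
next
  fix x assume "x \<in> arcs (QG D)"
  then show "head (QG D) x \<in> verts (QG D)"
    by (cases rule: QG_arcs_cases)
      (simp_all add: QG_tilde1 QG_tilde2 QG_tilde3 QG_tilde4 eta_in_QG eta_mu_in_QG arrows_reps)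
qed

lemma tilde_injs:
  "\<alpha> \<in> arrows1 D \<Longrightarrow> \<beta> \<in> arrows1 D \<Longrightarrow> tilde1 D \<alpha> = tilde1 D \<beta> \<longleftrightarrow> \<alpha> = \<beta>"
  "\<alpha> \<in> arrows2 D \<Longrightarrow> \<beta> \<in> arrows2 D \<Longrightarrow> tilde2 D \<alpha> \<mu> = tilde2 D \<beta> \<nu> \<longleftrightarrow> \<alpha> = \<beta> \<and> \<mu> mod n = \<nu> mod n"
  "\<alpha> \<in> arrows3 D \<Longrightarrow> \<beta> \<in> arrows3 D \<Longrightarrow> tilde3 D \<alpha> \<mu> = tilde3 D \<beta> \<nu> \<longleftrightarrow> \<alpha> = \<beta> \<and> \<mu> mod n = \<nu> mod n"
  "\<alpha> \<in> arrows4 D \<Longrightarrow> \<beta> \<in> arrows4 D \<Longrightarrow> tilde4 D \<alpha> \<mu> = tilde4 D \<beta> \<nu> \<longleftrightarrow> \<alpha> = \<beta> \<and> \<mu> mod n = \<nu> mod n"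
  subgoal using tilde_any_inj(1)[of \<alpha> \<beta> 0 0] by (auto simp: arrows_def tilde_any_simps)
  subgoal
    using tilde_any_inj[of \<alpha> \<beta> \<mu> \<nu>] arrows_disjoint(2)[of \<alpha>]
    unfolding arrows_def by (metis UnCI tilde_any_simps(2) tilde_cong(1))
  subgoal
    using tilde_any_inj[of \<alpha> \<beta> \<mu> \<nu>] arrows_disjoint(3)[of \<alpha>]
    unfolding arrows_def by (metis UnCI tilde_any_simps(3) tilde_cong(2))
  subgoal
    using tilde_any_inj[of \<alpha> \<beta> \<mu> \<nu>] arrows_disjoint(4)[of \<alpha>]
    unfolding arrows_def by (metis UnCI tilde_any_simps(4) tilde_cong(3))
  done

end

text \<open>The last two assumptions are the part of the invariance of \<open>W\<close> that the
  coefficient formulas for \<open>W_G\<close> consume. They exchange roles under duality, which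
  keeps the locale stable.\<close>

locale cyclic_datum = cyclic_action D for D :: "('v, 'a, 'k::field) qp_datum" +
  assumes finite_pot: "finite {p. pot D p \<noteq> 0}"
    and canonical_pot: "canonical (quiv D) (pot D)"
    and cycle_pot: "\<And>c. cyc_coeff (pot D) c \<noteq> 0 \<Longrightarrow>
      (head (quiv D) (hd c), c, head (quiv D) (hd c)) \<in> paths (quiv D) \<and> 3 \<le> length c"
    and coeff_star_free: "\<And>c. set c \<subseteq> arcs (quiv D) \<Longrightarrow> (\<And>\<alpha>. \<alpha> \<in> set c \<Longrightarrow> head (quiv D) \<alpha> \<notin> fix_reps D) \<Longrightarrow>
      cyc_coeff (pot D) (map (star_a D) c) = cyc_coeff (pot D) c"
    and coeff_fix_b_exp: "\<And>c. cyc_coeff (pot D) c \<noteq> 0 \<Longrightarrow> (\<And>\<alpha>. \<alpha> \<in> set c \<Longrightarrow> head (quiv D) \<alpha> \<in> fix_reps D) \<Longrightarrow>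
      int (gord D) dvd sum_list (map (b_exp D) c)"


section \<open>Closed words\<close>

text \<open>The cyclic index makes the notion visibly stable under rotation and matches the index
  pattern of \<open>hshape\<close>.\<close>

definition closed_word :: "('v, 'a) pre_digraph \<Rightarrow> 'a list \<Rightarrow> bool" where
  "closed_word Q c \<longleftrightarrow> c \<noteq> [] \<and> set c \<subseteq> arcs Q \<and>
     (\<forall>i < length c. tail Q (c ! i) = head Q (c ! (Suc i mod length c)))"

lemma closed_word_last:
  assumes "closed_word Q c"
  shows "tail Q (last c) = head Q (hd c)"
proof -
  have "c \<noteq> []" using assms by (simp add: closed_word_def)
  then have "tail Q (c ! (length c - 1)) = head Q (c ! (Suc (length c - 1) mod length c))"
    using assms by (simp add: closed_word_def)
  then show ?thesis using \<open>c \<noteq> []\<close> by (simp add: last_conv_nth hd_conv_nth)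
qed

lemma closed_word_path:
  assumes "wf_digraph Q"
  shows "closed_word Q c \<longleftrightarrow> c \<noteq> [] \<and> (head Q (hd c), c, head Q (hd c)) \<in> paths Q"
proof (cases "c = []")
  case False
  have "closed_word Q c \<longleftrightarrow> head Q (hd c) = tail Q (last c) \<and> set c \<subseteq> arcs Q \<and>
     (\<forall>i. Suc i < length c \<longrightarrow> tail Q (c ! i) = head Q (c ! Suc i))"
  proof
    assume c: "closed_word Q c"
    then have "tail Q (c ! i) = head Q (c ! Suc i)" if "Suc i < length c" for i
      using that unfolding closed_word_def by (metis Suc_lessD mod_less)
    then show "head Q (hd c) = tail Q (last c) \<and> set c \<subseteq> arcs Q \<and>
     (\<forall>i. Suc i < length c \<longrightarrow> tail Q (c ! i) = head Q (c ! Suc i))"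
      using c closed_word_last[OF c] by (simp add: closed_word_def)
  next
    assume c: "head Q (hd c) = tail Q (last c) \<and> set c \<subseteq> arcs Q \<and>
     (\<forall>i. Suc i < length c \<longrightarrow> tail Q (c ! i) = head Q (c ! Suc i))"
    have "tail Q (c ! i) = head Q (c ! (Suc i mod length c))" if "i < length c" for i
    proof (cases "Suc i < length c")
      case True
      then show ?thesis using c by simp
    next
      case False
      then have "Suc i = length c" using that by simp
      then have "Suc i mod length c = 0" "i = length c - 1" by simp_all
      then show ?thesis using c \<open>c \<noteq> []\<close> by (simp add: last_conv_nth hd_conv_nth)
    qed
    then show "closed_word Q c" using c \<open>c \<noteq> []\<close> by (simp add: closed_word_def)
  qed
  then show ?thesis using paths_conv[OF assms False] False by blast
qed (simp add: closed_word_def)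

lemma closed_word_rotate:
  assumes "closed_word Q c"
  shows "closed_word Q (rotate m c)"
  unfolding closed_word_def
proof (intro conjI allI impI)
  fix i assume "i < length (rotate m c)"
  then have i: "i < length c" and l: "0 < length c" by auto
  have "tail Q (c ! ((m + i) mod length c)) = head Q (c ! (Suc ((m + i) mod length c) mod length c))"
    using assms l by (simp add: closed_word_def)
  moreover have "Suc ((m + i) mod length c) mod length c = (m + Suc i mod length c) mod length c"
    by (simp add: mod_simps)
  ultimately show "tail Q (rotate m c ! i) = head Q (rotate m c ! (Suc i mod length (rotate m c)))"
    using i l by (simp add: nth_rotate)
qed (use assms in \<open>simp_all add: closed_word_def\<close>)

lemma closed_word_cyc_class: "d \<in> cyc_class c \<Longrightarrow> closed_word Q c \<Longrightarrow> closed_word Q d"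
  unfolding cyc_class_def by (auto intro: closed_word_rotate)

text \<open>A letter marked by a property that holds at one position only makes a word rigid under
  rotation. This aligns cycles of type (ii) and (iii), which have one exceptional vertex.\<close>

lemma cyc_class_unique_position:
  assumes "d \<in> cyc_class c" and k: "k < length c" and "P (d ! k)"
    and uniq: "\<And>i. i < length c \<Longrightarrow> P (c ! i) \<Longrightarrow> i = k"
  shows "d = c"
proof -
  obtain m where d: "d = rotate m c" using assms(1) unfolding cyc_class_def by auto
  have "P (c ! ((m + k) mod length c))"
    using assms(3) k unfolding d by (simp add: nth_rotate)
  moreover have "(m + k) mod length c < length c" by (intro mod_less_divisor le_less_trans[OF le0 k])
  ultimately have "(m + k) mod length c = k" using uniq by blast
  then have "(m + k) mod length c = k mod length c" using k by simp
  then have "length c dvd m" by (simp add: mod_eq_dvd_iff_nat)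
  then show ?thesis unfolding d by (simp add: rotate_id mod_eq_0_iff_dvd)
qed

lemma sum_list_nth: "length ts = l \<Longrightarrow> (\<Sum>j<l. ts ! j) = sum_list ts"
  by (simp add: sum_list_sum_nth atLeast0LessThan)

lemma sum_periodic_shift:
  fixes f :: "int \<Rightarrow> 'b::comm_monoid_add"
  assumes n: "0 < n" and per: "\<And>\<mu>. f (\<mu> mod n) = f \<mu>"
  shows "(\<Sum>\<mu>\<in>{0..<n}. f (\<mu> + k)) = (\<Sum>\<mu>\<in>{0..<n}. f \<mu>)"
proof (rule sum.reindex_bij_witness[where j = "\<lambda>\<mu>. (\<mu> + k) mod n" and i = "\<lambda>\<mu>. (\<mu> - k) mod n"])
  fix a assume "a \<in> {0..<n}"
  then show "((a + k) mod n - k) mod n = a" "((a - k) mod n + k) mod n = a"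
    by (simp_all add: mod_simps)
qed (use n in \<open>simp_all add: per\<close>)

lemma set_subset_nthI: "(\<And>i. i < length xs \<Longrightarrow> xs ! i \<in> A) \<Longrightarrow> set xs \<subseteq> A"
  by (auto simp: in_set_conv_nth)

declare One_nat_def [simp del] length_greater_0_conv [simp del]

context cyclic_datum
begin

subsection \<open>Orbits of words\<close>

lemma closed_word_ga:
  assumes "closed_word Q c"
  shows "closed_word Q (map (ga D t) c)"
  unfolding closed_word_def
proof (intro conjI allI impI)
  have c: "c \<noteq> []" "set c \<subseteq> arcs Q" using assms by (simp_all add: closed_word_def)
  then show "map (ga D t) c \<noteq> []" by simp
  show "set (map (ga D t) c) \<subseteq> arcs Q" using c ga_in by auto
  fix i assume "i < length (map (ga D t) c)"
  then have i: "i < length c" by simp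
  let ?j = "Suc i mod length c"
  have j: "?j < length c" using i by (intro mod_less_divisor) simp
  have "c ! i \<in> arcs Q" "c ! ?j \<in> arcs Q" using c i j nth_mem by blast+
  moreover have "tail Q (c ! i) = head Q (c ! ?j)" using assms i by (simp add: closed_word_def)
  ultimately show "tail Q (map (ga D t) c ! i) = head Q (map (ga D t) c ! (Suc i mod length (map (ga D t) c)))"
    using i j by (simp add: tail_ga head_ga)
qed

lemma map_star_pow: "set c \<subseteq> arcs Q \<Longrightarrow> map (star_a D ^^ i) c = map (ga D (int i)) c"
  by (rule map_cong[OF refl]) (blast intro: ga_star_a)

lemma map_ga_nat: "set c \<subseteq> arcs Q \<Longrightarrow> map (ga D t) c = map (star_a D ^^ nat (t mod n)) c"
  unfolding ga_def ..

lemma in_cyc_orbit_iff: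
  assumes "set c \<subseteq> arcs Q"
  shows "c' \<in> cyc_orbit D c \<longleftrightarrow> (\<exists>t. c' \<in> cyc_class (map (ga D t) c))"
proof
  assume "c' \<in> cyc_orbit D c"
  then show "\<exists>t. c' \<in> cyc_class (map (ga D t) c)"
    unfolding cyc_orbit_def map_star_pow[OF assms] by blast
next
  assume "\<exists>t. c' \<in> cyc_class (map (ga D t) c)"
  then show "c' \<in> cyc_orbit D c"
    unfolding cyc_orbit_def map_ga_nat[OF assms] by blast
qed

lemma map_ga_add: "set c \<subseteq> arcs Q \<Longrightarrow> map (ga D s) (map (ga D t) c) = map (ga D (s + t)) c"
  by (simp add: ga_add subset_eq)

lemma map_ga_0: "map (ga D 0) c = c"
  by (simp add: ga_def)

lemma set_map_ga: "set c \<subseteq> arcs Q \<Longrightarrow> set (map (ga D t) c) \<subseteq> arcs Q"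
  using ga_in by auto

lemma cyc_orbit_sym:
  assumes "set c \<subseteq> arcs Q" and "c' \<in> cyc_class (map (ga D t) c)"
  shows "c \<in> cyc_class (map (ga D (- t)) c')"
proof -
  have "map (ga D t) c \<in> cyc_class c'" using assms(2) by (rule cyc_class_sym)
  then have "map (ga D (- t)) (map (ga D t) c) \<in> cyc_class (map (ga D (- t)) c')"
    by (rule map_in_cyc_class)
  then show ?thesis using map_ga_add[OF assms(1), of "- t" t] map_ga_0 by simp
qed

lemma orbit_card_int:
  assumes "set c \<subseteq> arcs Q"
  shows "orbit_card D c = card (range (\<lambda>t. cyc_class (map (ga D t) c)))"
proof -
  have "range (\<lambda>i. cyc_class (map (star_a D ^^ i) c)) = range (\<lambda>t. cyc_class (map (ga D t) c))"
  proof (intro equalityI subsetI)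
    fix x assume "x \<in> range (\<lambda>i. cyc_class (map (star_a D ^^ i) c))"
    then show "x \<in> range (\<lambda>t. cyc_class (map (ga D t) c))"
      unfolding map_star_pow[OF assms] by blast
  next
    fix x assume "x \<in> range (\<lambda>t. cyc_class (map (ga D t) c))"
    then show "x \<in> range (\<lambda>i. cyc_class (map (star_a D ^^ i) c))"
      unfolding map_ga_nat[OF assms] by blast
  qed
  then show ?thesis unfolding orbit_card_def by simp
qed

lemma orbit_card_orbit:
  assumes c: "set c \<subseteq> arcs Q" and "c' \<in> cyc_class (map (ga D t) c)"
  shows "orbit_card D c' = orbit_card D c"
proof -
  have c': "set c' \<subseteq> arcs Q"
    using cyc_class_set[OF assms(2)] set_map_ga[OF c] by simp
  have *: "cyc_class (map (ga D s) c') = cyc_class (map (ga D (s + t)) c)" for s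
    using map_in_cyc_class[OF assms(2), of "ga D s"] by (simp only: map_ga_add[OF c] cyc_class_eq_iff)
  have "range (\<lambda>s. cyc_class (map (ga D s) c')) = range (\<lambda>s. cyc_class (map (ga D s) c))"
  proof (intro equalityI subsetI)
    fix x assume "x \<in> range (\<lambda>s. cyc_class (map (ga D s) c))"
    then obtain s where "x = cyc_class (map (ga D ((s - t) + t)) c)" by auto
    then show "x \<in> range (\<lambda>s. cyc_class (map (ga D s) c'))" unfolding *[symmetric] by blast
  qed (auto simp: *)
  then show ?thesis by (simp add: orbit_card_int c c')
qed

lemma coeff_ga_free:
  assumes "set c \<subseteq> arcs Q" and "\<And>\<alpha>. \<alpha> \<in> set c \<Longrightarrow> head Q \<alpha> \<notin> Fx"
  shows "cyc_coeff (pot D) (map (ga D t) c) = cyc_coeff (pot D) c"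
proof -
  have "cyc_coeff (pot D) (map (star_a D ^^ i) c) = cyc_coeff (pot D) c" for i
  proof (induction i)
    case (Suc i)
    have e: "map (star_a D ^^ Suc i) c = map (star_a D) (map (star_a D ^^ i) c)" by simp
    have "cyc_coeff (pot D) (map (star_a D) (map (star_a D ^^ i) c)) = cyc_coeff (pot D) (map (star_a D ^^ i) c)"
    proof (rule coeff_star_free)
      show "set (map (star_a D ^^ i) c) \<subseteq> arcs Q" using assms(1) star_a_pow_in by auto
      show "head Q \<alpha> \<notin> Fx" if "\<alpha> \<in> set (map (star_a D ^^ i) c)" for \<alpha>
      proof -
        obtain \<beta> where b: "\<beta> \<in> set c" "\<alpha> = (star_a D ^^ i) \<beta>" using \<open>\<alpha> \<in> _\<close> by auto
        then have "\<beta> \<in> arcs Q" using assms(1) by blast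
        then show ?thesis
          using assms(2)[OF b(1)] b(2) by (simp add: ga_star_a ga_ends_fix)
      qed
    qed
    then show ?case using Suc unfolding e by (rule trans)
  qed (simp add: map_ga_0)
  then show ?thesis unfolding map_ga_nat[OF assms(1)] .
qed

subsection \<open>Shapes\<close>

lemma hshapeD:
  assumes "hshape D (as, ts)"
  shows "as \<noteq> []" "length ts = length as" "set as \<subseteq> arcs Q"
    "i < length as \<Longrightarrow> as ! i \<in> arcs Q"
    "i < length as \<Longrightarrow> tail Q (as ! i) = gv D (ts ! i) (head Q (as ! (Suc i mod length as)))"
    "i < length as \<Longrightarrow> Suc i mod length as < length as"
  using assms nth_mem[of i as] unfolding hshape_def by auto

lemma length_hword [simp]: "length (hword D (as, ts)) = length as"
  by (simp add: hword_def)

lemma hword_nth: "i < length as \<Longrightarrow> hword D (as, ts) ! i = ga D (\<Sum>j<i. ts ! j) (as ! i)"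
  by (simp add: hword_def)

lemma set_hword: "set as \<subseteq> arcs Q \<Longrightarrow> set (hword D (as, ts)) \<subseteq> arcs Q"
  using ga_in by (auto simp: hword_def subset_eq)

lemma hword_zero:
  assumes "length ts = length as" and "\<And>i. i < length as \<Longrightarrow> ts ! i = 0"
  shows "hword D (as, ts) = as"
proof (rule nth_equalityI)
  fix i assume "i < length (hword D (as, ts))"
  then have i: "i < length as" by simp
  then have "(\<Sum>j<i. ts ! j) = 0" using assms by (intro sum.neutral) simp
  then show "hword D (as, ts) ! i = as ! i" using i by (simp add: hword_nth)
qed simp

lemma hword_cong:
  assumes "length ts = length as" "length ts' = length as" and "\<And>i. i < length as \<Longrightarrow> ts ! i mod n = ts' ! i mod n"
  shows "hword D (as, ts) = hword D (as, ts')"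
proof (rule nth_equalityI)
  fix i assume "i < length (hword D (as, ts))"
  then have i: "i < length as" by simp
  from i have "(\<Sum>j<i. ts ! j) mod n = (\<Sum>j<i. ts' ! j) mod n"
  proof (induction i)
    case (Suc i)
    then show ?case using mod_add_cong[OF Suc.IH assms(3)[of i]] by simp
  qed simp
  then show "hword D (as, ts) ! i = hword D (as, ts') ! i" unfolding hword_nth[OF i] by (rule fun_cong[OF ga_cong])
qed simp

lemma fix_count_hword:
  assumes "set as \<subseteq> arcs Q"
  shows "fix_count Q Fx (hword D (as, ts)) = card {i. i < length as \<and> head Q (as ! i) \<in> Fx}"
proof -
  have "head Q (hword D (as, ts) ! i) \<in> Fx \<longleftrightarrow> head Q (as ! i) \<in> Fx" if "i < length as" for i
  proof -
    have "as ! i \<in> arcs Q" using assms that nth_mem by blast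
    then show ?thesis using that by (simp add: hword_nth ga_ends_fix)
  qed
  then have "{i. i < length as \<and> head Q (hword D (as, ts) ! i) \<in> Fx} = {i. i < length as \<and> head Q (as ! i) \<in> Fx}"
    by blast
  then show ?thesis unfolding fix_count_def by simp
qed

text \<open>\<open>hshape\<close> links neighbouring arrows only up to translation. Read along
  \<open>hword\<close>, the last arrow starts at the target of the first one moved by the sum of all
  exponents; closedness and freeness of that orbit force the sum to vanish modulo
  \<open>n\<close>.\<close>

lemma shape_closed_sum:
  assumes h: "hshape D (as, ts)" and "closed_word Q (hword D (as, ts))" and "head Q (as ! 0) \<in> Fr"
  shows "n dvd sum_list ts"
proof -
  define k where "k = length as - 1"
  have k: "k < length as" "Suc k = length as" using hshapeD(1)[OF h] by (cases as; simp add: k_def)+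
  have l: "0 < length as" using k by simp
  have v: "head Q (as ! 0) \<in> verts Q" using assms(3) free_verts by blast
  have "tail Q (hword D (as, ts) ! k) = head Q (hword D (as, ts) ! 0)"
    using assms(2) k unfolding closed_word_def by (metis length_hword mod_self)
  then have "tail Q (ga D (\<Sum>j<k. ts ! j) (as ! k)) = head Q (as ! 0)"
    using k l by (simp add: hword_nth)
  moreover have "tail Q (as ! k) = gv D (ts ! k) (head Q (as ! 0))"
    using hshapeD(5)[OF h k(1)] k by simp
  ultimately have "gv D ((\<Sum>j<k. ts ! j) + ts ! k) (head Q (as ! 0)) = gv D 0 (head Q (as ! 0))"
    using hshapeD(4)[OF h k(1)] by (simp add: tail_ga gv_add[OF v])
  from free_unique[OF assms(3) assms(3) this]
  have "n dvd (\<Sum>j<Suc k. ts ! j)" by (simp add: dvd_eq_mod_eq_0)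
  then show ?thesis
    using sum_list_nth[of ts "Suc k"] hshapeD(2)[OF h] k by simp
qed

subsection \<open>The arrows occurring in the shapes\<close>

lemma tail_free_arrows1:
  assumes "\<alpha> \<in> arcs Q" and "head Q \<alpha> \<in> Fr" and "tail Q \<alpha> = gv D t \<epsilon>" and "\<epsilon> \<in> Fr"
  shows "\<alpha> \<in> arrows1 D" "t_exp D \<alpha> = t mod n"
proof -
  show "\<alpha> \<in> arrows1 D" using assms unfolding arrows1_def by blast
  then show "t_exp D \<alpha> = t mod n" using t_exp_eqI assms(3,4) by blast
qed

lemma hshape_iD:
  assumes "hshape_i D (as, ts)"
  shows "hshape D (as, ts)" "i < length as \<Longrightarrow> head Q (as ! i) \<in> Fr" "i < length as \<Longrightarrow> as ! i \<in> arrows1 D"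
    "i < length as \<Longrightarrow> t_exp D (as ! i) = ts ! i mod n"
proof -
  show h: "hshape D (as, ts)" using assms by (simp add: hshape_i_def)
  show f: "head Q (as ! i) \<in> Fr" if "i < length as" for i using assms that by (simp add: hshape_i_def)
  show "i < length as \<Longrightarrow> as ! i \<in> arrows1 D" "i < length as \<Longrightarrow> t_exp D (as ! i) = ts ! i mod n"
    using tail_free_arrows1[OF hshapeD(4)[OF h] f hshapeD(5)[OF h] f[OF hshapeD(6)[OF h]]] by blast+
qed

text \<open>The arrow \<open>as ! 1\<close> ends at the fixed vertex but starts at a translate of a
  representative; moving it back by its exponent gives an arrow of type (2).\<close>

lemma hshape_iiD:
  assumes "hshape_ii D (as, ts)"
  shows "hshape D (as, ts)" "1 < length as" "ts ! 0 = 0" "i < length as \<Longrightarrow> i \<noteq> 1 \<Longrightarrow> head Q (as ! i) \<in> Fr"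
    "head Q (as ! 1) \<in> Fx" "as ! 0 \<in> arrows3 D" "ga D (- (ts ! 1)) (as ! 1) \<in> arrows2 D"
    "1 < i \<Longrightarrow> i < length as \<Longrightarrow> as ! i \<in> arrows1 D"
    "1 < i \<Longrightarrow> i < length as \<Longrightarrow> t_exp D (as ! i) = ts ! i mod n"
proof -
  show h: "hshape D (as, ts)" and l: "1 < length as" and t0: "ts ! 0 = 0"
    using assms by (simp_all add: hshape_ii_def)
  have ends: "head Q (as ! i) \<in> (if i = 1 then Fx else Fr)" if "i < length as" for i
    using assms that by (simp add: hshape_ii_def)
  show f: "head Q (as ! i) \<in> Fr" if "i < length as" "i \<noteq> 1" for i
    using ends[OF that(1)] that(2) by simp
  show x: "head Q (as ! 1) \<in> Fx" using ends[OF l] by simp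
  have l0: "0 < length as" "Suc 0 mod length as = 1" using l by simp_all
  have "tail Q (as ! 0) = head Q (as ! 1)"
    using hshapeD(5)[OF h l0(1)] t0 l0 by simp
  then show "as ! 0 \<in> arrows3 D"
    using hshapeD(4)[OF h l0(1)] f[of 0] l0 x by (simp add: arrows3_def)
  have j: "Suc 1 mod length as < length as" "Suc 1 mod length as \<noteq> 1"
    using l by (cases "length as = 2"; simp)+
  note a1 = hshapeD(4)[OF h l]
  have "tail Q (ga D (- (ts ! 1)) (as ! 1)) = head Q (as ! (Suc 1 mod length as))"
    using hshapeD(5)[OF h l] f[OF j] free_verts by (simp add: tail_ga[OF a1] gv_add subset_eq)
  then show "ga D (- (ts ! 1)) (as ! 1) \<in> arrows2 D"
    using f[OF j] x by (simp add: arrows2_def ga_in[OF a1] head_ga[OF a1])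
  have j: "Suc i mod length as \<noteq> 1" if "1 < i" "i < length as"
    using that by (simp add: mod_Suc)
  show "1 < i \<Longrightarrow> i < length as \<Longrightarrow> as ! i \<in> arrows1 D"
    "1 < i \<Longrightarrow> i < length as \<Longrightarrow> t_exp D (as ! i) = ts ! i mod n"
    using tail_free_arrows1[OF hshapeD(4)[OF h] f hshapeD(5)[OF h] f[OF hshapeD(6)[OF h] j]] by simp_all
qed

lemma hshape_iiiD:
  assumes "hshape_iii D (as, ts)"
  shows "hshape D (as, ts)" "1 < length as" "i < length as \<Longrightarrow> ts ! i = 0"
    "head Q (as ! 1) \<in> Fr" "i < length as \<Longrightarrow> i \<noteq> 1 \<Longrightarrow> head Q (as ! i) \<in> Fx"
    "as ! 0 \<in> arrows2 D" "as ! 1 \<in> arrows3 D" "1 < i \<Longrightarrow> i < length as \<Longrightarrow> as ! i \<in> arrows4 D"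
    "i < length as \<Longrightarrow> tail Q (as ! i) = head Q (as ! (Suc i mod length as))"
proof -
  show h: "hshape D (as, ts)" and l: "1 < length as"
    using assms by (simp_all add: hshape_iii_def)
  show t0: "ts ! i = 0" if "i < length as" for i
    using assms that by (simp add: hshape_iii_def)
  have ends: "head Q (as ! i) \<in> (if i = 1 then Fr else Fx)" if "i < length as" for i
    using assms that by (simp add: hshape_iii_def)
  show f: "head Q (as ! 1) \<in> Fr" using ends[OF l] by simp
  show x: "head Q (as ! i) \<in> Fx" if "i < length as" "i \<noteq> 1" for i
    using ends[OF that(1)] that(2) by simp
  show t: "tail Q (as ! i) = head Q (as ! (Suc i mod length as))" if "i < length as" for i
    using hshapeD(5)[OF h that] t0[OF that] by simp
  have l0: "0 < length as" "Suc 0 mod length as = 1" using l by simp_all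
  show "as ! 0 \<in> arrows2 D"
    using hshapeD(4)[OF h l0(1)] t[OF l0(1)] f x[of 0] l0 by (simp add: arrows2_def)
  have j: "Suc i mod length as \<noteq> 1" if "1 \<le> i" "i < length as" for i
    using that by (simp add: mod_Suc)
  show "as ! 1 \<in> arrows3 D"
    using hshapeD(4)[OF h l] t[OF l] f x[OF hshapeD(6)[OF h l] j[OF _ l]] by (simp add: arrows3_def)
  show "1 < i \<Longrightarrow> i < length as \<Longrightarrow> as ! i \<in> arrows4 D"
    using hshapeD(4)[OF h, of i] t[of i] x[OF hshapeD(6)[OF h] j, of i] x[of i] by (simp add: arrows4_def)
qed

lemma hshape_ivD:
  assumes "hshape_iv D (as, ts)"
  shows "hshape D (as, ts)" "i < length as \<Longrightarrow> ts ! i = 0" "i < length as \<Longrightarrow> as ! i \<in> arrows4 D"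
    "i < length as \<Longrightarrow> tail Q (as ! i) = head Q (as ! (Suc i mod length as))"
    "hword D (as, ts) = as" "set as \<subseteq> arrows4 D"
proof -
  show h: "hshape D (as, ts)" using assms by (simp add: hshape_iv_def)
  show t0: "ts ! i = 0" if "i < length as" for i
    using assms that by (simp add: hshape_iv_def)
  have x: "head Q (as ! i) \<in> Fx" if "i < length as" for i
    using assms that by (simp add: hshape_iv_def)
  show t: "tail Q (as ! i) = head Q (as ! (Suc i mod length as))" if "i < length as" for i
    using hshapeD(5)[OF h that] t0[OF that] by simp
  show a: "as ! i \<in> arrows4 D" if "i < length as" for i
    using hshapeD(4)[OF h that] t[OF that] x[OF hshapeD(6)[OF h that]] x[OF that] by (simp add: arrows4_def)
  show "hword D (as, ts) = as" using hword_zero[OF hshapeD(2)[OF h] t0] .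
  show "set as \<subseteq> arrows4 D" using a by (auto simp: in_set_conv_nth)
qed

lemma hword_iii: "hshape_iii D (as, ts) \<Longrightarrow> hword D (as, ts) = as"
  by (rule hword_zero[OF hshapeD(2)[OF hshape_iiiD(1)] hshape_iiiD(3)])

lemma fix_count_shapes:
  "hshape_i D (as, ts) \<Longrightarrow> cyc_i Q Fx (hword D (as, ts))"
  "hshape_ii D (as, ts) \<Longrightarrow> cyc_ii Q Fx (hword D (as, ts))"
  "hshape_iii D (as, ts) \<Longrightarrow> cyc_iii Q Fx (hword D (as, ts))"
  "hshape_iv D (as, ts) \<Longrightarrow> cyc_iv Q Fx (hword D (as, ts))"
proof -
  assume s: "hshape_i D (as, ts)"
  note h = hshape_iD[OF s]
  have "{i. i < length as \<and> head Q (as ! i) \<in> Fx} = {}"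
    using h(2) free_fix_disjoint by blast
  then show "cyc_i Q Fx (hword D (as, ts))"
    unfolding cyc_i_def fix_count_hword[OF hshapeD(3)[OF h(1)]] by simp
next
  assume s: "hshape_ii D (as, ts)"
  note h = hshape_iiD[OF s]
  have "{i. i < length as \<and> head Q (as ! i) \<in> Fx} = {1}"
    using h(2,4,5) free_fix_disjoint by blast
  then show "cyc_ii Q Fx (hword D (as, ts))"
    unfolding cyc_ii_def fix_count_hword[OF hshapeD(3)[OF h(1)]] by simp
next
  assume s: "hshape_iii D (as, ts)"
  note h = hshape_iiiD[OF s]
  have "{i. i < length as \<and> head Q (as ! i) \<in> Fx} = {..<length as} - {1}"
    using h(4,5) free_fix_disjoint by blast
  then show "cyc_iii Q Fx (hword D (as, ts))"
    unfolding cyc_iii_def fix_count_hword[OF hshapeD(3)[OF h(1)]] using h(2) by simp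
next
  assume s: "hshape_iv D (as, ts)"
  note h = hshape_ivD[OF s]
  have "{i. i < length as \<and> head Q (as ! i) \<in> Fx} = {..<length as}"
    using h(3) arrows_ends(4) by blast
  then show "cyc_iv Q Fx (hword D (as, ts))"
    unfolding cyc_iv_def fix_count_hword[OF hshapeD(3)[OF h(1)]] by simp
qed

subsection \<open>The cycles of \<open>Q\<^sub>G\<close>\<close>

lemma b_sum_step: "1 \<le> i \<Longrightarrow> i \<le> length as \<Longrightarrow> b_sum D as i = b_exp D (as ! (i - 1)) + b_sum D as (Suc i)"
  by (simp add: b_sum_def sum.atLeast_Suc_atMost)

lemma b_sum_end: "length as < i \<Longrightarrow> b_sum D as i = 0"
  by (simp add: b_sum_def)

lemma b_sum_1: "b_sum D as 1 = sum_list (map (b_exp D) as)"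
proof -
  have "b_sum D as 1 = (\<Sum>j = Suc 0..<Suc (length as). b_exp D (as ! (j - 1)))"
    unfolding b_sum_def One_nat_def by (simp add: atLeastLessThanSuc_atLeastAtMost)
  also have "\<dots> = (\<Sum>j = 0..<length as. b_exp D (as ! j))"
    by (subst sum.shift_bounds_Suc_ivl) simp
  finally show ?thesis by (simp add: sum_list_sum_nth)
qed

lemma length_tilde_i [simp]: "length (tilde_i D (as, ts)) = length as"
  by (simp add: tilde_i_def)

lemma nth_tilde_i: "i < length as \<Longrightarrow> tilde_i D (as, ts) ! i = tilde1 D (as ! i)"
  by (simp add: tilde_i_def)

lemma length_tilde_ii: "1 < length as \<Longrightarrow> length (tilde_ii D (as, ts) \<mu>) = length as"
  by (simp add: tilde_ii_def)

lemma nth_tilde_ii: "i < length as \<Longrightarrow> tilde_ii D (as, ts) \<mu> ! i =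
   (if i = 0 then tilde3 D (as ! 0) \<mu> else if i = 1 then tilde2 D (ga D (- (ts ! 1)) (as ! 1)) \<mu>
    else tilde1 D (as ! i))"
  by (cases i; cases "i - 1") (simp_all add: tilde_ii_def One_nat_def numeral_2_eq_2)

lemma length_tilde_iii: "1 < length as \<Longrightarrow> length (tilde_iii D (as, ts) \<mu>) = length as"
  by (simp add: tilde_iii_def del: upt_Suc)

lemma nth_tilde_iii: "1 < length as \<Longrightarrow> i < length as \<Longrightarrow> tilde_iii D (as, ts) \<mu> ! i =
   (if i = 0 then tilde2 D (as ! 0) \<mu> else if i = 1 then tilde3 D (as ! 1) (\<mu> - b_sum D as 3)
    else tilde4 D (as ! i) (\<mu> - b_sum D as (i + 2)))"
proof -
  assume l: "1 < length as" and i: "i < length as"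
  show ?thesis
  proof (cases "i = 0 \<or> i = 1")
    case True
    then show ?thesis by (auto simp: tilde_iii_def)
  next
    case False
    then obtain k where k: "i = Suc (Suc k)" by (metis One_nat_def not0_implies_Suc)
    have "[3..<length as + 1] ! k = 3 + k" "k < length [3..<length as + 1]"
      using i k by (simp_all add: nth_upt)
    then have "tilde_iii D (as, ts) \<mu> ! i = tilde4 D (as ! (3 + k - 1)) (\<mu> - b_sum D as (3 + k + 1))"
      using k by (simp add: tilde_iii_def del: upt_Suc)
    moreover have "3 + k - 1 = i" "3 + k + 1 = i + 2" using k by simp_all
    ultimately show ?thesis using False by (simp only: if_False de_Morgan_disj)
  qed
qed

lemma length_tilde_iv [simp]: "length (tilde_iv D (as, ts) \<mu>) = length as"
  by (simp add: tilde_iv_def del: upt_Suc)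

lemma nth_tilde_iv: "i < length as \<Longrightarrow> tilde_iv D (as, ts) \<mu> ! i = tilde4 D (as ! i) (\<mu> - b_sum D as (i + 2))"
proof -
  assume i: "i < length as"
  have "tilde_iv D (as, ts) \<mu> ! i = tilde4 D (as ! (1 + i - 1)) (\<mu> - b_sum D as (1 + i + 1))"
    using i by (simp add: tilde_iv_def nth_upt del: upt_Suc)
  moreover have "1 + i - 1 = i" "1 + i + 1 = i + 2" by simp_all
  ultimately show ?thesis by (simp only:)
qed

lemma closed_tilde_i:
  assumes s: "hshape_i D (as, ts)"
  shows "closed_word (QG D) (tilde_i D (as, ts))"
  unfolding closed_word_def
proof (intro conjI allI impI)
  note h = hshape_iD[OF s] and h' = hshapeD[OF hshape_iD(1)[OF s]]
  show "tilde_i D (as, ts) \<noteq> []" using h'(1) by (simp add: tilde_i_def)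
  show "set (tilde_i D (as, ts)) \<subseteq> arcs (QG D)"
  proof
    fix x assume "x \<in> set (tilde_i D (as, ts))"
    then obtain i where "i < length as" "x = tilde1 D (as ! i)"
      by (auto simp: tilde_i_def in_set_conv_nth)
    then show "x \<in> arcs (QG D)" using QG_tilde1(1)[OF h(3)] by simp
  qed
  fix i assume "i < length (tilde_i D (as, ts))"
  then have i: "i < length as" by simp
  let ?j = "Suc i mod length as"
  note j = h'(6)[OF i]
  have "tail (QG D) (tilde1 D (as ! i)) = eta D (head Q (as ! ?j))"
    using QG_tilde1(3)[OF h(3)[OF i] h(2)[OF j] h'(5)[OF i]] .
  then show "tail (QG D) (tilde_i D (as, ts) ! i) =
      head (QG D) (tilde_i D (as, ts) ! (Suc i mod length (tilde_i D (as, ts))))"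
    using i j QG_tilde1(2)[OF h(3)[OF j]] by (simp add: nth_tilde_i)
qed

lemma closed_tilde_ii:
  assumes s: "hshape_ii D (as, ts)" and l3: "3 \<le> length as"
  shows "closed_word (QG D) (tilde_ii D (as, ts) \<mu>)"
  unfolding closed_word_def
proof (intro conjI allI impI)
  note h = hshape_iiD[OF s] and h' = hshapeD[OF hshape_iiD(1)[OF s]]
  note len = length_tilde_ii[OF h(2), of ts \<mu>]
  show "tilde_ii D (as, ts) \<mu> \<noteq> []" by (simp add: tilde_ii_def)
  have in_arcs: "tilde_ii D (as, ts) \<mu> ! i \<in> arcs (QG D)" if "i < length as" for i
    using that h(6,7) h(8)[of i] by (simp add: nth_tilde_ii QG_tilde1 QG_tilde2 QG_tilde3)
  show "set (tilde_ii D (as, ts) \<mu>) \<subseteq> arcs (QG D)"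
    by (intro set_subset_nthI in_arcs) (simp only: len)
  fix i assume "i < length (tilde_ii D (as, ts) \<mu>)"
  then have i: "i < length as" unfolding len .
  let ?j = "Suc i mod length as"
  note j = h'(6)[OF i]
  have "tail (QG D) (tilde_ii D (as, ts) \<mu> ! i) = head (QG D) (tilde_ii D (as, ts) \<mu> ! ?j)"
  proof -
    consider "i = 0" | "i = 1" | "1 < i" by linarith
    then show ?thesis
    proof cases
      case 1
      have j1: "?j = 1" using 1 l3 by simp
      have "tail Q (as ! 0) = head Q (as ! 1)"
        using h'(5)[OF i] 1 j1 h(3) by simp
      then show ?thesis
        using 1 i l3 j1 h(5) by (simp add: nth_tilde_ii QG_tilde3[OF h(6)] QG_tilde2[OF h(7)]
            head_ga[OF h'(4)[OF h(2)]])
    next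
      case 2
      have j2: "?j = 2" using 2 l3 by (simp add: mod_Suc numeral_2_eq_2)
      have l2: "2 < length as" using l3 by simp
      have v: "head Q (as ! 2) \<in> verts Q" using h(4)[OF l2] free_verts by auto
      have "tail Q (as ! 1) = gv D (ts ! 1) (head Q (as ! 2))"
        using h'(5)[OF i] j2 2 by simp
      then have "tail Q (ga D (- (ts ! 1)) (as ! 1)) = head Q (as ! 2)"
        by (simp add: tail_ga[OF h'(4)[OF h(2)]] gv_add[OF v])
      then show ?thesis
        using 2 l2 j2 by (simp add: nth_tilde_ii QG_tilde2[OF h(7)] QG_tilde1[OF h(8)[OF _ l2]])
    next
      case 3
      have j1: "?j \<noteq> 1" using 3 i by (simp add: mod_Suc)
      have "tail (QG D) (tilde1 D (as ! i)) = eta D (head Q (as ! ?j))"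
        using QG_tilde1(3)[OF h(8)[OF 3 i] h(4)[OF j j1] h'(5)[OF i]] .
      moreover have "head (QG D) (tilde_ii D (as, ts) \<mu> ! ?j) = eta D (head Q (as ! ?j))"
        using j j1 h(8)[of ?j] by (cases "?j = 0") (simp_all add: nth_tilde_ii QG_tilde3[OF h(6)] QG_tilde1)
      ultimately show ?thesis using 3 i by (simp add: nth_tilde_ii)
    qed
  qed
  then show "tail (QG D) (tilde_ii D (as, ts) \<mu> ! i) =
      head (QG D) (tilde_ii D (as, ts) \<mu> ! (Suc i mod length (tilde_ii D (as, ts) \<mu>)))"
    unfolding len .
qed

text \<open>A type (4) arrow lowers the index by its \<open>b\<close>, and the indices
  \<open>\<mu> - b_i\<close> telescope accordingly. No condition arises at the free vertex, where no
  index is carried.\<close>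

lemma closed_tilde_iii:
  assumes s: "hshape_iii D (as, ts)" and l3: "3 \<le> length as"
  shows "closed_word (QG D) (tilde_iii D (as, ts) \<mu>)"
  unfolding closed_word_def
proof (intro conjI allI impI)
  note h = hshape_iiiD[OF s] and h' = hshapeD[OF hshape_iiiD(1)[OF s]]
  note len = length_tilde_iii[OF h(2), of ts \<mu>] and nth = nth_tilde_iii[OF h(2), of _ ts \<mu>]
  show "tilde_iii D (as, ts) \<mu> \<noteq> []" by (simp add: tilde_iii_def)
  have in_arcs: "tilde_iii D (as, ts) \<mu> ! i \<in> arcs (QG D)" if "i < length as" for i
    using that h(6,7) h(8)[of i] by (simp add: nth QG_tilde4 QG_tilde2 QG_tilde3)
  show "set (tilde_iii D (as, ts) \<mu>) \<subseteq> arcs (QG D)"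
    by (intro set_subset_nthI in_arcs) (simp only: len)
  fix i assume "i < length (tilde_iii D (as, ts) \<mu>)"
  then have i: "i < length as" unfolding len .
  let ?j = "Suc i mod length as"
  note j = h'(6)[OF i] and t = h(9)[OF i]
  have "tail (QG D) (tilde_iii D (as, ts) \<mu> ! i) = head (QG D) (tilde_iii D (as, ts) \<mu> ! ?j)"
  proof (cases "i = 0")
    case True
    then have "?j = 1" using l3 by simp
    then show ?thesis
      using True t i h(2) by (simp add: nth QG_tilde2[OF h(6)] QG_tilde3[OF h(7)])
  next
    case False
    have "b_sum D as 3 = b_sum D as (1 + 2)" by (simp add: numeral_3_eq_3)
    then have ti: "tail (QG D) (tilde_iii D (as, ts) \<mu> ! i) = eta_mu D (tail Q (as ! i)) (\<mu> - b_sum D as (i + 2))"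
      using False i h(8)[of i] by (cases "i = 1") (simp_all add: nth QG_tilde3[OF h(7)] QG_tilde4)
    show ?thesis
    proof (cases "Suc i < length as")
      case True
      then have jj: "?j = Suc i" "1 < Suc i" using False by simp_all
      have "b_sum D as (i + 2) = b_exp D (as ! Suc i) + b_sum D as (Suc i + 2)"
        using b_sum_step[of "i + 2" as] True by simp
      then show ?thesis
        unfolding ti jj(1) using True t False jj(1) QG_tilde4(3)[OF h(8)[OF jj(2) True]] by (simp add: nth algebra_simps)
    next
      case F: False
      then have "Suc i = length as" using i by simp
      then have "?j = 0" "b_sum D as (i + 2) = 0" by (simp_all add: b_sum_end)
      then show ?thesis unfolding ti using t h(2) by (simp add: nth QG_tilde2[OF h(6)])
    qed
  qed
  then show "tail (QG D) (tilde_iii D (as, ts) \<mu> ! i) =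
      head (QG D) (tilde_iii D (as, ts) \<mu> ! (Suc i mod length (tilde_iii D (as, ts) \<mu>)))"
    unfolding len .
qed

text \<open>Inside the word the indices match by the recursion of \<open>b_sum\<close>. At the seam
  the last arrow starts at index \<open>\<mu>\<close> and the first one ends at \<open>\<mu>\<close>
  minus the total of \<open>b\<close>, so divisibility of the total closes the word.\<close>

lemma closed_tilde_iv:
  assumes s: "hshape_iv D (as, ts)" and b: "n dvd sum_list (map (b_exp D) as)"
  shows "closed_word (QG D) (tilde_iv D (as, ts) \<mu>)"
  unfolding closed_word_def
proof (intro conjI allI impI)
  note h = hshape_ivD[OF s] and h' = hshapeD[OF hshape_ivD(1)[OF s]]
  show "tilde_iv D (as, ts) \<mu> \<noteq> []" using h'(1) by (simp add: tilde_iv_def)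
  have in_arcs: "tilde_iv D (as, ts) \<mu> ! i \<in> arcs (QG D)" if "i < length as" for i
    using that h(3)[of i] by (simp add: nth_tilde_iv QG_tilde4)
  show "set (tilde_iv D (as, ts) \<mu>) \<subseteq> arcs (QG D)"
    by (intro set_subset_nthI in_arcs) (simp only: length_tilde_iv)
  fix i assume "i < length (tilde_iv D (as, ts) \<mu>)"
  then have i: "i < length as" by simp
  let ?j = "Suc i mod length as"
  note j = h'(6)[OF i] and t = h(4)[OF i]
  have "tail (QG D) (tilde_iv D (as, ts) \<mu> ! i) = eta_mu D (tail Q (as ! i)) (\<mu> - b_sum D as (i + 2))"
    using i by (simp add: nth_tilde_iv QG_tilde4[OF h(3)])
  also have "\<dots> = eta_mu D (head Q (as ! ?j)) (\<mu> - b_sum D as (?j + 2) - b_exp D (as ! ?j))"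
  proof (cases "Suc i < length as")
    case True
    then have "?j = Suc i" by simp
    moreover have "b_sum D as (i + 2) = b_exp D (as ! Suc i) + b_sum D as (Suc i + 2)"
      using b_sum_step[of "i + 2" as] True by simp
    ultimately show ?thesis using t by (simp add: algebra_simps)
  next
    case False
    then have "Suc i = length as" using i by simp
    then have "?j = 0" and e: "b_sum D as (i + 2) = 0" by (simp_all add: b_sum_end)
    have "b_sum D as 1 = b_exp D (as ! 0) + b_sum D as 2"
      using b_sum_step[of 1 as] i by (simp add: numeral_2_eq_2)
    then have "n dvd b_exp D (as ! 0) + b_sum D as 2" using b b_sum_1[of as] by simp
    then have "\<mu> mod n = (\<mu> - b_sum D as 2 - b_exp D (as ! 0)) mod n"
      by (simp add: mod_eq_dvd_iff add.commute)
    then show ?thesis using t \<open>?j = 0\<close> e by (simp add: eta_mu_eq_iff numeral_2_eq_2)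
  qed
  also have "\<dots> = head (QG D) (tilde_iv D (as, ts) \<mu> ! ?j)"
    using j by (simp add: nth_tilde_iv QG_tilde4[OF h(3)])
  finally show "tail (QG D) (tilde_iv D (as, ts) \<mu> ! i) =
      head (QG D) (tilde_iv D (as, ts) \<mu> ! (Suc i mod length (tilde_iv D (as, ts) \<mu>)))"
    by simp
qed

end


context cyclic_datum
begin

subsection \<open>Kinds of arrows\<close>

definition "kind1 x \<longleftrightarrow> (\<exists>\<alpha> \<in> arrows1 D. x = tilde1 D \<alpha>)"
definition "kind2 x \<longleftrightarrow> (\<exists>\<alpha> \<in> arrows2 D. \<exists>\<mu>. x = tilde2 D \<alpha> \<mu>)"
definition "kind3 x \<longleftrightarrow> (\<exists>\<alpha> \<in> arrows3 D. \<exists>\<mu>. x = tilde3 D \<alpha> \<mu>)"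
definition "kind4 x \<longleftrightarrow> (\<exists>\<alpha> \<in> arrows4 D. \<exists>\<mu>. x = tilde4 D \<alpha> \<mu>)"

lemma kinds_disjoint:
  "kind1 x \<Longrightarrow> \<not> kind2 x" "kind1 x \<Longrightarrow> \<not> kind3 x" "kind1 x \<Longrightarrow> \<not> kind4 x"
  "kind2 x \<Longrightarrow> \<not> kind3 x" "kind2 x \<Longrightarrow> \<not> kind4 x" "kind3 x \<Longrightarrow> \<not> kind4 x"
proof -
  have k1: "kind1 x \<Longrightarrow> \<exists>\<alpha> \<mu>. \<alpha> \<in> arrows1 D \<and> x = tilde_any \<alpha> \<mu>"
    unfolding kind1_def using tilde_any_simps(1) by metis
  have k2: "kind2 x \<Longrightarrow> \<exists>\<alpha> \<mu>. \<alpha> \<in> arrows2 D \<and> x = tilde_any \<alpha> \<mu>"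
    unfolding kind2_def using tilde_any_simps(2) by metis
  have k3: "kind3 x \<Longrightarrow> \<exists>\<alpha> \<mu>. \<alpha> \<in> arrows3 D \<and> x = tilde_any \<alpha> \<mu>"
    unfolding kind3_def using tilde_any_simps(3) by metis
  have k4: "kind4 x \<Longrightarrow> \<exists>\<alpha> \<mu>. \<alpha> \<in> arrows4 D \<and> x = tilde_any \<alpha> \<mu>"
    unfolding kind4_def using tilde_any_simps(4) by metis
  have *: "\<alpha> = \<beta>" if "\<alpha> \<in> arrows" "\<beta> \<in> arrows" "x = tilde_any \<alpha> \<mu>" "x = tilde_any \<beta> \<nu>" for \<alpha> \<beta> \<mu> \<nu>
    using tilde_any_inj(1)[OF that(1,2), of \<mu> \<nu>] that(3,4) by simp
  have a: "\<alpha> \<in> arrows1 D \<or> \<alpha> \<in> arrows2 D \<or> \<alpha> \<in> arrows3 D \<or> \<alpha> \<in> arrows4 D \<Longrightarrow> \<alpha> \<in> arrows" for \<alpha>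
    unfolding arrows_def by blast
  show "kind1 x \<Longrightarrow> \<not> kind2 x" using k1 k2 * a arrows_disjoint(1) by metis
  show "kind1 x \<Longrightarrow> \<not> kind3 x" using k1 k3 * a arrows_disjoint(1) by metis
  show "kind1 x \<Longrightarrow> \<not> kind4 x" using k1 k4 * a arrows_disjoint(1) by metis
  show "kind2 x \<Longrightarrow> \<not> kind3 x" using k2 k3 * a arrows_disjoint(2) by metis
  show "kind2 x \<Longrightarrow> \<not> kind4 x" using k2 k4 * a arrows_disjoint(2) by metis
  show "kind3 x \<Longrightarrow> \<not> kind4 x" using k3 k4 * a arrows_disjoint(3) by metis
qed

lemma kinds_tilde:
  "\<alpha> \<in> arrows1 D \<Longrightarrow> kind1 (tilde1 D \<alpha>)" "\<alpha> \<in> arrows2 D \<Longrightarrow> kind2 (tilde2 D \<alpha> \<mu>)"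
  "\<alpha> \<in> arrows3 D \<Longrightarrow> kind3 (tilde3 D \<alpha> \<mu>)" "\<alpha> \<in> arrows4 D \<Longrightarrow> kind4 (tilde4 D \<alpha> \<mu>)"
  unfolding kind1_def kind2_def kind3_def kind4_def by blast+

text \<open>Two tests on letters tell the four types of cycles of \<open>Q_G\<close> apart: words
  from type (i) pass only \<open>has1\<close>, from (ii) both, from (iii) only \<open>has2\<close>,
  from (iv) neither.\<close>

definition "has1 w \<longleftrightarrow> (\<exists>x \<in> set w. kind1 x)"
definition "has2 w \<longleftrightarrow> (\<exists>x \<in> set w. kind2 x)"

lemma has_cyc_class: "d \<in> cyc_class w \<Longrightarrow> has1 d = has1 w \<and> has2 d = has2 w"
  by (simp add: has1_def has2_def cyc_class_set)

lemma kinds_i: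
  assumes s: "hshape_i D (as, ts)"
  shows "x \<in> set (tilde_i D (as, ts)) \<Longrightarrow> kind1 x" "has1 (tilde_i D (as, ts))" "\<not> has2 (tilde_i D (as, ts))"
proof -
  show k: "kind1 x" if "x \<in> set (tilde_i D (as, ts))" for x
    using that hshape_iD(3)[OF s] kinds_tilde(1) by (auto simp: in_set_conv_nth nth_tilde_i)
  have "tilde_i D (as, ts) \<noteq> []" using hshapeD(1)[OF hshape_iD(1)[OF s]] by (simp add: tilde_i_def)
  then have "hd (tilde_i D (as, ts)) \<in> set (tilde_i D (as, ts))" by simp
  then show "has1 (tilde_i D (as, ts))" unfolding has1_def using k by blast
  show "\<not> has2 (tilde_i D (as, ts))" unfolding has2_def using k kinds_disjoint(1) by blast
qed

text \<open>The single letter of kind 3, at position 0, is the anchor that excludes nontrivial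
  rotations.\<close>

lemma kinds_ii:
  assumes s: "hshape_ii D (as, ts)" and l3: "3 \<le> length as"
  shows "kind3 (tilde_ii D (as, ts) \<mu> ! 0)"
    "i < length as \<Longrightarrow> kind3 (tilde_ii D (as, ts) \<mu> ! i) \<Longrightarrow> i = 0"
    "has1 (tilde_ii D (as, ts) \<mu>)" "has2 (tilde_ii D (as, ts) \<mu>)"
proof -
  note h = hshape_iiD[OF s]
  have l: "0 < length as" "2 < length as" using l3 by simp_all
  show "kind3 (tilde_ii D (as, ts) \<mu> ! 0)" using l kinds_tilde(3)[OF h(6)] by (simp add: nth_tilde_ii)
  show "i = 0" if "i < length as" "kind3 (tilde_ii D (as, ts) \<mu> ! i)"
  proof (rule ccontr)
    assume "i \<noteq> 0"
    then have "kind1 (tilde_ii D (as, ts) \<mu> ! i) \<or> kind2 (tilde_ii D (as, ts) \<mu> ! i)"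
      using that(1) kinds_tilde(2)[OF h(7)] kinds_tilde(1)[OF h(8)[of i]] by (simp add: nth_tilde_ii)
    then show False using that(2) kinds_disjoint by blast
  qed
  have "tilde_ii D (as, ts) \<mu> ! 2 \<in> set (tilde_ii D (as, ts) \<mu>)" "tilde_ii D (as, ts) \<mu> ! 1 \<in> set (tilde_ii D (as, ts) \<mu>)"
    using l h(2) by (simp_all add: length_tilde_ii)
  moreover have "kind1 (tilde_ii D (as, ts) \<mu> ! 2)" "kind2 (tilde_ii D (as, ts) \<mu> ! 1)"
    using l h(2) kinds_tilde(2)[OF h(7)] kinds_tilde(1)[OF h(8)[of 2]] by (simp_all add: nth_tilde_ii)
  ultimately show "has1 (tilde_ii D (as, ts) \<mu>)" "has2 (tilde_ii D (as, ts) \<mu>)"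
    unfolding has1_def has2_def by blast+
qed

text \<open>Here the anchor is the letter of kind 2 at position 0. The letter of kind 3 at position
  1 has a target fixed by the dual group, which is exploited in
  \<open>coeff_WG_star\<close>.\<close>

lemma kinds_iii:
  assumes s: "hshape_iii D (as, ts)" and l3: "3 \<le> length as"
  shows "kind2 (tilde_iii D (as, ts) \<mu> ! 0)"
    "i < length as \<Longrightarrow> kind2 (tilde_iii D (as, ts) \<mu> ! i) \<Longrightarrow> i = 0"
    "\<not> has1 (tilde_iii D (as, ts) \<mu>)" "has2 (tilde_iii D (as, ts) \<mu>)"
    "kind3 (tilde_iii D (as, ts) \<mu> ! 1)"
proof -
  note h = hshape_iiiD[OF s]
  note nth = nth_tilde_iii[OF h(2), of _ ts \<mu>] and len = length_tilde_iii[OF h(2), of ts \<mu>]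
  have l: "0 < length as" "2 < length as" using l3 by simp_all
  show k0: "kind2 (tilde_iii D (as, ts) \<mu> ! 0)" using l kinds_tilde(2)[OF h(6)] by (simp add: nth)
  show "kind3 (tilde_iii D (as, ts) \<mu> ! 1)" using h(2) kinds_tilde(3)[OF h(7)] by (simp add: nth)
  have k: "kind3 (tilde_iii D (as, ts) \<mu> ! i) \<or> kind4 (tilde_iii D (as, ts) \<mu> ! i)" if "i < length as" "i \<noteq> 0" for i
    using that kinds_tilde(3)[OF h(7)] kinds_tilde(4)[OF h(8)[of i]] by (simp add: nth)
  then show "i = 0" if "i < length as" "kind2 (tilde_iii D (as, ts) \<mu> ! i)"
    using that kinds_disjoint by blast
  have "\<not> kind1 (tilde_iii D (as, ts) \<mu> ! i)" if "i < length as" for i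
    using k[OF that] k0 kinds_disjoint by (cases "i = 0") blast+
  then show "\<not> has1 (tilde_iii D (as, ts) \<mu>)"
    unfolding has1_def by (metis in_set_conv_nth len)
  have "tilde_iii D (as, ts) \<mu> ! 0 \<in> set (tilde_iii D (as, ts) \<mu>)"
    using l by (simp add: len)
  then show "has2 (tilde_iii D (as, ts) \<mu>)" unfolding has2_def using k0 by blast
qed

lemma kinds_iv:
  assumes s: "hshape_iv D (as, ts)"
  shows "x \<in> set (tilde_iv D (as, ts) \<mu>) \<Longrightarrow> kind4 x" "\<not> has1 (tilde_iv D (as, ts) \<mu>)" "\<not> has2 (tilde_iv D (as, ts) \<mu>)"
proof -
  show k: "kind4 x" if x: "x \<in> set (tilde_iv D (as, ts) \<mu>)" for x
  proof -
    obtain i where "i < length as" "x = tilde_iv D (as, ts) \<mu> ! i"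
      using x unfolding in_set_conv_nth length_tilde_iv by blast
    then show ?thesis using kinds_tilde(4)[OF hshape_ivD(3)[OF s]] by (simp add: nth_tilde_iv)
  qed
  show "\<not> has1 (tilde_iv D (as, ts) \<mu>)" "\<not> has2 (tilde_iv D (as, ts) \<mu>)"
    unfolding has1_def has2_def using k kinds_disjoint by blast+
qed

subsection \<open>Shapes in the same orbit\<close>

text \<open>Normal form of an arrow with non-fixed target: it is translated until the target is a
  representative. Applied letterwise, it recovers \<open>as\<close> from any translate of its
  \<open>hword\<close>, whatever the exponents are.\<close>

definition red :: "'a \<Rightarrow> 'a" where
  "red \<beta> = (THE \<alpha>. \<alpha> \<in> arcs Q \<and> head Q \<alpha> \<in> Fr \<and> (\<exists>t. \<beta> = ga D t \<alpha>))"

lemma red_ga: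
  assumes "\<alpha> \<in> arcs Q" and "head Q \<alpha> \<in> Fr"
  shows "red (ga D t \<alpha>) = \<alpha>"
  unfolding red_def
proof (rule the_equality)
  fix \<beta> assume "\<beta> \<in> arcs Q \<and> head Q \<beta> \<in> Fr \<and> (\<exists>s. ga D t \<alpha> = ga D s \<beta>)"
  then obtain s where b: "\<beta> \<in> arcs Q" "head Q \<beta> \<in> Fr" "ga D t \<alpha> = ga D s \<beta>" by blast
  then have "gv D t (head Q \<alpha>) = gv D s (head Q \<beta>)"
    using assms(1) by (metis head_ga)
  from free_unique[OF assms(2) b(2) this] have "ga D t = ga D s" by (intro ga_cong) simp
  then show "\<beta> = \<alpha>" using b(3) ga_inj[OF assms(1) b(1), of s] by simp
qed (use assms in blast)

lemma in_hword_orbit: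
  assumes "set as \<subseteq> arcs Q" and "c \<in> cyc_orbit D (hword D (as, ts))"
  obtains t where "c \<in> cyc_class (map (ga D t) (hword D (as, ts)))"
  using assms in_cyc_orbit_iff[OF set_hword] by blast

lemma orbit_i:
  assumes s: "hshape_i D (as, ts)" and s': "hshape_i D (as', ts')"
    and orb: "hword D (as', ts') \<in> cyc_orbit D (hword D (as, ts))"
  shows "as' \<in> cyc_class as"
proof -
  note h = hshape_iD[OF s] and h' = hshape_iD[OF s']
  obtain t where t: "hword D (as', ts') \<in> cyc_class (map (ga D t) (hword D (as, ts)))"
    using in_hword_orbit[OF hshapeD(3)[OF h(1)] orb] .
  have "map red (hword D (as', ts')) = as'"
    by (rule nth_equalityI) (simp_all add: hword_nth red_ga hshapeD(4)[OF h'(1)] h'(2))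
  moreover have "map red (map (ga D t) (hword D (as, ts))) = as"
    by (rule nth_equalityI) (simp_all add: hword_nth red_ga ga_add hshapeD(4)[OF h(1)] h(2))
  ultimately show ?thesis using map_in_cyc_class[OF t, of red] by simp
qed

text \<open>The orbits of free representatives are free and contain one representative each, so only
  the neutral element can keep the target among the representatives.\<close>

lemma free_rotation_zero:
  assumes "\<alpha> \<in> arcs Q" "head Q \<alpha> \<in> Fr" "head Q (ga D t \<alpha>) \<in> Fr"
  shows "ga D t = ga D 0"
proof -
  have "gv D 0 (head Q (ga D t \<alpha>)) = gv D t (head Q \<alpha>)" using assms(1) by (simp add: head_ga)
  from free_unique[OF assms(3,2) this] show ?thesis by (intro ga_cong) simp
qed

text \<open>The only fixed vertex, at position 1, aligns the two words without rotation, and the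
  free target at position 0 excludes a translation. The letters are then compared in normal form,
  and \<open>t_2\<close> is read off from the tail of the second arrow.\<close>

lemma orbit_ii:
  assumes s: "hshape_ii D (as, ts)" and s': "hshape_ii D (as', ts')"
    and orb: "hword D (as', ts') \<in> cyc_orbit D (hword D (as, ts))"
  shows "as' = as" "ts' ! 1 mod n = ts ! 1 mod n"
proof -
  note h = hshape_iiD[OF s] and h' = hshape_iiD[OF s']
  note a = hshapeD[OF h(1)] and a' = hshapeD[OF h'(1)]
  obtain t where t: "hword D (as', ts') \<in> cyc_class (map (ga D t) (hword D (as, ts)))"
    using in_hword_orbit[OF a(3) orb] .
  have len: "length as' = length as" using cyc_class_length[OF t] by simp
  have l0: "0 < length as" using h(2) by simp
  have eq: "hword D (as', ts') = map (ga D t) (hword D (as, ts))"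
    using t
  proof (rule cyc_class_unique_position[where k = 1 and P = "\<lambda>\<beta>. head Q \<beta> \<in> Fx"])
    show "1 < length (map (ga D t) (hword D (as, ts)))" using h(2) by simp
    show "head Q (hword D (as', ts') ! 1) \<in> Fx"
      using h'(2,5) a'(4)[OF h'(2)] by (simp add: hword_nth ga_ends_fix)
    show "i = 1" if "i < length (map (ga D t) (hword D (as, ts)))"
      "head Q (map (ga D t) (hword D (as, ts)) ! i) \<in> Fx" for i
    proof -
      have i: "i < length as" using that(1) by simp
      have "head Q (as ! i) \<in> Fx"
        using that(2) i a(4)[OF i] by (simp add: hword_nth ga_ends_fix ga_in)
      then show ?thesis using h(4)[OF i] free_fix_disjoint by blast
    qed
  qed
  have nth: "ga D (\<Sum>j<i. ts' ! j) (as' ! i) = ga D t (ga D (\<Sum>j<i. ts ! j) (as ! i))" if "i < length as" for i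
    using arg_cong[OF eq, of "\<lambda>l. l ! i"] that len by (simp add: hword_nth)
  have 0: "as' ! 0 = ga D t (as ! 0)" using nth[OF l0] by simp
  have "head Q (as ! 0) \<in> Fr" "head Q (ga D t (as ! 0)) \<in> Fr"
    using h(4)[OF l0] h'(4)[of 0] 0 l0 len by simp_all
  then have t0: "ga D t = ga D 0" using free_rotation_zero[OF a(4)[OF l0]] by blast
  show as: "as' = as"
  proof (rule nth_equalityI[OF len])
    fix i assume "i < length as'"
    then have i: "i < length as" using len by simp
    show "as' ! i = as ! i"
    proof (cases "i = 1")
      case True
      then show ?thesis using nth[OF i] t0 h(3) h'(3) by simp
    next
      case False
      have "red (ga D (\<Sum>j<i. ts' ! j) (as' ! i)) = red (ga D (\<Sum>j<i. ts ! j) (as ! i))"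
        using nth[OF i] t0 by simp
      then show ?thesis
        using red_ga[OF a(4)[OF i] h(4)[OF i False]] red_ga[OF a'(4) h'(4)[OF _ False]] i len by simp
    qed
  qed
  have j: "Suc 1 mod length as \<noteq> 1" using h(2) by (cases "length as = 2") simp_all
  note f = h(4)[OF a(6)[OF h(2)] j]
  have "gv D (ts' ! 1) (head Q (as ! (Suc 1 mod length as))) = gv D (ts ! 1) (head Q (as ! (Suc 1 mod length as)))"
    using a(5)[OF h(2)] a'(5)[OF h'(2)] as by simp
  from free_unique[OF f f this] show "ts' ! 1 mod n = ts ! 1 mod n" by simp
qed

text \<open>The argument of \<open>orbit_ii\<close> with the roles reversed: the only non-fixed
  vertex excludes both rotation and translation.\<close>

lemma orbit_iii:
  assumes s: "hshape_iii D (as, ts)" and s': "hshape_iii D (as', ts')" and orb: "as' \<in> cyc_orbit D as"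
  shows "as' = as"
proof -
  note h = hshape_iiiD[OF s] and h' = hshape_iiiD[OF s']
  note a = hshapeD[OF h(1)] and a' = hshapeD[OF h'(1)]
  obtain t where t: "as' \<in> cyc_class (map (ga D t) as)"
    using orb in_cyc_orbit_iff[OF a(3)] by blast
  have eq: "as' = map (ga D t) as"
    using t
  proof (rule cyc_class_unique_position[where k = 1 and P = "\<lambda>\<beta>. head Q \<beta> \<notin> Fx"])
    show "1 < length (map (ga D t) as)" using h(2) by simp
    show "head Q (as' ! 1) \<notin> Fx" using free_fix_disjoint[OF h'(4)] .
    show "i = 1" if "i < length (map (ga D t) as)" "head Q (map (ga D t) as ! i) \<notin> Fx" for i
    proof (rule ccontr)
      assume "i \<noteq> 1"
      have i: "i < length as" using that(1) by simp
      then show False using h(5)[OF i \<open>i \<noteq> 1\<close>] that(2) a(4)[OF i] by (simp add: ga_ends_fix)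
    qed
  qed
  have "as' ! 1 = ga D t (as ! 1)" using eq h(2) by simp
  then have "ga D t = ga D 0" using free_rotation_zero[OF a(4)[OF h(2)] h(4)] h'(4) by simp
  then show ?thesis using eq by (simp only: map_ga_0)
qed

lemma orbit_iv:
  assumes "set as \<subseteq> arrows4 D" and "as' \<in> cyc_orbit D as"
  shows "as' \<in> cyc_class as"
proof -
  have "set as \<subseteq> arcs Q" using assms(1) arrows_in_arcs(4) by blast
  then obtain t where t: "as' \<in> cyc_class (map (ga D t) as)"
    using assms(2) in_cyc_orbit_iff by blast
  have "map (ga D t) as = as"
    by (rule map_idI) (use assms(1) ga_fix in blast)
  then show ?thesis using t by simp
qed

subsection \<open>Rotations of the cycles of \<open>Q\<^sub>G\<close>\<close>

text \<open>The word \<open>hword\<close> of a type (i) shape started at \<open>g^s\<close>, with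
  the stored exponents replaced by the intrinsic ones \<open>t_exp\<close>. The recursive form makes
  rotations tractable.\<close>

primrec lift :: "int \<Rightarrow> 'a list \<Rightarrow> 'a list" where
  "lift s [] = []"
| "lift s (\<alpha> # as) = ga D s \<alpha> # lift (s + t_exp D \<alpha>) as"

lemma lift_append: "lift s (as @ bs) = lift s as @ lift (s + sum_list (map (t_exp D) as)) bs"
  by (induction as arbitrary: s) (simp_all add: add.assoc)

lemma map_ga_lift: "set as \<subseteq> arcs Q \<Longrightarrow> map (ga D t) (lift s as) = lift (t + s) as"
  by (induction as arbitrary: s) (simp_all add: ga_add add.assoc)

lemma length_lift [simp]: "length (lift s as) = length as"
  by (induction as arbitrary: s) simp_all

lemma set_lift: "set as \<subseteq> arcs Q \<Longrightarrow> set (lift s as) \<subseteq> arcs Q"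
  by (induction as arbitrary: s) (simp_all add: ga_in)

lemma lift_nth: "i < length as \<Longrightarrow> lift s as ! i = ga D (s + (\<Sum>j<i. t_exp D (as ! j))) (as ! i)"
proof (induction as arbitrary: s i)
  case (Cons \<alpha> as)
  show ?case
  proof (cases i)
    case (Suc k)
    have "(\<Sum>j<Suc k. t_exp D ((\<alpha> # as) ! j)) = t_exp D \<alpha> + (\<Sum>j<k. t_exp D (as ! j))"
      by (subst sum.lessThan_Suc_shift) simp
    then show ?thesis using Cons.IH[of k "s + t_exp D \<alpha>"] Cons.prems Suc by (simp add: add.assoc)
  qed simp
qed simp

text \<open>Moving the leading arrow to the end translates the whole word by minus its exponent. The
  moved letter fits at the end because the remaining exponents add up to minus that exponent modulo
  \<open>n\<close>.\<close>

lemma lift_rotate: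
  assumes "set as \<subseteq> arcs Q" and "n dvd sum_list (map (t_exp D) as)"
  shows "\<exists>t. lift 0 (rotate m as) \<in> cyc_class (map (ga D t) (lift 0 as))"
proof (induction m)
  case 0
  then show ?case by (intro exI[of _ 0]) (simp add: map_ga_0)
next
  case (Suc m)
  then obtain t where t: "lift 0 (rotate m as) \<in> cyc_class (map (ga D t) (lift 0 as))" by blast
  show ?case
  proof (cases "rotate m as")
    case Nil
    then show ?thesis by (intro exI[of _ 0]) simp
  next
    case (Cons \<alpha> bs)
    have set: "set (\<alpha> # bs) \<subseteq> arcs Q" using assms(1) arg_cong[OF Cons, of set] by simp
    have "sum_list (map (t_exp D) (\<alpha> # bs)) = sum_list (map (t_exp D) as)"
      using sum_list_cyc_class[OF cyc_class_rotate, of "t_exp D" m as] Cons by simp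
    then have "n dvd sum_list (map (t_exp D) bs) - (- t_exp D \<alpha>)" using assms(2) by (simp add: add.commute)
    then have e: "ga D (sum_list (map (t_exp D) bs)) = ga D (- t_exp D \<alpha>)"
      by (intro ga_cong) (simp add: mod_eq_dvd_iff)
    have "lift 0 (rotate (Suc m) as) = lift 0 bs @ [ga D (- t_exp D \<alpha>) \<alpha>]"
      using Cons by (simp add: lift_append e)
    also have "\<dots> = rotate1 (map (ga D (- t_exp D \<alpha>)) (lift 0 (\<alpha> # bs)))"
      using set map_ga_lift[of bs "- t_exp D \<alpha>" "t_exp D \<alpha>"] by simp
    also have "\<dots> \<in> cyc_class (map (ga D (- t_exp D \<alpha>)) (lift 0 (\<alpha> # bs)))"
      by (rule rotate1_in_cyc_class)
    finally have 1: "lift 0 (rotate (Suc m) as) \<in> cyc_class (map (ga D (- t_exp D \<alpha>)) (lift 0 (rotate m as)))"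
      unfolding Cons .
    have "map (ga D (- t_exp D \<alpha>)) (lift 0 (rotate m as)) \<in> cyc_class (map (ga D (- t_exp D \<alpha> + t)) (lift 0 as))"
      using map_in_cyc_class[OF t, of "ga D (- t_exp D \<alpha>)"]
      by (simp only: map_ga_add[OF set_lift[OF assms(1)]])
    then show ?thesis using cyc_class_trans[OF _ 1] by blast
  qed
qed

lemma hword_lift:
  assumes s: "hshape_i D (as, ts)"
  shows "hword D (as, ts) = lift 0 as" "n dvd sum_list ts \<longleftrightarrow> n dvd sum_list (map (t_exp D) as)"
proof -
  note h = hshape_iD[OF s] and a = hshapeD[OF hshape_iD(1)[OF s]]
  have "hword D (as, ts) = hword D (as, map (t_exp D) as)"
    using h(4) a(2) by (intro hword_cong) simp_all
  also have "\<dots> = lift 0 as"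
    by (rule nth_equalityI) (simp_all add: hword_nth lift_nth)
  finally show "hword D (as, ts) = lift 0 as" .
  have "(\<Sum>j<length as. t_exp D (as ! j)) mod n = (\<Sum>j<length as. ts ! j mod n) mod n"
    using h(4) by (intro arg_cong[where f = "\<lambda>x. x mod n"] sum.cong) simp_all
  also have "\<dots> = (\<Sum>j<length as. ts ! j) mod n" by (rule mod_sum_eq)
  finally have "sum_list (map (t_exp D) as) mod n = sum_list ts mod n"
    using sum_list_nth[of ts "length as"] sum_list_nth[of "map (t_exp D) as" "length as"] a(2) by simp
  then show "n dvd sum_list ts \<longleftrightarrow> n dvd sum_list (map (t_exp D) as)"
    by (simp add: dvd_eq_mod_eq_0)
qed

text \<open>\<open>tilde1\<close> forgets the accumulated translations, so equality up to rotation
  above gives \<open>as'\<close> as a rotation of \<open>as\<close>; \<open>lift_rotate\<close>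
  converts this into a common orbit below.\<close>

lemma rotation_i:
  assumes s: "hshape_i D (as, ts)" and s': "hshape_i D (as', ts')" and sum: "n dvd sum_list ts"
    and rot: "tilde_i D (as', ts') \<in> cyc_class (tilde_i D (as, ts))"
  shows "\<exists>t. hword D (as', ts') \<in> cyc_class (map (ga D t) (hword D (as, ts)))"
proof -
  note h = hshape_iD[OF s] and h' = hshape_iD[OF s']
  have inj: "inj_on (tilde1 D) (arrows1 D)" using tilde_injs(1) by (intro inj_onI) blast
  have "set as \<subseteq> arrows1 D" "set as' \<subseteq> arrows1 D"
    using h(3) h'(3) by (auto simp: in_set_conv_nth)
  then have "as' \<in> cyc_class as"
    using rot map_in_cyc_class_iff[OF inj, of as as'] unfolding tilde_i_def by simp
  then obtain m where m: "as' = rotate m as" unfolding cyc_class_def by blast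
  have "hword D (as', ts') = lift 0 (rotate m as)" using hword_lift(1)[OF s'] m by simp
  then show ?thesis
    unfolding hword_lift(1)[OF s]
    using lift_rotate[OF hshapeD(3)[OF h(1)], of m] sum hword_lift(2)[OF s] by simp
qed

text \<open>The anchor aligns the words and shows the index. The exponent \<open>t_2\<close> is
  hidden, because the word contains only the arrow already moved back; it is recovered from the
  divisibility of both sums.\<close>

lemma rotation_ii:
  assumes s: "hshape_ii D (as, ts)" and s': "hshape_ii D (as', ts')"
    and sum: "n dvd sum_list ts" "n dvd sum_list ts'" and l3: "3 \<le> length as" "3 \<le> length as'"
    and rot: "tilde_ii D (as', ts') \<mu>' \<in> cyc_class (tilde_ii D (as, ts) \<mu>)"
  shows "as' = as" "\<mu>' mod n = \<mu> mod n" "hword D (as', ts') = hword D (as, ts)" "ts' ! 1 mod n = ts ! 1 mod n"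
proof -
  note h = hshape_iiD[OF s] and h' = hshape_iiD[OF s']
  note a = hshapeD[OF h(1)] and a' = hshapeD[OF h'(1)]
  have len: "length as' = length as"
    using cyc_class_length[OF rot] by (simp add: length_tilde_ii h(2) h'(2))
  have l0: "0 < length as" using h(2) by simp
  have eq: "tilde_ii D (as', ts') \<mu>' = tilde_ii D (as, ts) \<mu>"
    using rot
  proof (rule cyc_class_unique_position[where k = 0 and P = kind3])
    show "0 < length (tilde_ii D (as, ts) \<mu>)" using l0 h(2) by (simp add: length_tilde_ii)
    show "kind3 (tilde_ii D (as', ts') \<mu>' ! 0)" using kinds_ii(1)[OF s' l3(2)] .
    show "\<And>i. i < length (tilde_ii D (as, ts) \<mu>) \<Longrightarrow> kind3 (tilde_ii D (as, ts) \<mu> ! i) \<Longrightarrow> i = 0"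
      using kinds_ii(2)[OF s l3(1)] by (simp add: length_tilde_ii h(2))
  qed
  have nth: "tilde_ii D (as', ts') \<mu>' ! i = tilde_ii D (as, ts) \<mu> ! i" for i
    unfolding eq ..
  have 0: "as' ! 0 = as ! 0" "\<mu>' mod n = \<mu> mod n"
    using nth[of 0] l0 len tilde_injs(3)[OF h'(6) h(6)] by (simp_all add: nth_tilde_ii)
  show "\<mu>' mod n = \<mu> mod n" by (rule 0)
  have 1: "ga D (- (ts' ! 1)) (as' ! 1) = ga D (- (ts ! 1)) (as ! 1)"
    using nth[of 1] h(2) len tilde_injs(2)[OF h'(7) h(7)] by (simp add: nth_tilde_ii)
  have 2: "as' ! i = as ! i" if "1 < i" "i < length as" for i
    using nth[of i] that len tilde_injs(1)[OF h'(8)[of i] h(8)[of i]] by (simp add: nth_tilde_ii)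
  have ts: "n dvd ts' ! i - ts ! i" if "i \<noteq> 1" "i < length as" for i
  proof (cases "i = 0")
    case True
    then show ?thesis using h(3) h'(3) by simp
  next
    case False
    then have i: "1 < i" using that(1) by simp
    have "ts' ! i mod n = ts ! i mod n"
      using h(9)[OF i that(2)] h'(9)[OF i] 2[OF i that(2)] that(2) len by simp
    then show ?thesis by (simp add: mod_eq_dvd_iff)
  qed
  have "(\<Sum>i<length as. ts' ! i - ts ! i) = sum_list ts' - sum_list ts"
    using sum_list_nth[of ts "length as"] sum_list_nth[of ts' "length as"] a(2) a'(2) len
    by (simp add: sum_subtractf)
  then have "n dvd (\<Sum>i<length as. ts' ! i - ts ! i)" using sum by simp
  moreover have "(\<Sum>i<length as. ts' ! i - ts ! i) = (ts' ! 1 - ts ! 1) + (\<Sum>i\<in>{..<length as} - {1}. ts' ! i - ts ! i)"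
    using h(2) by (intro sum.remove) simp_all
  moreover have "n dvd (\<Sum>i\<in>{..<length as} - {1}. ts' ! i - ts ! i)"
    by (rule dvd_sum) (use ts in simp)
  \<comment> \<open>All exponents except the second one agree modulo \<open>n\<close>, and both
    totals are multiples of \<open>n\<close>; this pins down the second one.\<close>
  ultimately have d1: "n dvd ts' ! 1 - ts ! 1" by (simp add: dvd_add_left_iff)
  then show t1: "ts' ! 1 mod n = ts ! 1 mod n" by (simp add: mod_eq_dvd_iff)
  have "(- (ts' ! 1)) mod n = (- (ts ! 1)) mod n" using t1 by (rule mod_minus_cong)
  then have "as' ! 1 = as ! 1"
    using 1 ga_cong ga_inj[OF a'(4)[OF h'(2)] a(4)[OF h(2)]] by metis
  then show as: "as' = as"
    using 0(1) 2 by (intro nth_equalityI[OF len]) (metis len linorder_neqE_nat less_one)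
  have "ts' ! i mod n = ts ! i mod n" if "i < length as" for i
    using ts[OF _ that] t1 by (cases "i = 1") (simp_all add: mod_eq_dvd_iff)
  then show "hword D (as', ts') = hword D (as, ts)"
    unfolding as using a(2) a'(2) as by (intro hword_cong) simp_all
qed

lemma rotation_iii:
  assumes s: "hshape_iii D (as, ts)" and s': "hshape_iii D (as', ts')"
    and l3: "3 \<le> length as" "3 \<le> length as'"
    and rot: "tilde_iii D (as', ts') \<mu>' \<in> cyc_class (tilde_iii D (as, ts) \<mu>)"
  shows "as' = as" "\<mu>' mod n = \<mu> mod n"
proof -
  note h = hshape_iiiD[OF s] and h' = hshape_iiiD[OF s']
  note nth = nth_tilde_iii[OF h(2)] and nth' = nth_tilde_iii[OF h'(2)]
  have len: "length as' = length as"
    using cyc_class_length[OF rot] by (simp add: length_tilde_iii h(2) h'(2))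
  have l0: "0 < length as" using h(2) by simp
  have eq: "tilde_iii D (as', ts') \<mu>' = tilde_iii D (as, ts) \<mu>"
    using rot
  proof (rule cyc_class_unique_position[where k = 0 and P = kind2])
    show "0 < length (tilde_iii D (as, ts) \<mu>)" using l0 h(2) by (simp add: length_tilde_iii)
    show "kind2 (tilde_iii D (as', ts') \<mu>' ! 0)" using kinds_iii(1)[OF s' l3(2)] .
    show "\<And>i. i < length (tilde_iii D (as, ts) \<mu>) \<Longrightarrow> kind2 (tilde_iii D (as, ts) \<mu> ! i) \<Longrightarrow> i = 0"
      using kinds_iii(2)[OF s l3(1)] by (simp add: length_tilde_iii h(2))
  qed
  have e: "tilde_iii D (as', ts') \<mu>' ! i = tilde_iii D (as, ts) \<mu> ! i" for i
    unfolding eq ..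
  have 0: "as' ! 0 = as ! 0" "\<mu>' mod n = \<mu> mod n"
    using e[of 0] l0 len tilde_injs(2)[OF h'(6) h(6)] by (simp_all add: nth nth')
  show "\<mu>' mod n = \<mu> mod n" by (rule 0)
  show "as' = as"
  proof (rule nth_equalityI[OF len])
    fix i assume "i < length as'"
    then have i: "i < length as" "i < length as'" using len by simp_all
    consider "i = 0" | "i = 1" | "1 < i" by linarith
    then show "as' ! i = as ! i"
    proof cases
      case 1
      then show ?thesis using 0 by simp
    next
      case 2
      then show ?thesis
        using e[of 1] h(2) h'(2) tilde_injs(3)[OF h'(7) h(7)] by (simp add: nth nth')
    next
      case 3
      then show ?thesis
        using e[of i] i tilde_injs(4)[OF h'(8)[OF 3 i(2)] h(8)[OF 3 i(1)]] by (simp add: nth nth')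
    qed
  qed
qed

definition "under4 x = (THE \<alpha>. \<alpha> \<in> arrows4 D \<and> (\<exists>\<mu>. x = tilde4 D \<alpha> \<mu>))"

lemma under4: "\<alpha> \<in> arrows4 D \<Longrightarrow> under4 (tilde4 D \<alpha> \<mu>) = \<alpha>"
  unfolding under4_def by (rule the_equality) (use tilde_injs(4) in blast)+

lemma map_under4: "hshape_iv D (as, ts) \<Longrightarrow> map under4 (tilde_iv D (as, ts) \<mu>) = as"
  by (rule nth_equalityI) (simp_all add: nth_tilde_iv under4 hshape_ivD(3))

lemma rotation_iv:
  assumes s: "hshape_iv D (as, ts)" and s': "hshape_iv D (as', ts')"
    and rot: "tilde_iv D (as', ts') \<mu>' \<in> cyc_class (tilde_iv D (as, ts) \<mu>)"
  shows "as' \<in> cyc_class as"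
  using map_in_cyc_class[OF rot, of under4] by (simp add: map_under4[OF s] map_under4[OF s'])

text \<open>\<open>tilde_iv\<close> gives its arrows the indices \<open>\<mu> - b_{i+1}\<close>,
  sums over the arrows that follow. When the total of \<open>b\<close> is a multiple of
  \<open>n\<close> these are the running sums
  \<open>\<mu> + b(\<alpha>_1) + ... + b(\<alpha>_i)\<close>, which can be built
  recursively.\<close>

primrec lift4 :: "int \<Rightarrow> 'a list \<Rightarrow> ('v, 'a, 'k) skew list" where
  "lift4 s [] = []"
| "lift4 s (\<alpha> # as) = tilde4 D \<alpha> (s + b_exp D \<alpha>) # lift4 (s + b_exp D \<alpha>) as"

lemma lift4_append: "lift4 s (as @ bs) = lift4 s as @ lift4 (s + sum_list (map (b_exp D) as)) bs"
  by (induction as arbitrary: s) (simp_all add: add.assoc)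

lemma length_lift4 [simp]: "length (lift4 s as) = length as"
  by (induction as arbitrary: s) simp_all

lemma lift4_cong: "s mod n = s' mod n \<Longrightarrow> lift4 s as = lift4 s' as"
proof (induction as arbitrary: s s')
  case (Cons \<alpha> as)
  have e: "(s + b_exp D \<alpha>) mod n = (s' + b_exp D \<alpha>) mod n"
    using Cons.prems by (rule mod_add_cong) simp
  from Cons.IH[OF e] show ?case using tilde_cong(3)[OF e] by simp
qed simp

lemma lift4_nth: "i < length as \<Longrightarrow> lift4 s as ! i = tilde4 D (as ! i) (s + (\<Sum>j<Suc i. b_exp D (as ! j)))"
proof (induction as arbitrary: s i)
  case (Cons \<alpha> as)
  have e: "(\<Sum>j<Suc i. b_exp D ((\<alpha> # as) ! j)) = b_exp D \<alpha> + (\<Sum>j<i. b_exp D (as ! j))"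
    by (subst sum.lessThan_Suc_shift) simp
  show ?case
  proof (cases i)
    case (Suc k)
    then show ?thesis using Cons.IH[of k "s + b_exp D \<alpha>"] Cons.prems e by (simp add: add.assoc del: sum.lessThan_Suc)
  qed simp
qed simp

lemma b_sum_prefix: "i \<le> length as \<Longrightarrow> (\<Sum>j<i. b_exp D (as ! j)) + b_sum D as (Suc i) = sum_list (map (b_exp D) as)"
proof (induction i)
  case 0
  then show ?case using b_sum_1[of as] by (simp add: One_nat_def)
next
  case (Suc i)
  then show ?case using b_sum_step[of "Suc i" as] by simp
qed

lemma tilde_iv_lift4:
  assumes "n dvd sum_list (map (b_exp D) as)"
  shows "tilde_iv D (as, ts) \<mu> = lift4 \<mu> as"
proof (rule nth_equalityI)
  fix i assume "i < length (tilde_iv D (as, ts) \<mu>)"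
  then have i: "i < length as" by simp
  have "(\<Sum>j<Suc i. b_exp D (as ! j)) + b_sum D as (i + 2) = sum_list (map (b_exp D) as)"
    using b_sum_prefix[of "Suc i" as] i by simp
  then have "n dvd (\<Sum>j<Suc i. b_exp D (as ! j)) + b_sum D as (i + 2)" using assms by simp
  moreover have "(\<Sum>j<Suc i. b_exp D (as ! j)) + b_sum D as (i + 2) =
      (\<mu> + (\<Sum>j<Suc i. b_exp D (as ! j))) - (\<mu> - b_sum D as (i + 2))" by simp
  ultimately have "(\<mu> + (\<Sum>j<Suc i. b_exp D (as ! j))) mod n = (\<mu> - b_sum D as (i + 2)) mod n"
    by (simp only: mod_eq_dvd_iff)
  then show "tilde_iv D (as, ts) \<mu> ! i = lift4 \<mu> as ! i"
    unfolding lift4_nth[OF i] nth_tilde_iv[OF i] by (rule tilde_cong(3)[symmetric])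
qed simp

text \<open>A rotation of \<open>as\<close> shifts the index by an amount independent of
  \<open>s\<close>: each moved arrow takes its \<open>b\<close> along. Summing over all indices
  therefore does not see the rotation.\<close>

lemma lift4_rotate:
  assumes "n dvd sum_list (map (b_exp D) as)"
  shows "\<exists>k. \<forall>s. lift4 s (rotate m as) \<in> cyc_class (lift4 (s + k) as)"
proof (induction m)
  case 0
  then show ?case by (intro exI[of _ 0]) simp
next
  case (Suc m)
  then obtain k where k: "\<And>s. lift4 s (rotate m as) \<in> cyc_class (lift4 (s + k) as)" by blast
  show ?case
  proof (cases "rotate m as")
    case Nil
    then show ?thesis by simp
  next
    case (Cons \<alpha> bs)
    have "sum_list (map (b_exp D) (\<alpha> # bs)) = sum_list (map (b_exp D) as)"
      using sum_list_cyc_class[OF cyc_class_rotate, of "b_exp D" m as] Cons by simp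
    then have n: "n dvd sum_list (map (b_exp D) bs) + b_exp D \<alpha>" using assms by (simp add: add.commute)
    have "lift4 s (rotate (Suc m) as) \<in> cyc_class (lift4 (s + (k - b_exp D \<alpha>)) as)" for s
    proof -
      have "n dvd (s + sum_list (map (b_exp D) bs) + b_exp D \<alpha>) - s" using n by (simp add: algebra_simps)
      then have "(s + sum_list (map (b_exp D) bs) + b_exp D \<alpha>) mod n = s mod n" by (simp only: mod_eq_dvd_iff)
      from tilde_cong(3)[OF this, of \<alpha>]
      have "lift4 s (rotate (Suc m) as) = rotate1 (lift4 (s - b_exp D \<alpha>) (\<alpha> # bs))"
        using Cons by (simp add: lift4_append)
      also have "\<dots> \<in> cyc_class (lift4 (s - b_exp D \<alpha>) (rotate m as))"
        unfolding Cons by (rule rotate1_in_cyc_class)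
      finally show ?thesis
        using cyc_class_trans[OF k[of "s - b_exp D \<alpha>"]] by (simp add: algebra_simps)
    qed
    then show ?thesis by blast
  qed
qed

end


section \<open>The coefficients of \<open>W\<^sub>G\<close>\<close>

text \<open>The choice is separated from the datum so that all results can be instantiated a second
  time, with the dual datum and \<open>hat'\<close>.\<close>

locale cyclic_datum_hat = cyclic_datum D for D :: "('v, 'a, 'k::field) qp_datum" +
  fixes hat :: "'a list \<Rightarrow> 'a list \<times> int list"
  assumes hat: "hat_choice D hat"
begin

abbreviation "wt \<equiv> cyc_coeff (pot D)"

lemma cycle_closed: "c \<in> cycles_of (pot D) \<Longrightarrow> closed_word Q c \<and> 3 \<le> length c"
proof -
  assume "c \<in> cycles_of (pot D)"
  then have c: "(head Q (hd c), c, head Q (hd c)) \<in> paths Q" "3 \<le> length c"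
    using cycle_pot by (simp_all add: cycles_of_def)
  then have "c \<noteq> []" by auto
  then show ?thesis using c closed_word_path[OF wf_quiv] by blast
qed

lemma cycles_x_of:
  "cycles_i D \<subseteq> cycles_of (pot D)" "cycles_ii D \<subseteq> cycles_of (pot D)"
  "cycles_iii D \<subseteq> cycles_of (pot D)" "cycles_iv D \<subseteq> cycles_of (pot D)"
  by (auto simp: cycles_i_def cycles_ii_def cycles_iii_def cycles_iv_def)

lemma finite_cycles: "finite (cycles_i D)" "finite (cycles_ii D)" "finite (cycles_iii D)" "finite (cycles_iv D)"
  using cycles_x_of[THEN finite_subset, OF finite_cycles_of[OF finite_pot]] by simp_all

lemma hat_orbit:
  assumes "c \<in> cycles_of (pot D)"
  obtains t where "hword D (hat c) \<in> cyc_class (map (ga D t) c)"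
    "closed_word Q (hword D (hat c))" "3 \<le> length (hword D (hat c))"
proof -
  have c: "closed_word Q c" "3 \<le> length c" using cycle_closed[OF assms] by simp_all
  have "hword D (hat c) \<in> cyc_orbit D c" using hat assms unfolding hat_choice_def by blast
  then obtain t where t: "hword D (hat c) \<in> cyc_class (map (ga D t) c)"
    using in_cyc_orbit_iff c(1) unfolding closed_word_def by blast
  moreover have "closed_word Q (hword D (hat c))"
    using closed_word_cyc_class[OF t closed_word_ga[OF c(1)]] .
  moreover have "3 \<le> length (hword D (hat c))" using cyc_class_length[OF t] c(2) by simp
  ultimately show thesis using that by blast
qed

lemma hat_i:
  assumes "h \<in> hat ` cycles_i D"
  obtains as ts where "h = (as, ts)" "hshape_i D (as, ts)" "n dvd sum_list ts" "3 \<le> length as"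
proof -
  obtain c where c: "c \<in> cycles_i D" "h = hat c" using assms by blast
  obtain as ts where h: "h = (as, ts)" by (cases h)
  have cc: "c \<in> cycles_of (pot D)" using c(1) cycles_x_of by blast
  have "hshape_i D (hat c)" using c(1) hat cc unfolding hat_choice_def by blast
  then have s: "hshape_i D (as, ts)" using c(2) h by simp
  have "closed_word Q (hword D (hat c))" "3 \<le> length (hword D (hat c))"
    using hat_orbit[OF cc] by blast+
  moreover have hc: "hat c = (as, ts)" using c(2) h by simp
  ultimately have w: "closed_word Q (hword D (as, ts))" "3 \<le> length as" by (simp_all add: hc)
  have "0 < length as" using w(2) by linarith
  then have sum: "n dvd sum_list ts" using shape_closed_sum[OF hshape_iD(1)[OF s] w(1) hshape_iD(2)[OF s]] by blast
  show thesis using that[OF h s sum w(2)] .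
qed

lemma hat_ii:
  assumes "h \<in> hat ` cycles_ii D"
  obtains as ts where "h = (as, ts)" "hshape_ii D (as, ts)" "n dvd sum_list ts" "3 \<le> length as"
proof -
  obtain c where c: "c \<in> cycles_ii D" "h = hat c" using assms by blast
  obtain as ts where h: "h = (as, ts)" by (cases h)
  have cc: "c \<in> cycles_of (pot D)" using c(1) cycles_x_of by blast
  have "hshape_ii D (hat c)" using c(1) hat cc unfolding hat_choice_def by blast
  then have s: "hshape_ii D (as, ts)" using c(2) h by simp
  have "closed_word Q (hword D (hat c))" "3 \<le> length (hword D (hat c))"
    using hat_orbit[OF cc] by blast+
  moreover have hc: "hat c = (as, ts)" using c(2) h by simp
  ultimately have w: "closed_word Q (hword D (as, ts))" "3 \<le> length as" by (simp_all add: hc)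
  have "0 < length as" using w(2) by linarith
  then have "head Q (as ! 0) \<in> Fr" using hshape_iiD(4)[OF s, of 0] by simp
  then have sum: "n dvd sum_list ts" using shape_closed_sum[OF hshape_iiD(1)[OF s] w(1)] by blast
  show thesis using that[OF h s sum w(2)] .
qed

lemma hat_iii:
  assumes "h \<in> hat ` cycles_iii D"
  obtains as ts where "h = (as, ts)" "hshape_iii D (as, ts)" "3 \<le> length as"
proof -
  obtain c where c: "c \<in> cycles_iii D" "h = hat c" using assms by blast
  obtain as ts where h: "h = (as, ts)" by (cases h)
  have cc: "c \<in> cycles_of (pot D)" using c(1) cycles_x_of by blast
  have "hshape_iii D (hat c)" using c(1) hat cc unfolding hat_choice_def by blast
  then have s: "hshape_iii D (as, ts)" using c(2) h by simp
  have "closed_word Q (hword D (hat c))" "3 \<le> length (hword D (hat c))"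
    using hat_orbit[OF cc] by blast+
  moreover have hc: "hat c = (as, ts)" using c(2) h by simp
  ultimately have w: "closed_word Q (hword D (as, ts))" "3 \<le> length as" by (simp_all add: hc)
  show thesis using that[OF h s w(2)] .
qed

text \<open>The group fixes all arrows between fixed vertices, so the chosen word is a rotation of
  \<open>c\<close>. It has the same nonzero coefficient, and \<open>coeff_fix_b_exp\<close> applies
  to it.\<close>

lemma hat_iv:
  assumes "h \<in> hat ` cycles_iv D"
  obtains as ts where "h = (as, ts)" "hshape_iv D (as, ts)" "n dvd sum_list (map (b_exp D) as)" "3 \<le> length as"
proof -
  obtain c where c: "c \<in> cycles_iv D" "h = hat c" using assms by blast
  then have cc: "c \<in> cycles_of (pot D)" using cycles_x_of by blast
  obtain as ts where h: "h = (as, ts)" by (cases h)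
  have s: "hshape_iv D (as, ts)" using c hat cc h unfolding hat_choice_def by metis
  obtain t where t: "hword D (hat c) \<in> cyc_class (map (ga D t) c)" "3 \<le> length (hword D (hat c))"
    using hat_orbit[OF cc] by blast
  have t1: "as \<in> cyc_class (map (ga D t) c)" "3 \<le> length as"
    using t hshape_ivD(5)[OF s] c(2) h by simp_all
  have cQ: "set c \<subseteq> arcs Q" using cycle_closed[OF cc] by (simp add: closed_word_def)
  have "c \<in> cyc_class (map (ga D (- t)) as)" using cyc_orbit_sym[OF cQ t1(1)] .
  moreover have "map (ga D (- t)) as = as"
    by (rule map_idI) (use hshape_ivD(6)[OF s] ga_fix in blast)
  ultimately have "wt c = wt as" by (intro cyc_coeff_cyc_class) simp
  then have "wt as \<noteq> 0" using cc by (simp add: cycles_of_def)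
  then have "n dvd sum_list (map (b_exp D) as)"
    by (rule coeff_fix_b_exp) (use hshape_ivD(6)[OF s] arrows_ends(4) in blast)
  then show thesis using that h s t1(2) by blast
qed

subsection \<open>The support of \<open>W\<^sub>G\<close>\<close>

definition "words = tilde_i D ` hat ` cycles_i D \<union> (\<Union>\<mu>\<in>{0..<n}. (\<lambda>h. tilde_ii D h \<mu>) ` hat ` cycles_ii D) \<union>
  (\<Union>\<mu>\<in>{0..<n}. (\<lambda>h. tilde_iii D h \<mu>) ` hat ` cycles_iii D) \<union>
  (\<Union>\<mu>\<in>{0..<n}. (\<lambda>h. tilde_iv D h \<mu>) ` hat ` cycles_iv D)"

lemma wordsI:
  "h \<in> hat ` cycles_i D \<Longrightarrow> tilde_i D h \<in> words"
  "h \<in> hat ` cycles_ii D \<Longrightarrow> \<mu> \<in> {0..<n} \<Longrightarrow> tilde_ii D h \<mu> \<in> words"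
  "h \<in> hat ` cycles_iii D \<Longrightarrow> \<mu> \<in> {0..<n} \<Longrightarrow> tilde_iii D h \<mu> \<in> words"
  "h \<in> hat ` cycles_iv D \<Longrightarrow> \<mu> \<in> {0..<n} \<Longrightarrow> tilde_iv D h \<mu> \<in> words"
  unfolding words_def
  subgoal by (intro UnI1 imageI)
  subgoal by (rule UnI1, rule UnI1, rule UnI2, rule UN_I, assumption, rule image_eqI[where x = h]) simp_all
  subgoal by (rule UnI1, rule UnI2, rule UN_I, assumption, rule image_eqI[where x = h]) simp_all
  subgoal by (rule UnI2, rule UN_I, assumption, rule image_eqI[where x = h]) simp_all
  done

lemma finite_words: "finite words"
  unfolding words_def
  by (intro finite_UnI finite_UN_I finite_imageI finite_cycles finite_atLeastLessThan_int)

lemma words_cases: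
  assumes "d \<in> words"
  obtains (i) h where "h \<in> hat ` cycles_i D" "d = tilde_i D h"
    | (ii) h \<mu> where "h \<in> hat ` cycles_ii D" "\<mu> \<in> {0..<n}" "d = tilde_ii D h \<mu>"
    | (iii) h \<mu> where "h \<in> hat ` cycles_iii D" "\<mu> \<in> {0..<n}" "d = tilde_iii D h \<mu>"
    | (iv) h \<mu> where "h \<in> hat ` cycles_iv D" "\<mu> \<in> {0..<n}" "d = tilde_iv D h \<mu>"
proof -
  have *: thesis if d: "d \<in> (\<Union>\<mu>\<in>{0..<n}. (\<lambda>h. f h \<mu>) ` S)"
    and f: "\<And>h \<mu>. h \<in> S \<Longrightarrow> \<mu> \<in> {0..<n} \<Longrightarrow> d = f h \<mu> \<Longrightarrow> thesis" for f and S :: "('a list \<times> int list) set"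
  proof -
    obtain \<mu> where \<mu>: "\<mu> \<in> {0..<n}" "d \<in> (\<lambda>h. f h \<mu>) ` S" using d by (rule UN_E)
    obtain h where "d = f h \<mu>" "h \<in> S" using \<mu>(2) by (rule imageE)
    then show thesis using f \<mu>(1) by blast
  qed
  consider "d \<in> tilde_i D ` hat ` cycles_i D" | "d \<in> (\<Union>\<mu>\<in>{0..<n}. (\<lambda>h. tilde_ii D h \<mu>) ` hat ` cycles_ii D)"
    | "d \<in> (\<Union>\<mu>\<in>{0..<n}. (\<lambda>h. tilde_iii D h \<mu>) ` hat ` cycles_iii D)"
    | "d \<in> (\<Union>\<mu>\<in>{0..<n}. (\<lambda>h. tilde_iv D h \<mu>) ` hat ` cycles_iv D)"
    using assms unfolding words_def Un_iff by (elim disjE)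
  then show thesis
  proof cases
    case 1
    then show thesis by (elim imageE[where f = "tilde_i D"]) (rule i)
  next
    case 2
    then show thesis by (rule *) (rule ii)
  next
    case 3
    then show thesis by (rule *) (rule iii)
  next
    case 4
    then show thesis by (rule *) (rule iv)
  qed
qed

lemma closed_words:
  assumes "d \<in> words"
  shows "closed_word (QG D) d \<and> 3 \<le> length d"
  using assms
proof (cases d rule: words_cases)
  case (i h)
  obtain as ts where h: "h = (as, ts)" "hshape_i D (as, ts)" "3 \<le> length as" using hat_i[OF i(1)] by blast
  then show ?thesis using i(2) closed_tilde_i[OF h(2)] by simp
next
  case (ii h \<mu>)
  obtain as ts where h: "h = (as, ts)" "hshape_ii D (as, ts)" "3 \<le> length as" using hat_ii[OF ii(1)] by blast
  then show ?thesis using ii(3) closed_tilde_ii[OF h(2,3)] by (simp add: length_tilde_ii)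
next
  case (iii h \<mu>)
  obtain as ts where h: "h = (as, ts)" "hshape_iii D (as, ts)" "3 \<le> length as" using hat_iii[OF iii(1)] by blast
  then show ?thesis using iii(3) closed_tilde_iii[OF h(2,3)] by (simp add: length_tilde_iii)
next
  case (iv h \<mu>)
  obtain as ts where h: "h = (as, ts)" "hshape_iv D (as, ts)" "n dvd sum_list (map (b_exp D) as)" "3 \<le> length as"
    using hat_iv[OF iv(1)] by blast
  then show ?thesis using iv(3) closed_tilde_iv[OF h(2,3)] by simp
qed

lemma WG_eq_0: "(\<And>d. d \<in> words \<Longrightarrow> cyc_path (QG D) d p = (0::'k)) \<Longrightarrow> WG D hat p = 0"
proof -
  assume *: "\<And>d. d \<in> words \<Longrightarrow> cyc_path (QG D) d p = (0::'k)"
  have "(\<Sum>h\<in>hat ` cycles_i D. wt (hword D h) * (of_nat (orbit_card D (hword D h)) / of_nat (gord D)) *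
      cyc_path (QG D) (tilde_i D h) p) = 0"
    by (rule sum.neutral) (simp add: * wordsI(1))
  moreover have "(\<Sum>h\<in>hat ` cycles_ii D. wt (hword D h) *
        (\<Sum>\<mu> = 0..<n. zeta D powi (- (snd h ! 1) * \<mu>) * cyc_path (QG D) (tilde_ii D h \<mu>) p)) = 0"
    by (rule sum.neutral) (simp add: * wordsI(2))
  moreover have "(\<Sum>h\<in>hat ` cycles_iii D. wt (hword D h) * (\<Sum>\<mu> = 0..<n. cyc_path (QG D) (tilde_iii D h \<mu>) p)) = 0"
    by (rule sum.neutral) (simp add: * wordsI(3))
  moreover have "(\<Sum>h\<in>hat ` cycles_iv D. wt (hword D h) * (\<Sum>\<mu> = 0..<n. cyc_path (QG D) (tilde_iv D h \<mu>) p)) = 0"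
    by (rule sum.neutral) (simp add: * wordsI(4))
  ultimately show ?thesis unfolding WG_def by simp
qed

lemma cyc_path_apply: "cyc_path Q' d p = (if p = (head Q' (hd d), d, tail Q' (last d)) then 1 else 0)"
  by (simp add: cyc_path_def single_def)

lemma cyc_path_closed:
  "closed_word Q' d \<Longrightarrow> cyc_path Q' d (head Q' (hd l), l, head Q' (hd l)) = (if l = d then 1 else 0)"
  by (auto simp: cyc_path_apply closed_word_last)

lemma WG_support: "WG D hat p \<noteq> 0 \<Longrightarrow> \<exists>d \<in> words. p = (head (QG D) (hd d), d, head (QG D) (hd d))"
proof -
  assume "WG D hat p \<noteq> 0"
  then obtain d where d: "d \<in> words" "cyc_path (QG D) d p \<noteq> (0::'k)" using WG_eq_0 by blast
  then have "p = (head (QG D) (hd d), d, tail (QG D) (last d))" by (simp add: cyc_path_apply split: if_splits)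
  then show ?thesis using d(1) closed_word_last closed_words[OF d(1)] by auto
qed

lemma finite_WG: "finite {p. WG D hat p \<noteq> 0}"
proof (rule finite_subset)
  show "{p. WG D hat p \<noteq> 0} \<subseteq> (\<lambda>d. (head (QG D) (hd d), d, head (QG D) (hd d))) ` words"
    using WG_support by blast
qed (use finite_words in simp)

lemma WG_paths: "WG D hat p \<noteq> 0 \<Longrightarrow> p \<in> paths (QG D)"
  using WG_support closed_words closed_word_path[OF wf_QG] by blast

lemma WG_in_path_algebra: "WG D hat \<in> path_algebra (QG D)"
  by (rule path_algebraI[OF finite_WG WG_paths])

lemma canonical_WG: "canonical (QG D) (WG D hat)"
  unfolding canonical_def using WG_support closed_words by (fastforce simp: closed_word_def)

definition ind :: "'c list \<Rightarrow> 'c list \<Rightarrow> 'k" where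
  "ind w d = (if d \<in> cyc_class w then 1 else 0)"

text \<open>A rotation class is a set of words, so a word with rotational symmetry is still counted
  once.\<close>

lemma sum_cyc_path: "d \<in> words \<Longrightarrow>
  (\<Sum>l\<in>cyc_class w. cyc_path (QG D) d (head (QG D) (hd l), l, head (QG D) (hd l))) = ind w d"
  using closed_words by (simp add: cyc_path_closed ind_def)

lemma coeff_WG:
  "cyc_coeff (WG D hat) w =
     (\<Sum>h\<in>hat ` cycles_i D. wt (hword D h) * (of_nat (orbit_card D (hword D h)) / of_nat (gord D) * ind w (tilde_i D h)))
   + (\<Sum>h\<in>hat ` cycles_ii D. wt (hword D h) *
        (\<Sum>\<mu> = 0..<n. zeta D powi (- (snd h ! 1) * \<mu>) * ind w (tilde_ii D h \<mu>)))
   + (\<Sum>h\<in>hat ` cycles_iii D. wt (hword D h) * (\<Sum>\<mu> = 0..<n. ind w (tilde_iii D h \<mu>)))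
   + (\<Sum>h\<in>hat ` cycles_iv D. wt (hword D h) * (\<Sum>\<mu> = 0..<n. ind w (tilde_iv D h \<mu>)))"
proof -
  let ?P = "\<lambda>l. (head (QG D) (hd l), l, head (QG D) (hd l))"
  let ?C = "cyc_class w"
  have 1: "(\<Sum>l\<in>?C. \<Sum>h\<in>hat ` cycles_i D. wt (hword D h) *
      (of_nat (orbit_card D (hword D h)) / of_nat (gord D)) * cyc_path (QG D) (tilde_i D h) (?P l)) =
      (\<Sum>h\<in>hat ` cycles_i D. wt (hword D h) * (of_nat (orbit_card D (hword D h)) / of_nat (gord D) * ind w (tilde_i D h)))"
  proof (subst sum.swap, rule sum.cong[OF refl])
    fix h assume h: "h \<in> hat ` cycles_i D"
    show "(\<Sum>l\<in>?C. wt (hword D h) *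
        (of_nat (orbit_card D (hword D h)) / of_nat (gord D)) * cyc_path (QG D) (tilde_i D h) (?P l)) =
        wt (hword D h) * (of_nat (orbit_card D (hword D h)) / of_nat (gord D) * ind w (tilde_i D h))"
      by (simp only: sum_distrib_left[symmetric] sum_cyc_path[OF wordsI(1)[OF h]] mult.assoc)
  qed
  have 2: "(\<Sum>l\<in>?C. \<Sum>h\<in>hat ` cycles_ii D. wt (hword D h) *
        (\<Sum>\<mu> = 0..<n. zeta D powi (- (snd h ! 1) * \<mu>) * cyc_path (QG D) (tilde_ii D h \<mu>) (?P l))) =
      (\<Sum>h\<in>hat ` cycles_ii D. wt (hword D h) *
        (\<Sum>\<mu> = 0..<n. zeta D powi (- (snd h ! 1) * \<mu>) * ind w (tilde_ii D h \<mu>)))"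
  proof (subst sum.swap, rule sum.cong[OF refl])
    fix h assume h: "h \<in> hat ` cycles_ii D"
    have "(\<Sum>l\<in>?C. \<Sum>\<mu> = 0..<n. zeta D powi (- (snd h ! 1) * \<mu>) * cyc_path (QG D) (tilde_ii D h \<mu>) (?P l)) =
        (\<Sum>\<mu> = 0..<n. zeta D powi (- (snd h ! 1) * \<mu>) * ind w (tilde_ii D h \<mu>))"
      by (subst sum.swap) (simp add: sum_distrib_left[symmetric] sum_cyc_path wordsI(2)[OF h])
    then show "(\<Sum>l\<in>?C. wt (hword D h) *
        (\<Sum>\<mu> = 0..<n. zeta D powi (- (snd h ! 1) * \<mu>) * cyc_path (QG D) (tilde_ii D h \<mu>) (?P l))) =
        wt (hword D h) * (\<Sum>\<mu> = 0..<n. zeta D powi (- (snd h ! 1) * \<mu>) * ind w (tilde_ii D h \<mu>))"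
      by (simp only: sum_distrib_left[symmetric])
  qed
  have 3: "(\<Sum>l\<in>?C. \<Sum>h\<in>hat ` cycles_iii D. wt (hword D h) *
        (\<Sum>\<mu> = 0..<n. cyc_path (QG D) (tilde_iii D h \<mu>) (?P l))) =
      (\<Sum>h\<in>hat ` cycles_iii D. wt (hword D h) * (\<Sum>\<mu> = 0..<n. ind w (tilde_iii D h \<mu>)))"
  proof (subst sum.swap, rule sum.cong[OF refl])
    fix h assume h: "h \<in> hat ` cycles_iii D"
    have "(\<Sum>l\<in>?C. \<Sum>\<mu> = 0..<n. cyc_path (QG D) (tilde_iii D h \<mu>) (?P l)) =
        (\<Sum>\<mu> = 0..<n. ind w (tilde_iii D h \<mu>))"
      by (subst sum.swap) (simp add: sum_cyc_path wordsI(3)[OF h])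
    then show "(\<Sum>l\<in>?C. wt (hword D h) * (\<Sum>\<mu> = 0..<n. cyc_path (QG D) (tilde_iii D h \<mu>) (?P l))) =
        wt (hword D h) * (\<Sum>\<mu> = 0..<n. ind w (tilde_iii D h \<mu>))"
      by (simp only: sum_distrib_left[symmetric])
  qed
  have 4: "(\<Sum>l\<in>?C. \<Sum>h\<in>hat ` cycles_iv D. wt (hword D h) *
        (\<Sum>\<mu> = 0..<n. cyc_path (QG D) (tilde_iv D h \<mu>) (?P l))) =
      (\<Sum>h\<in>hat ` cycles_iv D. wt (hword D h) * (\<Sum>\<mu> = 0..<n. ind w (tilde_iv D h \<mu>)))"
  proof (subst sum.swap, rule sum.cong[OF refl])
    fix h assume h: "h \<in> hat ` cycles_iv D"
    have "(\<Sum>l\<in>?C. \<Sum>\<mu> = 0..<n. cyc_path (QG D) (tilde_iv D h \<mu>) (?P l)) =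
        (\<Sum>\<mu> = 0..<n. ind w (tilde_iv D h \<mu>))"
      by (subst sum.swap) (simp add: sum_cyc_path wordsI(4)[OF h])
    then show "(\<Sum>l\<in>?C. wt (hword D h) * (\<Sum>\<mu> = 0..<n. cyc_path (QG D) (tilde_iv D h \<mu>) (?P l))) =
        wt (hword D h) * (\<Sum>\<mu> = 0..<n. ind w (tilde_iv D h \<mu>))"
      by (simp only: sum_distrib_left[symmetric])
  qed
  have "cyc_coeff (WG D hat) w = (\<Sum>l\<in>?C. WG D hat (?P l))"
    by (rule cyc_coeff_canonical[OF canonical_WG])
  then show ?thesis unfolding WG_def sum.distrib 1 2 3 4 .
qed

lemma coeff_WG_nonzero:
  assumes "cyc_coeff (WG D hat) w \<noteq> 0"
  shows "\<exists>d \<in> words. w \<in> cyc_class d"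
proof -
  obtain l where "l \<in> cyc_class w" "WG D hat (head (QG D) (hd l), l, head (QG D) (hd l)) \<noteq> 0"
    using assms unfolding cyc_coeff_canonical[OF canonical_WG] by (meson sum.not_neutral_contains_not_neutral)
  then show ?thesis using WG_support cyc_class_sym by blast
qed

text \<open>\<open>has1\<close> and \<open>has2\<close> are invariant under rotation, so a test word
  sees only one of the four blocks of \<open>W_G\<close>.\<close>

lemma ind_0: "has1 d \<noteq> has1 w \<or> has2 d \<noteq> has2 w \<Longrightarrow> ind w d = 0"
  using has_cyc_class by (auto simp: ind_def)

lemma kinds_hat_i: "h \<in> hat ` cycles_i D \<Longrightarrow> has1 (tilde_i D h) \<and> \<not> has2 (tilde_i D h)"
  by (elim hat_i) (simp add: kinds_i)

lemma kinds_hat_ii: "h \<in> hat ` cycles_ii D \<Longrightarrow> has1 (tilde_ii D h \<mu>) \<and> has2 (tilde_ii D h \<mu>)"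
  by (elim hat_ii) (simp add: kinds_ii)

lemma kinds_hat_iii: "h \<in> hat ` cycles_iii D \<Longrightarrow> \<not> has1 (tilde_iii D h \<mu>) \<and> has2 (tilde_iii D h \<mu>)"
  by (elim hat_iii) (simp add: kinds_iii)

lemma kinds_hat_iv: "h \<in> hat ` cycles_iv D \<Longrightarrow> \<not> has1 (tilde_iv D h \<mu>) \<and> \<not> has2 (tilde_iv D h \<mu>)"
  by (elim hat_iv) (simp add: kinds_iv)

lemma coeff_WG_i: "has1 w \<Longrightarrow> \<not> has2 w \<Longrightarrow> cyc_coeff (WG D hat) w =
  (\<Sum>h\<in>hat ` cycles_i D. wt (hword D h) * (of_nat (orbit_card D (hword D h)) / of_nat (gord D) * ind w (tilde_i D h)))"
  unfolding coeff_WG by (simp add: ind_0 kinds_hat_ii kinds_hat_iii kinds_hat_iv)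

lemma coeff_WG_ii: "has1 w \<Longrightarrow> has2 w \<Longrightarrow> cyc_coeff (WG D hat) w =
  (\<Sum>h\<in>hat ` cycles_ii D. wt (hword D h) *
        (\<Sum>\<mu> = 0..<n. zeta D powi (- (snd h ! 1) * \<mu>) * ind w (tilde_ii D h \<mu>)))"
  unfolding coeff_WG by (simp add: ind_0 kinds_hat_i kinds_hat_iii kinds_hat_iv)

lemma coeff_WG_iii: "\<not> has1 w \<Longrightarrow> has2 w \<Longrightarrow> cyc_coeff (WG D hat) w =
  (\<Sum>h\<in>hat ` cycles_iii D. wt (hword D h) * (\<Sum>\<mu> = 0..<n. ind w (tilde_iii D h \<mu>)))"
  unfolding coeff_WG by (simp add: ind_0 kinds_hat_i kinds_hat_ii kinds_hat_iv)

lemma coeff_WG_iv: "\<not> has1 w \<Longrightarrow> \<not> has2 w \<Longrightarrow> cyc_coeff (WG D hat) w =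
  (\<Sum>h\<in>hat ` cycles_iv D. wt (hword D h) * (\<Sum>\<mu> = 0..<n. ind w (tilde_iv D h \<mu>)))"
  unfolding coeff_WG by (simp add: ind_0 kinds_hat_i kinds_hat_ii kinds_hat_iii)

subsection \<open>The coefficients of the cycles of \<open>W\<^sub>G\<close>\<close>

text \<open>A sum over the chosen representatives has at most one contribution, that of the orbit of \<open>c\<close>.\<close>

lemma sum_hat:
  assumes sub: "C \<subseteq> cycles_of (pot D)" and fin: "finite C" and c: "wt c \<noteq> 0 \<Longrightarrow> c \<in> C"
    and f: "\<And>h. h \<in> hat ` C \<Longrightarrow> f h \<noteq> 0 \<Longrightarrow> hword D h \<in> cyc_orbit D c \<and> wt (hword D h) = wt c"
  shows "(\<Sum>h\<in>hat ` C. wt (hword D h) * f h) = (if wt c = 0 then 0 else wt c * f (hat c))"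
proof (cases "wt c = 0")
  case True
  have "(\<Sum>h\<in>hat ` C. wt (hword D h) * f h) = 0"
  proof (rule sum.neutral, rule ballI)
    fix h assume "h \<in> hat ` C"
    then show "wt (hword D h) * f h = 0" using f True by (cases "f h = 0") simp_all
  qed
  then show ?thesis using True by simp
next
  case False
  then have cC: "c \<in> C" "c \<in> cycles_of (pot D)" using c sub by blast+
  have z: "wt (hword D h) * f h = 0" if hC: "h \<in> hat ` C" and hc: "h \<noteq> hat c" for h
  proof (rule ccontr)
    assume nz: "wt (hword D h) * f h \<noteq> 0"
    then have h: "hword D h \<in> cyc_orbit D c" "hword D h \<in> cycles_of (pot D)"
      using f[OF hC] by (simp_all add: cycles_of_def)
    obtain c' where c': "c' \<in> cycles_of (pot D)" "h = hat c'" using hC sub by blast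
    \<comment> \<open>The word of \<open>h\<close> is itself a cycle of \<open>W\<close> lying in
      the orbits of both \<open>c'\<close> and \<open>c\<close>; constancy of \<open>hat\<close> on
      orbits sends it to \<open>h\<close> and to \<open>hat c\<close>.\<close>
    have "hword D h \<in> cyc_orbit D c'" using hat c' unfolding hat_choice_def by blast
    then have "hat (hword D h) = h" using hat c' h(2) unfolding hat_choice_def by blast
    moreover have "hat (hword D h) = hat c" using hat cC(2) h unfolding hat_choice_def by blast
    ultimately show False using hc by simp
  qed
  have "(\<Sum>h\<in>hat ` C. wt (hword D h) * f h) = (\<Sum>h\<in>{hat c}. wt (hword D h) * f h)"
    by (rule sum.mono_neutral_right) (use fin cC z in auto)
  also have "\<dots> = wt (hword D (hat c)) * f (hat c)" by simp
  also have "\<dots> = wt c * f (hat c)"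
    using f[of "hat c"] cC(1) by (cases "f (hat c) = 0") simp_all
  finally show ?thesis using False by simp
qed

lemma hat_in_orbit: "wt c \<noteq> 0 \<Longrightarrow> hword D (hat c) \<in> cyc_orbit D c"
  using hat unfolding hat_choice_def cycles_of_def by blast

lemma coeff_shape:
  assumes "wt (hword D (as, ts)) \<noteq> 0"
  shows "hshape_i D (as, ts) \<Longrightarrow> hword D (as, ts) \<in> cycles_i D"
    "hshape_ii D (as, ts) \<Longrightarrow> hword D (as, ts) \<in> cycles_ii D"
    "hshape_iii D (as, ts) \<Longrightarrow> hword D (as, ts) \<in> cycles_iii D"
    "hshape_iv D (as, ts) \<Longrightarrow> hword D (as, ts) \<in> cycles_iv D"
  subgoal by (simp add: cycles_i_def cycles_of_def assms fix_count_shapes(1))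
  subgoal by (simp add: cycles_ii_def cycles_of_def assms fix_count_shapes(2))
  subgoal by (simp add: cycles_iii_def cycles_of_def assms fix_count_shapes(3))
  subgoal by (simp add: cycles_iv_def cycles_of_def assms fix_count_shapes(4))
  done

text \<open>The shape is arbitrary, not one chosen by \<open>hat\<close>: a chosen shape contributes
  only if its orbit is that of the given word, and coefficient and orbit length are constant on the
  orbit. This independence lets explicit shapes be used in the second construction.\<close>

lemma coeff_tilde_i:
  assumes s: "hshape_i D (as, ts)" and sum: "n dvd sum_list ts"
  shows "cyc_coeff (WG D hat) (tilde_i D (as, ts)) =
    wt (hword D (as, ts)) * (of_nat (orbit_card D (hword D (as, ts))) / of_nat (gord D))"
proof -
  let ?c = "hword D (as, ts)" and ?w = "tilde_i D (as, ts)"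
  let ?f = "\<lambda>h. of_nat (orbit_card D (hword D h)) / of_nat (gord D) * ind ?w (tilde_i D h)"
  have cQ: "set ?c \<subseteq> arcs Q" using set_hword[OF hshapeD(3)[OF hshape_iD(1)[OF s]]] .
  have nfix: "head Q \<alpha> \<notin> Fx" if \<alpha>: "\<alpha> \<in> set ?c" for \<alpha>
  proof -
    obtain i where i: "i < length as" "\<alpha> = ?c ! i" using \<alpha> by (metis in_set_conv_nth length_hword)
    then show ?thesis
      using free_fix_disjoint[OF hshape_iD(2)[OF s i(1)]] hshapeD(4)[OF hshape_iD(1)[OF s] i(1)]
      by (simp add: hword_nth ga_ends_fix)
  qed
  have "cyc_coeff (WG D hat) ?w = (\<Sum>h\<in>hat ` cycles_i D. wt (hword D h) * ?f h)"
    by (rule coeff_WG_i) (use kinds_i[OF s] in simp_all)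
  also have "\<dots> = (if wt ?c = 0 then 0 else wt ?c * ?f (hat ?c))"
  proof (rule sum_hat[OF cycles_x_of(1) finite_cycles(1)])
    show "wt ?c \<noteq> 0 \<Longrightarrow> ?c \<in> cycles_i D" using coeff_shape(1) s by blast
    fix h assume h: "h \<in> hat ` cycles_i D" and nz: "?f h \<noteq> 0"
    obtain as' ts' where h': "h = (as', ts')" "hshape_i D (as', ts')" using hat_i[OF h] .
    have "tilde_i D (as', ts') \<in> cyc_class ?w" using nz h'(1) by (simp add: ind_def split: if_splits)
    then obtain t where t: "hword D h \<in> cyc_class (map (ga D t) ?c)"
      using rotation_i[OF s h'(2) sum] h'(1) by blast
    then show "hword D h \<in> cyc_orbit D ?c \<and> wt (hword D h) = wt ?c"
      using in_cyc_orbit_iff[OF cQ] cyc_coeff_cyc_class[OF t, of "pot D"] coeff_ga_free[OF cQ nfix, of t] by auto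
  qed
  also have "\<dots> = wt ?c * (of_nat (orbit_card D ?c) / of_nat (gord D))"
  proof (cases "wt ?c = 0")
    case False
    then have cy: "?c \<in> cycles_i D" using coeff_shape(1) s by blast
    obtain as' ts' where h': "hat ?c = (as', ts')" "hshape_i D (as', ts')" using hat_i[OF imageI[OF cy]] .
    have orb: "hword D (as', ts') \<in> cyc_orbit D ?c" using hat_in_orbit[OF False] h'(1) by simp
    then obtain t where t: "hword D (as', ts') \<in> cyc_class (map (ga D t) ?c)"
      using in_cyc_orbit_iff[OF cQ] by blast
    have "tilde_i D (as', ts') \<in> cyc_class ?w"
      using map_in_cyc_class[OF orbit_i[OF s h'(2) orb]] by (simp add: tilde_i_def)
    then show ?thesis using False h'(1) orbit_card_orbit[OF cQ t] by (simp add: ind_def)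
  qed simp
  finally show ?thesis .
qed

text \<open>By \<open>rotation_ii\<close> a single pair of representative and index survives. Its
  power of zeta does not depend on the choice, since \<open>p(c)\<close> is determined modulo
  \<open>n\<close>.\<close>

lemma coeff_tilde_ii:
  assumes s: "hshape_ii D (as, ts)" and sum: "n dvd sum_list ts" and l3: "3 \<le> length as" and \<mu>: "0 \<le> \<mu>" "\<mu> < n"
  shows "cyc_coeff (WG D hat) (tilde_ii D (as, ts) \<mu>) = zeta D powi (- (ts ! 1) * \<mu>) * wt (hword D (as, ts))"
proof -
  let ?c = "hword D (as, ts)" and ?w = "tilde_ii D (as, ts) \<mu>"
  let ?f = "\<lambda>h. \<Sum>\<mu> = 0..<n. zeta D powi (- (snd h ! 1) * \<mu>) * ind ?w (tilde_ii D h \<mu>)"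
  have cQ: "set ?c \<subseteq> arcs Q" using set_hword[OF hshapeD(3)[OF hshape_iiD(1)[OF s]]] .
  have "cyc_coeff (WG D hat) ?w = (\<Sum>h\<in>hat ` cycles_ii D. wt (hword D h) * ?f h)"
    by (rule coeff_WG_ii) (use kinds_ii[OF s l3] in simp_all)
  also have "\<dots> = (if wt ?c = 0 then 0 else wt ?c * ?f (hat ?c))"
  proof (rule sum_hat[OF cycles_x_of(2) finite_cycles(2)])
    show "wt ?c \<noteq> 0 \<Longrightarrow> ?c \<in> cycles_ii D" using coeff_shape(2) s by blast
    fix h assume h: "h \<in> hat ` cycles_ii D" and nz: "?f h \<noteq> 0"
    obtain as' ts' where h': "h = (as', ts')" "hshape_ii D (as', ts')" "n dvd sum_list ts'" "3 \<le> length as'"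
      using hat_ii[OF h] .
    obtain \<nu> where "ind ?w (tilde_ii D h \<nu>) \<noteq> 0"
      using nz by (metis (no_types, lifting) mult_zero_right sum.neutral)
    then have "tilde_ii D (as', ts') \<nu> \<in> cyc_class ?w" using h'(1) by (simp add: ind_def split: if_splits)
    then have "hword D h = ?c" using rotation_ii(3)[OF s h'(2) sum h'(3) l3 h'(4)] h'(1) by simp
    moreover have "?c \<in> cyc_orbit D ?c"
      using in_cyc_orbit_iff[OF cQ] map_ga_0 cyc_class_refl by metis
    ultimately show "hword D h \<in> cyc_orbit D ?c \<and> wt (hword D h) = wt ?c" by simp
  qed
  also have "\<dots> = zeta D powi (- (ts ! 1) * \<mu>) * wt ?c"
  proof (cases "wt ?c = 0")
    case False
    then have cy: "?c \<in> cycles_ii D" using coeff_shape(2) s by blast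
    obtain as' ts' where h': "hat ?c = (as', ts')" "hshape_ii D (as', ts')" "n dvd sum_list ts'" "3 \<le> length as'"
      using hat_ii[OF imageI[OF cy]] .
    have orb: "hword D (as', ts') \<in> cyc_orbit D ?c" using hat_in_orbit[OF False] h'(1) by simp
    have o: "as' = as" "ts' ! 1 mod n = ts ! 1 mod n" using orbit_ii[OF s h'(2) orb] .
    have "(- (ts' ! 1)) mod n = (- (ts ! 1)) mod n" using o(2) by (rule mod_minus_cong)
    then have til: "tilde_ii D (as', ts') \<nu> = tilde_ii D (as, ts) \<nu>" for \<nu>
      using o(1) fun_cong[OF ga_cong, of "- (ts' ! 1)" "- (ts ! 1)"] by (simp add: tilde_ii_def)
    have z: "zeta D powi (- (ts' ! 1) * \<mu>) = zeta D powi (- (ts ! 1) * \<mu>)"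
      unfolding zeta_powi_eq_iff using \<open>(- (ts' ! 1)) mod n = (- (ts ! 1)) mod n\<close> by (rule mod_mult_cong) simp
    have "?f (hat ?c) = (\<Sum>\<nu> = 0..<n. if \<nu> = \<mu> then zeta D powi (- (ts ! 1) * \<mu>) else 0)"
    proof (rule sum.cong[OF refl])
      fix \<nu> assume "\<nu> \<in> {0..<n}"
      then have nu: "\<nu> mod n = \<mu> mod n \<longleftrightarrow> \<nu> = \<mu>" using \<mu> by simp
      have "tilde_ii D (as', ts') \<nu> \<in> cyc_class ?w \<longleftrightarrow> \<nu> = \<mu>"
      proof
        assume "tilde_ii D (as', ts') \<nu> \<in> cyc_class ?w"
        from rotation_ii(2)[OF s h'(2) sum h'(3) l3 h'(4) this] show "\<nu> = \<mu>" using nu by blast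
      qed (simp add: til)
      then show "zeta D powi (- (snd (hat ?c) ! 1) * \<nu>) * ind ?w (tilde_ii D (hat ?c) \<nu>) =
          (if \<nu> = \<mu> then zeta D powi (- (ts ! 1) * \<mu>) else 0)"
        unfolding h'(1) by (simp add: ind_def z[simplified])
    qed
    then show ?thesis using False \<mu> by simp
  qed simp
  finally show ?thesis .
qed

lemma coeff_tilde_iii:
  assumes s: "hshape_iii D (as, ts)" and l3: "3 \<le> length as" and \<mu>: "0 \<le> \<mu>" "\<mu> < n"
  shows "cyc_coeff (WG D hat) (tilde_iii D (as, ts) \<mu>) = wt as"
proof -
  let ?w = "tilde_iii D (as, ts) \<mu>"
  let ?f = "\<lambda>h. \<Sum>\<mu> = 0..<n. ind ?w (tilde_iii D h \<mu>)"
  have cQ: "set as \<subseteq> arcs Q" using hshapeD(3)[OF hshape_iiiD(1)[OF s]] .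
  note hw = hword_iii[OF s]
  have "cyc_coeff (WG D hat) ?w = (\<Sum>h\<in>hat ` cycles_iii D. wt (hword D h) * ?f h)"
    by (rule coeff_WG_iii) (use kinds_iii[OF s l3] in simp_all)
  also have "\<dots> = (if wt as = 0 then 0 else wt as * ?f (hat as))"
  proof (rule sum_hat[OF cycles_x_of(3) finite_cycles(3)])
    show "wt as \<noteq> 0 \<Longrightarrow> as \<in> cycles_iii D" using coeff_shape(3)[of as ts] s hw by simp
    fix h assume h: "h \<in> hat ` cycles_iii D" and nz: "?f h \<noteq> 0"
    obtain as' ts' where h': "h = (as', ts')" "hshape_iii D (as', ts')" "3 \<le> length as'"
      using hat_iii[OF h] .
    obtain \<nu> where "ind ?w (tilde_iii D h \<nu>) \<noteq> 0"
      using nz by (metis (no_types, lifting) sum.neutral)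
    then have "tilde_iii D (as', ts') \<nu> \<in> cyc_class ?w" using h'(1) by (simp add: ind_def split: if_splits)
    then have "hword D h = as" using rotation_iii(1)[OF s h'(2) l3 h'(3)] h'(1) hword_iii[OF h'(2)] by simp
    moreover have "as \<in> cyc_orbit D as"
      using in_cyc_orbit_iff[OF cQ] map_ga_0 cyc_class_refl by metis
    ultimately show "hword D h \<in> cyc_orbit D as \<and> wt (hword D h) = wt as" by simp
  qed
  also have "\<dots> = wt as"
  proof (cases "wt as = 0")
    case False
    then have cy: "as \<in> cycles_iii D" using coeff_shape(3)[of as ts] s hw by simp
    obtain as' ts' where h': "hat as = (as', ts')" "hshape_iii D (as', ts')" "3 \<le> length as'"
      using hat_iii[OF imageI[OF cy]] .
    have "as' \<in> cyc_orbit D as" using hat_in_orbit[OF False] h'(1) hword_iii[OF h'(2)] by simp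
    then have o: "as' = as" using orbit_iii[OF s h'(2)] by blast
    then have til: "tilde_iii D (as', ts') \<nu> = tilde_iii D (as, ts) \<nu>" for \<nu>
      by (simp add: tilde_iii_def)
    have "?f (hat as) = (\<Sum>\<nu> = 0..<n. if \<nu> = \<mu> then 1 else 0)"
    proof (rule sum.cong[OF refl])
      fix \<nu> assume "\<nu> \<in> {0..<n}"
      then have nu: "\<nu> mod n = \<mu> mod n \<longleftrightarrow> \<nu> = \<mu>" using \<mu> by simp
      have "tilde_iii D (as', ts') \<nu> \<in> cyc_class ?w \<longleftrightarrow> \<nu> = \<mu>"
      proof
        assume "tilde_iii D (as', ts') \<nu> \<in> cyc_class ?w"
        from rotation_iii(2)[OF s h'(2) l3 h'(3) this] show "\<nu> = \<mu>" using nu by blast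
      qed (simp add: til)
      then show "ind ?w (tilde_iii D (hat as) \<nu>) = (if \<nu> = \<mu> then 1 else 0)"
        unfolding h'(1) by (simp add: ind_def)
    qed
    then show ?thesis using False \<mu> by simp
  qed simp
  finally show ?thesis .
qed

lemma sum_ind: "finite A \<Longrightarrow> (\<Sum>\<nu>\<in>A. ind w (d \<nu>)) = of_nat (card {\<nu> \<in> A. d \<nu> \<in> cyc_class w})"
  unfolding ind_def by (simp add: sum.If_cases Int_def)

text \<open>A chosen cycle of type (iv) is known only up to rotation. The rotation shifts the index,
  and a sum over all residues absorbs the shift.\<close>

lemma sum_ind_tilde_iv_rotate:
  assumes "n dvd sum_list (map (b_exp D) as)" and "as' \<in> cyc_class as"
  shows "(\<Sum>\<nu> = 0..<n. ind w (tilde_iv D (as', ts') \<nu>)) = (\<Sum>\<nu> = 0..<n. ind w (tilde_iv D (as, ts) \<nu>))"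
proof -
  obtain m where m: "as' = rotate m as" using assms(2) unfolding cyc_class_def by blast
  have b: "n dvd sum_list (map (b_exp D) as')" using assms(1) sum_list_cyc_class[OF assms(2), of "b_exp D"] by simp
  obtain k where k: "\<And>\<nu>. lift4 \<nu> as' \<in> cyc_class (lift4 (\<nu> + k) as)"
    using lift4_rotate[OF assms(1), of m] m by blast
  have "ind w (lift4 \<nu> as') = ind w (lift4 (\<nu> + k) as)" for \<nu>
    using k[of \<nu>] cyc_class_sym cyc_class_trans unfolding ind_def by metis
  then have "(\<Sum>\<nu> = 0..<n. ind w (tilde_iv D (as', ts') \<nu>)) = (\<Sum>\<nu> = 0..<n. ind w (lift4 (\<nu> + k) as))"
    unfolding tilde_iv_lift4[OF b] by simp
  also have "\<dots> = (\<Sum>\<nu> = 0..<n. ind w (lift4 \<nu> as))"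
  proof (rule sum_periodic_shift[OF n_pos])
    show "ind w (lift4 (\<nu> mod n) as) = ind w (lift4 \<nu> as)" for \<nu>
      by (rule arg_cong[OF lift4_cong]) simp
  qed
  finally show ?thesis unfolding tilde_iv_lift4[OF assms(1)] .
qed

text \<open>Nothing anchors a word all of whose arrows have type (4): several indices may give
  rotations of the same word, and each of them contributes the coefficient of
  \<open>as\<close>.\<close>

lemma coeff_tilde_iv:
  assumes s: "hshape_iv D (as, ts)" and b: "n dvd sum_list (map (b_exp D) as)"
  shows "cyc_coeff (WG D hat) (tilde_iv D (as, ts) \<mu>) =
    wt as * of_nat (card {\<nu> \<in> {0..<n}. tilde_iv D (as, ts) \<nu> \<in> cyc_class (tilde_iv D (as, ts) \<mu>)})"
proof -
  let ?w = "tilde_iv D (as, ts) \<mu>"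
  let ?f = "\<lambda>h. \<Sum>\<mu> = 0..<n. ind ?w (tilde_iv D h \<mu>)"
  have cQ: "set as \<subseteq> arcs Q" using hshapeD(3)[OF hshape_ivD(1)[OF s]] .
  note hw = hshape_ivD(5)[OF s]
  have "cyc_coeff (WG D hat) ?w = (\<Sum>h\<in>hat ` cycles_iv D. wt (hword D h) * ?f h)"
    by (rule coeff_WG_iv) (use kinds_iv[OF s] in simp_all)
  also have "\<dots> = (if wt as = 0 then 0 else wt as * ?f (hat as))"
  proof (rule sum_hat[OF cycles_x_of(4) finite_cycles(4)])
    show "wt as \<noteq> 0 \<Longrightarrow> as \<in> cycles_iv D" using coeff_shape(4)[of as ts] s hw by simp
    fix h assume h: "h \<in> hat ` cycles_iv D" and nz: "?f h \<noteq> 0"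
    obtain as' ts' where h': "h = (as', ts')" "hshape_iv D (as', ts')" using hat_iv[OF h] .
    obtain \<nu> where "ind ?w (tilde_iv D h \<nu>) \<noteq> 0"
      using nz by (metis (no_types, lifting) sum.neutral)
    then have "tilde_iv D (as', ts') \<nu> \<in> cyc_class ?w" using h'(1) by (simp add: ind_def split: if_splits)
    then have as': "hword D h \<in> cyc_class as" using rotation_iv[OF s h'(2)] h'(1) hshape_ivD(5)[OF h'(2)] by simp
    then have "hword D h \<in> cyc_orbit D as"
      using in_cyc_orbit_iff[OF cQ] map_ga_0 by metis
    then show "hword D h \<in> cyc_orbit D as \<and> wt (hword D h) = wt as"
      using cyc_coeff_cyc_class[OF as'] by blast
  qed
  also have "\<dots> = wt as * ?f (as, ts)"
  proof (cases "wt as = 0")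
    case False
    then have cy: "as \<in> cycles_iv D" using coeff_shape(4)[of as ts] s hw by simp
    obtain as' ts' where h': "hat as = (as', ts')" "hshape_iv D (as', ts')" using hat_iv[OF imageI[OF cy]] .
    have "as' \<in> cyc_orbit D as" using hat_in_orbit[OF False] h'(1) hshape_ivD(5)[OF h'(2)] by simp
    then have "as' \<in> cyc_class as" using orbit_iv[OF hshape_ivD(6)[OF s]] by blast
    then show ?thesis using False h'(1) sum_ind_tilde_iv_rotate[OF b] by simp
  qed simp
  finally show ?thesis by (simp only: sum_ind finite_atLeastLessThan_int)
qed

end


section \<open>The dual action\<close>

lemma alg_ext_single:
  "alg_ext Q' f0 f1 (scal c (single q)) = scal c (path_image Q' f0 f1 q)"
proof (cases "c = 0")
  case True
  then show ?thesis by (simp add: alg_ext_def fun_eq_iff)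
next
  case False
  then have *: "{p. scal c (single q) p \<noteq> 0} = {q}" by (auto simp: scal_single_apply)
  show ?thesis
    unfolding alg_ext_def * by (rule ext) (simp add: scal_apply single_def)
qed

lemma dual_simps [simp]:
  "quiv (dual D hat) = QG D" "pot (dual D hat) = WG D hat" "act (dual D hat) = chi D"
  "gord (dual D hat) = gord D" "zeta (dual D hat) = zeta D"
  "free_reps (dual D hat) = (\<lambda>\<epsilon>. eta_mu D \<epsilon> 0) ` fix_reps D" "fix_reps (dual D hat) = eta D ` free_reps D"
  by (simp_all add: dual_def)

lemma inj_on_of_order:
  assumes "\<And>x. x \<in> A \<Longrightarrow> (f ^^ m) x = x" and "0 < m"
  shows "inj_on f A"
proof (rule inj_onI)
  fix x y assume "x \<in> A" "y \<in> A" "f x = f y"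
  moreover have "(f ^^ m) z = (f ^^ (m - 1)) (f z)" for z
    using assms(2) funpow_Suc_right[of "m - 1" f] by simp
  ultimately show "x = y" using assms(1) by metis
qed

context cyclic_datum
begin

lemma chi_skew_eta: "chi_skew D (eta D \<epsilon>) = eta D \<epsilon>"
proof
  fix i
  show "chi_skew D (eta D \<epsilon>) i = eta D \<epsilon> i"
    by (cases "i = 0") (simp_all add: chi_skew_def eta_def tensor_def scal_scal gpow_def)
qed

lemma zeta_idem: "zeta D ^ i * idem D \<mu> i = idem D (\<mu> + 1) i"
proof -
  have "zeta D powi (int i * (\<mu> + 1)) = zeta D powi (int i * \<mu>) * zeta D powi (int i)"
    by (simp only: distrib_left mult_1_right power_int_add[OF disjI1[OF zeta_nz]])
  then show ?thesis by (simp add: idem_def)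
qed

lemma chi_skew_eta_mu: "chi_skew D (eta_mu D \<epsilon> \<mu>) = eta_mu D \<epsilon> (\<mu> + 1)"
  by (rule ext) (simp add: chi_skew_def eta_mu_def tensor_def scal_scal zeta_idem)

lemma chi_skew_tilde1:
  assumes "\<alpha> \<in> arrows1 D"
  shows "chi_skew D (tilde1 D \<alpha>) = (\<lambda>i. scal (zeta D powi t_exp D \<alpha>) (tilde1 D \<alpha> i))"
proof
  fix i
  obtain \<epsilon> where t: "0 \<le> t_exp D \<alpha>" "t_exp D \<alpha> < n" using t_exp[OF assms] by blast
  show "chi_skew D (tilde1 D \<alpha>) i = scal (zeta D powi t_exp D \<alpha>) (tilde1 D \<alpha> i)"
    using t by (cases "i = nat (t_exp D \<alpha>)") (simp_all add: chi_skew_def tilde1_apply scal_scal gpow_at power_int_nonneg_exp)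
qed

lemma chi_skew_tilde:
  "\<alpha> \<in> arrows2 D \<Longrightarrow> chi_skew D (tilde2 D \<alpha> \<mu>) = tilde2 D \<alpha> (\<mu> + 1)"
  "chi_skew D (tilde3 D \<alpha> \<mu>) = tilde3 D \<alpha> (\<mu> + 1)"
  "chi_skew D (tilde4 D \<alpha> \<mu>) = tilde4 D \<alpha> (\<mu> + 1)"
  subgoal by (rule ext) (simp add: chi_skew_def tilde2_apply scal_scal zeta_idem)
  subgoal by (rule ext) (simp add: chi_skew_def tilde3_apply scal_scal zeta_idem)
  subgoal by (rule ext) (simp add: chi_skew_def tilde4_eq tilde3_apply scal_scal zeta_idem)
  done

lemma QG_arcs_tilde_any:
  assumes "x \<in> arcs (QG D)"
  obtains \<alpha> \<mu> where "\<alpha> \<in> arrows" "x = tilde_any \<alpha> \<mu>"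
proof -
  obtain s t where "QG_arrow D x s t" using assms by (auto simp: QG_def)
  from QG_arrow_tilde_any[OF this] show thesis using that by blast
qed

text \<open>\<open>chi_arrow\<close> is a definite description; injectivity of
  \<open>tilde_any\<close> up to nonzero scalars makes the arrow and the scalar in it
  unique.\<close>

lemma chi_arrowI:
  assumes y: "y \<in> arcs (QG D)" and s: "s \<noteq> 0" and x: "chi_skew D x = (\<lambda>i. scal s (y i))"
  shows "chi_arrow D x = scal s (arrow (QG D) y)"
  unfolding chi_arrow_def
proof (rule the_equality)
  show "\<exists>y'\<in>arcs (QG D). \<exists>r. chi_skew D x = (\<lambda>i. scal r (y' i)) \<and> scal s (arrow (QG D) y) = scal r (arrow (QG D) y')"
    using y x by blast
next
  fix z assume "\<exists>y\<in>arcs (QG D). \<exists>r. chi_skew D x = (\<lambda>i. scal r (y i)) \<and> z = scal r (arrow (QG D) y)"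
  then obtain y' r where y': "y' \<in> arcs (QG D)" "chi_skew D x = (\<lambda>i. scal r (y' i))" "z = scal r (arrow (QG D) y')"
    by blast
  obtain \<alpha> \<mu> where a: "\<alpha> \<in> arrows" "y = tilde_any \<alpha> \<mu>" using QG_arcs_tilde_any[OF y] .
  obtain \<beta> \<nu> where b: "\<beta> \<in> arrows" "y' = tilde_any \<beta> \<nu>" using QG_arcs_tilde_any[OF y'(1)] .
  have "(\<lambda>i. scal s (tilde_any \<alpha> \<mu> i)) = (\<lambda>i. scal r (tilde_any \<beta> \<nu> i))"
    using x y'(2) a(2) b(2) by simp
  from tilde_any_scal_inj[OF a(1) b(1) s this]
  have e: "s = r" "\<alpha> = \<beta>" "\<alpha> \<notin> arrows1 D \<Longrightarrow> \<mu> mod n = \<nu> mod n" by simp_all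
  have "tilde_any \<alpha> \<mu> = tilde_any \<alpha> \<nu>"
  proof (cases "\<alpha> \<in> arrows1 D")
    case False
    then show ?thesis using tilde_cong[OF e(3)] unfolding tilde_any_def by simp
  qed (simp add: tilde_any_def)
  then show "z = scal s (arrow (QG D) y)" using y'(3) e(1,2) a(2) b(2) by simp
qed

lemma chi_vertex: "chi D (vertex \<eta>) = vertex (chi_skew D \<eta>)"
  using alg_ext_single[of "QG D" "\<lambda>\<eta>. vertex (chi_skew D \<eta>)" "chi_arrow D" 1 "(\<eta>, [], \<eta>)"]
  by (simp add: chi_def vertex_def path_image_def)

text \<open>The extension multiplies the image of the arrow by the image of the vertex at its tail;
  the assumption on tails keeps this product from vanishing.\<close>

lemma chi_arrow_act:
  assumes x: "x \<in> arcs (QG D)" and y: "y \<in> arcs (QG D)" and s: "s \<noteq> 0" and xy: "chi_skew D x = (\<lambda>i. scal s (y i))"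
    and t: "tail (QG D) y = chi_skew D (tail (QG D) x)"
  shows "chi D (scal c (arrow (QG D) x)) = scal (c * s) (arrow (QG D) y)"
proof -
  have v: "chi_skew D (tail (QG D) x) \<in> verts (QG D)"
    using wf_digraph.tail_in_verts[OF wf_QG y] t by simp
  have "pmult (QG D) (scal s (arrow (QG D) y)) (vertex (chi_skew D (tail (QG D) x))) = scal s (arrow (QG D) y)"
    using pmult_arrow_vertex(1)[OF wf_QG y v, of s] t by simp
  then show ?thesis
    unfolding chi_def arrow_def[of _ x] alg_ext_single
    by (simp add: path_image_def chi_arrowI[OF y s xy] scal_scal)
qed

end

section \<open>The dual group on vertices and arrows of the first quiver\<close>

context cyclic_datum_hat
begin

abbreviation "E \<equiv> dual D hat"

lemma star_v_E:
  assumes "chi_skew D \<eta> \<in> verts (QG D)"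
  shows "star_v E \<eta> = chi_skew D \<eta>"
  unfolding star_v_def
proof (rule the_equality)
  show "chi_skew D \<eta> \<in> verts (quiv E) \<and> act E (vertex \<eta>) = vertex (chi_skew D \<eta>)"
    using assms by (simp add: chi_vertex)
  fix w assume "w \<in> verts (quiv E) \<and> act E (vertex \<eta>) = vertex w"
  then show "w = chi_skew D \<eta>" by (simp add: chi_vertex vertex_inj)
qed

lemma star_v_E_eta: "\<epsilon> \<in> Fr \<Longrightarrow> star_v E (eta D \<epsilon>) = eta D \<epsilon>"
  using star_v_E[of "eta D \<epsilon>"] by (simp add: chi_skew_eta eta_in_QG)

lemma star_v_E_eta_mu: "\<epsilon> \<in> Fx \<Longrightarrow> star_v E (eta_mu D \<epsilon> \<mu>) = eta_mu D \<epsilon> (\<mu> + 1)"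
  using star_v_E[of "eta_mu D \<epsilon> \<mu>"] by (simp add: chi_skew_eta_mu eta_mu_in_QG)

lemma star_a_E:
  assumes y: "y \<in> arcs (QG D)" and s: "s \<noteq> 0" and a: "chi D (arrow (QG D) x) = scal s (arrow (QG D) y)"
  shows "star_a E x = y"
  unfolding star_a_def
proof (rule the_equality)
  show "y \<in> arcs (quiv E) \<and> (\<exists>r. act E (arrow (quiv E) x) = scal r (arrow (quiv E) y))"
    using y a by auto
  fix \<beta> assume "\<beta> \<in> arcs (quiv E) \<and> (\<exists>r. act E (arrow (quiv E) x) = scal r (arrow (quiv E) \<beta>))"
  then show "\<beta> = y" using a s by (auto simp: arrow_eq_iff)
qed

lemma chi_tilde1:
  assumes "\<alpha> \<in> arrows1 D"
  shows "chi D (scal c (arrow (QG D) (tilde1 D \<alpha>))) = scal (c * zeta D powi t_exp D \<alpha>) (arrow (QG D) (tilde1 D \<alpha>))"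
    "star_a E (tilde1 D \<alpha>) = tilde1 D \<alpha>"
proof -
  obtain \<epsilon> where "\<epsilon> \<in> Fr" "tail Q \<alpha> = gv D (t_exp D \<alpha>) \<epsilon>" using t_exp[OF assms] by blast
  then have "tail (QG D) (tilde1 D \<alpha>) = eta D \<epsilon>" by (rule QG_tilde1(3)[OF assms])
  then have t: "tail (QG D) (tilde1 D \<alpha>) = chi_skew D (tail (QG D) (tilde1 D \<alpha>))" by (simp add: chi_skew_eta)
  have z: "zeta D powi t_exp D \<alpha> \<noteq> 0" using zeta_nz by simp
  note a = QG_tilde1(1)[OF assms]
  show c: "chi D (scal c (arrow (QG D) (tilde1 D \<alpha>))) = scal (c * zeta D powi t_exp D \<alpha>) (arrow (QG D) (tilde1 D \<alpha>))" for c
    by (rule chi_arrow_act[OF a a z chi_skew_tilde1[OF assms] t])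
  show "star_a E (tilde1 D \<alpha>) = tilde1 D \<alpha>"
    by (rule star_a_E[OF a z]) (use c[of 1] in simp)
qed

lemma chi_tilde_other:
  assumes x: "x \<in> arcs (QG D)" and y: "y \<in> arcs (QG D)" and xy: "chi_skew D x = y"
    and t: "tail (QG D) y = chi_skew D (tail (QG D) x)"
  shows "chi D (scal c (arrow (QG D) x)) = scal c (arrow (QG D) y)" "star_a E x = y"
proof -
  have xy': "chi_skew D x = (\<lambda>i. scal 1 (y i))" using xy by simp
  show c: "chi D (scal c (arrow (QG D) x)) = scal c (arrow (QG D) y)" for c
    using chi_arrow_act[OF x y _ xy' t, of c] by simp
  show "star_a E x = y"
    by (rule star_a_E[OF y, of 1]) (use c[of 1] in simp_all)
qed

lemma chi_tilde2:
  assumes "\<alpha> \<in> arrows2 D"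
  shows "chi D (scal c (arrow (QG D) (tilde2 D \<alpha> \<mu>))) = scal c (arrow (QG D) (tilde2 D \<alpha> (\<mu> + 1)))"
    "star_a E (tilde2 D \<alpha> \<mu>) = tilde2 D \<alpha> (\<mu> + 1)"
  by (intro chi_tilde_other; simp add: QG_tilde2[OF assms] chi_skew_tilde(1)[OF assms] chi_skew_eta)+

lemma chi_tilde3:
  assumes "\<alpha> \<in> arrows3 D"
  shows "chi D (scal c (arrow (QG D) (tilde3 D \<alpha> \<mu>))) = scal c (arrow (QG D) (tilde3 D \<alpha> (\<mu> + 1)))"
    "star_a E (tilde3 D \<alpha> \<mu>) = tilde3 D \<alpha> (\<mu> + 1)"
  by (intro chi_tilde_other; simp add: QG_tilde3[OF assms] chi_skew_tilde(2) chi_skew_eta_mu)+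

lemma chi_tilde4:
  assumes "\<alpha> \<in> arrows4 D"
  shows "chi D (scal c (arrow (QG D) (tilde4 D \<alpha> \<mu>))) = scal c (arrow (QG D) (tilde4 D \<alpha> (\<mu> + 1)))"
    "star_a E (tilde4 D \<alpha> \<mu>) = tilde4 D \<alpha> (\<mu> + 1)"
  by (intro chi_tilde_other; simp add: QG_tilde4[OF assms] chi_skew_tilde(3) chi_skew_eta_mu)+

lemma star_E_pow:
  "\<epsilon> \<in> Fr \<Longrightarrow> (star_v E ^^ i) (eta D \<epsilon>) = eta D \<epsilon>"
  "\<epsilon> \<in> Fx \<Longrightarrow> (star_v E ^^ i) (eta_mu D \<epsilon> \<mu>) = eta_mu D \<epsilon> (\<mu> + int i)"
  "\<alpha> \<in> arrows1 D \<Longrightarrow> (star_a E ^^ i) (tilde1 D \<alpha>) = tilde1 D \<alpha>"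
  "\<alpha> \<in> arrows2 D \<Longrightarrow> (star_a E ^^ i) (tilde2 D \<alpha> \<mu>) = tilde2 D \<alpha> (\<mu> + int i)"
  "\<alpha> \<in> arrows3 D \<Longrightarrow> (star_a E ^^ i) (tilde3 D \<alpha> \<mu>) = tilde3 D \<alpha> (\<mu> + int i)"
  "\<alpha> \<in> arrows4 D \<Longrightarrow> (star_a E ^^ i) (tilde4 D \<alpha> \<mu>) = tilde4 D \<alpha> (\<mu> + int i)"
  by (induction i)
    (simp_all add: star_v_E_eta star_v_E_eta_mu chi_tilde1 chi_tilde2 chi_tilde3 chi_tilde4 algebra_simps)

lemma mod_nat_mod: "(\<mu> + int (nat (t mod n))) mod n = (\<mu> + t) mod n"
  using n_pos by (simp add: mod_simps)

lemma g_E: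
  "\<epsilon> \<in> Fr \<Longrightarrow> gv E t (eta D \<epsilon>) = eta D \<epsilon>"
  "\<epsilon> \<in> Fx \<Longrightarrow> gv E t (eta_mu D \<epsilon> \<mu>) = eta_mu D \<epsilon> (\<mu> + t)"
  "\<alpha> \<in> arrows1 D \<Longrightarrow> ga E t (tilde1 D \<alpha>) = tilde1 D \<alpha>"
  "\<alpha> \<in> arrows2 D \<Longrightarrow> ga E t (tilde2 D \<alpha> \<mu>) = tilde2 D \<alpha> (\<mu> + t)"
  "\<alpha> \<in> arrows3 D \<Longrightarrow> ga E t (tilde3 D \<alpha> \<mu>) = tilde3 D \<alpha> (\<mu> + t)"
  "\<alpha> \<in> arrows4 D \<Longrightarrow> ga E t (tilde4 D \<alpha> \<mu>) = tilde4 D \<alpha> (\<mu> + t)"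
  unfolding gv_def ga_def dual_simps
  by (simp_all only: star_E_pow tilde_cong[OF mod_nat_mod])

lemma ends_E:
  "\<epsilon> \<in> Fx \<Longrightarrow> eta_mu D \<epsilon> \<mu> \<notin> fix_reps E"
  "\<epsilon> \<in> Fr \<Longrightarrow> eta D \<epsilon> \<in> fix_reps E"
  "\<alpha> \<in> arrows1 D \<Longrightarrow> tail (QG D) (tilde1 D \<alpha>) \<in> fix_reps E \<and> head (QG D) (tilde1 D \<alpha>) \<in> fix_reps E"
  "\<alpha> \<in> arrows2 D \<Longrightarrow> tail (QG D) (tilde2 D \<alpha> \<mu>) \<in> fix_reps E \<and> head (QG D) (tilde2 D \<alpha> \<mu>) \<notin> fix_reps E"
  "\<alpha> \<in> arrows3 D \<Longrightarrow> tail (QG D) (tilde3 D \<alpha> \<mu>) \<notin> fix_reps E \<and> head (QG D) (tilde3 D \<alpha> \<mu>) \<in> fix_reps E"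
  "\<alpha> \<in> arrows4 D \<Longrightarrow> tail (QG D) (tilde4 D \<alpha> \<mu>) \<notin> fix_reps E \<and> head (QG D) (tilde4 D \<alpha> \<mu>) \<notin> fix_reps E"
proof -
  show 1: "\<epsilon> \<in> Fx \<Longrightarrow> eta_mu D \<epsilon> \<mu> \<notin> fix_reps E" for \<epsilon> \<mu>
    using eta_neq_eta_mu by (auto simp del: eta_def eta_mu_def) metis
  show 2: "\<epsilon> \<in> Fr \<Longrightarrow> eta D \<epsilon> \<in> fix_reps E" for \<epsilon> by simp
  show "tail (QG D) (tilde1 D \<alpha>) \<in> fix_reps E \<and> head (QG D) (tilde1 D \<alpha>) \<in> fix_reps E" if a: "\<alpha> \<in> arrows1 D"
  proof -
    obtain \<epsilon> where e: "\<epsilon> \<in> Fr" "tail Q \<alpha> = gv D (t_exp D \<alpha>) \<epsilon>" using t_exp[OF a] by blast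
    show ?thesis
      unfolding QG_tilde1(2)[OF a] QG_tilde1(3)[OF a e] using 2[OF e(1)] 2[OF arrows_reps(1)[OF a]] by blast
  qed
  show "\<alpha> \<in> arrows2 D \<Longrightarrow> tail (QG D) (tilde2 D \<alpha> \<mu>) \<in> fix_reps E \<and> head (QG D) (tilde2 D \<alpha> \<mu>) \<notin> fix_reps E"
    using 1 2 arrows_reps(2)[of \<alpha>] by (simp only: QG_tilde2) blast
  show "\<alpha> \<in> arrows3 D \<Longrightarrow> tail (QG D) (tilde3 D \<alpha> \<mu>) \<notin> fix_reps E \<and> head (QG D) (tilde3 D \<alpha> \<mu>) \<in> fix_reps E"
    using 1 2 arrows_reps(3)[of \<alpha>] by (simp only: QG_tilde3) blast
  show "\<alpha> \<in> arrows4 D \<Longrightarrow> tail (QG D) (tilde4 D \<alpha> \<mu>) \<notin> fix_reps E \<and> head (QG D) (tilde4 D \<alpha> \<mu>) \<notin> fix_reps E"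
    using 1 arrows_reps(4)[of \<alpha>] by (simp only: QG_tilde4) blast
qed

lemma kinds_cases:
  assumes "x \<in> arcs (QG D)"
  shows "kind1 x \<or> kind2 x \<or> kind3 x \<or> kind4 x"
  using assms by (cases rule: QG_arcs_cases) (simp_all add: kinds_tilde)

lemma kinds_head_E:
  "kind1 x \<Longrightarrow> head (QG D) x \<in> fix_reps E" "kind2 x \<Longrightarrow> head (QG D) x \<notin> fix_reps E"
  "kind3 x \<Longrightarrow> head (QG D) x \<in> fix_reps E" "kind4 x \<Longrightarrow> head (QG D) x \<notin> fix_reps E"
  unfolding kind1_def kind2_def kind3_def kind4_def using ends_E by blast+

text \<open>\<open>\<chi>\<close> scales \<open>\<alpha> \<otimes> g^t\<close> by
  \<open>\<zeta>^t\<close>, so the exponent \<open>t\<close> of the original becomes the exponent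
  \<open>b\<close> of the dual.\<close>

lemma b_exp_E:
  assumes "\<alpha> \<in> arrows1 D"
  shows "b_exp E (tilde1 D \<alpha>) = t_exp D \<alpha>"
  unfolding b_exp_def
proof (rule the_equality)
  have c: "act E (arrow (quiv E) (tilde1 D \<alpha>)) = scal (zeta D powi t_exp D \<alpha>) (arrow (QG D) (tilde1 D \<alpha>))"
    using chi_tilde1(1)[OF assms, of 1] by simp
  obtain \<epsilon> where t: "0 \<le> t_exp D \<alpha>" "t_exp D \<alpha> < n" using t_exp[OF assms] by blast
  then show "0 \<le> t_exp D \<alpha> \<and> t_exp D \<alpha> < int (gord E) \<and>
     act E (arrow (quiv E) (tilde1 D \<alpha>)) = scal (zeta E powi t_exp D \<alpha>) (arrow (quiv E) (tilde1 D \<alpha>))"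
    using c by simp
  fix b assume b: "0 \<le> b \<and> b < int (gord E) \<and>
     act E (arrow (quiv E) (tilde1 D \<alpha>)) = scal (zeta E powi b) (arrow (quiv E) (tilde1 D \<alpha>))"
  then have "scal (zeta D powi b) (arrow (QG D) (tilde1 D \<alpha>)) = scal (zeta D powi t_exp D \<alpha>) (arrow (QG D) (tilde1 D \<alpha>))"
    using c by simp
  then have "b mod n = t_exp D \<alpha> mod n" using zeta_nz by (simp add: arrow_eq_iff zeta_powi_eq_iff)
  then show "b = t_exp D \<alpha>" using b t by simp
qed

section \<open>Invariance of the first potential and the axioms for the dual datum\<close>

lemma star_a_E_in: "x \<in> arcs (QG D) \<Longrightarrow> star_a E x \<in> arcs (QG D)"
  by (erule QG_arcs_cases)
    (simp_all add: chi_tilde1(2) chi_tilde2(2) chi_tilde3(2) chi_tilde4(2) QG_tilde1(1) QG_tilde2(1) QG_tilde3(1) QG_tilde4(1))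

lemma star_a_E_order: "x \<in> arcs (QG D) \<Longrightarrow> (star_a E ^^ gord D) x = x"
  by (erule QG_arcs_cases) (simp_all add: star_E_pow tilde_cong[of "_ + n" _])

lemma star_a_E_inj: "inj_on (star_a E) (arcs (QG D))"
  by (rule inj_on_of_order[OF star_a_E_order gord_pos])

lemma star_a_E_tilde_iv:
  assumes "hshape_iv D (as, ts)"
  shows "map (star_a E) (tilde_iv D (as, ts) \<mu>) = tilde_iv D (as, ts) (\<mu> + 1)"
  by (rule nth_equalityI)
    (simp_all add: nth_tilde_iv chi_tilde4(2)[OF hshape_ivD(3)[OF assms]] algebra_simps)

text \<open>Targets outside the dual fixed vertices leave only letters of kind 2 and 4. If kind 2
  occurs the coefficient is 0, since every type (iii) word also has a letter of kind 3. Otherwise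
  only type (iv) words matter; on them \<open>\<chi>\<close> shifts the index by one, which the sum
  over all indices absorbs.\<close>

lemma coeff_WG_star:
  assumes w: "set w \<subseteq> arcs (QG D)" and hd: "\<And>x. x \<in> set w \<Longrightarrow> head (QG D) x \<notin> fix_reps E"
  shows "cyc_coeff (WG D hat) (map (star_a E) w) = cyc_coeff (WG D hat) w"
proof -
  have k: "kind2 x \<or> kind4 x" if "x \<in> set w" for x
    using that w kinds_cases[of x] kinds_head_E hd by blast
  have k2: "kind2 (star_a E x)" if "kind2 x" for x
  proof -
    obtain \<alpha> \<mu> where "\<alpha> \<in> arrows2 D" "x = tilde2 D \<alpha> \<mu>" using \<open>kind2 x\<close> unfolding kind2_def by blast
    then show ?thesis by (simp add: chi_tilde2(2) kinds_tilde)
  qed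
  have k4: "kind4 (star_a E x)" if "kind4 x" for x
  proof -
    obtain \<alpha> \<mu> where "\<alpha> \<in> arrows4 D" "x = tilde4 D \<alpha> \<mu>" using \<open>kind4 x\<close> unfolding kind4_def by blast
    then show ?thesis by (simp add: chi_tilde4(2) kinds_tilde)
  qed
  have k': "kind2 x \<or> kind4 x" if "x \<in> set (map (star_a E) w)" for x
    using that k k2 k4 by auto
  have h1: "\<not> has1 w" "\<not> has1 (map (star_a E) w)"
    unfolding has1_def using k k' kinds_disjoint by blast+
  show ?thesis
  proof (cases "has2 w")
    case True
    then have h2: "has2 (map (star_a E) w)" unfolding has2_def using k2 by auto
    have z: "cyc_coeff (WG D hat) v = 0" if v: "\<And>x. x \<in> set v \<Longrightarrow> kind2 x \<or> kind4 x" "\<not> has1 v" "has2 v" for v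
    proof -
      have "ind v (tilde_iii D h \<mu>) = 0" if h: "h \<in> hat ` cycles_iii D" for h \<mu>
      proof -
        obtain as ts where h': "h = (as, ts)" "hshape_iii D (as, ts)" "3 \<le> length as" using hat_iii[OF h] .
        have "1 < length (tilde_iii D (as, ts) \<mu>)"
          using h'(3) length_tilde_iii[OF hshape_iiiD(2)[OF h'(2)]] by simp
        then have "tilde_iii D h \<mu> ! 1 \<in> set (tilde_iii D h \<mu>)" using h'(1) by simp
        moreover have "kind3 (tilde_iii D h \<mu> ! 1)" using kinds_iii(5)[OF h'(2,3)] h'(1) by simp
        ultimately have "\<not> tilde_iii D h \<mu> \<in> cyc_class v"
          using v(1) kinds_disjoint cyc_class_set by blast
        then show ?thesis by (simp add: ind_def)
      qed
      then show ?thesis unfolding coeff_WG_iii[OF v(2,3)] by simp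
    qed
    show ?thesis using z[OF k h1(1) True] z[OF k' h1(2) h2] by simp
  next
    case False
    have k4w: "kind4 x" if "x \<in> set w" for x using k[OF that] False that unfolding has2_def by blast
    have h2: "\<not> has2 (map (star_a E) w)"
      unfolding has2_def using k4w k4 kinds_disjoint(5) by auto
    have eq: "(\<Sum>\<mu> = 0..<n. ind (map (star_a E) w) (tilde_iv D h \<mu>)) = (\<Sum>\<mu> = 0..<n. ind w (tilde_iv D h \<mu>))"
      if h: "h \<in> hat ` cycles_iv D" for h
    proof -
      obtain as ts where h': "h = (as, ts)" "hshape_iv D (as, ts)" "n dvd sum_list (map (b_exp D) as)"
        using hat_iv[OF h] by blast
      have arcs: "set (tilde_iv D h \<mu>) \<subseteq> arcs (QG D)" for \<mu>
        using closed_tilde_iv[OF h'(2,3)] h'(1) unfolding closed_word_def by blast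
      have "ind (map (star_a E) w) (tilde_iv D h (\<mu> + 1)) = ind w (tilde_iv D h \<mu>)" for \<mu>
        using map_in_cyc_class_iff[OF star_a_E_inj w arcs[of \<mu>]] star_a_E_tilde_iv[OF h'(2), of \<mu>] h'(1)
        unfolding ind_def by simp
      then have "(\<Sum>\<mu> = 0..<n. ind w (tilde_iv D h \<mu>)) = (\<Sum>\<mu> = 0..<n. ind (map (star_a E) w) (tilde_iv D h (\<mu> + 1)))"
        by simp
      also have "\<dots> = (\<Sum>\<mu> = 0..<n. ind (map (star_a E) w) (tilde_iv D h \<mu>))"
      proof (rule sum_periodic_shift[OF n_pos])
        show "ind (map (star_a E) w) (tilde_iv D h (\<mu> mod n)) = ind (map (star_a E) w) (tilde_iv D h \<mu>)" for \<mu>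
          unfolding h'(1) tilde_iv_lift4[OF h'(3)] by (rule arg_cong[OF lift4_cong]) simp
      qed
      finally show ?thesis by simp
    qed
    show ?thesis
      unfolding coeff_WG_iv[OF h1(1) False] coeff_WG_iv[OF h1(2) h2]
      by (rule sum.cong[OF refl]) (simp add: eq)
  qed
qed

text \<open>Such a word comes from type (i), where the dual exponents \<open>b\<close> are the
  original exponents \<open>t\<close>; their sum is divisible because the original cycle closes
  up.\<close>

lemma words_fix_E:
  assumes d: "d \<in> words" and hd: "\<And>x. x \<in> set d \<Longrightarrow> head (QG D) x \<in> fix_reps E"
  shows "n dvd sum_list (map (b_exp E) d)"
proof -
  have h2: "\<not> has2 d" unfolding has2_def using hd kinds_head_E by blast
  have "d \<noteq> []" using closed_words[OF d] by (simp add: closed_word_def)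
  then have h4: "\<not> kind4 (hd d)" using hd kinds_head_E(4) by (meson hd_in_set)
  from d show ?thesis
  proof (cases d rule: words_cases)
    case (i h)
    obtain as ts where h: "h = (as, ts)" "hshape_i D (as, ts)" "n dvd sum_list ts" using hat_i[OF i(1)] by blast
    have "map (b_exp E) d = map (t_exp D) as"
    proof (rule nth_equalityI)
      fix j assume "j < length (map (b_exp E) d)"
      then have "j < length as" using i(2) h(1) by simp
      then show "map (b_exp E) d ! j = map (t_exp D) as ! j"
        using i(2) h(1) b_exp_E[OF hshape_iD(3)[OF h(2)]] by (simp add: nth_tilde_i)
    qed (use i(2) h(1) in simp)
    then show ?thesis using hword_lift(2)[OF h(2)] h(3) by simp
  next
    case (ii h \<mu>)
    then show ?thesis using kinds_hat_ii h2 by blast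
  next
    case (iii h \<mu>)
    then show ?thesis using kinds_hat_iii h2 by blast
  next
    case (iv h \<mu>)
    obtain as ts where h: "h = (as, ts)" "hshape_iv D (as, ts)" using hat_iv[OF iv(1)] by blast
    have "kind4 (hd d)" using kinds_iv(1)[OF h(2), of "hd d" \<mu>] \<open>d \<noteq> []\<close> iv(3) h(1) by simp
    then show ?thesis using h4 by blast
  qed
qed

text \<open>The passage which makes the coefficient formulas available a second time. The two
  assumptions on invariance are supplied by \<open>coeff_WG_star\<close> and
  \<open>words_fix_E\<close>.\<close>

theorem cyclic_datum_dual: "cyclic_datum E"
proof
  show "0 < gord E" using gord_pos by simp
  show "zeta E ^ gord E = 1" using zeta_pow_gord by simp
  show "zeta E ^ m \<noteq> 1" if "0 < m" "m < gord E" for m using zeta_primitive that by simp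
  have "wf_digraph (quiv E)" using wf_QG by simp
  then show "\<And>e. e \<in> arcs (quiv E) \<Longrightarrow> tail (quiv E) e \<in> verts (quiv E)"
    "\<And>e. e \<in> arcs (quiv E) \<Longrightarrow> head (quiv E) e \<in> verts (quiv E)" by (simp_all add: wf_digraph_def)
next
  fix v assume "v \<in> verts (quiv E)"
  then have v: "v \<in> verts (QG D)" by simp
  then show "star_v E v \<in> verts (quiv E)" "(star_v E ^^ gord E) v = v"
    by (cases rule: QG_verts_cases;
        simp add: star_v_E_eta star_v_E_eta_mu eta_in_QG eta_mu_in_QG star_E_pow eta_mu_eq_iff)+
  show "\<exists>t. \<exists>\<epsilon>\<in>free_reps E. v = gv E t \<epsilon>" if "v \<notin> fix_reps E"
    using v
  proof (cases rule: QG_verts_cases)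
    case (eta_mu \<epsilon> \<mu>)
    then have "v = gv E \<mu> (eta_mu D \<epsilon> 0)" by (simp add: g_E)
    then show ?thesis using eta_mu(1) by auto
  qed (use that in simp)
next
  fix x assume "x \<in> arcs (quiv E)"
  then have x: "x \<in> arcs (QG D)" by simp
  show "star_a E x \<in> arcs (quiv E)" "(star_a E ^^ gord E) x = x"
    using star_a_E_in[OF x] star_a_E_order[OF x] by simp_all
  have "tail (QG D) (star_a E x) = star_v E (tail (QG D) x) \<and> head (QG D) (star_a E x) = star_v E (head (QG D) x)"
    using x
  proof (cases rule: QG_arcs_cases)
    case (1 \<alpha>)
    obtain \<epsilon> where e: "\<epsilon> \<in> Fr" "tail Q \<alpha> = gv D (t_exp D \<alpha>) \<epsilon>" using t_exp[OF 1(1)] by blast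
    show ?thesis
      unfolding 1(2) chi_tilde1(2)[OF 1(1)] QG_tilde1(2)[OF 1(1)] QG_tilde1(3)[OF 1(1) e]
      using e(1) arrows_reps(1)[OF 1(1)] by (simp add: star_v_E_eta)
  next
    case (2 \<alpha> \<mu>)
    then show ?thesis
      by (simp add: chi_tilde2(2) QG_tilde2 star_v_E_eta star_v_E_eta_mu arrows_reps)
  next
    case (3 \<alpha> \<mu>)
    then show ?thesis
      by (simp add: chi_tilde3(2) QG_tilde3 star_v_E_eta star_v_E_eta_mu arrows_reps)
  next
    case (4 \<alpha> \<mu>)
    then show ?thesis
      by (simp add: chi_tilde4(2) QG_tilde4 star_v_E_eta_mu arrows_reps algebra_simps)
  qed
  then show "tail (quiv E) (star_a E x) = star_v E (tail (quiv E) x)"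
    "head (quiv E) (star_a E x) = star_v E (head (quiv E) x)" by simp_all
  show "act E (scal c (arrow (quiv E) x)) = scal c (arrow (quiv E) (star_a E x))"
    if "tail (quiv E) x \<notin> fix_reps E \<or> head (quiv E) x \<notin> fix_reps E" for c
    using x
  proof (cases rule: QG_arcs_cases)
    case (1 \<alpha>)
    then show ?thesis using that ends_E(3)[OF 1(1)] unfolding dual_simps(1) by blast
  next
    case (2 \<alpha> \<mu>)
    then show ?thesis by (simp add: chi_tilde2)
  next
    case (3 \<alpha> \<mu>)
    then show ?thesis by (simp add: chi_tilde3)
  next
    case (4 \<alpha> \<mu>)
    then show ?thesis by (simp add: chi_tilde4)
  qed
  show "star_a E x = x \<and> (\<exists>b::int. act E (arrow (quiv E) x) = scal (zeta E powi b) (arrow (quiv E) x))"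
    if "tail (quiv E) x \<in> fix_reps E" "head (quiv E) x \<in> fix_reps E"
    using x
  proof (cases rule: QG_arcs_cases)
    case (1 \<alpha>)
    then show ?thesis using chi_tilde1(1)[OF 1(1), of 1] chi_tilde1(2)[OF 1(1)] by auto
  next
    case (2 \<alpha> \<mu>)
    then show ?thesis using that ends_E(4)[OF 2(1)] unfolding dual_simps(1) by blast
  next
    case (3 \<alpha> \<mu>)
    then show ?thesis using that ends_E(5)[OF 3(1)] unfolding dual_simps(1) by blast
  next
    case (4 \<alpha> \<mu>)
    then show ?thesis using that ends_E(6)[OF 4(1)] unfolding dual_simps(1) by blast
  qed
next
  show "free_reps E \<subseteq> verts (quiv E)" "fix_reps E \<subseteq> verts (quiv E)"
    using eta_in_QG eta_mu_in_QG by auto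
  show "\<And>v. v \<in> fix_reps E \<Longrightarrow> star_v E v = v" by (auto simp: star_v_E_eta)
next
  fix \<epsilon> \<epsilon>' s t assume "\<epsilon> \<in> free_reps E" "\<epsilon>' \<in> free_reps E" and e: "gv E s \<epsilon> = gv E t \<epsilon>'"
  then obtain \<delta> \<delta>' where d: "\<delta> \<in> Fx" "\<epsilon> = eta_mu D \<delta> 0" "\<delta>' \<in> Fx" "\<epsilon>' = eta_mu D \<delta>' 0" by auto
  then have "eta_mu D \<delta> s = eta_mu D \<delta>' t" using e by (simp add: g_E)
  then show "\<epsilon> = \<epsilon>' \<and> s mod int (gord E) = t mod int (gord E)" using d by (simp add: eta_mu_eq_iff)
next
  show "gv E t \<epsilon> \<notin> fix_reps E" if e: "\<epsilon> \<in> free_reps E" for \<epsilon> t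
  proof -
    obtain \<delta> where "\<delta> \<in> Fx" "\<epsilon> = eta_mu D \<delta> 0" using e by auto
    then show ?thesis using ends_E(1) by (simp only: g_E) simp
  qed
  show "finite {p. pot E p \<noteq> 0}" using finite_WG by simp
  show "canonical (quiv E) (pot E)" using canonical_WG by simp
  show "(head (quiv E) (hd c), c, head (quiv E) (hd c)) \<in> paths (quiv E) \<and> 3 \<le> length c"
    if c: "cyc_coeff (pot E) c \<noteq> 0" for c
  proof -
    obtain d where d: "d \<in> words" "c \<in> cyc_class d" using coeff_WG_nonzero[of c] c by auto
    then have "closed_word (QG D) c" "3 \<le> length c"
      using closed_words[OF d(1)] closed_word_cyc_class[OF d(2), of "QG D"] cyc_class_length[OF d(2)] by simp_all
    then show ?thesis unfolding closed_word_path[OF wf_QG] by simp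
  qed
  show "cyc_coeff (pot E) (map (star_a E) c) = cyc_coeff (pot E) c"
    if "set c \<subseteq> arcs (quiv E)" "\<And>\<alpha>. \<alpha> \<in> set c \<Longrightarrow> head (quiv E) \<alpha> \<notin> fix_reps E" for c
    using coeff_WG_star[of c] that by (simp del: dual_simps(7))
  show "int (gord E) dvd sum_list (map (b_exp E) c)"
    if c: "cyc_coeff (pot E) c \<noteq> 0" and hd: "\<And>\<alpha>. \<alpha> \<in> set c \<Longrightarrow> head (quiv E) \<alpha> \<in> fix_reps E" for c
  proof -
    obtain d where d: "d \<in> words" "c \<in> cyc_class d" using coeff_WG_nonzero[of c] c by auto
    then have "n dvd sum_list (map (b_exp E) d)"
      using words_fix_E[OF d(1)] hd cyc_class_set[OF d(2)] by (simp del: dual_simps(7))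
    then show ?thesis using sum_list_cyc_class[OF d(2), of "b_exp E"] by simp
  qed
qed

text \<open>The index of an arrow is normalised by requiring its non-fixed end to be the
  representative \<open>eta_mu D \<epsilon> 0\<close>. An arrow of type (4) ends at index
  \<open>\<mu> - b(\<alpha>)\<close>, which explains the index \<open>b(\<alpha>)\<close> in the
  last line.\<close>

lemma arrows_E:
  "x \<in> arrows4 E \<longleftrightarrow> (\<exists>\<alpha> \<in> arrows1 D. x = tilde1 D \<alpha>)"
  "x \<in> arrows3 E \<longleftrightarrow> (\<exists>\<alpha> \<in> arrows2 D. x = tilde2 D \<alpha> 0)"
  "x \<in> arrows2 E \<longleftrightarrow> (\<exists>\<alpha> \<in> arrows3 D. x = tilde3 D \<alpha> 0)"
  "x \<in> arrows1 E \<longleftrightarrow> (\<exists>\<alpha> \<in> arrows4 D. x = tilde4 D \<alpha> (b_exp D \<alpha>))"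
proof -
  have eta_free: "eta_mu D \<epsilon> \<mu> \<in> free_reps E \<longleftrightarrow> \<mu> mod n = 0" if "\<epsilon> \<in> Fx" for \<epsilon> \<mu>
    using that by (auto simp: eta_mu_eq_iff)
  have eta_not_free: "eta D \<epsilon> \<notin> free_reps E" if "\<epsilon> \<in> Fr" for \<epsilon>
    using eta_neq_eta_mu[OF that] by (metis (no_types, lifting) dual_simps(6) imageE)
  have free_not: "\<eta> \<notin> fix_reps E" if "\<eta> \<in> free_reps E" for \<eta>
  proof -
    obtain \<epsilon> where "\<epsilon> \<in> Fx" "\<eta> = eta_mu D \<epsilon> 0" using \<open>\<eta> \<in> free_reps E\<close> by auto
    then show ?thesis using ends_E(1) by blast
  qed
  show "x \<in> arrows4 E \<longleftrightarrow> (\<exists>\<alpha> \<in> arrows1 D. x = tilde1 D \<alpha>)"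
  proof
    assume x: "x \<in> arrows4 E"
    then have "x \<in> arcs (QG D)" "tail (QG D) x \<in> fix_reps E" "head (QG D) x \<in> fix_reps E"
      unfolding arrows4_def dual_simps(1) by blast+
    then show "\<exists>\<alpha> \<in> arrows1 D. x = tilde1 D \<alpha>"
      by (cases rule: QG_arcs_cases) (use ends_E(4-6) in blast)+
  next
    assume "\<exists>\<alpha> \<in> arrows1 D. x = tilde1 D \<alpha>"
    then show "x \<in> arrows4 E"
      unfolding arrows4_def dual_simps(1) using ends_E(3) QG_tilde1(1) by blast
  qed
  show "x \<in> arrows3 E \<longleftrightarrow> (\<exists>\<alpha> \<in> arrows2 D. x = tilde2 D \<alpha> 0)"
  proof
    assume x: "x \<in> arrows3 E"
    then have x: "x \<in> arcs (QG D)" "tail (QG D) x \<in> fix_reps E" "head (QG D) x \<in> free_reps E"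
      unfolding arrows3_def dual_simps(1) by blast+
    from x(1) show "\<exists>\<alpha> \<in> arrows2 D. x = tilde2 D \<alpha> 0"
    proof (cases rule: QG_arcs_cases)
      case (2 \<alpha> \<mu>)
      then have "\<mu> mod n = 0 mod n" using x(3) eta_free arrows_reps(2)[OF 2(1)] by (simp add: QG_tilde2 del: dual_simps)
      then show ?thesis using 2(1,2) tilde_cong(1) by blast
    qed (use x ends_E(3-6) free_not in blast)+
  next
    assume "\<exists>\<alpha> \<in> arrows2 D. x = tilde2 D \<alpha> 0"
    then obtain \<alpha> where a: "\<alpha> \<in> arrows2 D" "x = tilde2 D \<alpha> 0" by blast
    have "head (QG D) x \<in> free_reps E"
      using a arrows_reps(2)[OF a(1)] by (simp add: QG_tilde2)
    then show "x \<in> arrows3 E"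
      unfolding arrows3_def dual_simps(1) using a ends_E(4)[OF a(1)] QG_tilde2(1)[OF a(1)] by blast
  qed
  show "x \<in> arrows2 E \<longleftrightarrow> (\<exists>\<alpha> \<in> arrows3 D. x = tilde3 D \<alpha> 0)"
  proof
    assume x: "x \<in> arrows2 E"
    then have x: "x \<in> arcs (QG D)" "head (QG D) x \<in> fix_reps E" "tail (QG D) x \<in> free_reps E"
      unfolding arrows2_def dual_simps(1) by blast+
    from x(1) show "\<exists>\<alpha> \<in> arrows3 D. x = tilde3 D \<alpha> 0"
    proof (cases rule: QG_arcs_cases)
      case (3 \<alpha> \<mu>)
      then have "\<mu> mod n = 0 mod n" using x(3) eta_free arrows_reps(3)[OF 3(1)] by (simp add: QG_tilde3 del: dual_simps)
      then show ?thesis using 3(1,2) tilde_cong(2) by blast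
    qed (use x ends_E(3-6) free_not in blast)+
  next
    assume "\<exists>\<alpha> \<in> arrows3 D. x = tilde3 D \<alpha> 0"
    then obtain \<alpha> where a: "\<alpha> \<in> arrows3 D" "x = tilde3 D \<alpha> 0" by blast
    have "tail (QG D) x \<in> free_reps E"
      using a arrows_reps(3)[OF a(1)] by (simp add: QG_tilde3)
    then show "x \<in> arrows2 E"
      unfolding arrows2_def dual_simps(1) using a ends_E(5)[OF a(1)] QG_tilde3(1)[OF a(1)] by blast
  qed
  show "x \<in> arrows1 E \<longleftrightarrow> (\<exists>\<alpha> \<in> arrows4 D. x = tilde4 D \<alpha> (b_exp D \<alpha>))"
  proof
    assume "x \<in> arrows1 E"
    then obtain t \<eta> where x: "x \<in> arcs (QG D)" "head (QG D) x \<in> free_reps E" "\<eta> \<in> free_reps E" "tail (QG D) x = gv E t \<eta>"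
      unfolding arrows1_def dual_simps(1) by blast
    obtain \<epsilon> where "\<epsilon> \<in> Fx" "\<eta> = eta_mu D \<epsilon> 0" using x(3) by auto
    then have tl: "tail (QG D) x \<notin> fix_reps E" unfolding x(4) using ends_E(1) by (simp only: g_E) simp
    from x(1) show "\<exists>\<alpha> \<in> arrows4 D. x = tilde4 D \<alpha> (b_exp D \<alpha>)"
    proof (cases rule: QG_arcs_cases)
      case (4 \<alpha> \<mu>)
      then have "(\<mu> - b_exp D \<alpha>) mod n = 0"
        using x(2) eta_free arrows_reps(4)[OF 4(1)] by (simp add: QG_tilde4 del: dual_simps)
      then have "\<mu> mod n = b_exp D \<alpha> mod n" by (simp add: mod_eq_dvd_iff mod_eq_0_iff_dvd)
      then show ?thesis using 4(1,2) tilde_cong(3) by blast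
    qed (use x(2) tl ends_E(3-5) free_not in blast)+
  next
    assume "\<exists>\<alpha> \<in> arrows4 D. x = tilde4 D \<alpha> (b_exp D \<alpha>)"
    then obtain \<alpha> where a: "\<alpha> \<in> arrows4 D" "x = tilde4 D \<alpha> (b_exp D \<alpha>)" by blast
    note f = arrows_reps(4)[OF a(1)]
    have "head (QG D) x \<in> free_reps E" "eta_mu D (tail Q \<alpha>) 0 \<in> free_reps E"
      using a f by (simp_all add: QG_tilde4)
    moreover have "tail (QG D) x = gv E (b_exp D \<alpha>) (eta_mu D (tail Q \<alpha>) 0)"
      using a f by (simp add: QG_tilde4 g_E)
    ultimately show "x \<in> arrows1 E"
      unfolding arrows1_def dual_simps(1) using a QG_tilde4(1)[OF a(1)] by blast
  qed
qed

end


section \<open>The given datum\<close>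

locale given_datum =
  fixes D :: "('v, 'a, 'k::field) qp_datum"
  assumes fin: "fin_digraph (quiv D)" and finite_potential: "finite_potential (quiv D) (pot D)"
    and group_action: "group_action D"
    and A1: "A1 D" and A2: "A2 D" and A3: "A3 D" and A4: "A4 D" and A5: "A5 D" and A6: "A6 D" and A7: "A7 D"
    and orbit_reps: "orbit_reps D"
begin

abbreviation "Q \<equiv> quiv D"

lemma wf: "wf_digraph Q"
  using fin by (simp add: fin_digraph_def)

section \<open>The hypotheses on the action, turned into combinatorics\<close>

lemma act_hom:
  "x \<in> path_algebra Q \<Longrightarrow> act D x \<in> path_algebra Q"
  "x \<in> path_algebra Q \<Longrightarrow> y \<in> path_algebra Q \<Longrightarrow> act D (pmult Q x y) = pmult Q (act D x) (act D y)"
  "x \<in> path_algebra Q \<Longrightarrow> y \<in> path_algebra Q \<Longrightarrow> act D (\<lambda>p. x p + y p) = (\<lambda>p. act D x p + act D y p)"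
  "x \<in> path_algebra Q \<Longrightarrow> act D (scal c x) = scal c (act D x)"
  "x \<in> path_algebra Q \<Longrightarrow> y \<in> path_algebra Q \<Longrightarrow> act D x = act D y \<Longrightarrow> x = y"
proof -
  have "act D \<in> ring_hom (path_ring Q) (path_ring Q)" "bij_betw (act D) (path_algebra Q) (path_algebra Q)"
    "\<And>c x. x \<in> path_algebra Q \<Longrightarrow> act D (scal c x) = scal c (act D x)"
    using group_action unfolding group_action_def path_alg_iso_def ring_iso_def path_ring_def by simp_all
  then show "x \<in> path_algebra Q \<Longrightarrow> act D x \<in> path_algebra Q"
    "x \<in> path_algebra Q \<Longrightarrow> y \<in> path_algebra Q \<Longrightarrow> act D (pmult Q x y) = pmult Q (act D x) (act D y)"
    "x \<in> path_algebra Q \<Longrightarrow> y \<in> path_algebra Q \<Longrightarrow> act D (\<lambda>p. x p + y p) = (\<lambda>p. act D x p + act D y p)"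
    "x \<in> path_algebra Q \<Longrightarrow> act D (scal c x) = scal c (act D x)"
    "x \<in> path_algebra Q \<Longrightarrow> y \<in> path_algebra Q \<Longrightarrow> act D x = act D y \<Longrightarrow> x = y"
    unfolding ring_hom_def path_ring_def bij_betw_def by (auto dest: inj_onD)
qed

lemma zero_in: "(\<lambda>p. 0) \<in> path_algebra Q"
  by (rule path_algebraI) simp_all

lemma act_zero: "act D (\<lambda>p. 0) = (\<lambda>p. 0)"
  using act_hom(4)[OF zero_in, of 0] by simp

lemma scal_single_in: "p \<in> paths Q \<Longrightarrow> scal c (single p) \<in> path_algebra Q"
proof -
  assume p: "p \<in> paths Q"
  have "{q. scal c (single p) q \<noteq> 0} \<subseteq> {p}" by (auto simp: scal_single_apply)
  then show ?thesis
  proof (rule path_algebraI[OF finite_subset])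
    show "q \<in> paths Q" if "scal c (single p) q \<noteq> 0" for q
      using that p by (simp add: scal_single_apply split: if_splits)
  qed simp
qed

lemma single_in: "p \<in> paths Q \<Longrightarrow> single p \<in> path_algebra Q"
  using scal_single_in[of p 1] by simp

lemma vertex_in: "v \<in> verts Q \<Longrightarrow> vertex v \<in> path_algebra Q"
  unfolding vertex_def by (rule single_in) (simp add: paths_Nil)

lemma arrow_in: "\<alpha> \<in> arcs Q \<Longrightarrow> arrow Q \<alpha> \<in> path_algebra Q"
  unfolding arrow_def by (rule single_in[OF arrow_path[OF wf]])

lemma star_v: "v \<in> verts Q \<Longrightarrow> star_v D v \<in> verts Q \<and> act D (vertex v) = vertex (star_v D v)"
proof -
  assume "v \<in> verts Q"
  then obtain w where "w \<in> verts Q" "act D (vertex v) = vertex w" using A2 unfolding A2_def by blast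
  then have "\<exists>!w. w \<in> verts Q \<and> act D (vertex v) = vertex w" by (auto simp: vertex_inj)
  from theI'[OF this] show ?thesis unfolding star_v_def .
qed

lemma scal_arrow_nz: "scal s (arrow Q \<alpha>) \<noteq> (\<lambda>p. 0) \<Longrightarrow> s \<noteq> 0"
  by auto

lemma act_arrow_nz: "\<alpha> \<in> arcs Q \<Longrightarrow> act D (arrow Q \<alpha>) \<noteq> (\<lambda>p. 0)"
proof
  assume \<alpha>: "\<alpha> \<in> arcs Q" and "act D (arrow Q \<alpha>) = (\<lambda>p. 0)"
  then have "arrow Q \<alpha> = (\<lambda>p. 0 :: 'k)" using act_hom(5)[OF arrow_in[OF \<alpha>] zero_in] act_zero by simp
  from fun_cong[OF this, of "(head Q \<alpha>, [\<alpha>], tail Q \<alpha>)"] show False by (simp add: arrow_def single_def)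
qed

lemma star_a: "\<alpha> \<in> arcs Q \<Longrightarrow> star_a D \<alpha> \<in> arcs Q \<and> (\<exists>s. s \<noteq> 0 \<and> act D (arrow Q \<alpha>) = scal s (arrow Q (star_a D \<alpha>)))"
proof -
  assume \<alpha>: "\<alpha> \<in> arcs Q"
  then obtain \<beta> s where b: "\<beta> \<in> arcs Q" "act D (arrow Q \<alpha>) = scal s (arrow Q \<beta>)" using A2 unfolding A2_def by blast
  then have s: "s \<noteq> 0" using act_arrow_nz[OF \<alpha>] scal_arrow_nz[of s \<beta>] by simp
  have "star_a D \<alpha> = \<beta>"
    unfolding star_a_def
  proof (rule the_equality)
    fix \<gamma> assume "\<gamma> \<in> arcs Q \<and> (\<exists>s. act D (arrow Q \<alpha>) = scal s (arrow Q \<gamma>))"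
    then show "\<gamma> = \<beta>" using b(2) s by (auto simp: arrow_eq_iff)
  qed (use b in blast)
  then show ?thesis using b s by blast
qed

definition "sc \<alpha> = (SOME s. s \<noteq> 0 \<and> act D (arrow Q \<alpha>) = scal s (arrow Q (star_a D \<alpha>)))"

lemma sc: "\<alpha> \<in> arcs Q \<Longrightarrow> sc \<alpha> \<noteq> 0" "\<alpha> \<in> arcs Q \<Longrightarrow> act D (arrow Q \<alpha>) = scal (sc \<alpha>) (arrow Q (star_a D \<alpha>))"
  using someI_ex[OF conjunct2[OF star_a]] unfolding sc_def by blast+

lemma sc_eqI: "\<alpha> \<in> arcs Q \<Longrightarrow> act D (arrow Q \<alpha>) = scal s (arrow Q \<beta>) \<Longrightarrow> sc \<alpha> = s \<and> star_a D \<alpha> = \<beta>"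
  using sc[of \<alpha>] by (auto simp: arrow_eq_iff)

text \<open>An arrow absorbs the idempotents of its two ends. Applying \<open>act\<close> to these
  products, the image stays nonzero only if the images of the ends are the ends of the
  image.\<close>

lemma star_a_ends:
  assumes \<alpha>: "\<alpha> \<in> arcs Q"
  shows "head Q (star_a D \<alpha>) = star_v D (head Q \<alpha>)" "tail Q (star_a D \<alpha>) = star_v D (tail Q \<alpha>)"
proof -
  let ?\<beta> = "star_a D \<alpha>"
  have \<beta>: "?\<beta> \<in> arcs Q" using star_a[OF \<alpha>] by blast
  have h: "head Q \<alpha> \<in> verts Q" and t: "tail Q \<alpha> \<in> verts Q"
    using wf \<alpha> by (auto simp: wf_digraph_def)
  have nz: "scal (sc \<alpha>) (arrow Q ?\<beta>) \<noteq> (\<lambda>p. 0)" using act_arrow_nz[OF \<alpha>] sc(2)[OF \<alpha>] by simp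
  have "pmult Q (vertex (head Q \<alpha>)) (arrow Q \<alpha>) = (arrow Q \<alpha> :: ('v, 'a, 'k) palg)"
    using pmult_arrow_vertex(2)[OF wf \<alpha> h, of 1] by simp
  then have "pmult Q (vertex (star_v D (head Q \<alpha>))) (scal (sc \<alpha>) (arrow Q ?\<beta>)) = scal (sc \<alpha>) (arrow Q ?\<beta>)"
    using act_hom(2)[OF vertex_in[OF h] arrow_in[OF \<alpha>]] star_v[OF h] sc(2)[OF \<alpha>] by simp
  then show "head Q ?\<beta> = star_v D (head Q \<alpha>)"
    using pmult_arrow_vertex(2)[OF wf \<beta>, of "star_v D (head Q \<alpha>)" "sc \<alpha>"] star_v[OF h] nz by (auto split: if_splits)
  have "pmult Q (arrow Q \<alpha>) (vertex (tail Q \<alpha>)) = (arrow Q \<alpha> :: ('v, 'a, 'k) palg)"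
    using pmult_arrow_vertex(1)[OF wf \<alpha> t, of 1] by simp
  then have "pmult Q (scal (sc \<alpha>) (arrow Q ?\<beta>)) (vertex (star_v D (tail Q \<alpha>))) = scal (sc \<alpha>) (arrow Q ?\<beta>)"
    using act_hom(2)[OF arrow_in[OF \<alpha>] vertex_in[OF t]] star_v[OF t] sc(2)[OF \<alpha>] by simp
  then show "tail Q ?\<beta> = star_v D (tail Q \<alpha>)"
    using pmult_arrow_vertex(1)[OF wf \<beta>, of "star_v D (tail Q \<alpha>)" "sc \<alpha>"] star_v[OF t] nz by (auto split: if_splits)
qed

lemma gord_pos: "0 < gord D"
  using group_action by (simp add: group_action_def)

lemma act_order: "x \<in> path_algebra Q \<Longrightarrow> (act D ^^ gord D) x = x"
  using group_action by (simp add: group_action_def)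

lemma star_v_pow: "v \<in> verts Q \<Longrightarrow> (star_v D ^^ i) v \<in> verts Q \<and> (act D ^^ i) (vertex v) = vertex ((star_v D ^^ i) v)"
  by (induction i) (simp_all add: star_v)

lemma star_v_order: "v \<in> verts Q \<Longrightarrow> (star_v D ^^ gord D) v = v"
  using star_v_pow[of v "gord D"] act_order[OF vertex_in[of v]] by (simp add: vertex_inj)

lemma star_a_pow: "\<alpha> \<in> arcs Q \<Longrightarrow> (star_a D ^^ i) \<alpha> \<in> arcs Q \<and>
   (\<exists>s. s \<noteq> 0 \<and> (act D ^^ i) (arrow Q \<alpha>) = scal s (arrow Q ((star_a D ^^ i) \<alpha>)))"
proof (induction i)
  case 0
  then show ?case by (intro conjI exI[of _ 1]) simp_all
next
  case (Suc i)
  let ?\<beta> = "(star_a D ^^ i) \<alpha>"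
  obtain s where s: "?\<beta> \<in> arcs Q" "s \<noteq> 0" "(act D ^^ i) (arrow Q \<alpha>) = scal s (arrow Q ?\<beta>)" using Suc by blast
  then have "(act D ^^ Suc i) (arrow Q \<alpha>) = scal (s * sc ?\<beta>) (arrow Q ((star_a D ^^ Suc i) \<alpha>))"
    by (simp add: act_hom(4)[OF arrow_in] sc(2) scal_scal)
  moreover have "s * sc ?\<beta> \<noteq> 0" using s sc(1) by simp
  moreover have "(star_a D ^^ Suc i) \<alpha> \<in> arcs Q" using star_a[OF s(1)] by simp
  ultimately show ?case by blast
qed

lemma star_a_order: "\<alpha> \<in> arcs Q \<Longrightarrow> (star_a D ^^ gord D) \<alpha> = \<alpha>"
proof -
  assume \<alpha>: "\<alpha> \<in> arcs Q"
  obtain s where "s \<noteq> 0" "(act D ^^ gord D) (arrow Q \<alpha>) = scal s (arrow Q ((star_a D ^^ gord D) \<alpha>))"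
    using star_a_pow[OF \<alpha>] by blast
  then have "scal 1 (arrow Q \<alpha>) = scal s (arrow Q ((star_a D ^^ gord D) \<alpha>))" using act_order[OF arrow_in[OF \<alpha>]] by simp
  then show ?thesis unfolding arrow_eq_iff by simp
qed

lemma star_a_inj: "inj_on (star_a D) (arcs Q)"
  by (rule inj_on_of_order[OF star_a_order gord_pos])

lemma reps: "free_reps D \<subseteq> verts Q - fixed_verts D" "fix_reps D \<subseteq> fixed_verts D"
  and rep_ex: "v \<in> verts Q \<Longrightarrow> \<exists>!\<epsilon>. \<epsilon> \<in> free_reps D \<union> fix_reps D \<and> (\<exists>i. (star_v D ^^ i) \<epsilon> = v)"
  using orbit_reps unfolding orbit_reps_def by auto

lemma fixed_pow: "v \<in> fixed_verts D \<Longrightarrow> (star_v D ^^ i) v = v"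
  by (induction i) (simp_all add: fixed_verts_def)

lemma pow_fixed: "v \<in> verts Q \<Longrightarrow> (star_v D ^^ i) v \<in> fixed_verts D \<Longrightarrow> (star_v D ^^ i) v = v"
proof -
  assume v: "v \<in> verts Q" and f: "(star_v D ^^ i) v \<in> fixed_verts D"
  have "(star_v D ^^ (gord D * i)) v = v" using funpow_mod_eq[OF star_v_order[OF v], of "gord D * i"] by simp
  \<comment> \<open>Completing the \<open>i\<close> steps to a multiple of the group order leads
    back to \<open>v\<close>, while the further steps do not move the fixed vertex reached.\<close>
  moreover have "gord D * i = (gord D * i - i) + i" using gord_pos by (cases "gord D") simp_all
  ultimately have "(star_v D ^^ (gord D * i - i)) ((star_v D ^^ i) v) = v" by (metis funpow_add o_apply)
  then show ?thesis using fixed_pow[OF f] by simp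
qed

text \<open>Bridges the hypotheses, phrased with \<open>fixed_verts\<close>, and the construction,
  phrased with \<open>fix_reps\<close>: the orbit of a fixed vertex contains nothing else, so its
  representative is the vertex itself.\<close>

lemma fixed_eq: "fixed_verts D = fix_reps D"
proof (intro equalityI subsetI)
  fix v assume f: "v \<in> fixed_verts D"
  then have v: "v \<in> verts Q" by (simp add: fixed_verts_def)
  obtain \<epsilon> i where e: "\<epsilon> \<in> free_reps D \<union> fix_reps D" "(star_v D ^^ i) \<epsilon> = v" using rep_ex[OF v] by blast
  have "\<epsilon> \<in> verts Q" using e(1) reps unfolding fixed_verts_def by blast
  then have "\<epsilon> = v" using pow_fixed[of \<epsilon> i] e(2) f by simp
  then show "v \<in> fix_reps D" using e(1) f reps(1) by blast
qed (use reps in blast)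

lemma gv_nat: "v \<in> verts Q \<Longrightarrow> (star_v D ^^ i) v = gv D (int i) v"
  unfolding gv_def by (simp add: funpow_mod_eq[OF star_v_order] flip: zmod_int)

text \<open>By (A3) the orbit has as many elements as there are exponents below the group order, so
  no two of these exponents give the same vertex.\<close>

lemma free_orbit_inj: "\<epsilon> \<in> free_reps D \<Longrightarrow> inj_on (\<lambda>i. (star_v D ^^ i) \<epsilon>) {..<gord D}"
proof (rule eq_card_imp_inj_on)
  assume \<epsilon>: "\<epsilon> \<in> free_reps D"
  then have e: "\<epsilon> \<in> verts Q - fixed_verts D" using reps by blast
  have "(\<lambda>i. (star_v D ^^ i) \<epsilon>) ` {..<gord D} = range (\<lambda>i. (star_v D ^^ i) \<epsilon>)"
  proof (intro equalityI subsetI)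
    fix x assume "x \<in> range (\<lambda>i. (star_v D ^^ i) \<epsilon>)"
    then obtain i where "x = (star_v D ^^ i) \<epsilon>" by blast
    then have "x = (star_v D ^^ (i mod gord D)) \<epsilon>" using funpow_mod_eq[OF star_v_order] e by simp
    moreover have "i mod gord D \<in> {..<gord D}" using gord_pos by simp
    ultimately show "x \<in> (\<lambda>i. (star_v D ^^ i) \<epsilon>) ` {..<gord D}" by blast
  qed blast
  then show "card ((\<lambda>i. (star_v D ^^ i) \<epsilon>) ` {..<gord D}) = card {..<gord D}"
    using A3 e unfolding A3_def by simp
qed simp

lemma cyclic_action: "cyclic_action D"
proof
  show "0 < gord D" by (rule gord_pos)
  show "zeta D ^ gord D = 1" "\<And>m. 0 < m \<Longrightarrow> m < gord D \<Longrightarrow> zeta D ^ m \<noteq> 1"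
    using A1 by (simp_all add: A1_def)
  show "\<And>e. e \<in> arcs Q \<Longrightarrow> tail Q e \<in> verts Q" "\<And>e. e \<in> arcs Q \<Longrightarrow> head Q e \<in> verts Q"
    using wf by (simp_all add: wf_digraph_def)
  show "\<And>v. v \<in> verts Q \<Longrightarrow> star_v D v \<in> verts Q" using star_v by blast
  show "\<And>\<alpha>. \<alpha> \<in> arcs Q \<Longrightarrow> star_a D \<alpha> \<in> arcs Q" using star_a by blast
  show "\<And>\<alpha>. \<alpha> \<in> arcs Q \<Longrightarrow> tail Q (star_a D \<alpha>) = star_v D (tail Q \<alpha>)"
    "\<And>\<alpha>. \<alpha> \<in> arcs Q \<Longrightarrow> head Q (star_a D \<alpha>) = star_v D (head Q \<alpha>)" by (simp_all add: star_a_ends)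
  show "\<And>v. v \<in> verts Q \<Longrightarrow> (star_v D ^^ gord D) v = v" by (rule star_v_order)
  show "\<And>\<alpha>. \<alpha> \<in> arcs Q \<Longrightarrow> (star_a D ^^ gord D) \<alpha> = \<alpha>" by (rule star_a_order)
  show free: "free_reps D \<subseteq> verts Q" "fix_reps D \<subseteq> verts Q"
    using reps unfolding fixed_verts_def by blast+
  show "\<And>v. v \<in> fix_reps D \<Longrightarrow> star_v D v = v" using reps(2) unfolding fixed_verts_def by blast
  show "act D (scal c (arrow Q \<alpha>)) = scal c (arrow Q (star_a D \<alpha>))"
    if \<alpha>: "\<alpha> \<in> arcs Q" and e: "tail Q \<alpha> \<notin> fix_reps D \<or> head Q \<alpha> \<notin> fix_reps D" for \<alpha> c
  proof -
    have "(act D ^^ Suc 0) (arrow Q \<alpha>) \<in> arrow Q ` arcs Q"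
      using A6 \<alpha> e unfolding A6_def fixed_eq by blast
    then obtain \<beta> where "act D (arrow Q \<alpha>) = scal 1 (arrow Q \<beta>)" by auto
    then have "act D (arrow Q \<alpha>) = arrow Q (star_a D \<alpha>)" using sc_eqI[OF \<alpha>] by fastforce
    then show ?thesis by (simp add: act_hom(4)[OF arrow_in[OF \<alpha>]])
  qed
  show "star_a D \<alpha> = \<alpha> \<and> (\<exists>b::int. act D (arrow Q \<alpha>) = scal (zeta D powi b) (arrow Q \<alpha>))"
    if \<alpha>: "\<alpha> \<in> arcs Q" and e: "tail Q \<alpha> \<in> fix_reps D" "head Q \<alpha> \<in> fix_reps D" for \<alpha>
  proof -
    obtain b :: int where "act D (arrow Q \<alpha>) = scal (zeta D powi b) (arrow Q \<alpha>)"
      using A5 \<alpha> e unfolding A5_def fixed_eq by blast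
    then show ?thesis using sc_eqI[OF \<alpha>] by blast
  qed
  show "\<exists>t. \<exists>\<epsilon>\<in>free_reps D. v = gv D t \<epsilon>" if v: "v \<in> verts Q" and nf: "v \<notin> fix_reps D" for v
  proof -
    obtain \<epsilon> i where e: "\<epsilon> \<in> free_reps D \<union> fix_reps D" "(star_v D ^^ i) \<epsilon> = v" using rep_ex[OF v] by blast
    have "\<epsilon> \<notin> fix_reps D" using fixed_pow[of \<epsilon> i] e(2) nf reps(2) by auto
    then have "\<epsilon> \<in> free_reps D" using e(1) by blast
    then show ?thesis using e(2) gv_nat[of \<epsilon> i] free(1) by blast
  qed
  show "\<epsilon> = \<epsilon>' \<and> s mod int (gord D) = t mod int (gord D)"
    if e: "\<epsilon> \<in> free_reps D" "\<epsilon>' \<in> free_reps D" and g: "gv D s \<epsilon> = gv D t \<epsilon>'" for \<epsilon> \<epsilon>' s t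
  proof -
    have "gv D s \<epsilon> \<in> verts Q" unfolding gv_def using star_v_pow free(1) e(1) by blast
    then have "\<exists>!\<delta>. \<delta> \<in> free_reps D \<union> fix_reps D \<and> (\<exists>i. (star_v D ^^ i) \<delta> = gv D s \<epsilon>)" by (rule rep_ex)
    moreover have "\<exists>i. (star_v D ^^ i) \<epsilon> = gv D s \<epsilon>" "\<exists>i. (star_v D ^^ i) \<epsilon>' = gv D s \<epsilon>"
      unfolding g unfolding g[symmetric] gv_def using g unfolding gv_def by metis+
    ultimately have eq: "\<epsilon> = \<epsilon>'" using e by blast
    have "nat (s mod int (gord D)) = nat (t mod int (gord D))"
      using free_orbit_inj[OF e(1)]
    proof (rule inj_onD)
      show "(star_v D ^^ nat (s mod int (gord D))) \<epsilon> = (star_v D ^^ nat (t mod int (gord D))) \<epsilon>"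
        using g eq unfolding gv_def by simp
    qed (use gord_pos in \<open>simp_all add: nat_less_iff\<close>)
    then show ?thesis using eq gord_pos by (simp add: nat_eq_iff)
  qed
  show "gv D t \<epsilon> \<notin> fix_reps D" if e: "\<epsilon> \<in> free_reps D" for \<epsilon> t
  proof
    assume f: "gv D t \<epsilon> \<in> fix_reps D"
    have v: "\<epsilon> \<in> verts Q" using free(1) e by blast
    have "gv D t \<epsilon> = \<epsilon>" using pow_fixed[OF v] f unfolding gv_def fixed_eq .
    then show False using f e reps by auto
  qed
qed

subsection \<open>The action on the potential\<close>

lemma pot_in: "pot D \<in> path_algebra Q"
  and pot_cycle: "pot D (w, l, u) \<noteq> 0 \<Longrightarrow> w = u \<and> 3 \<le> length l"
  using finite_potential unfolding finite_potential_def by blast+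

lemma pot_head: "pot D (w, l, u) \<noteq> 0 \<Longrightarrow> l \<noteq> [] \<and> w = head Q (hd l) \<and> u = head Q (hd l) \<and> set l \<subseteq> arcs Q"
proof -
  assume p: "pot D (w, l, u) \<noteq> 0"
  then have "l \<noteq> []" "w = u" using pot_cycle by force+
  moreover have "(w, l, u) \<in> paths Q" using path_algebra_supp[OF pot_in p] .
  ultimately show ?thesis using paths_conv[OF wf, of l w u] by blast
qed

lemma canonical_pot: "canonical Q (pot D)"
  unfolding canonical_def using pot_head by blast

lemma cycle_pot: "cyc_coeff (pot D) c \<noteq> 0 \<Longrightarrow> closed_word Q c \<and> 3 \<le> length c"
proof -
  assume "cyc_coeff (pot D) c \<noteq> 0"
  then obtain l where l: "l \<in> cyc_class c" "pot D (head Q (hd l), l, head Q (hd l)) \<noteq> 0"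
    unfolding cyc_coeff_canonical[OF canonical_pot] by (meson sum.not_neutral_contains_not_neutral)
  have "closed_word Q l"
    unfolding closed_word_path[OF wf] using path_algebra_supp[OF pot_in l(2)] pot_head[OF l(2)] by blast
  then show ?thesis
    using closed_word_cyc_class[OF cyc_class_sym[OF l(1)], of Q] pot_cycle[OF l(2)] cyc_class_length[OF l(1)] by simp
qed

abbreviation "P \<equiv> path_map (star_v D) (star_a D)"

definition sigma :: "('v, 'a) path \<Rightarrow> 'k" where
  "sigma = (\<lambda>(w, l, u). prod_list (map sc l))"

lemma act_single: "p \<in> paths Q \<Longrightarrow> P p \<in> paths Q \<and> act D (single p) = scal (sigma p) (single (P p))"
proof -
  have "P (w, l, u) \<in> paths Q \<and> act D (single (w, l, u)) = scal (sigma (w, l, u)) (single (P (w, l, u)))"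
    if "(w, l, u) \<in> paths Q" for w l u
    using that
  proof (induction l arbitrary: w)
    case Nil
    then show ?case using star_v[of u] by (simp add: paths_Nil sigma_def vertex_def)
  next
    case (Cons \<alpha> l)
    then have \<alpha>: "\<alpha> \<in> arcs Q" "head Q \<alpha> = w" and l: "(tail Q \<alpha>, l, u) \<in> paths Q" by (simp_all add: paths_Cons)
    have IH: "P (tail Q \<alpha>, l, u) \<in> paths Q"
      "act D (single (tail Q \<alpha>, l, u)) = scal (sigma (tail Q \<alpha>, l, u)) (single (P (tail Q \<alpha>, l, u)))"
      using Cons.IH[OF l] by blast+
    have \<beta>: "star_a D \<alpha> \<in> arcs Q" using star_a[OF \<alpha>(1)] by blast
    have path: "P (w, \<alpha> # l, u) \<in> paths Q"
      using IH(1) \<beta> \<alpha> by (simp add: paths_Cons star_a_ends)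
    have "single (w, \<alpha> # l, u) = (pmult Q (arrow Q \<alpha>) (single (tail Q \<alpha>, l, u)) :: ('v, 'a, 'k) palg)"
      using pmult_single[OF wf arrow_path[OF wf \<alpha>(1)] l, of "1::'k" 1] \<alpha>(2) by (simp add: arrow_def)
    then have "act D (single (w, \<alpha> # l, u)) =
        pmult Q (scal (sc \<alpha>) (arrow Q (star_a D \<alpha>))) (scal (sigma (tail Q \<alpha>, l, u)) (single (P (tail Q \<alpha>, l, u))))"
      using act_hom(2)[OF arrow_in[OF \<alpha>(1)] single_in[OF l]] sc(2)[OF \<alpha>(1)] IH(2) by simp
    also have "\<dots> = scal (sigma (w, \<alpha> # l, u)) (single (P (w, \<alpha> # l, u)))"
      using pmult_single[OF wf arrow_path[OF wf \<beta>] IH(1)[unfolded path_map_simp], of "sc \<alpha>" "sigma (tail Q \<alpha>, l, u)"]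
      by (simp add: arrow_def[of _ "star_a D \<alpha>"] star_a_ends[OF \<alpha>(1)] \<alpha>(2) sigma_def)
    finally show ?case using path by blast
  qed
  then show "p \<in> paths Q \<Longrightarrow> ?thesis" by (cases p) blast
qed

text \<open>\<open>act\<close> is additive on two summands, so finite sums go by induction;
  membership in the path algebra is carried along because additivity is known only there.\<close>

lemma act_sum:
  assumes "finite S" and "S \<subseteq> paths Q"
  shows "(\<lambda>p. \<Sum>q\<in>S. f q * single q p) \<in> path_algebra Q \<and>
    act D (\<lambda>p. \<Sum>q\<in>S. f q * single q p) = (\<lambda>p. \<Sum>q\<in>S. f q * (sigma q * single (P q) p))"
  using assms
proof (induction S rule: finite_induct)
  case empty
  then show ?case by (simp add: zero_in act_zero)
next
  case (insert q S)
  let ?x = "scal (f q) (single q)" and ?y = "\<lambda>p. \<Sum>q\<in>S. f q * single q p"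
  have q: "q \<in> paths Q" and IH: "?y \<in> path_algebra Q" "act D ?y = (\<lambda>p. \<Sum>q\<in>S. f q * (sigma q * single (P q) p))"
    using insert by auto
  have e: "(\<lambda>p. \<Sum>q\<in>insert q S. f q * single q p) = (\<lambda>p. ?x p + ?y p)"
    using insert(1,2) by (simp add: scal_def)
  have x: "?x \<in> path_algebra Q" by (rule scal_single_in[OF q])
  have fin: "finite {p. ?x p + ?y p \<noteq> 0}"
  proof (rule finite_subset)
    show "{p. ?x p + ?y p \<noteq> 0} \<subseteq> {p. ?x p \<noteq> 0} \<union> {p. ?y p \<noteq> 0}" by auto
    show "finite ({p. ?x p \<noteq> 0} \<union> {p. ?y p \<noteq> 0})"
      using path_algebra_fin[OF x] path_algebra_fin[OF IH(1)] by (rule finite_UnI)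
  qed
  have "(\<lambda>p. ?x p + ?y p) \<in> path_algebra Q"
    using fin
  proof (rule path_algebraI)
    show "p \<in> paths Q" if "?x p + ?y p \<noteq> 0" for p
      using that path_algebra_supp[OF x, of p] path_algebra_supp[OF IH(1), of p] by (cases "?x p = 0") simp_all
  qed
  moreover have "act D (\<lambda>p. ?x p + ?y p) = (\<lambda>p. \<Sum>q\<in>insert q S. f q * (sigma q * single (P q) p))"
    unfolding act_hom(3)[OF x IH(1)] IH(2) act_hom(4)[OF single_in[OF q]]
    using insert(1,2) act_single[OF q] by (simp add: scal_def mult.assoc)
  ultimately show ?case unfolding e by blast
qed

lemma act_pot: "act D (pot D) = (\<lambda>p. \<Sum>q\<in>{q. pot D q \<noteq> 0}. pot D q * (sigma q * single (P q) p))"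
proof -
  have fin: "finite {q. pot D q \<noteq> 0}" by (rule path_algebra_fin[OF pot_in])
  have "pot D = (\<lambda>p. \<Sum>q\<in>{q. pot D q \<noteq> 0}. pot D q * single q p)"
  proof
    fix p
    have "(\<Sum>q\<in>{q. pot D q \<noteq> 0}. pot D q * single q p) = (\<Sum>q\<in>{q. pot D q \<noteq> 0}. if q = p then pot D p else 0)"
      by (rule sum.cong[OF refl]) (simp add: single_def)
    then show "pot D p = (\<Sum>q\<in>{q. pot D q \<noteq> 0}. pot D q * single q p)" using fin by simp
  qed
  then have "act D (pot D) = act D (\<lambda>p. \<Sum>q\<in>{q. pot D q \<noteq> 0}. pot D q * single q p)" by (rule arg_cong)
  also have "\<dots> = (\<lambda>p. \<Sum>q\<in>{q. pot D q \<noteq> 0}. pot D q * (sigma q * single (P q) p))"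
    using act_sum[OF fin] path_algebra_supp[OF pot_in] by blast
  finally show ?thesis .
qed

lemma canonical_act_pot: "canonical Q (act D (pot D))"
  unfolding canonical_def
proof (intro allI impI)
  fix v l assume "act D (pot D) (v, l, v) \<noteq> 0"
  then have "(\<Sum>q\<in>{q. pot D q \<noteq> 0}. pot D q * (sigma q * single (P q) (v, l, v))) \<noteq> 0"
    using fun_cong[OF act_pot, of "(v, l, v)"] by simp
  then obtain q where "q \<in> {q. pot D q \<noteq> 0}" "pot D q * (sigma q * single (P q) (v, l, v)) \<noteq> 0"
    by (rule sum.not_neutral_contains_not_neutral)
  then have q: "pot D q \<noteq> 0" "pot D q * (sigma q * single (P q) (v, l, v)) \<noteq> 0" by simp_all
  obtain w l' u where qe: "q = (w, l', u)" by (cases q)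
  have Pq: "(v, l, v) = P q" using q(2) by (simp add: single_def split: if_splits)
  have q': "l' \<noteq> []" "w = head Q (hd l')" "set l' \<subseteq> arcs Q" using pot_head q(1) qe by blast+
  then have "hd l' \<in> arcs Q" by (meson hd_in_set subsetD)
  then show "l \<noteq> [] \<and> v = head Q (hd l)"
    using Pq qe q' by (simp add: hd_map star_a_ends)
qed

text \<open>Applying \<open>act\<close> to \<open>W\<close> moves each path along \<open>P\<close>
  and multiplies it by the scalars of its letters; (A4) identifies the class coefficients before and
  after. This scaling law is behind every later use of the invariance.\<close>

lemma coeff_star:
  assumes c: "set c \<subseteq> arcs Q"
  shows "cyc_coeff (pot D) (map (star_a D) c) = prod_list (map sc c) * cyc_coeff (pot D) c"
proof -
  have "cyc_coeff (act D (pot D)) (map (star_a D) c) = prod_list (map sc c) * cyc_coeff (pot D) c"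
  proof (rule cyc_coeff_map[OF canonical_pot canonical_act_pot])
    show "inj_on (star_a D) (set c)" using star_a_inj c by (rule inj_on_subset)
    fix l assume l: "l \<in> cyc_class c"
    then have lQ: "set l \<subseteq> arcs Q" using c cyc_class_set by blast
    let ?p = "(head Q (hd l), l, head Q (hd l))"
    let ?q = "(head Q (hd (map (star_a D) l)), map (star_a D) l, head Q (hd (map (star_a D) l)))"
    have fin: "finite {q. pot D q \<noteq> 0}" by (rule path_algebra_fin[OF pot_in])
    have iff: "?q = P q \<longleftrightarrow> q = ?p" if q: "pot D q \<noteq> 0" for q
    proof -
      obtain w l' u where qe: "q = (w, l', u)" by (cases q)
      have q': "l' \<noteq> []" "w = head Q (hd l')" "u = head Q (hd l')" "set l' \<subseteq> arcs Q" using pot_head q qe by blast+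
      then have hd: "hd l' \<in> arcs Q" by (meson hd_in_set subsetD)
      have "inj_on (star_a D) (set l \<union> set l')" using star_a_inj by (rule inj_on_subset) (use lQ q' in blast)
      then have m: "map (star_a D) l = map (star_a D) l' \<longleftrightarrow> l = l'" by (rule inj_on_map_eq_map)
      show ?thesis
      proof
        assume "?q = P q"
        then have "l = l'" using m qe by simp
        then show "q = ?p" using q' qe by simp
      next
        assume "q = ?p"
        then have "l = l'" using qe by simp
        then show "?q = P q" using qe q' hd by (simp add: hd_map star_a_ends)
      qed
    qed
    have "act D (pot D) ?q = (\<Sum>q\<in>{q. pot D q \<noteq> 0}. if q = ?p then pot D ?p * sigma ?p else 0)"
      unfolding act_pot by (rule sum.cong[OF refl]) (simp add: single_def iff)
    also have "\<dots> = sigma ?p * pot D ?p" using fin by simp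
    also have "sigma ?p = prod_list (map sc c)"
      using prod_list_cyc_class[OF l, of sc] by (simp add: sigma_def)
    finally show "act D (pot D) ?q = prod_list (map sc c) * pot D ?p" .
  qed
  moreover have "cyc_coeff ((act D ^^ Suc 0) (pot D)) (map (star_a D) c) = cyc_coeff (pot D) (map (star_a D) c)"
    using A4 unfolding A4_def same_potential_def by blast
  ultimately show ?thesis by simp
qed

lemma sc_value: "\<alpha> \<in> arcs Q \<Longrightarrow> sc \<alpha> = (if \<alpha> \<in> arrows4 D then zeta D powi b_exp D \<alpha> else 1)"
proof -
  interpret ca: cyclic_action D by (rule cyclic_action)
  assume \<alpha>: "\<alpha> \<in> arcs Q"
  show ?thesis
  proof (cases "\<alpha> \<in> arrows4 D")
    case True
    then show ?thesis using sc_eqI[OF \<alpha> ca.b_exp(3)[OF True]] by simp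
  next
    case False
    then have "tail Q \<alpha> \<notin> fix_reps D \<or> head Q \<alpha> \<notin> fix_reps D" using \<alpha> by (auto simp: arrows4_def)
    from ca.act_arrow_free[OF \<alpha> this, of 1] have "act D (arrow Q \<alpha>) = scal 1 (arrow Q (star_a D \<alpha>))" by simp
    then show ?thesis using sc_eqI[OF \<alpha>] False by simp
  qed
qed

lemma cyclic_datum: "cyclic_datum D"
proof -
  interpret ca: cyclic_action D by (rule cyclic_action)
  show ?thesis
  proof
    show "finite {p. pot D p \<noteq> 0}" by (rule path_algebra_fin[OF pot_in])
    show "canonical Q (pot D)" by (rule canonical_pot)
    show "(head Q (hd c), c, head Q (hd c)) \<in> paths Q \<and> 3 \<le> length c" if "cyc_coeff (pot D) c \<noteq> 0" for c
      using cycle_pot[OF that] closed_word_path[OF wf] by blast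
    show "cyc_coeff (pot D) (map (star_a D) c) = cyc_coeff (pot D) c"
      if c: "set c \<subseteq> arcs Q" and h: "\<And>\<alpha>. \<alpha> \<in> set c \<Longrightarrow> head Q \<alpha> \<notin> fix_reps D" for c
    proof -
      have "sc \<alpha> = 1" if "\<alpha> \<in> set c" for \<alpha>
      proof -
        have "\<alpha> \<in> arcs Q" "\<alpha> \<notin> arrows4 D" using \<open>\<alpha> \<in> set c\<close> c h ca.arrows_ends(4) by blast+
        then show ?thesis using sc_value by simp
      qed
      then have "map sc c = map (\<lambda>_. 1) c" by simp
      then have "prod_list (map sc c) = 1" by (induction c) simp_all
      then show ?thesis using coeff_star[OF c] by simp
    qed
    show "int (gord D) dvd sum_list (map (b_exp D) c)"
      if nz: "cyc_coeff (pot D) c \<noteq> 0" and h: "\<And>\<alpha>. \<alpha> \<in> set c \<Longrightarrow> head Q \<alpha> \<in> fix_reps D" for c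
    proof -
      have cl: "closed_word Q c" using cycle_pot[OF nz] by blast
      then have c: "set c \<subseteq> arcs Q" by (simp add: closed_word_def)
      have a4: "\<alpha> \<in> arrows4 D" if \<alpha>: "\<alpha> \<in> set c" for \<alpha>
      proof -
        obtain i where i: "i < length c" "\<alpha> = c ! i" using \<alpha> by (metis in_set_conv_nth)
        then have "tail Q \<alpha> = head Q (c ! (Suc i mod length c))" using cl by (simp add: closed_word_def)
        moreover have "Suc i mod length c < length c" by (rule mod_less_divisor[OF le_less_trans[OF le0 i(1)]])
        ultimately have "tail Q \<alpha> \<in> fix_reps D" using h nth_mem by metis
        then show ?thesis using h[OF \<alpha>] c \<alpha> by (auto simp: arrows4_def)
      qed
      have "map (star_a D) c = c"
        by (rule map_idI) (use a4 ca.act_arrow_fix in \<open>auto simp: arrows4_def\<close>)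
      \<comment> \<open>The word is its own image, so its nonzero coefficient cancels in the scaling
        law.\<close>
      then have "prod_list (map sc c) = 1" using coeff_star[OF c] nz by simp
      moreover have "prod_list (map sc l) = zeta D powi sum_list (map (b_exp D) l)" if "set l \<subseteq> set c" for l
        using that
      proof (induction l)
        case (Cons \<alpha> l)
        then have "\<alpha> \<in> set c" by simp
        then have "sc \<alpha> = zeta D powi b_exp D \<alpha>" using sc_value[of \<alpha>] a4 c by auto
        then show ?case using Cons by (simp add: power_int_add ca.zeta_nz)
      qed simp
      ultimately have "zeta D powi sum_list (map (b_exp D) c) = zeta D powi 0" by (metis order_refl power_int_0_right)
      then show ?thesis unfolding ca.zeta_powi_eq_iff by (simp add: mod_eq_0_iff_dvd)
    qed
  qed
qed

end


section \<open>The isomorphism of quivers\<close>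

locale dual_pair = cyclic_datum_hat D hat for D :: "('v, 'a, 'k::field) qp_datum"
    and hat :: "'a list \<Rightarrow> 'a list \<times> int list" +
  fixes hat' :: "('v, 'a, 'k) skew list \<Rightarrow> ('v, 'a, 'k) skew list \<times> int list"
  assumes hat': "hat_choice (dual D hat) hat'"
begin

text \<open>Everything proved for the first construction becomes available for the second one under
  the prefix \<open>dual\<close>.\<close>

sublocale dual: cyclic_datum_hat "dual D hat" hat'
  using cyclic_datum_dual hat' by (simp add: cyclic_datum_hat_def cyclic_datum_hat_axioms_def)

abbreviation "fv \<equiv> phi_v D E"
abbreviation "fa \<equiv> phi_a D E"

lemma eta_mu_E_free: "\<epsilon> \<in> Fx \<Longrightarrow> eta_mu D \<epsilon> 0 \<in> free_reps E"
  and eta_E_fix: "\<epsilon> \<in> Fr \<Longrightarrow> eta D \<epsilon> \<in> fix_reps E"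
  by simp_all

lemma phi_v_1:
  assumes "\<epsilon> \<in> Fx"
  shows "fv (eta E (eta_mu D \<epsilon> 0)) = \<epsilon>"
  unfolding phi_v_def
proof (rule the_equality)
  show "phi_v_graph D E (eta E (eta_mu D \<epsilon> 0)) \<epsilon>" using assms by (rule phi_v_graph.intros)
  fix v assume "phi_v_graph D E (eta E (eta_mu D \<epsilon> 0)) v"
  then show "v = \<epsilon>"
  proof (cases rule: phi_v_graph.cases)
    case 1
    then show ?thesis unfolding dual.eta_inj eta_mu_eq_iff by simp
  next
    case (2 \<delta> \<mu>)
    then show ?thesis using dual.eta_neq_eta_mu[OF eta_mu_E_free[OF assms] eta_E_fix] by blast
  qed
qed

lemma phi_v_2:
  assumes "\<epsilon> \<in> Fr"
  shows "fv (eta_mu E (eta D \<epsilon>) \<mu>) = gv D \<mu> \<epsilon>"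
  unfolding phi_v_def
proof (rule the_equality)
  have e: "eta_mu E (eta D \<epsilon>) (\<mu> mod n) = eta_mu E (eta D \<epsilon>) \<mu>" by (simp add: dual.eta_mu_eq_iff)
  have "phi_v_graph D E (eta_mu E (eta D \<epsilon>) (\<mu> mod n)) (gv D (\<mu> mod n) \<epsilon>)"
    using assms by (rule phi_v_graph.intros) (use n_pos in simp_all)
  then show "phi_v_graph D E (eta_mu E (eta D \<epsilon>) \<mu>) (gv D \<mu> \<epsilon>)" unfolding e gv_mod .
  fix v assume "phi_v_graph D E (eta_mu E (eta D \<epsilon>) \<mu>) v"
  then show "v = gv D \<mu> \<epsilon>"
  proof (cases rule: phi_v_graph.cases)
    case 1
    then show ?thesis using dual.eta_neq_eta_mu[OF eta_mu_E_free[OF 1(2)] eta_E_fix[OF assms], of \<mu>] by simp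
  next
    case (2 \<delta> \<nu>)
    have "eta D \<delta> = eta D \<epsilon>" "\<nu> mod n = \<mu> mod n" using dual.eta_mu_inj[OF 2(1)] by simp_all
    then have "\<delta> = \<epsilon>" unfolding eta_inj by blast
    have "gv D \<nu> = gv D \<mu>" using \<open>\<nu> mod n = \<mu> mod n\<close> by (rule gv_cong)
    then show ?thesis using 2(2) \<open>\<delta> = \<epsilon>\<close> by simp
  qed
qed

lemma arrows_E_I:
  "\<alpha> \<in> arrows1 D \<Longrightarrow> tilde1 D \<alpha> \<in> arrows4 E" "\<alpha> \<in> arrows2 D \<Longrightarrow> tilde2 D \<alpha> 0 \<in> arrows3 E"
  "\<alpha> \<in> arrows3 D \<Longrightarrow> tilde3 D \<alpha> 0 \<in> arrows2 E" "\<alpha> \<in> arrows4 D \<Longrightarrow> tilde4 D \<alpha> (b_exp D \<alpha>) \<in> arrows1 E"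
  unfolding arrows_E by blast+

text \<open>The four rules for \<open>phi_a\<close> concern four different kinds of arrows.
  Disjointness of the kinds then leaves one applicable rule in each uniqueness proof below.\<close>

lemma phi_a_graph_kind:
  assumes "phi_a_graph D E x \<alpha>"
  shows "(dual.kind1 x \<and> (\<exists>\<beta> \<in> arrows4 D. x = tilde1 E (tilde4 D \<beta> (b_exp D \<beta>)) \<and> \<alpha> = \<beta>)) \<or>
    (dual.kind2 x \<and> (\<exists>\<beta> \<in> arrows3 D. \<exists>\<nu>. x = tilde2 E (tilde3 D \<beta> 0) \<nu> \<and> \<alpha> = ga D \<nu> \<beta>)) \<or>
    (dual.kind3 x \<and> (\<exists>\<beta> \<in> arrows2 D. \<exists>\<nu>. x = tilde3 E (tilde2 D \<beta> 0) \<nu> \<and> \<alpha> = ga D \<nu> \<beta>)) \<or>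
    (dual.kind4 x \<and> (\<exists>\<beta> \<in> arrows1 D. \<exists>\<nu>. x = tilde4 E (tilde1 D \<beta>) \<nu> \<and> \<alpha> = ga D (\<nu> - t_exp D \<beta>) \<beta>))"
  using assms
proof (cases rule: phi_a_graph.cases)
  case 1
  then show ?thesis using dual.kinds_tilde(1)[OF arrows_E_I(4)] by blast
next
  case (2 \<beta> \<nu>)
  then show ?thesis using dual.kinds_tilde(2)[OF arrows_E_I(3)] by blast
next
  case (3 \<beta> \<nu>)
  then show ?thesis using dual.kinds_tilde(3)[OF arrows_E_I(2)] by blast
next
  case (4 \<beta> \<nu>)
  then show ?thesis using dual.kinds_tilde(4)[OF arrows_E_I(1)] by blast
qed

lemma phi_a_1:
  assumes "\<alpha> \<in> arrows4 D"
  shows "fa (tilde1 E (tilde4 D \<alpha> (b_exp D \<alpha>))) = \<alpha>"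
  unfolding phi_a_def
proof (rule the_equality)
  show "phi_a_graph D E (tilde1 E (tilde4 D \<alpha> (b_exp D \<alpha>))) \<alpha>" using assms by (rule phi_a_graph.intros)
  fix \<gamma> assume "phi_a_graph D E (tilde1 E (tilde4 D \<alpha> (b_exp D \<alpha>))) \<gamma>"
  from phi_a_graph_kind[OF this] dual.kinds_disjoint(1-3)[OF dual.kinds_tilde(1)[OF arrows_E_I(4)[OF assms]]]
  obtain \<beta> where b: "\<beta> \<in> arrows4 D" "tilde1 E (tilde4 D \<alpha> (b_exp D \<alpha>)) = tilde1 E (tilde4 D \<beta> (b_exp D \<beta>))" "\<gamma> = \<beta>"
    by blast
  then have "tilde4 D \<alpha> (b_exp D \<alpha>) = tilde4 D \<beta> (b_exp D \<beta>)"
    using dual.tilde_injs(1)[OF arrows_E_I(4)[OF assms] arrows_E_I(4)[OF b(1)]] by blast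
  then show "\<gamma> = \<alpha>" using tilde_injs(4)[OF assms b(1)] b(3) by blast
qed

lemma phi_a_2:
  assumes "\<alpha> \<in> arrows3 D"
  shows "fa (tilde2 E (tilde3 D \<alpha> 0) \<nu>) = ga D \<nu> \<alpha>"
  unfolding phi_a_def
proof (rule the_equality)
  have e: "tilde2 E (tilde3 D \<alpha> 0) (\<nu> mod n) = tilde2 E (tilde3 D \<alpha> 0) \<nu>"
    by (rule dual.tilde_cong(1)) simp
  have "phi_a_graph D E (tilde2 E (tilde3 D \<alpha> 0) (\<nu> mod n)) (ga D (\<nu> mod n) \<alpha>)"
    using assms by (rule phi_a_graph.intros) (use n_pos in simp_all)
  then show "phi_a_graph D E (tilde2 E (tilde3 D \<alpha> 0) \<nu>) (ga D \<nu> \<alpha>)" unfolding e ga_mod .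
  fix \<gamma> assume "phi_a_graph D E (tilde2 E (tilde3 D \<alpha> 0) \<nu>) \<gamma>"
  from phi_a_graph_kind[OF this] dual.kinds_disjoint(1)[of "tilde2 E (tilde3 D \<alpha> 0) \<nu>"]
    dual.kinds_disjoint(4,5)[OF dual.kinds_tilde(2)[OF arrows_E_I(3)[OF assms]], of \<nu>]
    dual.kinds_tilde(2)[OF arrows_E_I(3)[OF assms], of \<nu>]
  obtain \<beta> \<mu> where b: "\<beta> \<in> arrows3 D" "tilde2 E (tilde3 D \<alpha> 0) \<nu> = tilde2 E (tilde3 D \<beta> 0) \<mu>" "\<gamma> = ga D \<mu> \<beta>"
    by blast
  then have "tilde3 D \<alpha> 0 = tilde3 D \<beta> 0" "\<nu> mod n = \<mu> mod n"
    using dual.tilde_injs(2)[OF arrows_E_I(3)[OF assms] arrows_E_I(3)[OF b(1)]] by simp_all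
  then show "\<gamma> = ga D \<nu> \<alpha>" using tilde_injs(3)[OF assms b(1)] b(3) ga_cong by metis
qed

lemma phi_a_3:
  assumes "\<alpha> \<in> arrows2 D"
  shows "fa (tilde3 E (tilde2 D \<alpha> 0) \<nu>) = ga D \<nu> \<alpha>"
  unfolding phi_a_def
proof (rule the_equality)
  have e: "tilde3 E (tilde2 D \<alpha> 0) (\<nu> mod n) = tilde3 E (tilde2 D \<alpha> 0) \<nu>"
    by (rule dual.tilde_cong(2)) simp
  have "phi_a_graph D E (tilde3 E (tilde2 D \<alpha> 0) (\<nu> mod n)) (ga D (\<nu> mod n) \<alpha>)"
    using assms by (rule phi_a_graph.intros) (use n_pos in simp_all)
  then show "phi_a_graph D E (tilde3 E (tilde2 D \<alpha> 0) \<nu>) (ga D \<nu> \<alpha>)" unfolding e ga_mod .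
  fix \<gamma> assume "phi_a_graph D E (tilde3 E (tilde2 D \<alpha> 0) \<nu>) \<gamma>"
  from phi_a_graph_kind[OF this] dual.kinds_disjoint(2,4)[of "tilde3 E (tilde2 D \<alpha> 0) \<nu>"]
    dual.kinds_disjoint(6)[OF dual.kinds_tilde(3)[OF arrows_E_I(2)[OF assms]], of \<nu>]
    dual.kinds_tilde(3)[OF arrows_E_I(2)[OF assms], of \<nu>]
  obtain \<beta> \<mu> where b: "\<beta> \<in> arrows2 D" "tilde3 E (tilde2 D \<alpha> 0) \<nu> = tilde3 E (tilde2 D \<beta> 0) \<mu>" "\<gamma> = ga D \<mu> \<beta>"
    by blast
  then have "tilde2 D \<alpha> 0 = tilde2 D \<beta> 0" "\<nu> mod n = \<mu> mod n"
    using dual.tilde_injs(3)[OF arrows_E_I(2)[OF assms] arrows_E_I(2)[OF b(1)]] by simp_all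
  then show "\<gamma> = ga D \<nu> \<alpha>" using tilde_injs(2)[OF assms b(1)] b(3) ga_cong by metis
qed

lemma phi_a_4:
  assumes "\<alpha> \<in> arrows1 D"
  shows "fa (tilde4 E (tilde1 D \<alpha>) \<nu>) = ga D (\<nu> - t_exp D \<alpha>) \<alpha>"
  unfolding phi_a_def
proof (rule the_equality)
  have e: "tilde4 E (tilde1 D \<alpha>) (\<nu> mod n) = tilde4 E (tilde1 D \<alpha>) \<nu>"
    by (rule dual.tilde_cong(3)) simp
  have e': "ga D (\<nu> mod n - t_exp D \<alpha>) = ga D (\<nu> - t_exp D \<alpha>)" by (rule ga_cong) (simp add: mod_simps)
  have "phi_a_graph D E (tilde4 E (tilde1 D \<alpha>) (\<nu> mod n)) (ga D (\<nu> mod n - t_exp D \<alpha>) \<alpha>)"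
    using assms by (rule phi_a_graph.intros) (use n_pos in simp_all)
  then show "phi_a_graph D E (tilde4 E (tilde1 D \<alpha>) \<nu>) (ga D (\<nu> - t_exp D \<alpha>) \<alpha>)" unfolding e e' .
  fix \<gamma> assume "phi_a_graph D E (tilde4 E (tilde1 D \<alpha>) \<nu>) \<gamma>"
  from phi_a_graph_kind[OF this] dual.kinds_disjoint(3,5,6)[of "tilde4 E (tilde1 D \<alpha>) \<nu>"]
    dual.kinds_tilde(4)[OF arrows_E_I(1)[OF assms], of \<nu>]
  obtain \<beta> \<mu> where b: "\<beta> \<in> arrows1 D" "tilde4 E (tilde1 D \<alpha>) \<nu> = tilde4 E (tilde1 D \<beta>) \<mu>" "\<gamma> = ga D (\<mu> - t_exp D \<beta>) \<beta>"
    by blast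
  then have *: "tilde1 D \<alpha> = tilde1 D \<beta>" "\<nu> mod n = \<mu> mod n"
    using dual.tilde_injs(4)[OF arrows_E_I(1)[OF assms] arrows_E_I(1)[OF b(1)]] by simp_all
  have "ga D (\<mu> - t_exp D \<alpha>) = ga D (\<nu> - t_exp D \<alpha>)"
    by (rule ga_cong) (rule mod_diff_cong[OF *(2)[symmetric] refl])
  then show "\<gamma> = ga D (\<nu> - t_exp D \<alpha>) \<alpha>" using tilde_injs(1)[OF assms b(1)] *(1) b(3) by simp
qed

lemma QGE_arcs_cases:
  assumes "x \<in> arcs (QG E)"
  obtains (1) \<alpha> where "\<alpha> \<in> arrows4 D" "x = tilde1 E (tilde4 D \<alpha> (b_exp D \<alpha>))"
    | (2) \<alpha> \<nu> where "\<alpha> \<in> arrows3 D" "x = tilde2 E (tilde3 D \<alpha> 0) \<nu>"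
    | (3) \<alpha> \<nu> where "\<alpha> \<in> arrows2 D" "x = tilde3 E (tilde2 D \<alpha> 0) \<nu>"
    | (4) \<alpha> \<nu> where "\<alpha> \<in> arrows1 D" "x = tilde4 E (tilde1 D \<alpha>) \<nu>"
  using assms
proof (cases rule: dual.QG_arcs_cases)
  case (1 \<beta>)
  obtain \<alpha> where a: "\<alpha> \<in> arrows4 D" "\<beta> = tilde4 D \<alpha> (b_exp D \<alpha>)" using 1(1) unfolding arrows_E(4) by blast
  show thesis by (rule that(1)[OF a(1)]) (simp only: 1(2) a(2))
next
  case (2 \<beta> \<mu>)
  obtain \<alpha> where a: "\<alpha> \<in> arrows3 D" "\<beta> = tilde3 D \<alpha> 0" using 2(1) unfolding arrows_E(3) by blast
  show thesis by (rule that(2)[OF a(1)]) (simp only: 2(2) a(2))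
next
  case (3 \<beta> \<mu>)
  obtain \<alpha> where a: "\<alpha> \<in> arrows2 D" "\<beta> = tilde2 D \<alpha> 0" using 3(1) unfolding arrows_E(2) by blast
  show thesis by (rule that(3)[OF a(1)]) (simp only: 3(2) a(2))
next
  case (4 \<beta> \<mu>)
  obtain \<alpha> where a: "\<alpha> \<in> arrows1 D" "\<beta> = tilde1 D \<alpha>" using 4(1) unfolding arrows_E(1) by blast
  show thesis by (rule that(4)[OF a(1)]) (simp only: 4(2) a(2))
qed

lemma QGE_verts_cases:
  assumes "x \<in> verts (QG E)"
  obtains (1) \<epsilon> where "\<epsilon> \<in> Fx" "x = eta E (eta_mu D \<epsilon> 0)" | (2) \<epsilon> \<mu> where "\<epsilon> \<in> Fr" "x = eta_mu E (eta D \<epsilon>) \<mu>"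
  using assms
proof (cases rule: dual.QG_verts_cases)
  case (eta \<epsilon>)
  then show thesis using that(1) by auto
next
  case (eta_mu \<epsilon> \<mu>)
  then show thesis using that(2) by auto
qed

lemma bij_fv: "bij_betw fv (verts (QG E)) (verts Q)"
proof (rule bij_betw_imageI)
  show "inj_on fv (verts (QG E))"
  proof (rule inj_onI)
    fix x y assume x: "x \<in> verts (QG E)" and y: "y \<in> verts (QG E)" and xy: "fv x = fv y"
    from x show "x = y"
    proof (cases rule: QGE_verts_cases)
      case x: (1 \<epsilon>)
      from y show ?thesis
      proof (cases rule: QGE_verts_cases)
        case (1 \<delta>)
        then show ?thesis using x xy by (simp add: phi_v_1)
      next
        case (2 \<delta> \<mu>)
        then have "\<epsilon> = gv D \<mu> \<delta>" using x xy by (simp add: phi_v_1 phi_v_2)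
        then show ?thesis using x(1) free_not_fix[OF 2(1)] by blast
      qed
    next
      case x: (2 \<epsilon> \<nu>)
      from y show ?thesis
      proof (cases rule: QGE_verts_cases)
        case (1 \<delta>)
        then have "gv D \<nu> \<epsilon> = \<delta>" using x xy by (simp add: phi_v_1 phi_v_2)
        then show ?thesis using 1(1) free_not_fix[OF x(1)] by blast
      next
        case (2 \<delta> \<mu>)
        then have "gv D \<nu> \<epsilon> = gv D \<mu> \<delta>" using x xy by (simp add: phi_v_2)
        from free_unique[OF x(1) 2(1) this] show ?thesis using x(2) 2(2) by (simp add: dual.eta_mu_eq_iff)
      qed
    qed
  qed
  show "fv ` verts (QG E) = verts Q"
  proof (intro equalityI subsetI)
    fix v assume "v \<in> fv ` verts (QG E)"
    then obtain x where x: "x \<in> verts (QG E)" "v = fv x" by blast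
    from x(1) show "v \<in> verts Q"
    proof (cases rule: QGE_verts_cases)
      case (1 \<epsilon>)
      then show ?thesis using x(2) fix_verts phi_v_1 by auto
    next
      case (2 \<epsilon> \<mu>)
      then have "\<epsilon> \<in> verts Q" using free_verts by blast
      then show ?thesis using x(2) 2 by (simp add: phi_v_2 gv_in)
    qed
  next
    fix v assume v: "v \<in> verts Q"
    show "v \<in> fv ` verts (QG E)"
    proof (cases "v \<in> Fx")
      case True
      then show ?thesis
        using phi_v_1[OF True] dual.eta_in_QG[OF eta_mu_E_free[OF True]] by (metis image_eqI)
    next
      case False
      then obtain t \<epsilon> where e: "\<epsilon> \<in> Fr" "v = gv D t \<epsilon>" using free_cover[OF v] by blast
      then show ?thesis
        using phi_v_2[OF e(1), of t] dual.eta_mu_in_QG[OF eta_E_fix[OF e(1)], of t] by (metis image_eqI)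
    qed
  qed
qed

lemma fa_ends:
  assumes "x \<in> arcs (QG E)"
  shows "fa x \<in> arcs Q" "tail Q (fa x) = fv (tail (QG E) x)" "head Q (fa x) = fv (head (QG E) x)"
proof -
  have "fa x \<in> arcs Q \<and> tail Q (fa x) = fv (tail (QG E) x) \<and> head Q (fa x) = fv (head (QG E) x)"
    using assms
  proof (cases rule: QGE_arcs_cases)
    case (1 \<alpha>)
    note r = arrows_reps(4)[OF 1(1)] and a = arrows_E_I(4)[OF 1(1)]
    have "tail (QG E) x = eta E (eta_mu D (tail Q \<alpha>) 0)"
      unfolding 1(2)
    proof (rule dual.QG_tilde1(3)[OF a eta_mu_E_free])
      show "tail (quiv E) (tilde4 D \<alpha> (b_exp D \<alpha>)) = gv E (b_exp D \<alpha>) (eta_mu D (tail Q \<alpha>) 0)"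
        using r by (simp add: QG_tilde4[OF 1(1)] g_E)
    qed (use r in blast)
    moreover have "head (QG E) x = eta E (eta_mu D (head Q \<alpha>) 0)"
      unfolding 1(2) dual.QG_tilde1(2)[OF a] by (simp add: QG_tilde4[OF 1(1)])
    ultimately show ?thesis
      using r 1 arrows_in_arcs(4)[OF 1(1)] by (simp add: phi_a_1 phi_v_1)
  next
    case (2 \<alpha> \<nu>)
    note r = arrows_reps(3)[OF 2(1)] and a = arrows_E_I(3)[OF 2(1)] and q = arrows_in_arcs(3)[OF 2(1)]
    have "tail (QG E) x = eta E (eta_mu D (tail Q \<alpha>) 0)" "head (QG E) x = eta_mu E (eta D (head Q \<alpha>)) \<nu>"
      unfolding 2(2) dual.QG_tilde2[OF a] by (simp_all add: QG_tilde3[OF 2(1)])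
    then show ?thesis
      using r 2 q by (simp add: phi_a_2 phi_v_1 phi_v_2 ga_in tail_ga head_ga)
  next
    case (3 \<alpha> \<nu>)
    note r = arrows_reps(2)[OF 3(1)] and a = arrows_E_I(2)[OF 3(1)] and q = arrows_in_arcs(2)[OF 3(1)]
    have "tail (QG E) x = eta_mu E (eta D (tail Q \<alpha>)) \<nu>" "head (QG E) x = eta E (eta_mu D (head Q \<alpha>) 0)"
      unfolding 3(2) dual.QG_tilde3[OF a] by (simp_all add: QG_tilde2[OF 3(1)])
    then show ?thesis
      using r 3 q by (simp add: phi_a_3 phi_v_1 phi_v_2 ga_in tail_ga head_ga)
  next
    case (4 \<alpha> \<nu>)
    obtain \<epsilon> where e: "\<epsilon> \<in> Fr" "tail Q \<alpha> = gv D (t_exp D \<alpha>) \<epsilon>" using t_exp[OF 4(1)] by blast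
    note r = arrows_reps(1)[OF 4(1)] and a = arrows_E_I(1)[OF 4(1)] and q = arrows_in_arcs(1)[OF 4(1)]
    have "tail (QG E) x = eta_mu E (eta D \<epsilon>) \<nu>" "head (QG E) x = eta_mu E (eta D (head Q \<alpha>)) (\<nu> - t_exp D \<alpha>)"
      unfolding 4(2) dual.QG_tilde4[OF a] b_exp_E[OF 4(1)]
      by (simp_all add: QG_tilde1(2)[OF 4(1)] QG_tilde1(3)[OF 4(1) e])
    \<comment> \<open>Origin of the shift by \<open>t\<close> in \<open>phi\<close>: the tail of a
      type (1) arrow is \<open>g^t(\<epsilon>)\<close>, whereas the arrow above it starts at the
      vertex over \<open>g^\<nu>(\<epsilon>)\<close>.\<close>
    moreover have "gv D (\<nu> - t_exp D \<alpha>) (tail Q \<alpha>) = gv D \<nu> \<epsilon>"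
    proof -
      have "\<epsilon> \<in> verts Q" using e(1) free_verts by blast
      then show ?thesis unfolding e(2) by (simp add: gv_add)
    qed
    ultimately show ?thesis
      using r 4 q e(1) by (simp add: phi_a_4 phi_v_2 ga_in tail_ga head_ga)
  qed
  then show "fa x \<in> arcs Q" "tail Q (fa x) = fv (tail (QG E) x)" "head Q (fa x) = fv (head (QG E) x)"
    by blast+
qed

lemma ga_free_unique:
  assumes "\<alpha> \<in> arcs Q" "\<beta> \<in> arcs Q" "ga D s \<alpha> = ga D t \<beta>"
    and "head Q \<alpha> \<in> Fr \<and> head Q \<beta> \<in> Fr \<or> tail Q \<alpha> \<in> Fr \<and> tail Q \<beta> \<in> Fr"
  shows "\<alpha> = \<beta>" "s mod n = t mod n"
proof -
  have "gv D s (head Q \<alpha>) = gv D t (head Q \<beta>)" "gv D s (tail Q \<alpha>) = gv D t (tail Q \<beta>)"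
    using assms(1-3) by (metis head_ga, metis tail_ga)
  then show st: "s mod n = t mod n" using assms(4) free_unique by blast
  show "\<alpha> = \<beta>" using assms(3) ga_inj[OF assms(1,2), of s] ga_cong[OF st] by simp
qed

text \<open>Whether the tail and the head of the image are fixed tells the four kinds apart. Within
  a kind a representative end is free, so the image determines the arrow and its translation modulo
  \<open>n\<close>.\<close>

lemma inj_fa: "inj_on fa (arcs (QG E))"
proof (rule inj_onI)
  fix x y assume x: "x \<in> arcs (QG E)" and y: "y \<in> arcs (QG E)" and xy: "fa x = fa y"
  have ends1: "tail Q \<alpha> \<in> Fx \<and> head Q \<alpha> \<in> Fx" if "\<alpha> \<in> arrows4 D" for \<alpha>
    using arrows_ends(4)[OF that] .
  have ends2: "tail Q (ga D \<nu> \<alpha>) \<in> Fx \<and> head Q (ga D \<nu> \<alpha>) \<notin> Fx" if "\<alpha> \<in> arrows3 D" for \<alpha> \<nu>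
    using arrows_ends(3)[OF that] arrows_in_arcs(3)[OF that] by (simp add: ga_ends_fix)
  have ends3: "tail Q (ga D \<nu> \<alpha>) \<notin> Fx \<and> head Q (ga D \<nu> \<alpha>) \<in> Fx" if "\<alpha> \<in> arrows2 D" for \<alpha> \<nu>
    using arrows_ends(2)[OF that] arrows_in_arcs(2)[OF that] by (simp add: ga_ends_fix)
  have ends4: "tail Q (ga D \<nu> \<alpha>) \<notin> Fx \<and> head Q (ga D \<nu> \<alpha>) \<notin> Fx" if "\<alpha> \<in> arrows1 D" for \<alpha> \<nu>
    using arrows_ends(1)[OF that] arrows_in_arcs(1)[OF that] by (simp add: ga_ends_fix)
  from x show "x = y"
  proof (cases rule: QGE_arcs_cases)
    case x: (1 \<alpha>)
    note fx = phi_a_1[OF x(1), folded x(2)]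
    from y show ?thesis
    proof (cases rule: QGE_arcs_cases)
      case (1 \<beta>)
      then show ?thesis using fx phi_a_1[OF 1(1)] xy x(2) by simp
    next
      case (2 \<beta> \<mu>)
      then show ?thesis using fx phi_a_2[OF 2(1), of \<mu>] xy ends1[OF x(1)] ends2[OF 2(1), of \<mu>] by metis
    next
      case (3 \<beta> \<mu>)
      then show ?thesis using fx phi_a_3[OF 3(1), of \<mu>] xy ends1[OF x(1)] ends3[OF 3(1), of \<mu>] by metis
    next
      case (4 \<beta> \<mu>)
      then show ?thesis using fx phi_a_4[OF 4(1), of \<mu>] xy ends1[OF x(1)] ends4[OF 4(1)] by metis
    qed
  next
    case x: (2 \<alpha> \<nu>)
    note fx = phi_a_2[OF x(1), of \<nu>, folded x(2)] and e = ends2[OF x(1), of \<nu>]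
    from y show ?thesis
    proof (cases rule: QGE_arcs_cases)
      case (1 \<beta>)
      then show ?thesis using fx phi_a_1[OF 1(1)] xy e ends1[OF 1(1)] by metis
    next
      case (2 \<beta> \<mu>)
      have "ga D \<nu> \<alpha> = ga D \<mu> \<beta>" using fx phi_a_2[OF 2(1), of \<mu>] 2(2) xy by simp
      from ga_free_unique[OF arrows_in_arcs(3)[OF x(1)] arrows_in_arcs(3)[OF 2(1)] this]
      have u: "\<alpha> = \<beta>" "\<nu> mod n = \<mu> mod n" using arrows_reps(3)[OF x(1)] arrows_reps(3)[OF 2(1)] by blast+
      have "tilde2 E (tilde3 D \<beta> 0) \<nu> = tilde2 E (tilde3 D \<beta> 0) \<mu>" by (rule dual.tilde_cong(1)) (simp add: u(2))
      then show ?thesis using x(2) 2(2) u(1) by simp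
    next
      case (3 \<beta> \<mu>)
      then show ?thesis using fx phi_a_3[OF 3(1), of \<mu>] xy e ends3[OF 3(1), of \<mu>] by metis
    next
      case (4 \<beta> \<mu>)
      then show ?thesis using fx phi_a_4[OF 4(1), of \<mu>] xy e ends4[OF 4(1)] by metis
    qed
  next
    case x: (3 \<alpha> \<nu>)
    note fx = phi_a_3[OF x(1), of \<nu>, folded x(2)] and e = ends3[OF x(1), of \<nu>]
    from y show ?thesis
    proof (cases rule: QGE_arcs_cases)
      case (1 \<beta>)
      then show ?thesis using fx phi_a_1[OF 1(1)] xy e ends1[OF 1(1)] by metis
    next
      case (2 \<beta> \<mu>)
      then show ?thesis using fx phi_a_2[OF 2(1), of \<mu>] xy e ends2[OF 2(1), of \<mu>] by metis
    next
      case (3 \<beta> \<mu>)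
      have "ga D \<nu> \<alpha> = ga D \<mu> \<beta>" using fx phi_a_3[OF 3(1), of \<mu>] 3(2) xy by simp
      from ga_free_unique[OF arrows_in_arcs(2)[OF x(1)] arrows_in_arcs(2)[OF 3(1)] this]
      have u: "\<alpha> = \<beta>" "\<nu> mod n = \<mu> mod n" using arrows_reps(2)[OF x(1)] arrows_reps(2)[OF 3(1)] by blast+
      have "tilde3 E (tilde2 D \<beta> 0) \<nu> = tilde3 E (tilde2 D \<beta> 0) \<mu>" by (rule dual.tilde_cong(2)) (simp add: u(2))
      then show ?thesis using x(2) 3(2) u(1) by simp
    next
      case (4 \<beta> \<mu>)
      then show ?thesis using fx phi_a_4[OF 4(1), of \<mu>] xy e ends4[OF 4(1)] by metis
    qed
  next
    case x: (4 \<alpha> \<nu>)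
    note fx = phi_a_4[OF x(1), of \<nu>, folded x(2)] and e = ends4[OF x(1), of "\<nu> - t_exp D \<alpha>"]
    from y show ?thesis
    proof (cases rule: QGE_arcs_cases)
      case (1 \<beta>)
      then show ?thesis using fx phi_a_1[OF 1(1)] xy e ends1[OF 1(1)] by metis
    next
      case (2 \<beta> \<mu>)
      then show ?thesis using fx phi_a_2[OF 2(1), of \<mu>] xy e ends2[OF 2(1), of \<mu>] by metis
    next
      case (3 \<beta> \<mu>)
      then show ?thesis using fx phi_a_3[OF 3(1), of \<mu>] xy e ends3[OF 3(1), of \<mu>] by metis
    next
      case (4 \<beta> \<mu>)
      have "ga D (\<nu> - t_exp D \<alpha>) \<alpha> = ga D (\<mu> - t_exp D \<beta>) \<beta>" using fx phi_a_4[OF 4(1), of \<mu>] 4(2) xy by simp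
      from ga_free_unique[OF arrows_in_arcs(1)[OF x(1)] arrows_in_arcs(1)[OF 4(1)] this]
      have u: "\<alpha> = \<beta>" "(\<nu> - t_exp D \<alpha>) mod n = (\<mu> - t_exp D \<beta>) mod n"
        using arrows_reps(1)[OF x(1)] arrows_reps(1)[OF 4(1)] by blast+
      then have "\<nu> mod n = \<mu> mod n" by (simp add: mod_eq_dvd_iff)
      then have "tilde4 E (tilde1 D \<beta>) \<nu> = tilde4 E (tilde1 D \<beta>) \<mu>" by (intro dual.tilde_cong(3)) simp
      then show ?thesis using x(2) 4(2) u(1) by simp
    qed
  qed
qed

text \<open>An arrow between fixed vertices is itself of type (4). Any other arrow is translated
  until a non-fixed end becomes a representative, the target being preferred if both ends are
  non-fixed.\<close>

lemma surj_fa: "fa ` arcs (QG E) = arcs Q"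
proof (intro equalityI subsetI)
  fix \<alpha> assume "\<alpha> \<in> fa ` arcs (QG E)"
  then show "\<alpha> \<in> arcs Q" using fa_ends(1) by blast
next
  fix \<alpha> assume \<alpha>: "\<alpha> \<in> arcs Q"
  have move: "\<exists>s \<epsilon>. \<epsilon> \<in> Fr \<and> v = gv D s \<epsilon> \<and> gv D (- s) v = \<epsilon>" if v: "v \<in> verts Q" "v \<notin> Fx" for v
  proof -
    obtain s \<epsilon> where e: "\<epsilon> \<in> Fr" "v = gv D s \<epsilon>" using free_cover[OF v] by blast
    have "\<epsilon> \<in> verts Q" using e(1) free_verts by blast
    then have "gv D (- s) v = \<epsilon>" unfolding e(2) by (simp add: gv_add)
    then show ?thesis using e by blast
  qed
  have undo: "ga D s (ga D (- s) \<alpha>) = \<alpha>" for s using ga_add[OF \<alpha>, of s "- s"] by simp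
  note tv = tail_in[OF \<alpha>] and hv = head_in[OF \<alpha>]
  show "\<alpha> \<in> fa ` arcs (QG E)"
  proof (cases "head Q \<alpha> \<in> Fx")
    case hF: True
    show ?thesis
    proof (cases "tail Q \<alpha> \<in> Fx")
      case True
      then have a: "\<alpha> \<in> arrows4 D" using hF \<alpha> by (simp add: arrows4_def)
      show ?thesis using phi_a_1[OF a] dual.QG_tilde1(1)[OF arrows_E_I(4)[OF a]] by (metis image_eqI)
    next
      case False
      obtain s \<epsilon> where e: "\<epsilon> \<in> Fr" "tail Q \<alpha> = gv D s \<epsilon>" "gv D (- s) (tail Q \<alpha>) = \<epsilon>" using move[OF tv False] by blast
      have a: "ga D (- s) \<alpha> \<in> arrows2 D"
        using \<alpha> hF e(1,3) by (simp add: arrows2_def ga_in tail_ga head_ga)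
      show ?thesis
        using phi_a_3[OF a, of s] dual.QG_tilde3(1)[OF arrows_E_I(2)[OF a], of s] undo by (metis image_eqI)
    qed
  next
    case False
    obtain s \<epsilon> where e: "\<epsilon> \<in> Fr" "head Q \<alpha> = gv D s \<epsilon>" "gv D (- s) (head Q \<alpha>) = \<epsilon>" using move[OF hv False] by blast
    let ?\<beta> = "ga D (- s) \<alpha>"
    have b: "?\<beta> \<in> arcs Q" "head Q ?\<beta> \<in> Fr" using e(1,3) \<alpha> by (simp_all add: ga_in head_ga)
    show ?thesis
    proof (cases "tail Q \<alpha> \<in> Fx")
      case True
      then have a: "?\<beta> \<in> arrows3 D" using b \<alpha> by (simp add: arrows3_def tail_ga)
      show ?thesis
        using phi_a_2[OF a, of s] dual.QG_tilde2(1)[OF arrows_E_I(3)[OF a], of s] undo by (metis image_eqI)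
    next
      case False
      then have "tail Q ?\<beta> \<notin> Fx" using \<alpha> by (simp add: ga_ends_fix)
      then obtain t \<delta> where "\<delta> \<in> Fr" "tail Q ?\<beta> = gv D t \<delta>" using free_cover[OF tail_in[OF b(1)]] by blast
      then have a: "?\<beta> \<in> arrows1 D" using tail_free_arrows1(1)[OF b] by blast
      \<comment> \<open>The index is raised by \<open>t\<close> to cancel the shift in
        \<open>phi_a\<close>.\<close>
      have "fa (tilde4 E (tilde1 D ?\<beta>) (s + t_exp D ?\<beta>)) = \<alpha>" using phi_a_4[OF a] undo by simp
      then show ?thesis
        using dual.QG_tilde4(1)[OF arrows_E_I(1)[OF a], of "s + t_exp D ?\<beta>"] by (metis image_eqI)
    qed
  qed
qed

theorem quiver_iso_phi: "quiver_iso (QG E) Q fv fa"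
  unfolding quiver_iso_def using bij_fv inj_fa surj_fa fa_ends by (auto simp: bij_betw_def)

end


section \<open>Orbits of words: transitivity and invariance of the type\<close>

context cyclic_datum
begin

lemma cyc_orbit_trans:
  assumes c: "set c \<subseteq> arcs Q" and "c' \<in> cyc_orbit D c" and "c'' \<in> cyc_orbit D c'"
  shows "c'' \<in> cyc_orbit D c"
proof -
  obtain t where t: "c' \<in> cyc_class (map (ga D t) c)" using assms(2) in_cyc_orbit_iff[OF c] by blast
  have "set c' \<subseteq> arcs Q" using cyc_class_set[OF t] set_map_ga[OF c] by simp
  then obtain s where s: "c'' \<in> cyc_class (map (ga D s) c')" using assms(3) in_cyc_orbit_iff by blast
  have "map (ga D s) c' \<in> cyc_class (map (ga D (s + t)) c)"
    using map_in_cyc_class[OF t, of "ga D s"] by (simp only: map_ga_add[OF c])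
  then show ?thesis using cyc_class_trans[OF _ s] in_cyc_orbit_iff[OF c] by blast
qed

text \<open>The count of positions is rewritten as a sum of indicators over the letters, which is
  invariant under rotation; translating a letter does not change whether its target is
  fixed.\<close>

lemma fix_count_orbit:
  assumes c: "set c \<subseteq> arcs Q" and "c' \<in> cyc_orbit D c"
  shows "fix_count Q Fx c' = fix_count Q Fx c \<and> length c' = length c"
proof -
  have f: "fix_count Q Fx d = length (filter (\<lambda>\<alpha>. head Q \<alpha> \<in> Fx) d)" for d
    unfolding fix_count_def length_filter_conv_card ..
  have l: "length (filter (\<lambda>\<alpha>. head Q \<alpha> \<in> Fx) d) = sum_list (map (\<lambda>\<alpha>. if head Q \<alpha> \<in> Fx then 1 else 0) d)" for d
    by (induction d) simp_all
  obtain t where t: "c' \<in> cyc_class (map (ga D t) c)" using assms(2) in_cyc_orbit_iff[OF c] by blast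
  have "length (filter (\<lambda>\<alpha>. head Q \<alpha> \<in> Fx) c') = length (filter (\<lambda>\<alpha>. head Q \<alpha> \<in> Fx) (map (ga D t) c))"
    unfolding l by (rule sum_list_cyc_class[OF t])
  also have "\<dots> = length (filter (\<lambda>\<alpha>. head Q (ga D t \<alpha>) \<in> Fx) c)" by (simp add: filter_map o_def)
  also have "filter (\<lambda>\<alpha>. head Q (ga D t \<alpha>) \<in> Fx) c = filter (\<lambda>\<alpha>. head Q \<alpha> \<in> Fx) c"
    by (rule filter_cong[OF refl]) (use c ga_ends_fix(2) in blast)
  finally show ?thesis unfolding f using cyc_class_length[OF t] by simp
qed

lemma sum_b_rest: "sum_list (map (b_exp D) l) = b_sum D (x # y # l) 3"
  using b_sum_prefix[of 2 "x # y # l"] by (simp add: numeral_2_eq_2 numeral_3_eq_3)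

end

section \<open>Comparing the potentials\<close>

text \<open>The full scaling law and the classification into four types are needed for the given
  potential only, so they are kept out of \<open>cyclic_datum\<close> and are not demanded of the
  dual.\<close>

locale dual_pair_weights = dual_pair D hat hat' for D :: "('v, 'a, 'k::field) qp_datum" and hat hat' +
  assumes coeff_star: "\<And>c. set c \<subseteq> arcs (quiv D) \<Longrightarrow> cyc_coeff (pot D) (map (star_a D) c) =
      prod_list (map (\<lambda>\<alpha>. if \<alpha> \<in> arrows4 D then zeta D powi b_exp D \<alpha> else 1) c) * cyc_coeff (pot D) c"
    and cycle_types: "\<And>c. c \<in> cycles_of (pot D) \<Longrightarrow>
      c \<in> cycles_i D \<or> c \<in> cycles_ii D \<or> c \<in> cycles_iii D \<or> c \<in> cycles_iv D"
begin

definition "scl \<alpha> = (if \<alpha> \<in> arrows4 D then zeta D powi b_exp D \<alpha> else 1)"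

lemma scl_star: "\<alpha> \<in> arcs Q \<Longrightarrow> scl ((star_a D ^^ i) \<alpha>) = scl \<alpha>"
proof -
  assume \<alpha>: "\<alpha> \<in> arcs Q"
  have e: "(star_a D ^^ i) \<alpha> = ga D (int i) \<alpha>" by (rule ga_star_a[OF \<alpha>])
  show ?thesis
  proof (cases "\<alpha> \<in> arrows4 D")
    case True
    then show ?thesis unfolding e by (simp add: ga_fix)
  next
    case False
    have "ga D (int i) \<alpha> \<in> arrows4 D \<longleftrightarrow> \<alpha> \<in> arrows4 D"
      using \<alpha> by (simp add: arrows4_def ga_in ga_ends_fix)
    then show ?thesis unfolding e using False by (simp add: scl_def)
  qed
qed

text \<open>Translation does not change the scalar of an arrow, so every application of
  \<open>g\<close> contributes the same factor.\<close>

lemma wt_ga: "set c \<subseteq> arcs Q \<Longrightarrow> wt (map (ga D \<nu>) c) = prod_list (map scl c) ^ nat (\<nu> mod n) * wt c"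
proof -
  assume c: "set c \<subseteq> arcs Q"
  have "wt (map (star_a D ^^ i) c) = prod_list (map scl c) ^ i * wt c" for i
  proof (induction i)
    case (Suc i)
    have in_arcs: "set (map (star_a D ^^ i) c) \<subseteq> arcs Q" using c star_a_pow_in by auto
    have "map scl (map (star_a D ^^ i) c) = map scl c" using c by (simp add: scl_star subset_eq)
    then have "wt (map (star_a D) (map (star_a D ^^ i) c)) = prod_list (map scl c) * wt (map (star_a D ^^ i) c)"
      using coeff_star[OF in_arcs] by (simp only: scl_def[abs_def])
    moreover have "map (star_a D) (map (star_a D ^^ i) c) = map (star_a D ^^ Suc i) c" by simp
    ultimately have "wt (map (star_a D ^^ Suc i) c) = prod_list (map scl c) * wt (map (star_a D ^^ i) c)" by metis
    then show ?case by (simp only: Suc.IH power_Suc mult.assoc)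
  qed (simp add: map_ga_0)
  then show ?thesis unfolding map_ga_nat[OF c] .
qed

text \<open>No arrow of a type (ii) cycle joins two fixed vertices, so no scalars arise.\<close>

lemma wt_ga_ii:
  assumes s: "hshape_ii D (as, ts)"
  shows "wt (map (ga D \<nu>) (hword D (as, ts))) = wt (hword D (as, ts))"
proof -
  note h = hshape_iiD[OF s] and a = hshapeD[OF hshape_iiD(1)[OF s]]
  have "hword D (as, ts) ! i \<notin> arrows4 D" if i: "i < length as" for i
  proof -
    have "tail Q (as ! i) \<notin> Fx \<or> head Q (as ! i) \<notin> Fx"
    proof (cases "i = 1")
      case True
      then have "tail Q (ga D (- (ts ! 1)) (as ! i)) \<notin> Fx" using arrows_ends(2)[OF h(7)] by blast
      then show ?thesis using a(4)[OF i] by (simp add: ga_ends_fix)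
    next
      case False
      then show ?thesis using h(4)[OF i] free_fix_disjoint by blast
    qed
    then show ?thesis using i a(4)[OF i] by (simp add: arrows4_def hword_nth ga_ends_fix)
  qed
  then have "map scl (hword D (as, ts)) = replicate (length as) 1"
    by (intro nth_equalityI) (simp_all add: scl_def)
  then show ?thesis using wt_ga[OF set_hword[OF a(3)]] by simp
qed

text \<open>Only the arrows between fixed vertices, from the third one on, carry scalars; their
  exponents add up to \<open>b_3 = q(c)\<close>.\<close>

lemma wt_ga_iii:
  assumes s: "hshape_iii D (as, ts)" and \<nu>: "0 \<le> \<nu>" "\<nu> < n"
  shows "wt (map (ga D \<nu>) as) = zeta D powi (b_sum D as 3 * \<nu>) * wt as"
proof -
  note h = hshape_iiiD[OF s] and a = hshapeD[OF hshape_iiiD(1)[OF s]]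
  obtain x y l where as: "as = x # y # l" using h(2) by (cases as; cases "tl as") auto
  have "scl x = 1" "scl y = 1"
    using h(6,7) arrows_disjoint(2,3) unfolding as scl_def by auto
  moreover have "set l \<subseteq> arrows4 D"
  proof (rule set_subset_nthI)
    fix i assume "i < length l"
    then show "l ! i \<in> arrows4 D" using h(8)[of "Suc (Suc i)"] unfolding as by simp
  qed
  then have "prod_list (map scl l) = zeta D powi sum_list (map (b_exp D) l)"
    by (induction l) (simp_all add: scl_def power_int_add zeta_nz)
  ultimately have "prod_list (map scl as) = zeta D powi b_sum D as 3"
    unfolding as sum_b_rest[of l x y, symmetric] by simp
  then show ?thesis
    using wt_ga[OF a(3), of \<nu>] \<nu> by (simp add: power_int_mult power_int_nonneg_exp)
qed

text \<open>\<open>f \<nu>\<close> is the cycle of the second quiver which lies over \<open>g\<^sup>\<nu>(c)\<close>, where \<open>c = hword D h\<close>.\<close>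

definition matching :: "'a list \<times> int list \<Rightarrow> (int \<Rightarrow> (('v, 'a, 'k) skew, ('v, 'a, 'k) skew, 'k) skew list) \<Rightarrow> bool" where
  "matching h f \<longleftrightarrow> set (hword D h) \<subseteq> arcs Q \<and> (\<forall>\<nu>. 0 \<le> \<nu> \<longrightarrow> \<nu> < n \<longrightarrow> set (f \<nu>) \<subseteq> arcs (QG E) \<and>
     map fa (f \<nu>) = map (ga D \<nu>) (hword D h) \<and>
     cyc_coeff (WG E hat') (f \<nu>) = wt (map (ga D \<nu>) (hword D h)))"

lemma matching_eq:
  assumes "matching h f" and "0 \<le> \<nu>" "\<nu> < n" and "w \<in> cyc_class (f \<nu>)"
  shows "cyc_coeff (WG E hat') w = wt (map fa w)"
proof -
  have f: "cyc_coeff (WG E hat') (f \<nu>) = wt (map fa (f \<nu>))" using assms(1-3) unfolding matching_def by simp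
  show ?thesis
    using cyc_coeff_cyc_class[OF assms(4), of "WG E hat'"]
      cyc_coeff_cyc_class[OF map_in_cyc_class[OF assms(4), of fa], of "pot D"] f by simp
qed

text \<open>Injectivity of \<open>fa\<close> lifts membership in an orbit below to membership in a
  rotation class above, so one matching settles all words over the orbit.\<close>

lemma matching_orbit:
  assumes m: "matching h f" and w: "set w \<subseteq> arcs (QG E)" and orb: "map fa w \<in> cyc_class (map (ga D t) (hword D h))"
  shows "cyc_coeff (WG E hat') w = wt (map fa w)"
proof (rule matching_eq[OF m])
  show \<nu>: "0 \<le> t mod n" "t mod n < n" using n_pos by simp_all
  have "map fa (f (t mod n)) = map (ga D (t mod n)) (hword D h)" "set (f (t mod n)) \<subseteq> arcs (QG E)"
    using m \<nu> unfolding matching_def by blast+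
  then show "w \<in> cyc_class (f (t mod n))"
    using orb map_in_cyc_class_iff[OF inj_fa _ w, of "f (t mod n)"] by simp
qed

subsection \<open>Cycles of type (i)\<close>

text \<open>For the dual group the letters \<open>tilde1\<close> join fixed vertices, so the shape
  has type (iv) and its exponents vanish.\<close>

definition "enc_i as = (map (tilde1 D) as, replicate (length as) (0::int))"

lemma enc_i:
  assumes s: "hshape_i D (as, ts)"
  shows "hshape_iv E (enc_i as)" "hword E (enc_i as) = tilde_i D (as, ts)"
proof -
  have cl: "closed_word (quiv E) (map (tilde1 D) as)" using closed_tilde_i[OF s] by (simp add: tilde_i_def)
  have hd: "head (quiv E) (tilde1 D (as ! i)) \<in> fix_reps E" if "i < length as" for i
    using kinds_head_E(1)[OF kinds_tilde(1)[OF hshape_iD(3)[OF s that]]] by simp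
  have "hshape E (enc_i as)"
    using cl unfolding closed_word_def hshape_def enc_i_def by (simp del: dual_simps)
  then show sh: "hshape_iv E (enc_i as)"
    unfolding hshape_iv_def enc_i_def using hd by (simp del: dual_simps)
  show "hword E (enc_i as) = tilde_i D (as, ts)"
    using dual.hshape_ivD(5)[OF sh[unfolded enc_i_def]] by (simp add: enc_i_def tilde_i_def)
qed

lemma fa_lift4: "set as \<subseteq> arrows1 D \<Longrightarrow> map fa (dual.lift4 s (map (tilde1 D) as)) = lift s as"
  by (induction as arbitrary: s) (simp_all add: b_exp_E phi_a_4)

lemma matching_i:
  assumes s: "hshape_i D (as, ts)" and sum: "n dvd sum_list ts"
  shows "matching (as, ts) (tilde_iv E (enc_i as))"
  unfolding matching_def
proof (intro conjI allI impI)
  let ?c = "hword D (as, ts)"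
  note a = hshapeD[OF hshape_iD(1)[OF s]] and e = enc_i[OF s]
  show cQ: "set ?c \<subseteq> arcs Q" by (rule set_hword[OF a(3)])
  have as1: "set as \<subseteq> arrows1 D" by (rule set_subset_nthI) (rule hshape_iD(3)[OF s])
  have "map (b_exp E) (map (tilde1 D) as) = map (t_exp D) as" using as1 b_exp_E by (simp add: subset_eq)
  then have sumE: "int (gord E) dvd sum_list (map (b_exp E) (map (tilde1 D) as))"
    using sum hword_lift(2)[OF s] by (simp only: dual_simps)
  have til: "tilde_iv E (enc_i as) \<nu> = dual.lift4 \<nu> (map (tilde1 D) as)" for \<nu>
    unfolding enc_i_def by (rule dual.tilde_iv_lift4[OF sumE])
  show m: "map fa (tilde_iv E (enc_i as) \<nu>) = map (ga D \<nu>) ?c" for \<nu>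
    unfolding til fa_lift4[OF as1] hword_lift(1)[OF s] using map_ga_lift[OF a(3), of \<nu> 0] by simp
  show arcs: "set (tilde_iv E (enc_i as) \<nu>) \<subseteq> arcs (QG E)" for \<nu>
    using dual.closed_tilde_iv[OF e(1)[unfolded enc_i_def] sumE] by (simp add: closed_word_def enc_i_def)
  fix \<nu>
  define f where "f \<nu> = cyc_class (map (ga D \<nu>) ?c)" for \<nu>
  \<comment> \<open>The indices giving one class above correspond to the exponents giving one
    translate of \<open>c\<close> up to rotation; their number is the order of the stabiliser of the
    class of \<open>c\<close>.\<close>
  have "tilde_iv E (enc_i as) \<mu> \<in> cyc_class (tilde_iv E (enc_i as) \<nu>) \<longleftrightarrow> f \<mu> = f \<nu>" for \<mu>
    unfolding f_def cyc_class_eq_iff m[symmetric] map_in_cyc_class_iff[OF inj_fa arcs arcs] ..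
  then have card: "{\<mu> \<in> {0..<int (gord E)}. tilde_iv E (enc_i as) \<mu> \<in> cyc_class (tilde_iv E (enc_i as) \<nu>)} =
      {\<mu> \<in> {0..<n}. f \<mu> = f \<nu>}" by simp
  have "card (range f) * card {\<mu> \<in> {0..<n}. f \<mu> = f \<nu>} = gord D"
  proof (rule cyclic_orbit_count[OF gord_pos])
    show "f (i + k) = f (j + k)" if "f i = f j" for i j k
    proof -
      have "map (ga D i) ?c \<in> cyc_class (map (ga D j) ?c)" using \<open>f i = f j\<close> unfolding f_def cyc_class_eq_iff .
      from map_in_cyc_class[OF this, of "ga D k"] show ?thesis
        unfolding f_def cyc_class_eq_iff by (simp only: map_ga_add[OF cQ] add.commute)
    qed
    show "f (i mod n) = f i" for i unfolding f_def by simp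
  qed
  moreover have "card (range f) = orbit_card D ?c" unfolding f_def by (rule orbit_card_int[OF cQ, symmetric])
  ultimately have cnt: "of_nat (orbit_card D ?c) * of_nat (card {\<mu> \<in> {0..<n}. f \<mu> = f \<nu>}) = (of_nat (gord D) :: 'k)"
    by (simp flip: of_nat_mult)
  have nfix: "head Q \<alpha> \<notin> Fx" if \<alpha>: "\<alpha> \<in> set ?c" for \<alpha>
  proof -
    obtain i where i: "i < length as" "\<alpha> = ?c ! i" using \<alpha> by (metis in_set_conv_nth length_hword)
    then show ?thesis
      using free_fix_disjoint[OF hshape_iD(2)[OF s i(1)]] a(4)[OF i(1)] by (simp add: hword_nth ga_ends_fix)
  qed
  have "cyc_coeff (WG E hat') (tilde_iv E (enc_i as) \<nu>) =
      dual.wt (tilde_i D (as, ts)) * of_nat (card {\<mu> \<in> {0..<n}. f \<mu> = f \<nu>})"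
    using dual.coeff_tilde_iv[OF e(1)[unfolded enc_i_def] sumE, of \<nu>] card
    unfolding enc_i_def[symmetric] by (simp add: tilde_i_def)
  also have "\<dots> = wt ?c * ((of_nat (orbit_card D ?c) * of_nat (card {\<mu> \<in> {0..<n}. f \<mu> = f \<nu>})) / of_nat (gord D))"
    using coeff_tilde_i[OF s sum] by simp
  also have "\<dots> = wt ?c" unfolding cnt using n_nz by simp
  also have "\<dots> = wt (map (ga D \<nu>) ?c)" using coeff_ga_free[OF cQ nfix] by simp
  finally show "cyc_coeff (WG E hat') (tilde_iv E (enc_i as) \<nu>) = wt (map (ga D \<nu>) ?c)" .
qed

subsection \<open>Cycles of type (iv)\<close>

text \<open>With index \<open>b(\<alpha>)\<close> each arrow ends at the representative
  \<open>eta_mu D \<epsilon> 0\<close> and starts at its translate by \<open>\<chi>^b\<close>, which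
  is why the exponents are the numbers \<open>b\<close>.\<close>

definition "enc_iv as = (map (\<lambda>\<alpha>. tilde4 D \<alpha> (b_exp D \<alpha>)) as, map (b_exp D) as)"

lemma dual_lift:
  assumes "set as \<subseteq> arrows4 D" shows "dual.lift s (map (\<lambda>\<alpha>. tilde4 D \<alpha> (b_exp D \<alpha>)) as) = lift4 s as"
  using assms
proof (induction as arbitrary: s)
  case (Cons \<alpha> as)
  then have \<alpha>: "\<alpha> \<in> arrows4 D" by simp
  have "t_exp E (tilde4 D \<alpha> (b_exp D \<alpha>)) = b_exp D \<alpha> mod int (gord E)"
  proof (rule dual.t_exp_eqI[OF arrows_E_I(4)[OF \<alpha>]])
    show "eta_mu D (tail Q \<alpha>) 0 \<in> free_reps E" using arrows_reps(4)[OF \<alpha>] by simp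
    show "tail (quiv E) (tilde4 D \<alpha> (b_exp D \<alpha>)) = gv E (b_exp D \<alpha>) (eta_mu D (tail Q \<alpha>) 0)"
      using arrows_reps(4)[OF \<alpha>] by (simp add: QG_tilde4[OF \<alpha>] g_E)
  qed
  then have "t_exp E (tilde4 D \<alpha> (b_exp D \<alpha>)) = b_exp D \<alpha>" using b_exp[OF \<alpha>] by simp
  then show ?case using Cons \<alpha> by (simp add: g_E add.commute)
qed simp

lemma enc_iv:
  assumes s: "hshape_iv D (as, ts)" and b: "n dvd sum_list (map (b_exp D) as)"
  shows "hshape_i E (enc_iv as)" "hword E (enc_iv as) = tilde_iv D (as, ts) 0"
proof -
  note h = hshape_ivD[OF s] and a = hshapeD[OF hshape_ivD(1)[OF s]]
  have hd: "head (quiv E) (tilde4 D (as ! i) (b_exp D (as ! i))) = eta_mu D (head Q (as ! i)) 0" if "i < length as" for i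
    using h(3)[OF that] by (simp add: QG_tilde4)
  have fx: "head Q (as ! i) \<in> Fx" if "i < length as" for i using arrows_reps(4)[OF h(3)[OF that]] by blast
  show sh: "hshape_i E (enc_iv as)"
    unfolding hshape_i_def hshape_def enc_iv_def case_prod_conv
  proof (intro conjI allI impI)
    show "set (map (\<lambda>\<alpha>. tilde4 D \<alpha> (b_exp D \<alpha>)) as) \<subseteq> arcs (quiv E)"
      using h(6) QG_tilde4(1) by auto
    fix i assume "i < length (map (\<lambda>\<alpha>. tilde4 D \<alpha> (b_exp D \<alpha>)) as)"
    then have i: "i < length as" by simp
    show "head (quiv E) (map (\<lambda>\<alpha>. tilde4 D \<alpha> (b_exp D \<alpha>)) as ! i) \<in> free_reps E"
      using i hd[OF i] fx[OF i] by simp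
    show "tail (quiv E) (map (\<lambda>\<alpha>. tilde4 D \<alpha> (b_exp D \<alpha>)) as ! i) = gv E (map (b_exp D) as ! i)
        (head (quiv E) (map (\<lambda>\<alpha>. tilde4 D \<alpha> (b_exp D \<alpha>)) as ! (Suc i mod length (map (\<lambda>\<alpha>. tilde4 D \<alpha> (b_exp D \<alpha>)) as))))"
      using i a(6)[OF i] hd[OF a(6)[OF i]] fx[OF a(6)[OF i]] h(4)[OF i]
      by (simp add: QG_tilde4[OF h(3)[OF i]] g_E)
  qed (use a(1) in simp_all)
  show "hword E (enc_iv as) = tilde_iv D (as, ts) 0"
    using dual.hword_lift(1)[OF sh[unfolded enc_iv_def]] dual_lift[OF h(6)] tilde_iv_lift4[OF b]
    unfolding enc_iv_def by simp
qed

lemma ga_lift4: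
  assumes "set as \<subseteq> arrows4 D" shows "map (ga E t) (lift4 s as) = lift4 (t + s) as"
  using assms by (induction as arbitrary: s) (simp_all add: g_E add.assoc add.commute add.left_commute)

text \<open>\<open>g\<close> fixes every arrow of the cycle, so a single word lies over all
  translates. Since \<open>\<chi>\<close> shifts the index, the words counted in
  \<open>coeff_tilde_iv\<close> form a dual orbit, the one whose length enters the dual
  formula.\<close>

lemma matching_iv:
  assumes s: "hshape_iv D (as, ts)" and b: "n dvd sum_list (map (b_exp D) as)"
  shows "matching (as, ts) (\<lambda>\<nu>. tilde_i E (enc_iv as))"
  unfolding matching_def
proof (intro conjI allI impI)
  note h = hshape_ivD[OF s] and a = hshapeD[OF hshape_ivD(1)[OF s]] and e = enc_iv[OF s b]
  show "set (hword D (as, ts)) \<subseteq> arcs Q" using h(5) a(3) by simp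
  have ga: "map (ga D \<nu>) as = as" for \<nu> by (rule map_idI) (use h(6) ga_fix in blast)
  show "set (tilde_i E (enc_iv as)) \<subseteq> arcs (QG E)"
    using dual.closed_tilde_i[OF e(1)[unfolded enc_iv_def]] by (simp add: closed_word_def enc_iv_def)
  show "map fa (tilde_i E (enc_iv as)) = map (ga D \<nu>) (hword D (as, ts))" for \<nu>
    unfolding h(5) ga using h(6) phi_a_1 by (simp add: enc_iv_def tilde_i_def map_idI subset_eq)
  fix \<nu>
  let ?d = "tilde_iv D (as, ts) 0"
  have til: "tilde_iv D (as, ts) \<mu> = lift4 \<mu> as" for \<mu> by (rule tilde_iv_lift4[OF b])
  define f where "f \<mu> = cyc_class (lift4 \<mu> as)" for \<mu>
  have dG: "set ?d \<subseteq> arcs (quiv E)" using closed_tilde_iv[OF s b] by (simp add: closed_word_def)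
  have ga_d: "map (ga E t) ?d = lift4 t as" for t unfolding til using ga_lift4[OF h(6), of t 0] by simp
  have "card (range f) * card {\<mu> \<in> {0..<n}. f \<mu> = f 0} = gord D"
  proof (rule cyclic_orbit_count[OF gord_pos])
    show "f (i + k) = f (j + k)" if "f i = f j" for i j k
    proof -
      have "lift4 i as \<in> cyc_class (lift4 j as)" using \<open>f i = f j\<close> unfolding f_def cyc_class_eq_iff .
      from map_in_cyc_class[OF this, of "ga E k"] show ?thesis
        unfolding f_def cyc_class_eq_iff by (simp only: ga_lift4[OF h(6)] add.commute)
    qed
    show "f (i mod n) = f i" for i unfolding f_def by (rule arg_cong[OF lift4_cong]) simp
  qed
  moreover have "card (range f) = orbit_card E ?d"
    unfolding f_def dual.orbit_card_int[OF dG] ga_d ..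
  ultimately have cnt: "of_nat (orbit_card E ?d) * of_nat (card {\<mu> \<in> {0..<n}. f \<mu> = f 0}) = (of_nat (gord D) :: 'k)"
    by (simp flip: of_nat_mult)
  have "tilde_iv D (as, ts) \<mu> \<in> cyc_class ?d \<longleftrightarrow> f \<mu> = f 0" for \<mu>
    unfolding til f_def cyc_class_eq_iff ..
  then have wtd: "dual.wt ?d = wt as * of_nat (card {\<mu> \<in> {0..<n}. f \<mu> = f 0})"
    using coeff_tilde_iv[OF s b, of 0] by simp
  have "n dvd sum_list (snd (enc_iv as))" using b by (simp add: enc_iv_def)
  then have "cyc_coeff (WG E hat') (tilde_i E (enc_iv as)) = dual.wt ?d * (of_nat (orbit_card E ?d) / of_nat (gord D))"
    using dual.coeff_tilde_i[OF e(1)[unfolded enc_iv_def]] unfolding e(2)[symmetric] by (simp add: enc_iv_def)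
  also have "\<dots> = wt as * ((of_nat (orbit_card E ?d) * of_nat (card {\<mu> \<in> {0..<n}. f \<mu> = f 0})) / of_nat (gord D))"
    unfolding wtd by simp
  also have "\<dots> = wt as" unfolding cnt using n_nz by simp
  finally show "cyc_coeff (WG E hat') (tilde_i E (enc_iv as)) = wt (map (ga D \<nu>) (hword D (as, ts)))"
    unfolding h(5) ga .
qed

subsection \<open>Cycles of type (ii)\<close>

text \<open>Index 0 makes the vertex over the fixed vertex a dual representative; the dual type is
  (iii), hence the zero exponents.\<close>

definition "enc_ii h = (tilde_ii D h 0, replicate (length (tilde_ii D h 0)) (0::int))"

lemma enc_ii:
  assumes s: "hshape_ii D (as, ts)" and l3: "3 \<le> length as"
  shows "hshape_iii E (enc_ii (as, ts))" "hword E (enc_ii (as, ts)) = tilde_ii D (as, ts) 0"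
proof -
  let ?w = "tilde_ii D (as, ts) 0"
  note h = hshape_iiD[OF s] and len = length_tilde_ii[OF hshape_iiD(2)[OF s], of ts 0]
  have cl: "closed_word (quiv E) ?w" using closed_tilde_ii[OF s l3] by simp
  have hd: "head (quiv E) (?w ! i) \<in> (if i = 1 then free_reps E else fix_reps E)" if i: "i < length as" for i
  proof (cases "i = 1")
    case True
    then show ?thesis using h(5) head_ga hshapeD(4)[OF h(1)] i by (simp add: nth_tilde_ii QG_tilde2[OF h(7)])
  next
    case False
    then have "kind3 (?w ! i) \<or> kind1 (?w ! i)"
      using i kinds_tilde(3)[OF h(6)] kinds_tilde(1)[OF h(8)[of i]] by (simp add: nth_tilde_ii)
    then show ?thesis using False kinds_head_E by auto
  qed
  have "hshape E (enc_ii (as, ts))"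
    using cl unfolding closed_word_def hshape_def enc_ii_def by (simp del: dual_simps)
  then show sh: "hshape_iii E (enc_ii (as, ts))"
    unfolding hshape_iii_def enc_ii_def case_prod_conv len using hd h(2) by (simp del: dual_simps)
  show "hword E (enc_ii (as, ts)) = ?w"
    using dual.hword_iii[OF sh[unfolded enc_ii_def]] by (simp only: enc_ii_def)
qed

text \<open>Compared letter by letter: the dual indices subtract exponents \<open>t\<close> that
  follow a position, while \<open>hword\<close> adds those that precede it. The two agree modulo
  \<open>n\<close> because all exponents add up to a multiple of \<open>n\<close>.\<close>

lemma matching_ii:
  assumes s: "hshape_ii D (as, ts)" and sum: "n dvd sum_list ts" and l3: "3 \<le> length as"
  shows "matching (as, ts) (tilde_iii E (enc_ii (as, ts)))"
  unfolding matching_def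
proof (intro conjI allI impI)
  let ?c = "hword D (as, ts)" and ?w = "tilde_ii D (as, ts) 0"
  note h = hshape_iiD[OF s] and a = hshapeD[OF hshape_iiD(1)[OF s]] and e = enc_ii[OF s l3]
  note len = length_tilde_ii[OF h(2), of ts 0]
  have l3E: "3 \<le> length ?w" using l3 len by simp
  show cQ: "set ?c \<subseteq> arcs Q" by (rule set_hword[OF a(3)])
  show "set (tilde_iii E (enc_ii (as, ts)) \<nu>) \<subseteq> arcs (QG E)" for \<nu>
    using dual.closed_tilde_iii[OF e(1)[unfolded enc_ii_def] l3E] by (simp add: closed_word_def enc_ii_def)
  have w: "?w ! i = tilde1 D (as ! i)" if "2 \<le> i" "i < length as" for i
    using that by (simp add: nth_tilde_ii)
  \<comment> \<open>Descending induction from the end of the word, where it is the divisibility of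
    the full sum. From position 2 on all letters have type (1).\<close>
  have cum: "n dvd (\<Sum>j<i. ts ! j) + b_sum E ?w (Suc i)" if "2 \<le> i" "i \<le> length as" for i
    using that(2,1)
  proof (induction i rule: inc_induct)
    case base
    have "b_sum E ?w (Suc (length as)) = 0" by (rule dual.b_sum_end) (simp add: len)
    then show ?case using sum sum_list_nth[OF a(2)] by simp
  next
    case (step i)
    then have i: "2 \<le> i" "i < length as" by simp_all
    have "b_sum E ?w (Suc i) = b_exp E (?w ! (Suc i - 1)) + b_sum E ?w (Suc (Suc i))"
      by (rule dual.b_sum_step) (use i len in simp_all)
    also have "b_exp E (?w ! (Suc i - 1)) = ts ! i mod n"
      using w[OF i] b_exp_E[OF h(8)[of i]] h(9)[of i] i by simp
    finally have eq: "(\<Sum>j<i. ts ! j) + b_sum E ?w (Suc i) =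
        ((\<Sum>j<Suc i. ts ! j) + b_sum E ?w (Suc (Suc i))) - (ts ! i - ts ! i mod n)" by simp
    have "n dvd (\<Sum>j<Suc i. ts ! j) + b_sum E ?w (Suc (Suc i))" using step.IH i by simp
    then show ?case unfolding eq by (rule dvd_diff) simp
  qed
  show m: "map fa (tilde_iii E (enc_ii (as, ts)) \<nu>) = map (ga D \<nu>) ?c" for \<nu>
  proof (rule nth_equalityI)
    have lw: "1 < length ?w" using h(2) len by simp
    note nth = dual.nth_tilde_iii[OF lw] and lenE = dual.length_tilde_iii[OF lw]
    show "length (map fa (tilde_iii E (enc_ii (as, ts)) \<nu>)) = length (map (ga D \<nu>) ?c)"
      by (simp add: enc_ii_def lenE len)
    fix i assume "i < length (map fa (tilde_iii E (enc_ii (as, ts)) \<nu>))"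
    then have i: "i < length as" by (simp add: enc_ii_def lenE len)
    then have iw: "i < length ?w" using len by simp
    note gac = fun_cong[OF ga_cong]
    have ni: "tilde_iii E (enc_ii (as, ts)) \<nu> ! i = (if i = 0 then tilde2 E (?w ! 0) \<nu>
      else if i = 1 then tilde3 E (?w ! 1) (\<nu> - b_sum E ?w 3) else tilde4 E (?w ! i) (\<nu> - b_sum E ?w (i + 2)))"
      unfolding enc_ii_def by (rule nth[OF iw])
    have "fa (tilde_iii E (enc_ii (as, ts)) \<nu> ! i) = ga D (\<nu> + (\<Sum>j<i. ts ! j)) (as ! i)"
    proof -
      consider "i = 0" | "i = 1" | "2 \<le> i" by linarith
      then show ?thesis
      proof cases
        case 1
        then show ?thesis using i h(6) ni by (simp add: nth_tilde_ii phi_a_2)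
      next
        case 2
        have "(\<Sum>j<2. ts ! j) = ts ! 0 + ts ! 1" by (simp add: numeral_2_eq_2 One_nat_def)
        moreover have "Suc 2 = 3" by simp
        ultimately have "n dvd (ts ! 0 + ts ! 1) + b_sum E ?w 3" using cum[of 2] l3 by simp
        then have "n dvd - (ts ! 1 + b_sum E ?w 3)" unfolding dvd_minus_iff using h(3) by simp
        then have "(\<nu> - b_sum E ?w 3 + - (ts ! 1)) mod n = (\<nu> + (\<Sum>j<i. ts ! j)) mod n"
          using 2 h(3) by (simp add: mod_eq_dvd_iff algebra_simps)
        from gac[OF this, of "as ! 1"] show ?thesis
          using 2 i h(7) a(4)[OF h(2)] ni by (simp add: nth_tilde_ii phi_a_3 ga_add)
      next
        case 3
        have "b_sum E ?w (Suc i) = b_exp E (?w ! (Suc i - 1)) + b_sum E ?w (Suc (Suc i))"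
          by (rule dual.b_sum_step) (use i len in simp_all)
        then have bs: "b_sum E ?w (Suc i) = t_exp D (as ! i) + b_sum E ?w (i + 2)"
          using w[OF 3 i] b_exp_E[OF h(8)[of i]] i 3 by simp
        have "n dvd - ((\<Sum>j<i. ts ! j) + b_sum E ?w (Suc i))" unfolding dvd_minus_iff using cum[of i] 3 i by simp
        then have "(\<nu> - b_sum E ?w (i + 2) - t_exp D (as ! i)) mod n = (\<nu> + (\<Sum>j<i. ts ! j)) mod n"
          unfolding bs by (simp add: mod_eq_dvd_iff algebra_simps)
        from gac[OF this, of "as ! i"] show ?thesis
          using 3 i h(8)[of i] w[OF 3 i] ni by (simp add: phi_a_4)
      qed
    qed
    then show "map fa (tilde_iii E (enc_ii (as, ts)) \<nu>) ! i = map (ga D \<nu>) ?c ! i"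
      using i a(4)[OF i] by (simp add: hword_nth ga_add enc_ii_def lenE len)
  qed
  fix \<nu> assume \<nu>: "0 \<le> \<nu>" "\<nu> < n"
  have "cyc_coeff (WG E hat') (tilde_iii E (enc_ii (as, ts)) \<nu>) = dual.wt ?w"
    using dual.coeff_tilde_iii[OF e(1)[unfolded enc_ii_def] l3E] \<nu> by (simp add: enc_ii_def)
  also have "\<dots> = wt ?c" using coeff_tilde_ii[OF s sum l3, of 0] n_pos by simp
  finally show "cyc_coeff (WG E hat') (tilde_iii E (enc_ii (as, ts)) \<nu>) = wt (map (ga D \<nu>) ?c)"
    unfolding wt_ga_ii[OF s] .
qed


subsection \<open>Cycles of type (iii)\<close>

text \<open>Type (4) letters are normalised as in \<open>enc_iv\<close>. The second exponent
  \<open>- b_3\<close> makes the total vanish and gives \<open>p(d) = - q(c)\<close>, so the factor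
  \<open>\<zeta>^(- p(d) \<nu>)\<close> of the second potential becomes the factor of the scaling
  law.\<close>

definition "enc_iii as =
  (map (\<lambda>i. if i = 0 then tilde2 D (as ! 0) 0 else if i = 1 then tilde3 D (as ! 1) (- b_sum D as 3)
     else tilde4 D (as ! i) (b_exp D (as ! i))) [0..<length as],
   map (\<lambda>i. if i = 0 then 0 else if i = 1 then - b_sum D as 3 else b_exp D (as ! i)) [0..<length as])"

lemma enc_iii_nth:
  "i < length as \<Longrightarrow> fst (enc_iii as) ! i = (if i = 0 then tilde2 D (as ! 0) 0 else if i = 1
     then tilde3 D (as ! 1) (- b_sum D as 3) else tilde4 D (as ! i) (b_exp D (as ! i)))"
  "i < length as \<Longrightarrow> snd (enc_iii as) ! i = (if i = 0 then 0 else if i = 1 then - b_sum D as 3 else b_exp D (as ! i))"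
  "length (fst (enc_iii as)) = length as" "length (snd (enc_iii as)) = length as"
  by (simp_all add: enc_iii_def)

lemma enc_iii_sum: "2 \<le> i \<Longrightarrow> i \<le> length as \<Longrightarrow> (\<Sum>j<i. snd (enc_iii as) ! j) = - b_sum D as (Suc i)"
proof (induction i rule: nat_induct_at_least)
  case base
  then show ?case by (simp add: numeral_2_eq_2 numeral_3_eq_3 enc_iii_nth One_nat_def)
next
  case (Suc i)
  then have "b_sum D as (Suc i) = b_exp D (as ! i) + b_sum D as (Suc (Suc i))"
    using b_sum_step[of "Suc i" as] by simp
  then show ?case using Suc by (simp add: enc_iii_nth)
qed

lemma enc_iii:
  assumes s: "hshape_iii D (as, ts)" and l3: "3 \<le> length as"
  shows "hshape_ii E (enc_iii as)" "hword E (enc_iii as) = tilde_iii D (as, ts) 0" "n dvd sum_list (snd (enc_iii as))"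
proof -
  note h = hshape_iiiD[OF s] and a = hshapeD[OF hshape_iiiD(1)[OF s]]
  obtain bs ss where bs: "enc_iii as = (bs, ss)" by (cases "enc_iii as")
  note nth = enc_iii_nth(1)[of _ as, unfolded bs fst_conv] enc_iii_nth(2)[of _ as, unfolded bs snd_conv]
    and len = enc_iii_nth(3,4)[of as, unfolded bs fst_conv snd_conv]
  note q = QG_tilde2[OF h(6), of 0] QG_tilde3[OF h(7), of "- b_sum D as 3"]
  have q4: "tail (QG D) (tilde4 D (as ! i) (b_exp D (as ! i))) = eta_mu D (tail Q (as ! i)) (b_exp D (as ! i))"
    "head (QG D) (tilde4 D (as ! i) (b_exp D (as ! i))) = eta_mu D (head Q (as ! i)) 0"
    "tilde4 D (as ! i) (b_exp D (as ! i)) \<in> arcs (QG D)" if "2 \<le> i" "i < length as" for i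
    using QG_tilde4[OF h(8)[of i], of "b_exp D (as ! i)"] that by simp_all
  have l: "0 < length as" "1 < length as" "2 < length as" using l3 by simp_all
  have in_arcs: "bs ! i \<in> arcs (QG D)" if "i < length as" for i
    using that q q4(3)[of i] by (simp add: nth)
  have heads: "head (QG D) (bs ! i) = eta_mu D (head Q (as ! i)) 0" "head Q (as ! i) \<in> Fx"
    if "i < length as" "i \<noteq> 1" for i
    using that q q4(2)[of i] h(5)[of i] by (simp_all add: nth)
  have head1: "head (QG D) (bs ! 1) = eta D (head Q (as ! 1))" using l q by (simp add: nth)
  have "hshape E (bs, ss)"
    unfolding hshape_def case_prod_conv
  proof (intro conjI allI impI)
    show "bs \<noteq> []" "length ss = length bs" using len l by auto
    show "set bs \<subseteq> arcs (quiv E)" by (rule set_subset_nthI) (use in_arcs len in simp)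
    fix i assume "i < length bs"
    then have i: "i < length as" using len by simp
    have j: "Suc i mod length as < length as" "1 \<le> i \<Longrightarrow> Suc i mod length as \<noteq> 1"
      using a(6)[OF i] i by (simp_all add: mod_Suc)
    show "tail (quiv E) (bs ! i) = gv E (ss ! i) (head (quiv E) (bs ! (Suc i mod length bs)))"
    proof (cases "i = 0")
      case True
      then have "Suc i mod length as = 1" using l by simp
      then show ?thesis using True l len q h(4) head1 h(9)[OF i] by (simp add: nth g_E)
    next
      case False
      then have j1: "Suc i mod length as \<noteq> 1" using j(2) by simp
      have "gv E (ss ! i) (eta_mu D (head Q (as ! (Suc i mod length as))) 0) = eta_mu D (tail Q (as ! i)) (ss ! i)"
        using heads(2)[OF j(1) j1] h(9)[OF i] by (simp add: g_E)
      then show ?thesis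
        using False i len q q4(1)[of i] heads(1)[OF j(1) j1] by (cases "i = 1") (simp_all add: nth)
    qed
  qed
  then show sh: "hshape_ii E (enc_iii as)"
    unfolding bs hshape_ii_def case_prod_conv using len l heads head1 h(4) by (simp add: nth)
  show "n dvd sum_list (snd (enc_iii as))"
    using enc_iii_sum[of "length as" as] sum_list_nth[OF enc_iii_nth(4), of as] l3 by (simp add: b_sum_end)
  show "hword E (enc_iii as) = tilde_iii D (as, ts) 0"
    unfolding bs
  proof (rule nth_equalityI)
    show "length (hword E (bs, ss)) = length (tilde_iii D (as, ts) 0)" using len l by (simp add: length_tilde_iii)
    fix i assume "i < length (hword E (bs, ss))"
    then have i: "i < length as" "i < length bs" using len by simp_all
    have e: "(\<Sum>j<i. ss ! j) = - b_sum D as (Suc i)" if "2 \<le> i" using enc_iii_sum[OF that, of as] i bs by simp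
    consider "i = 0" | "i = 1" | "2 \<le> i" by linarith
    then show "hword E (bs, ss) ! i = tilde_iii D (as, ts) 0 ! i"
    proof cases
      case 1
      then show ?thesis using i by (simp add: dual.hword_nth nth nth_tilde_iii[OF l(2)])
    next
      case 2
      have "(\<Sum>j<1. ss ! j) = ss ! 0" by (simp add: One_nat_def)
      then show ?thesis using 2 i l by (simp add: dual.hword_nth nth nth_tilde_iii[OF l(2)])
    next
      case 3
      have "b_sum D as (Suc i) = b_exp D (as ! i) + b_sum D as (i + 2)" using b_sum_step[of "Suc i" as] i by simp
      then show ?thesis
        using 3 i e[OF 3] g_E(6)[OF h(8)[of i]] by (simp add: dual.hword_nth nth nth_tilde_iii[OF l(2)])
    qed
  qed
qed

lemma matching_iii:
  assumes s: "hshape_iii D (as, ts)" and l3: "3 \<le> length as"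
  shows "matching (as, ts) (tilde_ii E (enc_iii as))"
  unfolding matching_def
proof (intro conjI allI impI)
  note h = hshape_iiiD[OF s] and a = hshapeD[OF hshape_iiiD(1)[OF s]] and e = enc_iii[OF s l3]
  have hw: "hword D (as, ts) = as" by (rule hword_iii[OF s])
  show "set (hword D (as, ts)) \<subseteq> arcs Q" unfolding hw by (rule a(3))
  obtain bs ss where bs: "enc_iii as = (bs, ss)" by (cases "enc_iii as")
  note sh = e(1)[unfolded bs]
  note nth = enc_iii_nth(1)[of _ as, unfolded bs fst_conv] enc_iii_nth(2)[of _ as, unfolded bs snd_conv]
    and len = enc_iii_nth(3,4)[of as, unfolded bs fst_conv snd_conv]
  have l3E: "3 \<le> length bs" using l3 len by simp
  have lE: "1 < length bs" using l3E by simp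
  show "set (tilde_ii E (enc_iii as) \<nu>) \<subseteq> arcs (QG E)" for \<nu>
    using dual.closed_tilde_ii[OF sh l3E] unfolding bs by (simp add: closed_word_def)
  show "map fa (tilde_ii E (enc_iii as) \<nu>) = map (ga D \<nu>) (hword D (as, ts))" for \<nu>
    unfolding hw bs
  proof (rule nth_equalityI)
    note lenE = dual.length_tilde_ii[OF lE, of ss \<nu>]
    show "length (map fa (tilde_ii E (bs, ss) \<nu>)) = length (map (ga D \<nu>) as)" by (simp add: lenE len)
    fix i assume "i < length (map fa (tilde_ii E (bs, ss) \<nu>))"
    then have i: "i < length as" "i < length bs" by (simp_all add: lenE len)
    have ni: "tilde_ii E (bs, ss) \<nu> ! i = (if i = 0 then tilde3 E (bs ! 0) \<nu>
        else if i = 1 then tilde2 E (ga E (- (ss ! 1)) (bs ! 1)) \<nu> else tilde1 E (bs ! i))"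
      by (rule dual.nth_tilde_ii[OF i(2)])
    consider "i = 0" | "i = 1" | "2 \<le> i" by linarith
    then have "fa (tilde_ii E (bs, ss) \<nu> ! i) = ga D \<nu> (as ! i)"
    proof cases
      case 1
      then show ?thesis using i ni h(6) by (simp add: nth phi_a_3)
    next
      case 2
      \<comment> \<open>The shift in \<open>tilde_ii\<close> undoes the index \<open>- b_3\<close>,
        which restores the normalised arrow on which \<open>phi_a\<close> is given.\<close>
      have "ga E (- (ss ! 1)) (bs ! 1) = tilde3 D (as ! 1) 0"
        using h(2) g_E(5)[OF h(7)] by (simp add: nth)
      then show ?thesis using 2 ni h(7) by (simp add: phi_a_2)
    next
      case 3
      then show ?thesis using i ni h(8)[of i] by (simp add: nth phi_a_1 ga_fix)
    qed
    then show "map fa (tilde_ii E (bs, ss) \<nu>) ! i = map (ga D \<nu>) as ! i" using i by (simp add: lenE)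
  qed
  fix \<nu> assume \<nu>: "0 \<le> \<nu>" "\<nu> < n"
  have "int (gord E) dvd sum_list ss" using e(3) bs by simp
  from dual.coeff_tilde_ii[OF sh this l3E, of \<nu>] \<nu>
  have "cyc_coeff (WG E hat') (tilde_ii E (enc_iii as) \<nu>) = zeta D powi (- (ss ! 1) * \<nu>) * dual.wt (tilde_iii D (as, ts) 0)"
    unfolding e(2)[symmetric] bs by simp
  also have "dual.wt (tilde_iii D (as, ts) 0) = wt as" using coeff_tilde_iii[OF s l3, of 0] n_pos by simp
  also have "- (ss ! 1) = b_sum D as 3" using h(2) by (simp add: nth)
  also have "zeta D powi (b_sum D as 3 * \<nu>) * wt as = wt (map (ga D \<nu>) (hword D (as, ts)))"
    unfolding hw using wt_ga_iii[OF s \<nu>] by simp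
  finally show "cyc_coeff (WG E hat') (tilde_ii E (enc_iii as) \<nu>) = wt (map (ga D \<nu>) (hword D (as, ts)))" .
qed

subsection \<open>The potentials\<close>

text \<open>One half of the comparison, for words over cycles of \<open>W\<close>: the image lies in
  the orbit of the word chosen for it, and the matching of the chosen shape covers that
  orbit.\<close>

lemma coeff_of_wt:
  assumes w: "set w \<subseteq> arcs (QG E)" and nz: "wt (map fa w) \<noteq> 0"
  shows "cyc_coeff (WG E hat') w = wt (map fa w)"
proof -
  let ?c = "map fa w"
  have c: "?c \<in> cycles_of (pot D)" using nz by (simp add: cycles_of_def)
  have cQ: "set ?c \<subseteq> arcs Q" using cycle_closed[OF c] by (simp add: closed_word_def)
  obtain t where t: "hword D (hat ?c) \<in> cyc_class (map (ga D t) ?c)" using hat_orbit[OF c] by blast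
  have "\<exists>f. matching (hat ?c) f"
    using cycle_types[OF c]
  proof (elim disjE)
    assume "?c \<in> cycles_i D"
    then obtain as ts where "hat ?c = (as, ts)" "hshape_i D (as, ts)" "n dvd sum_list ts" using hat_i[OF imageI] by metis
    then show ?thesis using matching_i by metis
  next
    assume "?c \<in> cycles_ii D"
    then obtain as ts where "hat ?c = (as, ts)" "hshape_ii D (as, ts)" "n dvd sum_list ts" "3 \<le> length as"
      using hat_ii[OF imageI] by metis
    then show ?thesis using matching_ii by metis
  next
    assume "?c \<in> cycles_iii D"
    then obtain as ts where "hat ?c = (as, ts)" "hshape_iii D (as, ts)" "3 \<le> length as" using hat_iii[OF imageI] by metis
    then show ?thesis using matching_iii by metis
  next
    assume "?c \<in> cycles_iv D"
    then obtain as ts where "hat ?c = (as, ts)" "hshape_iv D (as, ts)" "n dvd sum_list (map (b_exp D) as)"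
      using hat_iv[OF imageI] by metis
    then show ?thesis using matching_iv by metis
  qed
  then show ?thesis using matching_orbit[OF _ w cyc_orbit_sym[OF cQ t]] by blast
qed

text \<open>Traces a cycle of \<open>W_G\<close> back to a chosen cycle of \<open>W\<close>. Apart
  from type (i), where there is no index, a contributing word with index \<open>\<mu>\<close> is the
  image under \<open>\<chi>^\<mu>\<close> of the word with index 0, which is the word of the
  explicit shape.\<close>

lemma orbit_E_cases:
  assumes "c \<in> cycles_of (pot E)"
  shows "(\<exists>as ts. hshape_i D (as, ts) \<and> n dvd sum_list ts \<and> c \<in> cyc_orbit E (hword E (enc_i as)) \<and>
      hshape_iv E (enc_i as)) \<or>
    (\<exists>as ts. hshape_ii D (as, ts) \<and> n dvd sum_list ts \<and> 3 \<le> length as \<and>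
      c \<in> cyc_orbit E (hword E (enc_ii (as, ts))) \<and> hshape_iii E (enc_ii (as, ts))) \<or>
    (\<exists>as ts. hshape_iii D (as, ts) \<and> 3 \<le> length as \<and> c \<in> cyc_orbit E (hword E (enc_iii as)) \<and>
      hshape_ii E (enc_iii as)) \<or>
    (\<exists>as ts. hshape_iv D (as, ts) \<and> n dvd sum_list (map (b_exp D) as) \<and> c \<in> cyc_orbit E (hword E (enc_iv as)) \<and>
      hshape_i E (enc_iv as))"
proof -
  have "cyc_coeff (WG D hat) c \<noteq> 0" using assms by (simp add: cycles_of_def)
  then obtain d where d: "d \<in> words" "c \<in> cyc_class d" using coeff_WG_nonzero by blast
  have dE: "set d \<subseteq> arcs (quiv E)" using closed_words[OF d(1)] by (simp add: closed_word_def)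
  have orb: "c \<in> cyc_orbit E e" if e: "set e \<subseteq> arcs (quiv E)" and "d = map (ga E \<mu>) e" for e \<mu>
    using d(2) dual.in_cyc_orbit_iff[OF e] that(2) by blast
  from d(1) show ?thesis
  proof (cases d rule: words_cases)
    case (i h)
    obtain as ts where h: "h = (as, ts)" "hshape_i D (as, ts)" "n dvd sum_list ts" using hat_i[OF i(1)] by blast
    have eq: "d = hword E (enc_i as)" using enc_i(2)[OF h(2)] i(2) h(1) by simp
    have "c \<in> cyc_orbit E (hword E (enc_i as))"
      using orb[of d 0] dE dual.map_ga_0 unfolding eq by metis
    then show ?thesis using h(2,3) enc_i(1)[OF h(2)] by blast
  next
    case (ii h \<mu>)
    obtain as ts where h: "h = (as, ts)" "hshape_ii D (as, ts)" "n dvd sum_list ts" "3 \<le> length as"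
      using hat_ii[OF ii(1)] by blast
    note s = hshape_iiD[OF h(2)]
    let ?e = "hword E (enc_ii (as, ts))"
    have e: "?e = tilde_ii D (as, ts) 0" by (rule enc_ii(2)[OF h(2,4)])
    have eE: "set ?e \<subseteq> arcs (quiv E)" unfolding e using closed_tilde_ii[OF h(2,4)] by (simp add: closed_word_def)
    have "d = map (ga E \<mu>) ?e"
    proof (rule nth_equalityI)
      show "length d = length (map (ga E \<mu>) ?e)" using ii(3) h(1) s(2) e by (simp add: length_tilde_ii)
      fix j assume "j < length d"
      then have j: "j < length as" using ii(3) h(1) s(2) by (simp add: length_tilde_ii)
      then show "d ! j = map (ga E \<mu>) ?e ! j"
        unfolding ii(3) h(1) e using s(2) g_E(5)[OF s(6), of \<mu> 0] g_E(4)[OF s(7), of \<mu> 0] g_E(3)[OF s(8)[of j], of \<mu>]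
        by (simp add: nth_tilde_ii length_tilde_ii)
    qed
    then show ?thesis using orb[OF eE] h(2-4) enc_ii(1)[OF h(2,4)] by blast
  next
    case (iii h \<mu>)
    obtain as ts where h: "h = (as, ts)" "hshape_iii D (as, ts)" "3 \<le> length as"
      using hat_iii[OF iii(1)] by blast
    note s = hshape_iiiD[OF h(2)]
    let ?e = "hword E (enc_iii as)"
    have e: "?e = tilde_iii D (as, ts) 0" by (rule enc_iii(2)[OF h(2,3)])
    have eE: "set ?e \<subseteq> arcs (quiv E)" unfolding e using closed_tilde_iii[OF h(2,3)] by (simp add: closed_word_def)
    have "d = map (ga E \<mu>) ?e"
    proof (rule nth_equalityI)
      show "length d = length (map (ga E \<mu>) ?e)" using iii(3) h(1) s(2) e by (simp add: length_tilde_iii)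
      fix j assume "j < length d"
      then have j: "j < length as" using iii(3) h(1) s(2) by (simp add: length_tilde_iii)
      then show "d ! j = map (ga E \<mu>) ?e ! j"
        unfolding iii(3) h(1) e using s(2) g_E(4)[OF s(6), of \<mu> 0] g_E(5)[OF s(7), of \<mu>] g_E(6)[OF s(8)[of j], of \<mu>]
        by (simp add: nth_tilde_iii[OF s(2)] length_tilde_iii)
    qed
    then show ?thesis using orb[OF eE] h(2,3) enc_iii(1)[OF h(2,3)] by blast
  next
    case (iv h \<mu>)
    obtain as ts where h: "h = (as, ts)" "hshape_iv D (as, ts)" "n dvd sum_list (map (b_exp D) as)"
      using hat_iv[OF iv(1)] by blast
    let ?e = "hword E (enc_iv as)"
    have e: "?e = tilde_iv D (as, ts) 0" by (rule enc_iv(2)[OF h(2,3)])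
    have eE: "set ?e \<subseteq> arcs (quiv E)" unfolding e using closed_tilde_iv[OF h(2,3)] by (simp add: closed_word_def)
    have "d = map (ga E \<mu>) ?e"
      unfolding e iv(3) h(1) tilde_iv_lift4[OF h(3)] ga_lift4[OF hshape_ivD(6)[OF h(2)]] by simp
    then show ?thesis using orb[OF eE] h(2,3) enc_iv(1)[OF h(2,3)] by blast
  qed
qed

lemma cyc_types_disjoint:
  assumes "3 \<le> length c"
  shows "\<not> (cyc_i Q' F c \<and> cyc_ii Q' F c)" "\<not> (cyc_i Q' F c \<and> cyc_iii Q' F c)" "\<not> (cyc_i Q' F c \<and> cyc_iv Q' F c)"
    "\<not> (cyc_ii Q' F c \<and> cyc_iii Q' F c)" "\<not> (cyc_ii Q' F c \<and> cyc_iv Q' F c)" "\<not> (cyc_iii Q' F c \<and> cyc_iv Q' F c)"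
  using assms by (auto simp: cyc_i_def cyc_ii_def cyc_iii_def cyc_iv_def)

lemma orbit_E_types:
  assumes "c \<in> cyc_orbit E (hword E h)"
  shows "hshape_i E h \<Longrightarrow> cyc_i (quiv E) (fix_reps E) c" "hshape_ii E h \<Longrightarrow> cyc_ii (quiv E) (fix_reps E) c"
    "hshape_iii E h \<Longrightarrow> cyc_iii (quiv E) (fix_reps E) c" "hshape_iv E h \<Longrightarrow> cyc_iv (quiv E) (fix_reps E) c"
proof -
  obtain bs ss where h: "h = (bs, ss)" by (cases h)
  have fc: "fix_count (quiv E) (fix_reps E) c = fix_count (quiv E) (fix_reps E) (hword E h) \<and> length c = length (hword E h)"
    if "hshape E h"
    by (rule dual.fix_count_orbit[OF _ assms]) (use dual.set_hword[OF dual.hshapeD(3)] that h in blast)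
  show "hshape_i E h \<Longrightarrow> cyc_i (quiv E) (fix_reps E) c"
    using fc dual.fix_count_shapes(1) dual.hshape_iD(1) unfolding h cyc_i_def by metis
  show "hshape_ii E h \<Longrightarrow> cyc_ii (quiv E) (fix_reps E) c"
    using fc dual.fix_count_shapes(2) dual.hshape_iiD(1) unfolding h cyc_ii_def by metis
  show "hshape_iii E h \<Longrightarrow> cyc_iii (quiv E) (fix_reps E) c"
    using fc dual.fix_count_shapes(3) dual.hshape_iiiD(1) unfolding h cyc_iii_def by metis
  show "hshape_iv E h \<Longrightarrow> cyc_iv (quiv E) (fix_reps E) c"
    using fc dual.fix_count_shapes(4) dual.hshape_ivD(1) unfolding h cyc_iv_def by metis
qed

text \<open>The four alternatives of \<open>orbit_E_cases\<close> belong to four dual types, which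
  are constant on orbits and exclude each other for words of length at least 3; the type of
  \<open>c\<close> selects one alternative.\<close>

lemma orbit_E:
  "c \<in> cycles_iv E \<Longrightarrow> \<exists>as ts. hshape_i D (as, ts) \<and> n dvd sum_list ts \<and> c \<in> cyc_orbit E (hword E (enc_i as))"
  "c \<in> cycles_iii E \<Longrightarrow> \<exists>as ts. hshape_ii D (as, ts) \<and> n dvd sum_list ts \<and> 3 \<le> length as \<and>
      c \<in> cyc_orbit E (hword E (enc_ii (as, ts)))"
  "c \<in> cycles_ii E \<Longrightarrow> \<exists>as ts. hshape_iii D (as, ts) \<and> 3 \<le> length as \<and> c \<in> cyc_orbit E (hword E (enc_iii as))"
  "c \<in> cycles_i E \<Longrightarrow> \<exists>as ts. hshape_iv D (as, ts) \<and> n dvd sum_list (map (b_exp D) as) \<and>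
      c \<in> cyc_orbit E (hword E (enc_iv as))"
proof -
  note t = orbit_E_types
  have d: "3 \<le> length c" if "c \<in> cycles_of (pot E)" using dual.cycle_closed[OF that] by blast
  note disj = cyc_types_disjoint[OF d, of "quiv E" "fix_reps E"]
  show "\<exists>as ts. hshape_i D (as, ts) \<and> n dvd sum_list ts \<and> c \<in> cyc_orbit E (hword E (enc_i as))" if "c \<in> cycles_iv E"
  proof -
    have c: "c \<in> cycles_of (pot E)" "cyc_iv (quiv E) (fix_reps E) c" using that by (simp_all add: cycles_iv_def)
    show ?thesis using orbit_E_cases[OF c(1)] t[of c] c(2) disj[OF c(1)] by blast
  qed
  show "\<exists>as ts. hshape_ii D (as, ts) \<and> n dvd sum_list ts \<and> 3 \<le> length as \<and>
      c \<in> cyc_orbit E (hword E (enc_ii (as, ts)))" if "c \<in> cycles_iii E"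
  proof -
    have c: "c \<in> cycles_of (pot E)" "cyc_iii (quiv E) (fix_reps E) c" using that by (simp_all add: cycles_iii_def)
    show ?thesis using orbit_E_cases[OF c(1)] t[of c] c(2) disj[OF c(1)] by blast
  qed
  show "\<exists>as ts. hshape_iii D (as, ts) \<and> 3 \<le> length as \<and> c \<in> cyc_orbit E (hword E (enc_iii as))" if "c \<in> cycles_ii E"
  proof -
    have c: "c \<in> cycles_of (pot E)" "cyc_ii (quiv E) (fix_reps E) c" using that by (simp_all add: cycles_ii_def)
    show ?thesis using orbit_E_cases[OF c(1)] t[of c] c(2) disj[OF c(1)] by blast
  qed
  show "\<exists>as ts. hshape_iv D (as, ts) \<and> n dvd sum_list (map (b_exp D) as) \<and>
      c \<in> cyc_orbit E (hword E (enc_iv as))" if "c \<in> cycles_i E"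
  proof -
    have c: "c \<in> cycles_of (pot E)" "cyc_i (quiv E) (fix_reps E) c" using that by (simp_all add: cycles_i_def)
    show ?thesis using orbit_E_cases[OF c(1)] t[of c] c(2) disj[OF c(1)] by blast
  qed
qed

lemma hat'_orbit:
  assumes "c \<in> cycles_of (pot E)" and "c \<in> cyc_orbit E e" and "set e \<subseteq> arcs (quiv E)"
  shows "hword E (hat' c) \<in> cyc_orbit E e"
  using dual.cyc_orbit_trans[OF assms(3,2)] hat' assms(1) unfolding hat_choice_def by blast

text \<open>The other half, for words occurring in the second potential. \<open>hat'\<close> may
  differ from the explicit shape: not visibly in the words for types (ii) and (iii), by a rotation
  for (i), by a rotation and a shift of the index for (iv). In each case the word lies in the class
  of a matching.\<close>

lemma coeff_of_WG:
  assumes nz: "cyc_coeff (WG E hat') w \<noteq> 0"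
  shows "cyc_coeff (WG E hat') w = wt (map fa w)"
proof -
  obtain d where d: "d \<in> dual.words" "w \<in> cyc_class d" using dual.coeff_WG_nonzero[OF nz] by blast
  have "\<exists>h f \<nu>. matching h f \<and> 0 \<le> \<nu> \<and> \<nu> < n \<and> d \<in> cyc_class (f \<nu>)"
    using d(1)
  proof (cases d rule: dual.words_cases)
    case (i h)
    obtain bs ss where h: "h = (bs, ss)" "hshape_i E (bs, ss)" using dual.hat_i[OF i(1)] by blast
    obtain c where c: "c \<in> cycles_i E" "h = hat' c" using i(1) by blast
    obtain as ts where as: "hshape_iv D (as, ts)" "n dvd sum_list (map (b_exp D) as)" "c \<in> cyc_orbit E (hword E (enc_iv as))"
      using orbit_E(4)[OF c(1)] by blast
    obtain bs' ss' where e: "enc_iv as = (bs', ss')" by (cases "enc_iv as")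
    have s: "hshape_i E (bs', ss')" using enc_iv(1)[OF as(1,2)] e by simp
    have "hword E (bs, ss) \<in> cyc_orbit E (hword E (bs', ss'))"
      using hat'_orbit[OF subsetD[OF dual.cycles_x_of(1) c(1)] as(3)[unfolded e]
          dual.set_hword[OF dual.hshapeD(3)[OF dual.hshape_iD(1)[OF s]]]]
      unfolding c(2)[symmetric] h(1) .
    from map_in_cyc_class[OF dual.orbit_i[OF s h(2) this], of "tilde1 E"]
    have "d \<in> cyc_class (tilde_i E (enc_iv as))" unfolding i(2) h(1) e by (simp add: tilde_i_def)
    then show ?thesis using matching_iv[OF as(1,2)] n_pos by blast
  next
    case (ii h \<nu>)
    obtain bs ss where h: "h = (bs, ss)" "hshape_ii E (bs, ss)" using dual.hat_ii[OF ii(1)] by blast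
    obtain c where c: "c \<in> cycles_ii E" "h = hat' c" using ii(1) by blast
    obtain as ts where as: "hshape_iii D (as, ts)" "3 \<le> length as" "c \<in> cyc_orbit E (hword E (enc_iii as))"
      using orbit_E(3)[OF c(1)] by blast
    obtain bs' ss' where e: "enc_iii as = (bs', ss')" by (cases "enc_iii as")
    have s: "hshape_ii E (bs', ss')" using enc_iii(1)[OF as(1,2)] e by simp
    have "hword E (bs, ss) \<in> cyc_orbit E (hword E (bs', ss'))"
      using hat'_orbit[OF subsetD[OF dual.cycles_x_of(2) c(1)] as(3)[unfolded e]
          dual.set_hword[OF dual.hshapeD(3)[OF dual.hshape_iiD(1)[OF s]]]]
      unfolding c(2)[symmetric] h(1) .
    note o = dual.orbit_ii[OF s h(2) this]
    have "ga E (- (ss ! 1)) = ga E (- (ss' ! 1))" by (rule dual.ga_cong) (rule mod_minus_cong[OF o(2)])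
    then have "d = tilde_ii E (enc_iii as) \<nu>" unfolding ii(3) h(1) e by (simp add: tilde_ii_def o(1))
    then show ?thesis using matching_iii[OF as(1,2)] ii(2) cyc_class_refl by (metis atLeastLessThan_iff dual_simps(4))
  next
    case (iii h \<nu>)
    obtain bs ss where h: "h = (bs, ss)" "hshape_iii E (bs, ss)" using dual.hat_iii[OF iii(1)] by blast
    obtain c where c: "c \<in> cycles_iii E" "h = hat' c" using iii(1) by blast
    obtain as ts where as: "hshape_ii D (as, ts)" "n dvd sum_list ts" "3 \<le> length as"
      "c \<in> cyc_orbit E (hword E (enc_ii (as, ts)))"
      using orbit_E(2)[OF c(1)] by blast
    obtain bs' ss' where e: "enc_ii (as, ts) = (bs', ss')" by (cases "enc_ii (as, ts)")
    have s: "hshape_iii E (bs', ss')" using enc_ii(1)[OF as(1,3)] e by simp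
    have "hword E (bs, ss) \<in> cyc_orbit E (hword E (bs', ss'))"
      using hat'_orbit[OF subsetD[OF dual.cycles_x_of(3) c(1)] as(4)[unfolded e]
          dual.set_hword[OF dual.hshapeD(3)[OF dual.hshape_iiiD(1)[OF s]]]]
      unfolding c(2)[symmetric] h(1) .
    then have "bs = bs'" using dual.orbit_iii[OF s h(2)] dual.hword_iii[OF h(2)] dual.hword_iii[OF s] by simp
    then have "d = tilde_iii E (enc_ii (as, ts)) \<nu>" unfolding iii(3) h(1) e by (simp add: tilde_iii_def)
    then show ?thesis using matching_ii[OF as(1-3)] iii(2) cyc_class_refl by (metis atLeastLessThan_iff dual_simps(4))
  next
    case (iv h \<nu>)
    obtain bs ss where h: "h = (bs, ss)" "hshape_iv E (bs, ss)" "int (gord E) dvd sum_list (map (b_exp E) bs)"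
      using dual.hat_iv[OF iv(1)] by blast
    obtain c where c: "c \<in> cycles_iv E" "h = hat' c" using iv(1) by blast
    obtain as ts where as: "hshape_i D (as, ts)" "n dvd sum_list ts" "c \<in> cyc_orbit E (hword E (enc_i as))"
      using orbit_E(1)[OF c(1)] by blast
    obtain bs' ss' where e: "enc_i as = (bs', ss')" by (cases "enc_i as")
    have s: "hshape_iv E (bs', ss')" using enc_i(1)[OF as(1)] e by simp
    have "hword E (bs, ss) \<in> cyc_orbit E (hword E (bs', ss'))"
      using hat'_orbit[OF subsetD[OF dual.cycles_x_of(4) c(1)] as(3)[unfolded e]
          dual.set_hword[OF dual.hshapeD(3)[OF dual.hshape_ivD(1)[OF s]]]]
      unfolding c(2)[symmetric] h(1) .
    then have b: "bs \<in> cyc_class bs'"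
      using dual.orbit_iv[OF dual.hshape_ivD(6)[OF s]] dual.hshape_ivD(5)[OF h(2)] dual.hshape_ivD(5)[OF s] by simp
    then have sum: "int (gord E) dvd sum_list (map (b_exp E) bs')"
      using h(3) sum_list_cyc_class[OF b, of "b_exp E"] by simp
    obtain m where m: "bs = rotate m bs'" using b unfolding cyc_class_def by blast
    obtain k where k: "dual.lift4 \<nu> bs \<in> cyc_class (dual.lift4 (\<nu> + k) bs')"
      using dual.lift4_rotate[OF sum, of m] m by blast
    have "d = dual.lift4 \<nu> bs" unfolding iv(3) h(1) by (rule dual.tilde_iv_lift4[OF h(3)])
    moreover have "tilde_iv E (enc_i as) ((\<nu> + k) mod n) = dual.lift4 (\<nu> + k) bs'"
      unfolding e dual.tilde_iv_lift4[OF sum] by (rule dual.lift4_cong) simp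
    moreover have "0 \<le> (\<nu> + k) mod n" "(\<nu> + k) mod n < n" using n_pos by simp_all
    ultimately show ?thesis using matching_i[OF as(1,2)] k by metis
  qed
  then obtain h f \<nu> where "matching h f" "0 \<le> \<nu>" "\<nu> < n" "d \<in> cyc_class (f \<nu>)" by blast
  then show ?thesis using matching_eq cyc_class_trans[OF _ d(2)] by blast
qed

text \<open>If either side is nonzero one of the two halves applies; otherwise both sides are
  0.\<close>

lemma coeff_fa: "set w \<subseteq> arcs (QG E) \<Longrightarrow> cyc_coeff (WG E hat') w = wt (map fa w)"
  using coeff_of_wt coeff_of_WG by metis

section \<open>Transporting the coefficients along phi\<close>

sublocale phi: quiver_isomorphism "QG E" Q fv fa
  using dual.wf_QG wf_quiv quiver_iso_phi by (rule quiver_isomorphism.intro)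

lemma phi_F: "phi D E = phi.F"
  unfolding phi_def phi.F_def ..

lemma canonical_phi: "canonical Q (phi.F (WG E hat') :: ('v, 'a, 'k) palg)"
  unfolding canonical_def
proof (intro allI impI)
  fix v l assume nz: "phi.F (WG E hat') (v, l, v) \<noteq> (0 :: 'k)"
  then have "(v, l, v) \<in> paths Q" using phi.F_outside[OF dual.WG_in_path_algebra] by blast
  then obtain p where p: "p \<in> paths (QG E)" "(v, l, v) = phi.P p" using phi.P_bij unfolding bij_betw_def by blast
  then have "WG E hat' p \<noteq> 0" using phi.F_P[OF dual.WG_in_path_algebra p(1)] nz by simp
  then obtain d where d: "d \<in> dual.words" "p = (head (QG E) (hd d), d, head (QG E) (hd d))" using dual.WG_support by blast
  have "d \<noteq> []" "set d \<subseteq> arcs (QG E)" using dual.closed_words[OF d(1)] by (simp_all add: closed_word_def)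
  then have "hd d \<in> arcs (QG E)" by (meson hd_in_set subsetD)
  then show "l \<noteq> [] \<and> v = head Q (hd l)" using p(2) d(2) \<open>d \<noteq> []\<close> by (simp add: hd_map phi.head_f1)
qed

lemma coeff_phi:
  assumes w: "set w \<subseteq> arcs (QG E)"
  shows "cyc_coeff (phi.F (WG E hat')) (map fa w) = cyc_coeff (WG E hat') w"
proof (cases "w = []")
  case True
  \<comment> \<open>The empty word is treated apart, since \<open>hd\<close> says nothing about it;
    a canonical potential has no such term.\<close>
  have "cyc_coeff (WG E hat') [] = 0"
    unfolding cyc_coeff_canonical[OF dual.canonical_WG]
    by (rule sum.neutral) (use dual.canonical_WG in \<open>auto simp: canonical_def cyc_class_def\<close>)
  moreover have "cyc_coeff (phi.F (WG E hat') :: ('v, 'a, 'k) palg) [] = 0"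
    unfolding cyc_coeff_canonical[OF canonical_phi]
    by (rule sum.neutral) (use canonical_phi in \<open>auto simp: canonical_def cyc_class_def\<close>)
  ultimately show ?thesis using True by simp
next
  case False
  have "cyc_coeff (phi.F (WG E hat')) (map fa w) = 1 * cyc_coeff (WG E hat') w"
  proof (rule cyc_coeff_map[OF dual.canonical_WG canonical_phi])
    show "inj_on fa (set w)" using inj_fa w by (rule inj_on_subset)
    fix l assume l: "l \<in> cyc_class w"
    have l': "l \<noteq> []" "set l \<subseteq> arcs (QG E)" using cyc_class_length[OF l] cyc_class_set[OF l] False w by auto
    then have hd: "hd l \<in> arcs (QG E)" by (meson hd_in_set subsetD)
    let ?p = "(head (QG E) (hd l), l, head (QG E) (hd l))"
    have P: "phi.P ?p = (head Q (hd (map fa l)), map fa l, head Q (hd (map fa l)))"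
      using hd l'(1) by (simp add: hd_map phi.head_f1)
    show "phi.F (WG E hat') (head Q (hd (map fa l)), map fa l, head Q (hd (map fa l))) = 1 * WG E hat' ?p"
    proof (cases "?p \<in> paths (QG E)")
      case True
      then show ?thesis using phi.F_P[OF dual.WG_in_path_algebra] unfolding P[symmetric] by (simp only: mult_1)
    next
      case F: False
      have "phi.P ?p \<notin> paths Q"
      proof
        assume "phi.P ?p \<in> paths Q"
        then have "closed_word Q (map fa l)" unfolding P using closed_word_path[OF wf_quiv] l'(1) by blast
        then have t: "tail Q (map fa l ! i) = head Q (map fa l ! (Suc i mod length l))" if "i < length l" for i
          using that unfolding closed_word_def by simp
        \<comment> \<open>Closedness lifts along \<open>fa\<close> because \<open>fv\<close> is
          injective on vertices.\<close>
        have "closed_word (QG E) l"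
          unfolding closed_word_def
        proof (intro conjI allI impI)
          fix i assume i: "i < length l"
          have j: "Suc i mod length l < length l" by (rule mod_less_divisor[OF le_less_trans[OF le0 i]])
          have a: "l ! i \<in> arcs (QG E)" "l ! (Suc i mod length l) \<in> arcs (QG E)" using l'(2) i j nth_mem by blast+
          then have "fv (tail (QG E) (l ! i)) = fv (head (QG E) (l ! (Suc i mod length l)))"
            using t[OF i] i j by (simp add: phi.head_f1 phi.tail_f1)
          then show "tail (QG E) (l ! i) = head (QG E) (l ! (Suc i mod length l))"
            using a bij_fv dual.wf_QG unfolding bij_betw_def inj_on_def wf_digraph_def by blast
        qed (use l' in simp_all)
        then show False using F closed_word_path[OF dual.wf_QG] by blast
      qed
      moreover have "WG E hat' ?p = 0" using F dual.WG_paths by blast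
      ultimately show ?thesis
        using phi.F_outside[OF dual.WG_in_path_algebra] unfolding P[symmetric] by (simp only: mult_1)
    qed
  qed
  then show ?thesis by simp
qed

text \<open>Surjectivity of \<open>fa\<close> lifts every word in the arrows of \<open>Q\<close> to
  the source quiver; a word with a foreign letter has coefficient 0 in both potentials.\<close>

theorem same_potential_phi: "same_potential (phi D E (WG E hat')) (pot D)"
  unfolding same_potential_def phi_F
proof
  fix c show "cyc_coeff (phi.F (WG E hat')) c = wt c"
  proof (cases "set c \<subseteq> arcs Q")
    case True
    have "c \<in> lists (fa ` arcs (QG E))" unfolding surj_fa using True by (simp add: in_lists_conv_set subset_eq)
    then obtain w where "c = map fa w" "w \<in> lists (arcs (QG E))" unfolding lists_image by blast
    then have w: "c = map fa w" "set w \<subseteq> arcs (QG E)" by (simp_all add: in_lists_conv_set subset_eq)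
    show ?thesis unfolding w(1) coeff_phi[OF w(2)] by (rule coeff_fa[OF w(2)])
  next
    case False
    have "wt c = 0" using False cycle_closed[of c] by (auto simp: cycles_of_def closed_word_def)
    moreover have "cyc_coeff (phi.F (WG E hat')) c = (0 :: 'k)"
      unfolding cyc_coeff_canonical[OF canonical_phi]
    proof (rule sum.neutral, rule ballI)
      fix l assume "l \<in> cyc_class c"
      then have "\<not> set l \<subseteq> arcs Q" using False cyc_class_set by metis
      then have "(head Q (hd l), l, head Q (hd l)) \<notin> paths Q" by (auto simp: paths_def pre_digraph.awalk_def)
      then show "phi.F (WG E hat') (head Q (hd l), l, head Q (hd l)) = (0 :: 'k)"
        by (rule phi.F_outside[OF dual.WG_in_path_algebra])
    qed
    ultimately show ?thesis by simp
  qed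
qed

end

theorem proposition5p3:
  fixes D :: "('v, 'a, 'k::field) qp_datum"
    and hat :: "'a list \<Rightarrow> 'a list \<times> int list"
    and hat' :: "('v, 'a, 'k) skew list \<Rightarrow> ('v, 'a, 'k) skew list \<times> int list"
  assumes "fin_digraph (quiv D)" and "Digraph_Component.connected (quiv D)"
    and "finite_potential (quiv D) (pot D)"
    and "admissible (quiv D) (jacobian_ideal (quiv D) (pot D))"
    and "group_action D"
    and "A1 D" and "A2 D" and "A3 D" and "A4 D" and "A5 D" and "A6 D" and "A7 D"
    and "orbit_reps D"
    and "hat_choice D hat" and "hat_choice (dual D hat) hat'"
  shows "quiver_iso (QG (dual D hat)) (quiv D) (phi_v D (dual D hat)) (phi_a D (dual D hat)) \<and>
    path_alg_iso (QG (dual D hat)) (quiv D)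
      (phi D (dual D hat) :: (_, _, 'k) palg \<Rightarrow> ('v, 'a, 'k) palg) \<and>
    same_potential (phi D (dual D hat) (WG (dual D hat) hat')) (pot D)"
proof -
  interpret g: given_datum D using assms by (intro given_datum.intro)
  interpret dual_pair D hat hat'
    using g.cyclic_datum assms(14,15)
    by (simp add: dual_pair_def dual_pair_axioms_def cyclic_datum_hat_def cyclic_datum_hat_axioms_def)
  interpret dual_pair_weights D hat hat'
  proof
    fix c :: "'a list"
    show "cyc_coeff (pot D) (map (star_a D) c) =
        prod_list (map (\<lambda>\<alpha>. if \<alpha> \<in> arrows4 D then zeta D powi b_exp D \<alpha> else 1) c) * cyc_coeff (pot D) c"
      if c: "set c \<subseteq> arcs (quiv D)"
    proof -
      have eq: "map g.sc c = map (\<lambda>\<alpha>. if \<alpha> \<in> arrows4 D then zeta D powi b_exp D \<alpha> else 1) c"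
        using c by (intro map_cong[OF refl] g.sc_value) blast
      show ?thesis unfolding eq[symmetric] by (rule g.coeff_star[OF c])
    qed
    show "c \<in> cycles_i D \<or> c \<in> cycles_ii D \<or> c \<in> cycles_iii D \<or> c \<in> cycles_iv D" if "c \<in> cycles_of (pot D)"
      using that assms(12)
      unfolding A7_def cycles_i_def cycles_ii_def cycles_iii_def cycles_iv_def g.fixed_eq by blast
  qed
  \<comment> \<open>Finiteness is pulled back along the bijection on vertices; it provides the unit
    of the path algebra of the source.\<close>
  have "finite (verts (QG (dual D hat)))"
    using bij_betw_finite[OF bij_fv] assms(1) by (simp add: fin_digraph_def fin_digraph_axioms_def)
  then show ?thesis
    using quiver_iso_phi phi.path_alg_iso_F same_potential_phi unfolding phi_F by blast
qed

end
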